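(* Let $u^0\in L^2(\Omega)$ and $f(t)=t^{\mu}*g(t)=\int_0^t(t-\zeta)^\mu g(\zeta)\,d\zeta$ with $\mu>-1$, where $g\in W^{1,\infty}(0,T;L^2(\Omega))$ and $\int_0^t(t-\zeta)^{\min(\alpha+\mu,0)}\|g''(\zeta)\|\,d\zeta<\infty$ for $t\in(0,T]$. Let $u_h$ be the solution of the semidiscrete finite element problem and let $\tilde u_h^n$ be the solution of the fully discrete scheme (CN-I) with step size $\tau=T/N$ (both defined in the context). Then there is a constant $c>0$, independent of $\tau$, $n$, $h$, $u^0$ and $g$, such that for $1\le n\le N$ $$\|u_h(t_n)-\tilde u_h^n\|\le c\,\tau^2\Big(t_n^{-2}\|u^0\|+t_n^{\alpha+\mu-1}\|g(0)\|+t_n^{\alpha+\mu}\|g'(0)\|+\int_0^{t_n}(t_n-\zeta)^{\alpha+\mu}\|g''(\zeta)\|\,d\zeta\Big).$$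
   Context: Let $0<\alpha<1$, $T>0$, and let $\Omega\subset\mathbb{R}^d$ ($d=1,2$) be a bounded domain. $A$ is a self-adjoint positive definite second-order elliptic partial differential operator in $\Omega$ with homogeneous Dirichlet boundary condition, with associated bilinear form $A(\cdot,\cdot)$. $(\cdot,\cdot)$ and $\|\cdot\|$ are the inner product and norm of $L^2(\Omega)$. The underlying problem is ${}^{C}D_t^\alpha u+Au=f$ in $\Omega\times(0,T]$, $u=0$ on $\partial\Omega\times(0,T]$, $u(0)=u^0$, where ${}^{C}D_t^{\alpha}u(t)=\frac{1}{\Gamma(1-\alpha)}\int_0^t(t-\zeta)^{-\alpha}u'(\zeta)\,d\zeta$ is the Caputo derivative. Primes on $g$ denote time derivatives, and $f(t),g(t)$ abbreviate $f(\cdot,t),g(\cdot,t)$. Semidiscrete problem. $X_h\subset H_0^1(\Omega)$ is the space of continuous piecewise linear finite elements on a regular triangulation of $\Omega$ of maximal diameter $h$; $P_h:L^2(\Omega)\to X_h$ is the $L^2$-projection; $A_h:X_h\to X_h$ is defined by $(A_h\varphi,\psi)=A(\varphi,\psi)$ for all $\varphi,\psi\in X_h$; $f_h=P_hf$. $u_h$ solves ${}^{C}D_t^\alpha u_h(t)+A_hu_h(t)=f_h(t)$ for $t>0$, $u_h(0)=P_hu^0$. Scheme (CN-I). Let $N\in\mathbb{N}$, $\tau=T/N$, $t_n=n\tau$. Let $F_h(t)=\int_0^tf_h(\xi)\,d\xi$ and $F_h^n=F_h(t_n)$. Let $\sigma_0=1$, $\sigma_j=(1-\frac{\alpha+1}{j})\sigma_{j-1}$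 for $j\ge1$, i.e. $\sum_{j\ge0}\sigma_jz^j=(1-z)^\alpha$. Let $D_\tau$ be the second-order BDF operator $D_\tau\varphi(t)=\frac1\tau\big(\frac32\varphi(t)-2\varphi(t-\tau)+\frac12\varphi(t-2\tau)\big)$; all functions (including $t^{2-\alpha}$, $F_h$, $\tilde U_h$) are taken to be $0$ for $t\le0$, so $\tilde U_h^{0}=\tilde U_h^{-1}=0$. For $n=1,\dots,N$ the scheme determines $\tilde U_h^n,\tilde u_h^n\in X_h$ by $$\tau^{-\alpha}\sum_{j=0}^{n}\sigma_j\tilde U_h^{n-j}+(1-\tfrac\alpha2)A_h\tilde U_h^n+\tfrac\alpha2A_h\tilde U_h^{n-1}=(1-\tfrac\alpha2)F_h^n+\tfrac\alpha2F_h^{n-1}+(1-\tfrac\alpha2)D_\tau\frac{t_n^{2-\alpha}}{\Gamma(3-\alpha)}u_h(0)+\tfrac\alpha2D_\tau\frac{t_{n-1}^{2-\alpha}}{\Gamma(3-\alpha)}u_h(0),$$ $$\tilde u_h^n=\frac1\tau\Big(\frac32\tilde U_h^n-2\tilde U_h^{n-1}+\frac12\tilde U_h^{n-2}\Big).$$ *)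

theory Defs
  imports "HOL-Analysis.Analysis"
begin

section \<open>The Hilbert space of square integrable functions\<close>

text \<open>
  The type \<open>'a L2\<close> is the space of real square integrable functions on the whole space, modulo
  equality almost everywhere.  \<open>L2_on \<Omega>\<close>, the functions vanishing outside \<open>\<Omega>\<close>, is
  the space of square integrable functions on \<open>\<Omega>\<close> (extension by zero is an isometry).
  Completeness and separability make the Bochner integral of the library available for
  functions with values in this space.
\<close>

definition square_integrable :: "('a::euclidean_space \<Rightarrow> real) \<Rightarrow> bool" where
  "square_integrable f \<longleftrightarrow> f \<in> borel_measurable lborel \<and> integrable lborel (\<lambda>x. (f x)\<^sup>2)"

lemma square_integrable_0: "square_integrable (\<lambda>x. 0)"
  by (simp add: square_integrable_def)

lemma square_integrable_mult:
  assumes "square_integrable f" "square_integrable g"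
  shows "integrable lborel (\<lambda>x. f x * g x)"
proof (rule Bochner_Integration.integrable_bound[where f = "\<lambda>x. (f x)\<^sup>2 + (g x)\<^sup>2"])
  show "integrable lborel (\<lambda>x. (f x)\<^sup>2 + (g x)\<^sup>2)"
    using assms by (auto simp: square_integrable_def)
  show "(\<lambda>x. f x * g x) \<in> borel_measurable lborel"
    using assms by (auto simp: square_integrable_def)
  have "\<bar>a * b\<bar> \<le> a\<^sup>2 + b\<^sup>2" for a b :: real
  proof -
    have "0 \<le> (\<bar>a\<bar> - \<bar>b\<bar>)\<^sup>2" by simp
    then have "2 * (\<bar>a\<bar> * \<bar>b\<bar>) \<le> a\<^sup>2 + b\<^sup>2"
      by (simp add: power2_diff)
    moreover have "0 \<le> \<bar>a\<bar> * \<bar>b\<bar>" by simp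
    ultimately show ?thesis unfolding abs_mult by linarith
  qed
  then show "AE x in lborel. norm (f x * g x) \<le> norm ((f x)\<^sup>2 + (g x)\<^sup>2)"
    by simp
qed

lemma square_integrable_add:
  assumes "square_integrable f" "square_integrable g"
  shows "square_integrable (\<lambda>x. f x + g x)"
proof -
  have "integrable lborel (\<lambda>x. (f x)\<^sup>2 + 2 * (f x * g x) + (g x)\<^sup>2)"
    using assms square_integrable_mult[OF assms] by (auto simp: square_integrable_def)
  then show ?thesis
    using assms by (auto simp: square_integrable_def power2_sum algebra_simps)
qed

lemma square_integrable_scale:
  assumes "square_integrable f"
  shows "square_integrable (\<lambda>x. r * f x)"
  using assms by (auto simp: square_integrable_def power_mult_distrib)

lemma square_integrable_diff:
  assumes "square_integrable f" "square_integrable g"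
  shows "square_integrable (\<lambda>x. f x - g x)"
  using square_integrable_add[OF assms(1) square_integrable_scale[OF assms(2), of "-1"]] by simp

quotient_type (overloaded) 'a L2 = "'a::euclidean_space \<Rightarrow> real" / partial:
  "\<lambda>f g. square_integrable f \<and> square_integrable g \<and> (AE x in lborel. f x = g x)"
proof (rule part_equivpI)
  show "\<exists>f::'a \<Rightarrow> real. square_integrable f \<and> square_integrable f \<and> (AE x in lborel. f x = f x)"
    using square_integrable_0 by auto
  show "symp (\<lambda>(f::'a \<Rightarrow> real) g. square_integrable f \<and> square_integrable g \<and> (AE x in lborel. f x = g x))"
    by (auto intro!: sympI)
  show "transp (\<lambda>(f::'a \<Rightarrow> real) g. square_integrable f \<and> square_integrable g \<and> (AE x in lborel. f x = g x))"
    by (auto intro!: transpI)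
qed

instantiation L2 :: (euclidean_space) real_vector
begin

lift_definition zero_L2 :: "'a L2" is "\<lambda>x. 0"
  by (simp add: square_integrable_0)

lift_definition plus_L2 :: "'a L2 \<Rightarrow> 'a L2 \<Rightarrow> 'a L2" is "\<lambda>f g x. f x + g x"
  by (auto intro: square_integrable_add)

lift_definition minus_L2 :: "'a L2 \<Rightarrow> 'a L2 \<Rightarrow> 'a L2" is "\<lambda>f g x. f x - g x"
  by (auto intro: square_integrable_diff)

lift_definition uminus_L2 :: "'a L2 \<Rightarrow> 'a L2" is "\<lambda>f x. - f x"
  by (auto intro: square_integrable_scale[of _ "-1", simplified])

lift_definition scaleR_L2 :: "real \<Rightarrow> 'a L2 \<Rightarrow> 'a L2" is "\<lambda>r f x. r * f x"
  by (auto intro: square_integrable_scale)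

instance
proof
  fix u v w :: "'a L2" and r s :: real
  show "u + v + w = u + (v + w)"
    by transfer (auto intro: square_integrable_add simp: add.assoc)
  show "u + v = v + u"
    by transfer (auto intro: square_integrable_add simp: add.commute)
  show "0 + u = u"
    by transfer auto
  show "- u + u = 0"
    by transfer (auto simp: square_integrable_0)
  show "u - v = u + - v"
    by transfer (auto intro: square_integrable_diff)
  show "r *\<^sub>R (u + v) = r *\<^sub>R u + r *\<^sub>R v"
    by transfer (auto intro: square_integrable_add square_integrable_scale simp: algebra_simps)
  show "(r + s) *\<^sub>R u = r *\<^sub>R u + s *\<^sub>R u"
    by transfer (auto intro: square_integrable_add square_integrable_scale simp: algebra_simps)
  show "r *\<^sub>R s *\<^sub>R u = (r * s) *\<^sub>R u"
    by transfer (auto intro: square_integrable_add square_integrable_scale simp: algebra_simps)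
  show "1 *\<^sub>R u = u"
    by transfer auto
qed

end

instantiation L2 :: (euclidean_space) real_inner
begin

lift_definition inner_L2 :: "'a L2 \<Rightarrow> 'a L2 \<Rightarrow> real" is "\<lambda>f g. LINT x|lborel. f x * g x"
  by (rule integral_cong_AE) (auto simp: square_integrable_def)

definition norm_L2 :: "'a L2 \<Rightarrow> real" where
  "norm_L2 v = sqrt (inner v v)"

definition sgn_L2 :: "'a L2 \<Rightarrow> 'a L2" where
  "sgn_L2 v = v /\<^sub>R norm v"

definition dist_L2 :: "'a L2 \<Rightarrow> 'a L2 \<Rightarrow> real" where
  "dist_L2 v w = norm (v - w)"

definition uniformity_L2 :: "('a L2 \<times> 'a L2) filter" where
  "uniformity_L2 = (INF e\<in>{0<..}. principal {(v, w). dist v w < e})"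

definition open_L2 :: "'a L2 set \<Rightarrow> bool" where
  "open_L2 U \<longleftrightarrow> (\<forall>v\<in>U. eventually (\<lambda>(v', w). v' = v \<longrightarrow> w \<in> U) uniformity)"

instance
proof
  fix u v w :: "'a L2" and r :: real
  show "inner u v = inner v u"
    by transfer (simp add: mult.commute)
  show "inner (u + v) w = inner u w + inner v w"
    by transfer (auto simp: distrib_right square_integrable_mult)
  show "inner (r *\<^sub>R u) v = r * inner u v"
    by transfer (auto simp: mult.assoc)
  show "0 \<le> inner u u"
    by transfer auto
  show "inner u u = 0 \<longleftrightarrow> u = 0"
  proof transfer
    fix f :: "'a \<Rightarrow> real"
    assume "square_integrable f \<and> square_integrable f \<and> (AE x in lborel. f x = f x)"
    then have f: "square_integrable f" by simp
    have "(LINT x|lborel. f x * f x) = 0 \<longleftrightarrow> (AE x in lborel. f x * f x = 0)"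
      using square_integrable_mult[OF f f] by (intro integral_nonneg_eq_0_iff_AE) auto
    then show "(LINT x|lborel. f x * f x) = 0 \<longleftrightarrow>
        square_integrable f \<and> square_integrable (\<lambda>x. 0::real) \<and> (AE x in lborel. f x = 0)"
      using f square_integrable_0 by auto
  qed
  show "norm u = sqrt (inner u u)"
    by (rule norm_L2_def)
  show "sgn u = u /\<^sub>R norm u"
    by (rule sgn_L2_def)
  show "dist u v = norm (u - v)"
    by (rule dist_L2_def)
  show "(uniformity :: ('a L2 \<times> 'a L2) filter) = (INF e\<in>{0<..}. principal {(v, w). dist v w < e})"
    by (rule uniformity_L2_def)
  show "open U \<longleftrightarrow> (\<forall>v\<in>U. eventually (\<lambda>(v', w). v' = v \<longrightarrow> w \<in> U) uniformity)" for U :: "'a L2 set"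
    by (rule open_L2_def)
qed

end

text \<open>\<open>L2_of f\<close> is the class of \<open>f\<close>, \<open>L2_fun v\<close> a representative of \<open>v\<close>.\<close>

abbreviation L2_of :: "('a::euclidean_space \<Rightarrow> real) \<Rightarrow> 'a L2" where
  "L2_of \<equiv> abs_L2"

abbreviation L2_fun :: "'a::euclidean_space L2 \<Rightarrow> 'a \<Rightarrow> real" where
  "L2_fun \<equiv> rep_L2"

lemma square_integrable_L2_fun: "square_integrable (L2_fun v)"
  using Quotient3_rep_reflp[OF Quotient3_L2] by auto

lemma L2_of_L2_fun [simp]: "L2_of (L2_fun v) = v"
  by (rule Quotient3_abs_rep[OF Quotient3_L2])

lemma L2_of_eq_iff:
  assumes "square_integrable f" "square_integrable g"
  shows "L2_of f = L2_of g \<longleftrightarrow> (AE x in lborel. f x = g x)"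
  using Quotient3_rel[OF Quotient3_L2, of f g] assms by auto

lemma AE_L2_fun_L2_of:
  assumes "square_integrable f"
  shows "AE x in lborel. L2_fun (L2_of f) x = f x"
  using L2_of_eq_iff[OF square_integrable_L2_fun assms] L2_of_L2_fun by blast

lemma L2_of_arith:
  assumes "square_integrable f" "square_integrable g"
  shows "L2_of f + L2_of g = L2_of (\<lambda>x. f x + g x)"
    "L2_of f - L2_of g = L2_of (\<lambda>x. f x - g x)"
    "inner (L2_of f) (L2_of g) = (LINT x|lborel. f x * g x)"
  using assms by (simp_all add: plus_L2.abs_eq minus_L2.abs_eq inner_L2.abs_eq)

lemma scaleR_L2_of:
  assumes "square_integrable f"
  shows "r *\<^sub>R L2_of f = L2_of (\<lambda>x. r * f x)"
  using assms by (simp add: scaleR_L2.abs_eq)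

lemma norm_L2_of_squared:
  assumes "square_integrable f"
  shows "(norm (L2_of f))\<^sup>2 = (LINT x|lborel. (f x)\<^sup>2)"
  using L2_of_arith(3)[OF assms assms] by (simp only: power2_norm_eq_inner) (simp add: power2_eq_square)

lemma norm_L2_of_le:
  assumes f: "f \<in> borel_measurable lborel"
    and le: "(\<integral>\<^sup>+x. ennreal ((f x)\<^sup>2) \<partial>lborel) \<le> ennreal (e\<^sup>2)" and e: "0 \<le> e"
  shows "square_integrable f" "norm (L2_of f) \<le> e"
proof -
  have "integrable lborel (\<lambda>x. (f x)\<^sup>2)"
  proof (rule integrableI_nonneg)
    show "(\<integral>\<^sup>+x. ennreal ((f x)\<^sup>2) \<partial>lborel) < \<infinity>"
      using le by (rule order.strict_trans1) simp
  qed (use f in auto)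
  then show sq: "square_integrable f"
    using f by (simp add: square_integrable_def)
  have "ennreal ((norm (L2_of f))\<^sup>2) = (\<integral>\<^sup>+x. ennreal ((f x)\<^sup>2) \<partial>lborel)"
    unfolding norm_L2_of_squared[OF sq]
    using \<open>integrable lborel (\<lambda>x. (f x)\<^sup>2)\<close> by (subst nn_integral_eq_integral) auto
  then have "ennreal ((norm (L2_of f))\<^sup>2) \<le> ennreal (e\<^sup>2)"
    using le by simp
  then have "(norm (L2_of f))\<^sup>2 \<le> e\<^sup>2"
    by (subst (asm) ennreal_le_iff) auto
  then show "norm (L2_of f) \<le> e"
    using e by (rule power2_le_imp_le)
qed

lemma nn_integral_L2_fun:
  "(\<integral>\<^sup>+x. ennreal ((L2_fun v x)\<^sup>2) \<partial>lborel) = ennreal ((norm v)\<^sup>2)"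
  using square_integrable_L2_fun[of v] norm_L2_of_squared[OF square_integrable_L2_fun, of v]
  by (subst nn_integral_eq_integral) (auto simp: square_integrable_def)

lemma AE_L2_fun_diff: "AE x in lborel. L2_fun (v - w) x = L2_fun v x - L2_fun w x"
proof -
  have "v - w = L2_of (\<lambda>x. L2_fun v x - L2_fun w x)"
    using L2_of_arith(2)[OF square_integrable_L2_fun square_integrable_L2_fun, of v w] by simp
  then show ?thesis
    using AE_L2_fun_L2_of[OF square_integrable_diff[OF square_integrable_L2_fun square_integrable_L2_fun], of v w]
    by simp
qed

lemma summable_imp_convergent_telescope:
  fixes y :: "nat \<Rightarrow> real"
  assumes "summable (\<lambda>k. \<bar>y (Suc k) - y k\<bar>)"
  shows "convergent y"
proof -
  have "summable (\<lambda>k. y (Suc k) - y k)"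
    using assms by (rule summable_rabs_cancel)
  then have "convergent (\<lambda>n. \<Sum>k<n. y (Suc k) - y k)"
    by (simp add: summable_iff_convergent)
  then have "convergent (\<lambda>n. y n - y 0)"
    by (simp add: sum_lessThan_telescope)
  then have "convergent (\<lambda>n. (y n - y 0) + y 0)"
    by (intro convergent_add convergent_const)
  then show ?thesis by simp
qed

lemma AE_convergent_L2:
  assumes Y: "\<And>k. norm (Y (Suc k) - Y k) \<le> (1/4) ^ k"
  shows "AE x in lborel. convergent (\<lambda>k. L2_fun (Y k) x)"
proof -
  define d where "d k = L2_fun (Y (Suc k) - Y k)" for k
  have sq: "square_integrable (L2_fun v)" for v :: "'a L2" by (rule square_integrable_L2_fun)
  have [measurable]: "L2_fun v \<in> borel_measurable borel" for v :: "'a L2"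
    using sq[of v] by (simp add: square_integrable_def)
  have [measurable]: "d k \<in> borel_measurable borel" for k
    by (simp add: d_def)
  have "(\<integral>\<^sup>+x. (\<Sum>k. ennreal (4 ^ k * (d k x)\<^sup>2)) \<partial>lborel) = (\<Sum>k. \<integral>\<^sup>+x. ennreal (4 ^ k * (d k x)\<^sup>2) \<partial>lborel)"
    by (intro nn_integral_suminf) auto
  also have "\<dots> \<le> (\<Sum>k. ennreal ((1/4) ^ k))"
  proof (rule suminf_le)
    show "(\<integral>\<^sup>+x. ennreal (4 ^ k * (d k x)\<^sup>2) \<partial>lborel) \<le> ennreal ((1/4) ^ k)" for k
    proof -
      have "(\<integral>\<^sup>+x. ennreal (4 ^ k * (d k x)\<^sup>2) \<partial>lborel) = ennreal (4 ^ k) * ennreal ((norm (Y (Suc k) - Y k))\<^sup>2)"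
        unfolding nn_integral_L2_fun[symmetric] d_def[symmetric]
        by (subst nn_integral_cmult[symmetric]) (auto simp: ennreal_mult)
      also have "\<dots> = ennreal (4 ^ k * (norm (Y (Suc k) - Y k))\<^sup>2)"
        by (simp add: ennreal_mult)
      also have "\<dots> \<le> ennreal (4 ^ k * ((1/4) ^ k)\<^sup>2)"
        using power_mono[OF Y[of k], of 2] by (intro ennreal_leI mult_left_mono) auto
      also have "(4::real) ^ k * ((1/4) ^ k)\<^sup>2 = (1/4) ^ k"
        by (simp add: power2_eq_square power_divide)
      finally show ?thesis .
    qed
  qed auto
  also have "\<dots> = ennreal (\<Sum>k. (1/4) ^ k)"
    by (intro suminf_ennreal2) (auto intro: summable_geometric)
  also have "\<dots> < \<infinity>" by simp
  finally have fin: "(\<integral>\<^sup>+x. (\<Sum>k. ennreal (4 ^ k * (d k x)\<^sup>2)) \<partial>lborel) \<noteq> \<infinity>" by simp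
  have "AE x in lborel. (\<Sum>k. ennreal (4 ^ k * (d k x)\<^sup>2)) \<noteq> \<infinity>"
    by (rule nn_integral_PInf_AE[OF _ fin]) auto
  moreover have "AE x in lborel. \<forall>k. d k x = L2_fun (Y (Suc k)) x - L2_fun (Y k) x"
    unfolding AE_all_countable
  proof
    show "AE x in lborel. d k x = L2_fun (Y (Suc k)) x - L2_fun (Y k) x" for k
      unfolding d_def by (rule AE_L2_fun_diff)
  qed
  ultimately show ?thesis
  proof eventually_elim
    case (elim x)
    define C where "C = enn2real (\<Sum>k. ennreal (4 ^ k * (d k x)\<^sup>2))"
    have C: "(\<Sum>k. ennreal (4 ^ k * (d k x)\<^sup>2)) = ennreal C"
      using elim(1) by (simp add: C_def less_top)
    have C0: "0 \<le> C" by (simp add: C_def)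
    have "\<bar>d k x\<bar> \<le> sqrt C * (1/2) ^ k" for k
    proof -
      have "(\<Sum>i\<in>{k}. ennreal (4 ^ i * (d i x)\<^sup>2)) \<le> (\<Sum>i. ennreal (4 ^ i * (d i x)\<^sup>2))"
        by (rule sum_le_suminf) auto
      then have "4 ^ k * (d k x)\<^sup>2 \<le> C"
        unfolding C using C0 by (simp add: ennreal_le_iff)
      moreover have "(2::real) ^ k * 2 ^ k = 4 ^ k"
        by (simp flip: power_mult_distrib)
      then have "(2 ^ k * \<bar>d k x\<bar>)\<^sup>2 = 4 ^ k * (d k x)\<^sup>2"
        by (simp add: power_mult_distrib) (simp add: power2_eq_square)
      ultimately have "(2 ^ k * \<bar>d k x\<bar>)\<^sup>2 \<le> C"
        by simp
      then have "2 ^ k * \<bar>d k x\<bar> \<le> sqrt C"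
        by (rule real_le_rsqrt)
      then show ?thesis
        by (simp add: power_divide pos_le_divide_eq mult.commute)
    qed
    then have "norm \<bar>d k x\<bar> \<le> sqrt C * (1/2) ^ k" for k by simp
    moreover have "summable (\<lambda>k. sqrt C * (1/2::real) ^ k)"
      by (rule summable_mult, rule summable_geometric) simp
    ultimately have "summable (\<lambda>k. \<bar>d k x\<bar>)"
      by (rule summable_comparison_test'[rotated])
    then show ?case
      using elim(2) by (intro summable_imp_convergent_telescope) simp
  qed
qed

instance L2 :: (euclidean_space) complete_space
proof
  fix X :: "nat \<Rightarrow> 'a L2"
  assume "Cauchy X"
  have sq: "square_integrable (L2_fun v)" for v :: "'a L2" by (rule square_integrable_L2_fun)
  have [measurable]: "L2_fun v \<in> borel_measurable borel" for v :: "'a L2"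
    using sq[of v] by (simp add: square_integrable_def)
  have "\<exists>r. strict_mono r \<and> (\<forall>k. \<forall>m\<ge>r k. \<forall>n\<ge>r k. norm (X m - X n) < (1/4) ^ k)"
  proof -
    have *: "\<exists>M>m. \<forall>i\<ge>M. \<forall>j\<ge>M. norm (X i - X j) < (1/4) ^ k" for k m
    proof -
      obtain M where M: "\<forall>i\<ge>M. \<forall>j\<ge>M. norm (X i - X j) < (1/4) ^ k"
        using \<open>Cauchy X\<close>[unfolded Cauchy_iff, rule_format, of "(1/4)^k"] by auto
      then show ?thesis by (intro exI[of _ "max M (Suc m)"]) auto
    qed
    have "\<exists>f. \<forall>n. (\<forall>i\<ge>f n. \<forall>j\<ge>f n. norm (X i - X j) < (1/4) ^ n) \<and> f n < f (Suc n)"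
    proof (rule dependent_nat_choice)
      show "\<exists>M. \<forall>i\<ge>M. \<forall>j\<ge>M. norm (X i - X j) < (1/4) ^ 0"
        using *[of 0 0] by (elim exE conjE) (rule exI)
      show "\<exists>M. (\<forall>i\<ge>M. \<forall>j\<ge>M. norm (X i - X j) < (1/4) ^ Suc n) \<and> m < M" for m n
        using *[of m "Suc n"] by (elim exE conjE) (intro exI conjI)
    qed
    then show ?thesis
      unfolding strict_mono_Suc_iff by blast
  qed
  then obtain r where r: "strict_mono r"
    and rX: "\<And>k m n. m \<ge> r k \<Longrightarrow> n \<ge> r k \<Longrightarrow> norm (X m - X n) < (1/4) ^ k" by blast
  define Y where "Y = X \<circ> r"
  have mono: "r k \<le> r m" if "k \<le> m" for k m
    using r that by (simp add: strict_mono_less_eq)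
  have YY: "norm (Y m - Y k) \<le> (1/4) ^ k" if "k \<le> m" for k m
    using rX[of k "r m" "r k"] mono[OF that] by (simp add: Y_def)
  have conv: "AE x in lborel. convergent (\<lambda>k. L2_fun (Y k) x)"
    by (rule AE_convergent_L2) (use YY in auto)
  define f where "f x = lim (\<lambda>k. L2_fun (Y k) x)" for x
  have [measurable]: "f \<in> borel_measurable borel"
    unfolding f_def by measurable
  have fatou: "(\<integral>\<^sup>+x. ennreal ((f x - L2_fun (Y k) x)\<^sup>2) \<partial>lborel) \<le> ennreal (((1/4) ^ k)\<^sup>2)" for k
  proof -
    have "(\<integral>\<^sup>+x. ennreal ((f x - L2_fun (Y k) x)\<^sup>2) \<partial>lborel)
        = (\<integral>\<^sup>+x. liminf (\<lambda>m. ennreal ((L2_fun (Y m) x - L2_fun (Y k) x)\<^sup>2)) \<partial>lborel)"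
    proof (rule nn_integral_cong_AE, use conv in eventually_elim)
      case (elim x)
      then have "(\<lambda>m. L2_fun (Y m) x) \<longlonglongrightarrow> f x"
        by (simp add: f_def convergent_LIMSEQ_iff)
      then have "(\<lambda>m. ennreal ((L2_fun (Y m) x - L2_fun (Y k) x)\<^sup>2)) \<longlonglongrightarrow> ennreal ((f x - L2_fun (Y k) x)\<^sup>2)"
        by (intro tendsto_intros)
      then show ?case
        by (intro lim_imp_Liminf[symmetric]) auto
    qed
    also have "\<dots> \<le> liminf (\<lambda>m. \<integral>\<^sup>+x. ennreal ((L2_fun (Y m) x - L2_fun (Y k) x)\<^sup>2) \<partial>lborel)"
      by (intro nn_integral_liminf) auto
    also have "\<dots> = liminf (\<lambda>m. ennreal ((norm (Y m - Y k))\<^sup>2))"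
    proof -
      have "(\<integral>\<^sup>+x. ennreal ((L2_fun (Y m) x - L2_fun (Y k) x)\<^sup>2) \<partial>lborel) = ennreal ((norm (Y m - Y k))\<^sup>2)" for m
        unfolding nn_integral_L2_fun[symmetric]
        by (intro nn_integral_cong_AE) (use AE_L2_fun_diff[of "Y m" "Y k"] in auto)
      then show ?thesis by simp
    qed
    also have "\<dots> \<le> liminf (\<lambda>m::nat. ennreal (((1/4) ^ k)\<^sup>2))"
      using YY by (intro Liminf_mono eventually_sequentiallyI[of k]) (auto intro!: ennreal_leI power_mono)
    also have "\<dots> = ennreal (((1/4) ^ k)\<^sup>2)"
      by (simp add: Liminf_const)
    finally show ?thesis .
  qed
  have diff: "square_integrable (\<lambda>x. f x - L2_fun (Y k) x)"
      "norm (L2_of (\<lambda>x. f x - L2_fun (Y k) x)) \<le> (1/4) ^ k" for k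
    using norm_L2_of_le[OF _ fatou[of k]] by auto
  have sqf: "square_integrable f"
    using square_integrable_add[OF diff(1) sq, of 0 "Y 0"] by simp
  have lim: "norm (L2_of f - Y k) \<le> (1/4) ^ k" for k
    using diff(2)[of k] L2_of_arith(2)[OF sqf sq, of "Y k"] by simp
  have "(\<lambda>k. Y k - L2_of f) \<longlonglongrightarrow> 0"
    by (rule Lim_null_comparison[where g = "\<lambda>k. (1/4)^k"])
       (use lim in \<open>simp_all add: norm_minus_commute LIMSEQ_power_zero\<close>)
  then have "(X \<circ> r) \<longlonglongrightarrow> L2_of f"
    unfolding Y_def by (rule LIM_zero_cancel)
  then show "convergent X"
    using Cauchy_converges_subseq[OF \<open>Cauchy X\<close> r] unfolding convergent_def by blast
qed

lemma countable_dense_subspace: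
  fixes S :: "'a::real_normed_vector set"
  assumes "countable S"
  shows "\<exists>D. countable D \<and> S \<subseteq> closure D \<and> subspace (closure D)"
proof -
  define comb :: "(real \<times> 'a) list \<Rightarrow> 'a" where "comb l = sum_list (map (\<lambda>(q, s). q *\<^sub>R s) l)" for l
  define D where "D = comb ` lists (\<rat> \<times> S)"
  have "countable D"
    unfolding D_def using assms countable_rat by (intro countable_image countable_lists countable_SIGMA) auto
  moreover have "s \<in> D" if "s \<in> S" for s
    unfolding D_def by (rule image_eqI[where x = "[(1, s)]"]) (use that in \<open>auto simp: comb_def\<close>)
  then have "S \<subseteq> closure D"
    using closure_subset by blast
  moreover have "subspace (closure D)"
  proof (rule subspaceI)
    have "0 \<in> D"
      unfolding D_def by (rule image_eqI[where x = "[]"]) (auto simp: comb_def)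
    then show "0 \<in> closure D"
      using closure_subset by blast
    have add: "x + y \<in> D" if "x \<in> D" "y \<in> D" for x y
    proof -
      obtain l m where "x = comb l" "y = comb m" "l \<in> lists (\<rat> \<times> S)" "m \<in> lists (\<rat> \<times> S)"
        using \<open>x \<in> D\<close> \<open>y \<in> D\<close> unfolding D_def by blast
      then show ?thesis
        unfolding D_def by (intro image_eqI[where x = "l @ m"]) (auto simp: comb_def)
    qed
    have scale: "q *\<^sub>R x \<in> D" if "x \<in> D" "q \<in> \<rat>" for x q
    proof -
      obtain l where l: "x = comb l" "l \<in> lists (\<rat> \<times> S)"
        using \<open>x \<in> D\<close> unfolding D_def by blast
      have "q *\<^sub>R comb m = comb (map (\<lambda>(r, s). (q * r, s)) m)" for m
        by (induction m) (auto simp: comb_def scaleR_add_right)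
      moreover have "map (\<lambda>(r, s). (q * r, s)) l \<in> lists (\<rat> \<times> S)"
        using l(2) that(2) by (auto simp: lists_eq_set)
      ultimately show ?thesis
        using l(1) by (auto simp: D_def)
    qed
    show "x + y \<in> closure D" if xy: "x \<in> closure D" "y \<in> closure D" for x y
    proof -
      obtain f g where "\<And>n::nat. f n \<in> D" "f \<longlonglongrightarrow> x" "\<And>n::nat. g n \<in> D" "g \<longlonglongrightarrow> y"
        using xy unfolding closure_sequential by blast
      then show ?thesis
        unfolding closure_sequential
        by (intro exI[where x = "\<lambda>n. f n + g n"]) (auto intro: add tendsto_add)
    qed
    show "c *\<^sub>R x \<in> closure D" if x: "x \<in> closure D" for c x
    proof -
      obtain f where "\<And>n::nat. f n \<in> D" "f \<longlonglongrightarrow> x"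
        using x unfolding closure_sequential by blast
      moreover have "c \<in> closure \<rat>"
        by (simp add: Rats_closure_real)
      then obtain q where "\<And>n::nat. q n \<in> \<rat>" "q \<longlonglongrightarrow> c"
        unfolding closure_sequential by blast
      ultimately show ?thesis
        unfolding closure_sequential
        by (intro exI[where x = "\<lambda>n. q n *\<^sub>R f n"]) (auto intro: scale tendsto_scaleR)
    qed
  qed
  ultimately show ?thesis by blast
qed

lemma tendsto_L2_of:
  assumes s: "\<And>n. s n \<in> borel_measurable lborel" and f: "f \<in> borel_measurable lborel"
    and w: "square_integrable w"
    and bound: "\<And>n x. \<bar>s n x\<bar> \<le> w x" and lim: "\<And>x. (\<lambda>n. s n x) \<longlonglongrightarrow> f x"
  shows "(\<lambda>n. L2_of (s n)) \<longlonglongrightarrow> L2_of f"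
proof -
  have fw: "\<bar>f x\<bar> \<le> w x" for x
    by (rule LIMSEQ_le_const2[OF tendsto_rabs[OF lim]]) (use bound in auto)
  have sq: "square_integrable u" if "u \<in> borel_measurable lborel" "\<And>x. \<bar>u x\<bar> \<le> w x" for u
  proof -
    have "(u x)\<^sup>2 \<le> (w x)\<^sup>2" for x
      using power_mono[OF that(2)[of x], of 2] by simp
    then have "integrable lborel (\<lambda>x. (u x)\<^sup>2)"
      using w that(1) by - (rule Bochner_Integration.integrable_bound[of lborel "\<lambda>x. (w x)\<^sup>2"],
         auto simp: square_integrable_def)
    then show ?thesis
      using that(1) by (simp add: square_integrable_def)
  qed
  note sqs = sq[OF s bound] and sqf = sq[OF f fw]
  have "(\<lambda>n. LINT x|lborel. (s n x - f x)\<^sup>2) \<longlonglongrightarrow> (LINT x|(lborel :: 'a measure). (0::real))"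
  proof (rule integral_dominated_convergence[where w = "\<lambda>x. 4 * (w x)\<^sup>2"])
    show "integrable lborel (\<lambda>x. 4 * (w x)\<^sup>2)"
      using w by (simp add: square_integrable_def)
    show "AE x in lborel. (\<lambda>n. (s n x - f x)\<^sup>2) \<longlonglongrightarrow> 0"
    proof (rule AE_I2)
      fix x
      have "(\<lambda>n. (s n x - f x)\<^sup>2) \<longlonglongrightarrow> (f x - f x)\<^sup>2"
        by (intro tendsto_intros lim)
      then show "(\<lambda>n. (s n x - f x)\<^sup>2) \<longlonglongrightarrow> 0" by simp
    qed
    show "AE x in lborel. norm ((s n x - f x)\<^sup>2) \<le> 4 * (w x)\<^sup>2" for n
    proof (rule AE_I2)
      fix x
      have "\<bar>s n x - f x\<bar> \<le> 2 * w x"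
        using bound[of n x] fw[of x] by linarith
      then have "\<bar>s n x - f x\<bar>\<^sup>2 \<le> (2 * w x)\<^sup>2"
        by (intro power_mono) auto
      then show "norm ((s n x - f x)\<^sup>2) \<le> 4 * (w x)\<^sup>2"
        by (simp add: power_mult_distrib)
    qed
  qed (use s f in auto)
  then have "(\<lambda>n. (norm (L2_of (s n) - L2_of f))\<^sup>2) \<longlonglongrightarrow> 0"
    by (simp add: L2_of_arith(2)[OF sqs sqf] norm_L2_of_squared[OF square_integrable_diff[OF sqs sqf]])
  then have "(\<lambda>n. sqrt ((norm (L2_of (s n) - L2_of f))\<^sup>2)) \<longlonglongrightarrow> sqrt 0"
    by (rule tendsto_real_sqrt)
  then have "(\<lambda>n. norm (L2_of (s n) - L2_of f)) \<longlonglongrightarrow> 0"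
    by simp
  then show ?thesis
    by (intro LIM_zero_cancel[of "\<lambda>n. L2_of (s n)"]) (simp add: tendsto_norm_zero_iff)
qed

lemma square_integrable_indicator:
  assumes "A \<in> sets borel" "emeasure lborel A < \<infinity>"
  shows "square_integrable (indicator A :: 'a::euclidean_space \<Rightarrow> real)"
proof -
  have "(\<lambda>x. (indicator A x :: real)\<^sup>2) = indicator A"
    by (auto simp: indicator_def)
  then show ?thesis
    using assms by (simp add: square_integrable_def)
qed

lemma L2_of_0: "L2_of (\<lambda>x. 0) = 0"
  by (simp add: zero_L2.abs_eq)

lemma L2_of_sum_in_subspace:
  assumes "subspace V" "finite Y"
    and "\<And>y. y \<in> Y \<Longrightarrow> square_integrable (h y)" "\<And>y. y \<in> Y \<Longrightarrow> L2_of (h y) \<in> V"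
  shows "square_integrable (\<lambda>x. \<Sum>y\<in>Y. h y x) \<and> L2_of (\<lambda>x. \<Sum>y\<in>Y. h y x) \<in> V"
  using assms(2-)
proof (induction Y)
  case empty
  then show ?case
    using subspace_0[OF assms(1)] by (simp add: square_integrable_0 L2_of_0)
next
  case (insert y Y)
  then have sq: "square_integrable (h y)" "square_integrable (\<lambda>x. \<Sum>y\<in>Y. h y x)"
    and V: "L2_of (h y) \<in> V" "L2_of (\<lambda>x. \<Sum>y\<in>Y. h y x) \<in> V" by auto
  have "(\<lambda>x. \<Sum>y\<in>insert y Y. h y x) = (\<lambda>x. h y x + (\<Sum>y\<in>Y. h y x))"
    using insert.hyps by auto
  then show ?case
    using square_integrable_add[OF sq] L2_of_arith(1)[OF sq] subspace_add[OF assms(1) V] by simp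
qed

lemma L2_separable: "\<exists>D :: 'a::euclidean_space L2 set. countable D \<and> closure D = UNIV"
proof -
  obtain B :: "'a set set" where B: "countable B" "topological_basis B"
    using ex_countable_basis by blast
  define G where "G = Inter ` {F. finite F \<and> F \<subseteq> B}"
  have UG: "UNIV \<in> G"
    unfolding G_def by (rule image_eqI[where x = "{}"]) auto
  have "countable G"
    unfolding G_def by (intro countable_image countable_Collect_finite_subset B(1))
  have Int: "Int_stable G"
  proof (rule Int_stableI)
    fix a b assume "a \<in> G" "b \<in> G"
    then obtain F F' where "a = \<Inter>F" "b = \<Inter>F'" "finite F" "finite F'" "F \<subseteq> B" "F' \<subseteq> B"
      by (auto simp: G_def)
    then show "a \<inter> b \<in> G"
      unfolding G_def by (intro image_eqI[where x = "F \<union> F'"]) auto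
  qed
  have openG: "open U" if "U \<in> G" for U
    using that topological_basis_open[OF B(2)] by (auto simp: G_def intro!: open_Inter)
  have "B \<subseteq> G"
    unfolding G_def by (auto intro!: image_eqI[where x = "{b}" for b])
  have sG: "sets borel = sigma_sets UNIV G"
  proof
    have "sets borel = sigma_sets UNIV B"
      by (subst borel_eq_countable_basis[OF B]) (simp add: sets_measure_of)
    then show "sets borel \<subseteq> sigma_sets UNIV G"
      using sigma_sets_mono'[OF \<open>B \<subseteq> G\<close>, of UNIV] by simp
    show "sigma_sets UNIV G \<subseteq> sets (borel :: 'a measure)"
      using sets.sigma_sets_subset[of G "borel :: 'a measure"] openG by (simp add: subset_iff)
  qed
  define S where "S = (\<lambda>(U, k). L2_of (indicator (U \<inter> ball 0 (real k)) :: 'a \<Rightarrow> real)) ` (G \<times> UNIV)"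
  have "countable S"
    unfolding S_def using \<open>countable G\<close> by (intro countable_image countable_SIGMA) auto
  then obtain D where D: "countable D" "S \<subseteq> closure D" "subspace (closure D)"
    using countable_dense_subspace by blast
  define V where "V = closure D"
  have V: "S \<subseteq> V" "subspace V" "closed V"
    using D by (auto simp: V_def)
  have SV: "L2_of (indicator (U \<inter> ball 0 (real k)) :: 'a \<Rightarrow> real) \<in> V" if "U \<in> G" for U k
    by (rule subsetD[OF V(1)[unfolded S_def]], rule image_eqI[where x = "(U, k)"]) (use that in auto)
  have fin: "emeasure lborel (A \<inter> ball 0 r) < \<infinity>" if "A \<in> sets borel" for A :: "'a set" and r
  proof -
    have "emeasure lborel (A \<inter> ball 0 r) \<le> emeasure lborel (ball (0::'a) r)"
      by (rule emeasure_mono) auto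
    also have "\<dots> < \<infinity>"
      by (rule emeasure_bounded_finite) simp
    finally show ?thesis .
  qed
  have sqb: "square_integrable (indicator (A \<inter> ball 0 r) :: 'a \<Rightarrow> real)" if "A \<in> sets borel" for A :: "'a set" and r
    using that fin by (intro square_integrable_indicator) auto
  have 1: "L2_of (indicator (A \<inter> ball 0 (real k)) :: 'a \<Rightarrow> real) \<in> V" if "A \<in> sets borel" for A k
  proof -
    have A: "A \<in> sigma_sets UNIV G"
      using that sG by simp
    have G: "G \<subseteq> Pow UNIV" by simp
    from Int G A show ?thesis
    proof (induction rule: sigma_sets_induct_disjoint)
      case (basic A)
      then show ?case
        by (rule SV)
    next
      case empty
      show ?case
        using subspace_0[OF V(2)] by (simp add: L2_of_0)
    next
      case (compl A)
      then have A: "A \<in> sets borel" using sG by simp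
      have "L2_of (indicator (UNIV \<inter> ball 0 (real k)) :: 'a \<Rightarrow> real) \<in> V"
        by (rule SV[OF UG])
      then have "L2_of (indicator (UNIV \<inter> ball 0 (real k)) :: 'a \<Rightarrow> real) - L2_of (indicator (A \<inter> ball 0 (real k))) \<in> V"
        using compl(2) by (intro subspace_diff[OF V(2)])
      moreover have "(\<lambda>x. indicator (UNIV \<inter> ball 0 (real k)) x - indicator (A \<inter> ball 0 (real k)) x :: real)
          = indicator ((UNIV - A) \<inter> ball 0 (real k))"
        by (auto simp: indicator_def)
      ultimately show ?case
        using L2_of_arith(2)[OF sqb[of UNIV "real k"] sqb[OF A, of "real k"]] by simp
    next
      case (union A)
      then have A: "A i \<in> sets borel" for i using sG by auto
      let ?s = "\<lambda>n. indicator ((\<Union>i<n. A i) \<inter> ball 0 (real k)) :: 'a \<Rightarrow> real"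
      have sV: "L2_of (?s n) \<in> V" for n
      proof (induction n)
        case 0
        show ?case
          using subspace_0[OF V(2)] by (simp add: L2_of_0)
      next
        case (Suc n)
        have "x \<notin> A n" if "x \<in> A i" "i < n" for x i
          using that disjoint_family_onD[OF union(1), of i n] by auto
        then have "?s (Suc n) = (\<lambda>x. ?s n x + indicator (A n \<inter> ball 0 (real k)) x)"
          by (auto simp: fun_eq_iff indicator_def less_Suc_eq)
        moreover have "(\<Union>i<n. A i) \<in> sets borel"
          using A by auto
        ultimately show ?case
          using L2_of_arith(1)[OF sqb[of "\<Union>i<n. A i" "real k"] sqb[OF A, of n "real k"]]
            subspace_add[OF V(2) Suc union(3)[of n]] by simp
      qed
      have "(\<lambda>n. L2_of (?s n)) \<longlonglongrightarrow> L2_of (indicator ((\<Union>i. A i) \<inter> ball 0 (real k)))"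
      proof (rule tendsto_L2_of)
        show "square_integrable (indicator (UNIV \<inter> ball 0 (real k)) :: 'a \<Rightarrow> real)"
          by (rule sqb) simp
        show "(\<lambda>n. ?s n x) \<longlonglongrightarrow> indicator ((\<Union>i. A i) \<inter> ball 0 (real k)) x" for x
          unfolding indicator_inter_arith
          by (intro tendsto_mult LIMSEQ_indicator_UN tendsto_const)
        have "U \<inter> ball 0 (real k) \<in> sets borel" if "U \<in> sets borel" for U :: "'a set"
          using that by simp
        moreover have "(\<Union>i<n. A i) \<in> sets borel" "(\<Union>i. A i) \<in> sets borel" for n
          using A by auto
        ultimately show "?s n \<in> borel_measurable lborel"
            "(indicator ((\<Union>i. A i) \<inter> ball 0 (real k)) :: 'a \<Rightarrow> real) \<in> borel_measurable lborel" for n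
          by (simp_all only: borel_measurable_indicator_iff borel_measurable_indicator measurable_lborel2 space_borel Int_UNIV_right)
      qed (auto simp: indicator_def)
      then show ?case
        using closed_sequentially[OF V(3) sV] by simp
    qed
  qed
  have 2: "L2_of (indicator A :: 'a \<Rightarrow> real) \<in> V" if A: "A \<in> sets borel" "emeasure lborel A < \<infinity>" for A
  proof -
    have "(\<lambda>k. L2_of (indicator (A \<inter> ball 0 (real k)) :: 'a \<Rightarrow> real)) \<longlonglongrightarrow> L2_of (indicator A)"
    proof (rule tendsto_L2_of)
      show "square_integrable (indicator A :: 'a \<Rightarrow> real)"
        using A by (rule square_integrable_indicator)
      show "(\<lambda>k. indicator (A \<inter> ball 0 (real k)) x :: real) \<longlonglongrightarrow> indicator A x" for x
      proof (rule tendsto_eventually)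
        obtain n where "norm x < real n"
          using reals_Archimedean2 by blast
        then have "\<And>k. k \<ge> n \<Longrightarrow> norm x < real k"
          by (meson less_le_trans of_nat_le_iff)
        then show "\<forall>\<^sub>F k in sequentially. (indicator (A \<inter> ball 0 (real k)) x :: real) = indicator A x"
          by (intro eventually_sequentiallyI[of n]) (auto simp: indicator_def)
      qed
      show "(indicator (A \<inter> ball 0 (real k)) :: 'a \<Rightarrow> real) \<in> borel_measurable lborel"
          "(indicator A :: 'a \<Rightarrow> real) \<in> borel_measurable lborel" for k
        using A(1) sets.Int[OF A(1), of "ball 0 (real k)"]
        by (simp_all only: borel_measurable_indicator measurable_lborel2 borel_open open_ball)
    qed (auto simp: indicator_def)
    then show ?thesis
      using closed_sequentially[OF V(3) 1[OF A(1)]] by simp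
  qed
  have 3: "L2_of s \<in> V" if s: "simple_function lborel s" "square_integrable s" for s :: "'a \<Rightarrow> real"
  proof -
    have fin: "finite (range s)"
      using s(1) by (simp add: simple_function_def)
    have sb: "s -` {y} \<in> sets borel" for y
      using s(2) measurable_sets[of s lborel borel "{y}"] by (auto simp: square_integrable_def)
    have em: "emeasure lborel (s -` {y}) < \<infinity>" if "y \<noteq> 0" for y
    proof -
      have "integrable lborel (\<lambda>x. y\<^sup>2 * indicator (s -` {y}) x :: real)"
        using s(2) sb by - (rule Bochner_Integration.integrable_bound[of lborel "\<lambda>x. (s x)\<^sup>2"],
           auto simp: square_integrable_def indicator_def)
      then have "integrable lborel (\<lambda>x. (1 / y\<^sup>2) * (y\<^sup>2 * indicator (s -` {y}) x) :: real)"
        by (rule integrable_mult_right)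
      then have "integrable lborel (indicator (s -` {y}) :: 'a \<Rightarrow> real)"
        using that by simp
      then show ?thesis
        using sb by (simp add: integrable_indicator_iff)
    qed
    have "square_integrable (\<lambda>x. \<Sum>y\<in>range s - {0}. y * indicator (s -` {y}) x) \<and>
        L2_of (\<lambda>x. \<Sum>y\<in>range s - {0}. y * indicator (s -` {y}) x) \<in> V"
    proof (rule L2_of_sum_in_subspace[OF V(2)])
      fix y assume "y \<in> range s - {0}"
      then have y: "square_integrable (indicator (s -` {y}) :: 'a \<Rightarrow> real)" "L2_of (indicator (s -` {y}) :: 'a \<Rightarrow> real) \<in> V"
        using square_integrable_indicator[OF sb em] 2[OF sb em] by auto
      show "square_integrable (\<lambda>x. y * indicator (s -` {y}) x)"
        by (rule square_integrable_scale[OF y(1)])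
      show "L2_of (\<lambda>x. y * indicator (s -` {y}) x) \<in> V"
        using subspace_scale[OF V(2) y(2)] scaleR_L2_of[OF y(1)] by metis
    qed (use fin in auto)
    moreover have "(\<lambda>x. \<Sum>y\<in>range s - {0}. y * indicator (s -` {y}) x) = s"
    proof
      fix x
      have "(\<Sum>y\<in>range s - {0}. y * indicator (s -` {y}) x) = (\<Sum>y\<in>range s. if y = s x then y else 0)"
        using fin by (intro sum.mono_neutral_cong_left) (auto simp: indicator_def)
      then show "(\<Sum>y\<in>range s - {0}. y * indicator (s -` {y}) x) = s x"
        using fin by (simp add: sum.delta)
    qed
    ultimately show ?thesis by simp
  qed
  have "v \<in> V" for v
  proof -
    let ?f = "L2_fun v"
    have sq: "square_integrable ?f" by (rule square_integrable_L2_fun)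
    then have f: "?f \<in> borel_measurable lborel" by (simp add: square_integrable_def)
    obtain s where s: "\<And>i. simple_function lborel (s i)"
      and lim: "\<And>x. (\<lambda>i. s i x) \<longlonglongrightarrow> ?f x" and bound: "\<And>i x. \<bar>s i x\<bar> \<le> 2 * \<bar>?f x\<bar>"
      using borel_measurable_implies_sequence_metric[OF f, of 0] by (auto simp: dist_real_def)
    have w: "square_integrable (\<lambda>x. 2 * \<bar>?f x\<bar>)"
      using sq by (auto simp: square_integrable_def power_mult_distrib)
    have sb: "s i \<in> borel_measurable lborel" for i
      using s by (rule borel_measurable_simple_function)
    have "square_integrable (s i)" for i
    proof -
      have "(s i x)\<^sup>2 \<le> (2 * \<bar>?f x\<bar>)\<^sup>2" for x
        using power_mono[OF bound[of i x], of 2] by simp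
      then have "integrable lborel (\<lambda>x. (s i x)\<^sup>2)"
        using w sb[of i] by - (rule Bochner_Integration.integrable_bound[of lborel "\<lambda>x. (2 * \<bar>?f x\<bar>)\<^sup>2"],
           auto simp: square_integrable_def)
      then show ?thesis
        using sb by (simp add: square_integrable_def)
    qed
    then have "L2_of (s i) \<in> V" for i
      using 3 s by blast
    moreover have "(\<lambda>i. L2_of (s i)) \<longlonglongrightarrow> L2_of ?f"
      by (rule tendsto_L2_of[OF sb f w bound lim])
    ultimately have "L2_of ?f \<in> V"
      by (rule closed_sequentially[OF V(3)])
    then show ?thesis by simp
  qed
  then show ?thesis
    using D(1) by (auto simp: V_def)
qed

instance L2 :: (euclidean_space) second_countable_topology
proof
  obtain D :: "'a L2 set" where D: "countable D" "closure D = UNIV"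
    using L2_separable by blast
  define B where "B = (\<lambda>(d, n). ball d (1 / real (Suc n))) ` (D \<times> UNIV)"
  have "countable B"
    unfolding B_def using D(1) by (intro countable_image countable_SIGMA) auto
  moreover have "topological_basis B"
  proof (rule topological_basisI)
    fix U and v :: "'a L2"
    assume "open U" "v \<in> U"
    then obtain e where e: "e > 0" "ball v e \<subseteq> U"
      using open_contains_ball by blast
    obtain n where n: "1 / real (Suc n) < e / 2"
      using nat_approx_posE[of "e / 2"] e(1) by auto
    have "v \<in> closure D" using D(2) by simp
    then obtain d where d: "d \<in> D" "dist d v < 1 / real (Suc n)"
      unfolding closure_approachable by (meson of_nat_0_less_iff zero_less_Suc zero_less_divide_1_iff)
    have "ball d (1 / real (Suc n)) \<subseteq> ball v e"
    proof
      fix w assume "w \<in> ball d (1 / real (Suc n))"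
      then have "dist d w < e / 2" "dist d v < e / 2"
        using n d(2) by auto
      then show "w \<in> ball v e"
        using dist_triangle_half_r[of d v e w] by (simp add: dist_commute)
    qed
    then show "\<exists>b\<in>B. v \<in> b \<and> b \<subseteq> U"
      using d e(2) by (intro bexI[of _ "ball d (1 / real (Suc n))"]) (auto simp: B_def)
  qed (auto simp: B_def)
  ultimately show "\<exists>B :: 'a L2 set set. countable B \<and> open = generate_topology B"
    using topological_basis_imp_subbasis by blast
qed

instance L2 :: (euclidean_space) polish_space ..

instance L2 :: (euclidean_space) banach ..

definition L2_on :: "'a::euclidean_space set \<Rightarrow> 'a L2 set" where
  "L2_on \<Omega> = {v. AE x in lborel. x \<notin> \<Omega> \<longrightarrow> L2_fun v x = 0}"


section \<open>Sobolev spaces\<close>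

text \<open>Infinitely differentiable functions: the function is differentiable and so, again, are all
  its partial derivatives.\<close>

coinductive smooth :: "('a::euclidean_space \<Rightarrow> real) \<Rightarrow> bool" where
  "\<forall>x. \<phi> differentiable at x \<Longrightarrow>
   \<forall>i\<in>Basis. smooth (\<lambda>x. frechet_derivative \<phi> (at x) i) \<Longrightarrow> smooth \<phi>"

definition test_function :: "'a::euclidean_space set \<Rightarrow> ('a \<Rightarrow> real) \<Rightarrow> bool" where
  "test_function U \<phi> \<longleftrightarrow>
     smooth \<phi> \<and> compact (closure {x. \<phi> x \<noteq> 0}) \<and> closure {x. \<phi> x \<noteq> 0} \<subseteq> U"

definition has_weak_pderiv :: "'a::euclidean_space set \<Rightarrow> 'a \<Rightarrow> 'a L2 \<Rightarrow> 'a L2 \<Rightarrow> bool" where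
  "has_weak_pderiv \<Omega> i v w \<longleftrightarrow> v \<in> L2_on \<Omega> \<and> w \<in> L2_on \<Omega> \<and>
     (\<forall>\<phi>. test_function \<Omega> \<phi> \<longrightarrow>
        inner v (L2_of (\<lambda>x. frechet_derivative \<phi> (at x) i)) = - inner w (L2_of \<phi>))"

definition weak_pderiv :: "'a::euclidean_space set \<Rightarrow> 'a \<Rightarrow> 'a L2 \<Rightarrow> 'a L2" where
  "weak_pderiv \<Omega> i v = (THE w. has_weak_pderiv \<Omega> i v w)"

definition H1 :: "'a::euclidean_space set \<Rightarrow> 'a L2 set" where
  "H1 \<Omega> = {v. \<forall>i\<in>Basis. \<exists>w. has_weak_pderiv \<Omega> i v w}"

text \<open>The closure of the test functions in the norm of \<open>H1\<close>.\<close>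

definition H1_0 :: "'a::euclidean_space set \<Rightarrow> 'a L2 set" where
  "H1_0 \<Omega> = {v \<in> H1 \<Omega>. \<exists>\<phi>. (\<forall>k::nat. test_function \<Omega> (\<phi> k)) \<and>
     (\<lambda>k. L2_of (\<phi> k)) \<longlonglongrightarrow> v \<and>
     (\<forall>i\<in>Basis. (\<lambda>k. L2_of (\<lambda>x. frechet_derivative (\<phi> k) (at x) i)) \<longlonglongrightarrow> weak_pderiv \<Omega> i v)}"

text \<open>Functions of time with values in a Banach space.\<close>

definition has_weak_time_deriv ::
    "real \<Rightarrow> (real \<Rightarrow> 'b::{banach, second_countable_topology}) \<Rightarrow> (real \<Rightarrow> 'b) \<Rightarrow> bool" where
  "has_weak_time_deriv T g g' \<longleftrightarrow>
     (\<forall>K. compact K \<and> K \<subseteq> {0<..<T} \<longrightarrow> set_integrable lborel K g \<and> set_integrable lborel K g') \<and>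
     (\<forall>\<phi>. test_function {0<..<T} \<phi> \<longrightarrow>
        (LINT t:{0<..<T}|lborel. deriv \<phi> t *\<^sub>R g t) = - (LINT t:{0<..<T}|lborel. \<phi> t *\<^sub>R g' t))"

definition Linfty :: "real \<Rightarrow> 'b::{banach, second_countable_topology} set \<Rightarrow> (real \<Rightarrow> 'b) \<Rightarrow> bool" where
  "Linfty T H g \<longleftrightarrow> set_borel_measurable lborel {0<..<T} g \<and>
     (\<exists>M. AE t in lborel. t \<in> {0<..<T} \<longrightarrow> g t \<in> H \<and> norm (g t) \<le> M)"

text \<open>\<open>g\<close> belongs to the Sobolev space \<open>W\<close> of order 1 and exponent infinity on \<open>(0, T)\<close> with
  values in \<open>H\<close>, and \<open>g'\<close> is its weak derivative.\<close>

definition W1infty ::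
    "real \<Rightarrow> 'b::{banach, second_countable_topology} set \<Rightarrow> (real \<Rightarrow> 'b) \<Rightarrow> (real \<Rightarrow> 'b) \<Rightarrow> bool" where
  "W1infty T H g g' \<longleftrightarrow> Linfty T H g \<and> Linfty T H g' \<and> has_weak_time_deriv T g g'"


section \<open>The elliptic operator\<close>

definition bounded_domain :: "'a::euclidean_space set \<Rightarrow> bool" where
  "bounded_domain \<Omega> \<longleftrightarrow> open \<Omega> \<and> connected \<Omega> \<and> bounded \<Omega> \<and> \<Omega> \<noteq> {}"

text \<open>A formally self-adjoint real second-order operator is in divergence form,
  \<open>A u = - (\<Sum>i j. \<partial>\<^sub>i (a\<^sub>i\<^sub>j \<partial>\<^sub>j u)) + q u\<close> with \<open>a\<close> symmetric; with the homogeneous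
  Dirichlet condition its bilinear form on \<open>H1_0 \<Omega>\<close> is the following one.\<close>

definition elliptic_form ::
    "(real^'n) set \<Rightarrow> (real^'n \<Rightarrow> real^'n^'n) \<Rightarrow> (real^'n \<Rightarrow> real) \<Rightarrow> (real^'n) L2 \<Rightarrow> (real^'n) L2 \<Rightarrow> real" where
  "elliptic_form \<Omega> a q v w =
     (LINT x:\<Omega>|lborel.
        (\<Sum>i\<in>UNIV. \<Sum>j\<in>UNIV. a x $ i $ j * L2_fun (weak_pderiv \<Omega> (axis j 1) v) x
                                         * L2_fun (weak_pderiv \<Omega> (axis i 1) w) x)
        + q x * L2_fun v x * L2_fun w x)"

text \<open>The second condition gives self-adjointness, the third uniform ellipticity; the last one is
  positive definiteness, \<open>(A v, v) \<ge> \<gamma> (v, v)\<close> with \<open>\<gamma> > 0\<close>.  The sign of \<open>q\<close> is not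
  restricted.\<close>

definition elliptic_operator ::
    "(real^'n) set \<Rightarrow> (real^'n \<Rightarrow> real^'n^'n) \<Rightarrow> (real^'n \<Rightarrow> real) \<Rightarrow> bool" where
  "elliptic_operator \<Omega> a q \<longleftrightarrow>
     (set_borel_measurable lborel \<Omega> a \<and> bounded (a ` \<Omega>) \<and>
      set_borel_measurable lborel \<Omega> q \<and> bounded (q ` \<Omega>)) \<and>
     (\<forall>x\<in>\<Omega>. transpose (a x) = a x) \<and>
     (\<exists>a0>0. \<forall>x\<in>\<Omega>. \<forall>\<xi>. a0 * (norm \<xi>)\<^sup>2 \<le> inner \<xi> (a x *v \<xi>)) \<and>
     (\<exists>\<gamma>>0. \<forall>v\<in>H1_0 \<Omega>. \<gamma> * (norm v)\<^sup>2 \<le> elliptic_form \<Omega> a q v v)"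


section \<open>Finite elements\<close>

text \<open>A conforming triangulation of mesh size \<open>h\<close> with shape regularity constant \<open>\<kappa>\<close>.\<close>

definition regular_triangulation :: "real \<Rightarrow> real \<Rightarrow> (real^'n) set \<Rightarrow> (real^'n) set set \<Rightarrow> bool" where
  "regular_triangulation \<kappa> h \<Omega> \<T> \<longleftrightarrow>
     triangulation \<T> \<and> (\<forall>K\<in>\<T>. int CARD('n) simplex K) \<and> \<Union>\<T> = closure \<Omega> \<and>
     h = Max (diameter ` \<T>) \<and>
     (\<forall>K\<in>\<T>. \<exists>x r. r > 0 \<and> cball x r \<subseteq> K \<and> diameter K \<le> \<kappa> * r)"

definition fe_space :: "(real^'n) set \<Rightarrow> (real^'n) set set \<Rightarrow> (real^'n) L2 set" where
  "fe_space \<Omega> \<T> = {v \<in> H1_0 \<Omega>. \<exists>w. continuous_on (closure \<Omega>) w \<and>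
     (\<forall>K\<in>\<T>. \<exists>b c. \<forall>x\<in>K. w x = inner b x + c) \<and>
     (AE x in lborel. x \<in> \<Omega> \<longrightarrow> L2_fun v x = w x)}"

definition L2_projection :: "'a::euclidean_space L2 set \<Rightarrow> 'a L2 \<Rightarrow> 'a L2" where
  "L2_projection X v = (THE w. w \<in> X \<and> (\<forall>\<psi>\<in>X. inner w \<psi> = inner v \<psi>))"

definition discrete_operator ::
    "'a::euclidean_space L2 set \<Rightarrow> ('a L2 \<Rightarrow> 'a L2 \<Rightarrow> real) \<Rightarrow> 'a L2 \<Rightarrow> 'a L2" where
  "discrete_operator X B \<phi> = (THE w. w \<in> X \<and> (\<forall>\<psi>\<in>X. inner w \<psi> = B \<phi> \<psi>))"


section \<open>The semidiscrete problem\<close>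

definition caputo_deriv ::
    "real \<Rightarrow> (real \<Rightarrow> 'b::{banach, second_countable_topology}) \<Rightarrow> real \<Rightarrow> 'b" where
  "caputo_deriv \<alpha> u t =
     (1 / Gamma (1 - \<alpha>)) *\<^sub>R (LINT \<zeta>:{0..t}|lborel. (t - \<zeta>) powr (- \<alpha>) *\<^sub>R vector_derivative u (at \<zeta>))"

definition semidiscrete_solution ::
    "'b::{banach, second_countable_topology} set \<Rightarrow> ('b \<Rightarrow> 'b) \<Rightarrow> real \<Rightarrow> real \<Rightarrow> (real \<Rightarrow> 'b) \<Rightarrow> 'b \<Rightarrow> (real \<Rightarrow> 'b) \<Rightarrow> bool" where
  "semidiscrete_solution X Ah \<alpha> T fh v u \<longleftrightarrow>
     (\<forall>t\<in>{0..T}. u t \<in> X) \<and> continuous_on {0..T} u \<and> u 0 = v \<and>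
     (\<forall>t\<in>{0<..<T}. u differentiable at t) \<and>
     (\<forall>t\<in>{0<..T}.
        set_integrable lborel {0..t} (\<lambda>\<zeta>. (t - \<zeta>) powr (- \<alpha>) *\<^sub>R vector_derivative u (at \<zeta>)) \<and>
        caputo_deriv \<alpha> u t + Ah (u t) = fh t)"

definition convolution_source ::
    "real \<Rightarrow> (real \<Rightarrow> 'b::{banach, second_countable_topology}) \<Rightarrow> real \<Rightarrow> 'b" where
  "convolution_source \<mu> g t = (LINT \<zeta>:{0..t}|lborel. (t - \<zeta>) powr \<mu> *\<^sub>R g \<zeta>)"


section \<open>The fully discrete scheme\<close>

primrec cq_weight :: "real \<Rightarrow> nat \<Rightarrow> real" where
  "cq_weight \<alpha> 0 = 1"
| "cq_weight \<alpha> (Suc j) = (1 - (\<alpha> + 1) / real (Suc j)) * cq_weight \<alpha> j"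

definition bdf2 :: "real \<Rightarrow> (real \<Rightarrow> 'b::real_vector) \<Rightarrow> real \<Rightarrow> 'b" where
  "bdf2 \<tau> \<phi> t = (1 / \<tau>) *\<^sub>R ((3/2) *\<^sub>R \<phi> t - 2 *\<^sub>R \<phi> (t - \<tau>) + (1/2) *\<^sub>R \<phi> (t - 2 * \<tau>))"

definition primitive :: "(real \<Rightarrow> 'b::{banach, second_countable_topology}) \<Rightarrow> real \<Rightarrow> 'b" where
  "primitive f t = (LINT \<xi>:{0..t}|lborel. f \<xi>)"

definition start_kernel :: "real \<Rightarrow> real \<Rightarrow> real" where
  "start_kernel \<alpha> t = (if t \<le> 0 then 0 else t powr (2 - \<alpha>) / Gamma (3 - \<alpha>))"

text \<open>The unknowns \<open>U\<close> are indexed by integers, with value zero at nonpositive indices.\<close>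

definition cn1_solution ::
    "'b::{banach, second_countable_topology} set \<Rightarrow> ('b \<Rightarrow> 'b) \<Rightarrow> real \<Rightarrow> real \<Rightarrow> nat \<Rightarrow> (real \<Rightarrow> 'b) \<Rightarrow> 'b \<Rightarrow>
     (int \<Rightarrow> 'b) \<Rightarrow> (nat \<Rightarrow> 'b) \<Rightarrow> bool" where
  "cn1_solution X Ah \<alpha> \<tau> N fh v U u \<longleftrightarrow>
     (\<forall>k\<le>0. U k = 0) \<and>
     (\<forall>n\<in>{1..N}. U (int n) \<in> X \<and> u n \<in> X \<and>
        \<tau> powr (- \<alpha>) *\<^sub>R (\<Sum>j\<le>n. cq_weight \<alpha> j *\<^sub>R U (int n - int j))
          + (1 - \<alpha>/2) *\<^sub>R Ah (U (int n)) + (\<alpha>/2) *\<^sub>R Ah (U (int n - 1))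
        = (1 - \<alpha>/2) *\<^sub>R primitive fh (real n * \<tau>) + (\<alpha>/2) *\<^sub>R primitive fh ((real n - 1) * \<tau>)
          + ((1 - \<alpha>/2) * bdf2 \<tau> (start_kernel \<alpha>) (real n * \<tau>)) *\<^sub>R v
          + ((\<alpha>/2) * bdf2 \<tau> (start_kernel \<alpha>) ((real n - 1) * \<tau>)) *\<^sub>R v \<and>
        u n = (1 / \<tau>) *\<^sub>R ((3/2) *\<^sub>R U (int n) - 2 *\<^sub>R U (int n - 1) + (1/2) *\<^sub>R U (int n - 2)))"

end

(*
Expanding in an L2-orthonormal eigenbasis of the discrete operator reduces the estimate to scalar
modes, which depend on the single parameter L = (eigenvalue) * tau^alpha; Bessel's inequality puts
them together again as soon as the scalar bounds are uniform in L.

For one mode the resolvents 1 / (s^alpha + L) of the equation and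
(1 - alpha s / 2) / (s^alpha + L (1 - alpha s / 2)) of the scheme are Stieltjes transforms of explicit
nonnegative densities on the negative axis, plus a pole in the case of the scheme.  Comparing the
densities shows that the error for the source 1 decays like y^(alpha - 2) uniformly in L, and it has
integral zero because the scheme is of second order.  The errors for the initial value and for the
sources t^q are BDF2 differences and convolutions of this function, where the vanishing integral
yields the missing power of decay.  Testing the weak derivatives of g with smooth cutoff functions
gives the expansion g(t) = g(0) + t g'(0) + (t * g'')(t) that matches the four terms of the bound.
*)
theory Submission
  imports Defs "HOL-Complex_Analysis.Complex_Analysis" "HOL-Real_Asymp.Real_Asymp"
begin

text \<open>The obstacle is uniformity in \<open>L\<close>: the eigenvalues are unbounded as the
  mesh is refined, so expanding a fixed mode in powers of the step is of no use. On the cut both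
  resolvents have the density \<open>kdens al L\<close>, evaluated at two different moduli, and
  \<open>kdens_bound\<close> and \<open>kdens_diff\<close> estimate it and its differences through
  the moduli alone. Second order thereby becomes the elementary closeness, at \<open>y = 0\<close>,
  of \<open>cut_symbol al (exp y - 1)\<close> to \<open>y powr al\<close> and of the BDF2 factor to
  \<open>1 / y\<close>; large \<open>y\<close> is damped by \<open>exp (- n y)\<close>.

  The scheme sees only samples of the primitive of the source. For the source
  \<open>jf (q + 1)\<close> these are samples of \<open>jf (q + 2)\<close>, which is
  \<open>jf q\<close> convolved with the ramp \<open>jf 2\<close>. Hence the discrete solution is
  exactly \<open>jf q\<close> convolved with a piecewise linear function, and no quadrature error is
  left to be treated. The starting term has the same form with \<open>q = 1 - al\<close>. The
  integral equation of the exact response is not found by inverting a transform: it is verified on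
  Laplace transforms at integers and carried back by \<open>Lerch\<close>.\<close>

abbreviation (input) "SI \<equiv> set_integrable lborel"
abbreviation (input) "SM \<equiv> set_borel_measurable lborel"
abbreviation (input) "iv x \<equiv> \<i> * complex_of_real x"

lemmas LB_def = set_lebesgue_integral_def
lemmas SI_def = set_integrable_def
lemmas SI_mult = set_integrable_mult_right
lemmas SM_def = set_borel_measurable_def
lemmas LB_mult = set_integral_mult_right
lemmas SI_HK = set_borel_integral_eq_integral
lemmas LB_cong = set_lebesgue_integral_cong
lemmas LB_diff = set_integral_diff
lemmas SI_subset = set_integrable_subset
lemmas SI_bound = set_integrable_bound
lemmas LB_add = set_integral_add
lemmas SI_cong = set_integrable_cong
lemmas SI_Icc = borel_integrable_atLeastAtMost'

section \<open>Change of variables and a Cauchy formula for the cut plane\<close>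

text \<open>The transformation theorem lives on Lebesgue measurable sets; the Borel measurability in
  \<open>m\<close> brings integrability and value back to \<open>lborel\<close>.\<close>

lemma LB_subst:
 fixes f g g' :: "real => real"
 assumes S: "S : sets borel" "g ` S : sets borel"
  and der: "!!x. x : S ==> (g has_field_derivative g' x) (at x)"
  and inj: "inj_on g S"
  and f: "SI (g ` S) f"
  and m: "SM S (%x. abs (g' x) * f (g x))"
 shows "SI S (%x. abs (g' x) * f (g x))"
  and "(LBINT x:g ` S. f x) = (LBINT x:S. abs (g' x) * f (g x))"
proof -
 have f': "f absolutely_integrable_on (g ` S)" "integral (g ` S) f = (LBINT x:g ` S. f x)"
  using f S unfolding SI_def LB_def by (auto simp: integrable_completion SI_def LB_def
     set_lebesgue_integral_eq_integral(2)[symmetric] integral_completion)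
 have der': "(g has_field_derivative g' x) (at x within S)" if "x : S" for x
  using der[OF that] has_field_derivative_at_within by blast
 have Sl: "S : sets lebesgue" using S(1) by simp
 have *: "(%x. abs (g' x) * f (g x)) absolutely_integrable_on S"
  "integral S (%x. abs (g' x) * f (g x)) = (LBINT x:g ` S. f x)"
  using has_absolute_integral_change_of_variables_1'[OF Sl der' inj, of f "LBINT x:g ` S. f x"] f' by auto
 thus 1: "SI S (%x. abs (g' x) * f (g x))"
  using m by (auto simp: SI_def SM_def integrable_completion)
 show "(LBINT x:g ` S. f x) = (LBINT x:S. abs (g' x) * f (g x))"
  using * m by (auto simp: set_lebesgue_integral_eq_integral(2)[symmetric] SI_def
    SM_def LB_def integral_completion)
qed

text \<open>Splitting \<open>cis (pi*t)\<close> off numerator and denominator leaves the quotient of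
  \<open>2 cos (pi t)\<close> and \<open>- 2 i sin (pi t)\<close>: the Cayley map sends the unit
  circle to the imaginary axis.\<close>

lemma Cayley_circle:
 assumes "0 < t" "t < 1"
 shows "(1 + cis (2*pi*t)) / (1 - cis (2*pi*t)) = \<i> * of_real (cot (pi*t))"
proof -
 define s where "s = pi*t"
 have s: "0 < s" "s < pi" using assms by (auto simp: s_def)
 have sin: "sin s > 0" using s by (rule sin_gt_zero)
 have c: "cis (2*pi*t) = cis s * cis s" by (simp add: s_def cis_mult algebra_simps)
 have e: "1 = cis s * cis (- s)" by (simp add: cis_mult)
 have n: "1 + cis s * cis s = cis s * (cis (-s) + cis s)" by (subst (1) e) (simp only: distrib_left)
 have d: "1 - cis s * cis s = cis s * (cis (-s) - cis s)" by (subst (1) e) (simp only: right_diff_distrib)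
 have a1: "cis (-s) + cis s = of_real (2*cos s)" by (simp add: complex_eq_iff)
 have a2: "cis (-s) - cis s = - \<i> * of_real (2 * sin s)" by (simp add: complex_eq_iff)
 have "(1 + cis (2*pi*t)) / (1 - cis (2*pi*t)) = of_real (2*cos s) / (- \<i> * of_real (2 * sin s))"
  unfolding c n d a1 a2 by simp
 also have "... = \<i> * of_real (cot s)"
  using sin by (auto simp: cot_def divide_simps)
 finally show ?thesis by (simp add: s_def)
qed

text \<open>The Cayley map \<open>c\<close> sends the disc to the right half-plane, \<open>0\<close>
  to \<open>a\<close> and \<open>1\<close> to infinity. Decay at infinity makes the transported
  function continuous on the closed disc, so Cauchy's formula at the centre holds on the boundary
  circle itself, without a limit of smaller radii.\<close>

lemma half_plane_mean_value:
 fixes F :: "complex => complex"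
 assumes cont: "continuous_on {u. Re u >= 0} F" and hol: "F holomorphic_on {u. Re u > 0}"
  and inf: "!!ep. ep > 0 ==> EX B. ALL u. Re u >= 0 --> norm u >= B --> norm (F u) < ep"
  and a: "a > 0"
 shows "((%t. F (\<i> * of_real (a*cot (pi*t)))) has_integral F (of_real a)) {0..1}"
proof -
 define c :: "complex => complex" where "c \<zeta> = of_real a * ((1 + \<zeta>) / (1 - \<zeta>))" for \<zeta>
 define g where "g \<zeta> = (if \<zeta> = 1 then 0 else F (c \<zeta>))" for \<zeta>
 have Re: "Re (c \<zeta>) = a*(1 - (norm \<zeta>)\<^sup>2) / (norm (1 - \<zeta>))\<^sup>2" if "\<zeta> ~= 1" for \<zeta>
  unfolding c_def by (simp add: Re_divide cmod_power2) (simp add: power2_eq_square algebra_simps)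
 have Re0: "Re (c \<zeta>) >= 0" if "\<zeta> ~= 1" "norm \<zeta> <= 1" for \<zeta>
  unfolding Re[OF that(1)] using that a by (auto intro!: divide_nonneg_nonneg mult_nonneg_nonneg simp: power_le_one)
 have Re1: "Re (c \<zeta>) > 0" if "norm \<zeta> < 1" for \<zeta>
 proof -
  have "\<zeta> ~= 1" using that by auto
  have "(norm \<zeta>)\<^sup>2 < 1"
   using that power_strict_mono[of "norm \<zeta>" 1 2] by simp
  thus ?thesis
   unfolding Re[OF \<open>\<zeta> ~= 1\<close>] using a by (intro divide_pos_pos mult_pos_pos) auto
 qed
 have contc: "continuous_on (cball 0 1 - {1}) c"
  unfolding c_def by (intro continuous_intros) auto
 have "continuous_on (cball 0 1 - {1}) (F \<circ> c)" by (rule continuous_on_compose[OF contc continuous_on_subset[OF cont]]) (use Re0 in auto)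
 hence contg1: "continuous_on (cball 0 1 - {1}) g" by (rule continuous_on_eq) (auto simp: g_def)
 have contg: "continuous_on (cball 0 1) g"
  unfolding continuous_on_eq_continuous_within
 proof
  fix \<zeta> :: complex assume \<zeta>: "\<zeta> : cball 0 1"
  show "continuous (at \<zeta> within cball 0 1) g"
  proof (cases "\<zeta> = 1")
   case True
   have "(g \<longlongrightarrow> 0) (at 1 within cball 0 1)"
   proof (rule tendstoI)
    fix ep :: real assume "ep > 0"
    then obtain B where B: "!!u. Re u >= 0 ==> norm u >= B ==> norm (F u) < ep" using inf by blast
    have "filterlim (%\<zeta>. c \<zeta>) at_infinity (at 1 within cball 0 1)"
    proof -
     have "((%\<zeta>::complex. 1 - \<zeta>) \<longlongrightarrow> 0) (at 1 within cball 0 1)" by (rule tendsto_eq_intros refl | simp)+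
     hence 1: "filterlim (%\<zeta>::complex. 1 - \<zeta>) (at 0) (at 1 within cball 0 1)" by (auto simp: filterlim_at eventually_at_filter)
     have 2: "((%\<zeta>::complex. of_real a * (1 + \<zeta>)) \<longlongrightarrow> of_real a * 2) (at 1 within cball 0 1)" by (rule tendsto_eq_intros refl | simp)+
     have "filterlim (%\<zeta>. of_real a * (1 + \<zeta>) / (1 - \<zeta>)) at_infinity (at (1::complex) within cball 0 1)" by (rule filterlim_divide_at_infinity[OF 2 1]) (use a in auto)
     thus ?thesis by (simp add: c_def)
    qed
    hence "eventually (%\<zeta>. norm (c \<zeta>) >= max 1 B) (at 1 within cball 0 1)" by (subst (asm) filterlim_at_infinity[of 0], simp, elim allE[of _ "max 1 B"]) auto
    thus "eventually (%\<zeta>. dist (g \<zeta>) 0 < ep) (at 1 within cball 0 1)"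
     unfolding eventually_at_filter
    proof eventually_elim
     case (elim \<zeta>)
     thus ?case using B[OF Re0[of \<zeta>]] by (auto simp: g_def)
    qed
   qed
   thus ?thesis by (simp add: continuous_within True g_def)
  next
   case False
   have "continuous (at \<zeta> within (cball 0 1 - {1})) g"
    using contg1 \<zeta> False by (auto simp: continuous_on_eq_continuous_within)
   moreover have "at \<zeta> within (cball 0 1 - {1}) = at \<zeta> within cball 0 1" by (rule at_within_nhd[of _ "- {1}"]) (use False in auto)
   ultimately show ?thesis by (simp add: continuous_within)
  qed
 qed
 have holg: "g holomorphic_on ball 0 1"
 proof -
  have "c holomorphic_on ball 0 1"
   unfolding c_def by (intro holomorphic_intros) auto
  hence "(F \<circ> c) holomorphic_on ball 0 1" by (rule holomorphic_on_compose_gen[OF _ hol]) (use Re1 in auto)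
  thus ?thesis by (rule holomorphic_transform) (auto simp: g_def)
 qed
 have "((%u. g u / (u - 0)) has_contour_integral (2 * of_real pi * \<i> * g 0)) (circlepath 0 1)" by (rule Cauchy_integral_circlepath[OF contg holg]) auto
 hence "((%t. (2 * of_real pi * \<i>) * g (cis (2*pi*t))) has_integral 2 * of_real pi * \<i> * g 0) {0..1}"
  unfolding has_contour_integral_def
 proof (rule has_integral_eq[rotated])
  fix t :: real assume t: "t : {0..1}"
  have ce: "exp (2 * of_real pi * \<i> * of_real t) = cis (2*pi*t)" by (simp add: cis_conv_exp mult_ac)
  have vd: "vector_derivative (circlepath 0 1) (at t within {0..1}) = 2 * of_real pi * \<i> * cis (2*pi*t)"
   using vector_derivative_circlepath01[of t 0 1] t by (simp add: ce)
  have cp: "circlepath 0 1 t = cis (2*pi*t)"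
   unfolding circlepath by (simp add: ce)
  show "g (circlepath 0 1 t) / (circlepath 0 1 t - 0) * vector_derivative (circlepath 0 1) (at t within {0..1})
    = 2 * of_real pi * \<i> * g (cis (2*pi*t))"
   unfolding vd cp by (simp add: field_simps)
 qed
 hence "((%t. 1 / (2 * of_real pi * \<i>)*((2 * of_real pi * \<i>) * g (cis (2*pi*t)))) has_integral
   1 / (2 * of_real pi * \<i>)*(2 * of_real pi * \<i> * g 0)) {0..1}" by (rule has_integral_mult_right)
 hence I: "((%t. g (cis (2*pi*t))) has_integral g 0) {0..1}" by simp
 have g0: "g 0 = F (of_real a)" by (simp add: g_def c_def)
 show ?thesis
  unfolding g0[symmetric]
 proof (rule has_integral_spike_finite[OF _ _ I])
  show "finite {0, 1::real}" by simp
  fix t :: real assume "t : {0..1} - {0, 1}"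
  hence t: "0 < t" "t < 1" by auto
  have sin: "sin (pi*t) > 0" using t by (intro sin_gt_zero) auto
  have "cis (2*pi*t) ~= 1"
  proof
   assume "cis (2*pi*t) = 1"
   hence "Re (cis (2*(pi*t))) = 1" by (simp add: mult.assoc)
   thus False using sin by (simp add: cos_double_sin)
  qed
  thus "F (\<i> * of_real (a*cot (pi*t))) = g (cis (2*pi*t))"
   using Cayley_circle[OF t] by (simp add: g_def c_def mult_ac)
 qed
qed

text \<open>For \<open>t\<close> in \<open>(0, 1/2)\<close> the points \<open>i a cot (pi t)\<close>
  run through the upper half of the imaginary axis, and their squares run once through the
  cut.\<close>

lemma cot_square_image:
 assumes "(a::real) > 0"
 shows "(%t. (a*cot (pi*t))\<^sup>2) ` {0<..<1/2} = {0<..}" "inj_on (%t. (a*cot (pi*t))\<^sup>2) {0<..<1/2}"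
  and "!!t. t : {0<..<1/2} ==> sin (pi*t) > 0 & cot (pi*t) > 0"
proof -
 show pos: "sin (pi*t) > 0 & cot (pi*t) > 0" if "t : {0<..<1/2}" for t
 proof -
  have "0 < pi*t" "pi*t < pi/2" using that by auto
  hence "sin (pi*t) > 0" "cos (pi*t) > 0" by (auto intro!: sin_gt_zero cos_gt_zero)
  thus ?thesis by (simp add: cot_def)
 qed
 have ct: "cot x = inverse (tan x)" for x :: real by (simp add: cot_def tan_def)
 show "(%t. (a*cot (pi*t))\<^sup>2) ` {0<..<1/2} = {0<..}"
 proof (intro equalityI subsetI)
  fix x assume "x : (%t. (a*cot (pi*t))\<^sup>2) ` {0<..<1/2}"
  thus "x : {0<..}" using pos assms by fastforce
 next
  fix x :: real assume "x : {0<..}"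
  hence x: "x > 0" by simp
  define t where "t = arctan (a / sqrt x) / pi"
  have "0 < arctan (a / sqrt x)" "arctan (a / sqrt x) < pi/2"
   using assms x arctan_ubound by auto
  hence "t : {0<..<1/2}" by (auto simp: t_def field_simps)
  moreover have "cot (pi*t) = sqrt x / a" by (simp add: t_def ct tan_arctan)
  hence "(a*cot (pi*t))\<^sup>2 = x" using assms x by simp
  ultimately show "x : (%t. (a*cot (pi*t))\<^sup>2) ` {0<..<1/2}" by (intro image_eqI[of _ _ t]) simp_all
 qed
 show "inj_on (%t. (a*cot (pi*t))\<^sup>2) {0<..<1/2}"
 proof (rule inj_onI)
  fix s t assume st: "s : {0<..<1/2}" "t : {0<..<1/2}" and "(a*cot (pi * s))\<^sup>2 = (a*cot (pi*t))\<^sup>2"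
  hence "a*cot (pi * s) = a*cot (pi*t)"
   using pos[OF st(1)] pos[OF st(2)] assms by (subst (asm) power2_eq_iff_nonneg) auto
  hence "tan (pi * s) = tan (pi*t)" using assms by (simp add: ct)
  have "arctan (tan (pi*r)) = pi*r" if "r : {0<..<1/2}" for r
  proof (rule arctan_tan)
   have "0 < pi*r" "pi*r < pi/2" using that by auto
   thus "- (pi/2) < pi*r" "pi*r < pi/2" by linarith+
  qed
  note arct = this
  have "pi * s = arctan (tan (pi * s))" by (rule arct[OF st(1), symmetric])
  also have "... = arctan (tan (pi*t))" by (simp only: \<open>tan (pi * s) = tan (pi * t)\<close>)
  also have "... = pi*t" by (rule arct[OF st(2)])
  finally have "pi * s = pi*t" .
  thus "s = t" by simp
 qed
qed

text \<open>Under \<open>w = u\<^sup>2\<close> the right half-plane corresponds to the plane cut along the negative axis, and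
 this is the Cauchy formula on the boundary of the cut.  It comes from the mean value formula for
 \<open>u F(u) / (1 + ep u)\<close>, where the factor depending on \<open>ep\<close> only serves to make the function vanish at infinity.\<close>

lemma Stieltjes_representation:
 fixes F :: "complex => complex"
 assumes cont: "continuous_on {u. Re u >= 0} F" and hol: "F holomorphic_on {u. Re u > 0}"
  and inf: "!!ep. ep > 0 ==> EX B. ALL u. Re u >= 0 --> norm u >= B --> norm (F u) < ep"
  and a: "a > 0"
  and sym: "!!y. y > 0 ==> F (- (iv y)) = cnj (F (iv y))"
  and int: "SI {0<..} (%x. norm (F (iv (sqrt x))) / (x + a\<^sup>2))"
 shows "SI {0<..} (%x. Im (F (iv (sqrt x))) / (x + a\<^sup>2))"
  and "Re (F (of_real a)) = - (1 / pi)*(LBINT x:{0<..}. Im (F (iv (sqrt x))) / (x + a\<^sup>2))"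
proof -
 let ?B = "LBINT x:{0<..}. Im (F (iv (sqrt x))) / (x + a\<^sup>2)"
 let ?A = "of_real a"
 define S :: "real set" where "S = {0<..<1/2}"
 define et where "et t = a*cot (pi*t)" for t
 define g where "g t = (et t)\<^sup>2" for t
 define g' where "g' t = 2*et t * (a*(pi*- inverse ((sin (pi*t))\<^sup>2)))" for t
 have pos: "sin (pi*t) > 0" "cot (pi*t) > 0" "et t > 0" if "t : S" for t
  using cot_square_image(3)[OF a] that a by (auto simp: S_def et_def)
 have img: "g ` S = {0<..}" "inj_on g S"
  using cot_square_image(1,2)[OF a] by (simp_all add: S_def g_def[abs_def] et_def)
 have der: "(g has_field_derivative g' t) (at t)" if "t : S" for t
 proof -
  have "((%t. cot (pi*t)) has_field_derivative - inverse ((sin (pi*t))\<^sup>2) * pi) (at t)" by (rule DERIV_chain2[OF DERIV_cot]) (use pos(1)[OF that] in "auto intro!: derivative_eq_intros")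
  thus ?thesis
   unfolding g_def g'_def et_def by (auto intro!: derivative_eq_intros)
 qed
 have contet: "continuous_on S et"
  unfolding et_def using pos(1) by (auto intro!: continuous_intros simp: less_imp_neq[symmetric] dest!: pos(1))
 have contF: "continuous_on X (%x. F (iv (h x)))" if "continuous_on X h" for X and h :: "real => real" by (rule continuous_on_compose2[OF cont]) (use that in "auto intro!: continuous_intros")
 have mes: "SM X h" if "continuous_on X h" "X : sets borel" for X and h :: "real => real"
  using borel_measurable_continuous_on_indicator[OF that(2,1)] by (simp add: SM_def)
 \<comment> \<open>The Jacobian cancels the kernel \<open>1 / (x + a^2)\<close> up to
   \<open>2 pi cot (pi t)\<close>, which is proportional to the boundary point itself. This is the
   origin of the factor \<open>u\<close> in the mean value formula for
   \<open>u F(u)\<close>.\<close>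
 have jac: "abs (g' t) / (g t + a\<^sup>2) = 2*pi*cot (pi*t)" if "t : S" for t
 proof -
  have "g t + a\<^sup>2 = a\<^sup>2*((cos (pi*t))\<^sup>2 + (sin (pi*t))\<^sup>2) / (sin (pi*t))\<^sup>2"
   using pos(1)[OF that] by (simp only: g_def et_def cot_def power_mult_distrib power_divide distrib_left add_divide_distrib) simp
  hence 1: "g t + a\<^sup>2 = a\<^sup>2 / (sin (pi*t))\<^sup>2" by simp
  have 2: "abs (g' t) = 2*et t * (a*(pi*inverse ((sin (pi*t))\<^sup>2)))"
   using pos[OF that] a by (simp add: g'_def abs_mult)
  show ?thesis unfolding 1 2 using pos[OF that] a by (simp add: et_def power2_eq_square field_simps)
 qed
 have sq: "sqrt (g t) = et t" if "t : S" for t using pos(3)[OF that] by (simp add: g_def)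
 have contg': "continuous_on S g'"
  unfolding g'_def using pos(1) by (intro continuous_intros contet) (auto dest!: pos(1))
 have contg: "continuous_on S g" unfolding g_def by (intro continuous_intros contet)
 \<comment> \<open>Stated for a general \<open>ph\<close> because it is applied twice: with the norm
   it produces the integrable majorant, with \<open>Im\<close> the representation.\<close>
 have subst: "SI S (%t. 2*pi*cot (pi*t) * ph (F (iv (et t))))"
   "(LBINT x:{0<..}. ph (F (iv (sqrt x))) / (x + a\<^sup>2)) = (LBINT t:S. 2*pi*cot (pi*t) * ph (F (iv (et t))))"
   "SI {0<..} (%x. ph (F (iv (sqrt x))) / (x + a\<^sup>2))"
  if ph: "continuous_on UNIV ph" "!!z. abs (ph z) <= norm z" for ph :: "complex => real"
 proof -
  let ?f = "%x. ph (F (iv (sqrt x))) / (x + a\<^sup>2)"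
  have c: "continuous_on {0<..} ?f"
  proof -
   have "x + a\<^sup>2 ~= 0" if "x > 0" for x
    using that zero_le_power2[of a] by linarith
   thus ?thesis by (intro continuous_intros continuous_on_compose2[OF ph(1)] contF) auto
  qed
  show i: "SI {0<..} ?f"
   using int
  proof (rule SI_bound)
   show "SM {0<..} ?f" by (rule mes[OF c]) auto
   show "AE x in lborel. x : {0<..} --> norm (?f x) <= norm (cmod (F (iv (sqrt x))) / (x + a\<^sup>2))"
    using ph(2) by (intro AE_I2) (auto simp: abs_mult intro!: divide_right_mono)
  qed
  have S': "S : sets borel" "g ` S : sets borel" by (simp add: S_def, simp add: img)
  have c2: "continuous_on S (%t. abs (g' t) * ?f (g t))" by (intro continuous_intros contg' continuous_on_compose2[OF c contg]) (auto simp: g_def dest: pos(3))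
  have i': "SI (g ` S) ?f" using i by (simp add: img)
  have e: "abs (g' t) * ?f (g t) = 2*pi*cot (pi*t) * ph (F (iv (et t)))" if "t : S" for t
   using jac[OF that] sq[OF that] by (metis (no_types, lifting) times_divide_eq_left times_divide_eq_right mult.commute)
  note * = LB_subst[OF S' der img(2) i' mes[OF c2 S'(1)]]
  show "SI S (%t. 2*pi*cot (pi*t) * ph (F (iv (et t))))"
   using *(1) e by (simp cong: SI_cong)
  show "(LBINT x:{0<..}. ?f x) = (LBINT t:S. 2*pi*cot (pi*t) * ph (F (iv (et t))))"
   using *(2) LB_cong[of S lborel "%t. abs (g' t) * ?f (g t)"] e S'(1) by (simp add: img)
 qed
 note subN = subst[OF continuous_on_norm[OF continuous_on_id], simplified]
 note subI = subst[of Im, OF _ abs_Im_le_cmod, OF continuous_on_Im[OF continuous_on_id]]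
 show "SI {0<..} (%x. Im (F (iv (sqrt x))) / (x + a\<^sup>2))" by (rule subI(3))
 define Ph where "Ph ep u = u*F u / (1 + of_real ep * u)" for ep :: real and u
 define ph where "ph ep t = Re (Ph ep (iv (et t)))" for ep t
 have nz: "1 + of_real ep * u ~= 0" if "ep > 0" "Re u >= 0" for ep u
 proof
  assume "1 + of_real ep * u = 0"
  hence "Re (1 + of_real ep * u) = 0" by simp
  hence "1 + ep*Re u = 0" by simp
  moreover have "ep*Re u >= 0" using that by simp
  ultimately show False by linarith
 qed
 have mv: "((ph ep) has_integral (a*Re (F ?A) / (1 + ep*a))) {0..1}" if ep: "ep > 0" for ep
 proof -
  have "((%t. Ph ep (\<i> * of_real (a*cot (pi*t)))) has_integral Ph ep ?A) {0..1}"
  proof (rule half_plane_mean_value[OF _ _ _ a])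
   show "continuous_on {u. 0 <= Re u} (Ph ep)"
    unfolding Ph_def using nz[OF ep] by (intro continuous_intros cont) auto
   show "Ph ep holomorphic_on {u. 0 < Re u}"
    unfolding Ph_def using nz[OF ep] by (intro holomorphic_intros hol) auto
   fix e :: real assume e: "e > 0"
   then obtain B where B: "!!u. 0 <= Re u ==> B <= norm u ==> norm (F u) < e*ep"
    using inf[of "e*ep"] ep by auto
   show "EX B. ALL u. 0 <= Re u --> B <= cmod u --> cmod (Ph ep u) < e"
   proof (intro exI[of _ B] allI impI)
    fix u assume u: "0 <= Re u" "B <= cmod u"
    have "norm (of_real ep * u) <= norm (1 + of_real ep * u)"
    proof -
     have "(Re (of_real ep * u))\<^sup>2 <= (Re (1 + of_real ep * u))\<^sup>2"
      using u(1) ep by (intro power_mono) auto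
     thus ?thesis by (simp add: cmod_def)
    qed
    hence n: "ep*norm u <= norm (1 + of_real ep * u)" using ep by (simp add: norm_mult)
    have p: "norm (1 + of_real ep * u) > 0" using nz[OF ep u(1)] by simp
    have "norm u * norm (F u) <= norm (F u) / ep*norm (1 + of_real ep * u)"
     using mult_right_mono[OF n, of "norm (F u) / ep"] ep by (simp add: field_simps)
    also have "... < e*norm (1 + of_real ep * u)"
     using B[OF u] ep p by (intro mult_strict_right_mono) (auto simp: field_simps)
    finally show "cmod (Ph ep u) < e"
     using p by (simp add: Ph_def norm_mult norm_divide field_simps)
   qed
  qed
  hence "((Re \<circ> (%t. Ph ep (\<i> * of_real (a*cot (pi*t))))) has_integral Re (Ph ep ?A)) {0..1}" by (rule has_integral_linear[OF _ bounded_linear_Re])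
  moreover have "Re (Ph ep ?A) = a*Re (F ?A) / (1 + ep*a)"
  proof -
   have "Ph ep ?A = of_real (a / (1 + ep*a)) * F ?A" by (simp add: Ph_def)
   thus ?thesis by (simp only: Re_complex_of_real Im_complex_of_real times_complex.sel) simp
  qed
  ultimately show ?thesis by (simp add: ph_def[abs_def] et_def o_def)
 qed
 \<comment> \<open>On the imaginary axis \<open>1 + ep u\<close> has real part 1, so the bound is
   free of \<open>ep\<close> and survives the limit.\<close>
 have bnd: "abs (ph ep t) <= et t * norm (F (iv (et t)))" if "t : S" for ep t
 proof -
  have 1: "norm (1 + of_real ep * (iv (et t))) >= 1"
   using complex_Re_le_cmod[of "1 + of_real ep * (iv (et t))"] by simp
  have "abs (ph ep t) <= norm (Ph ep (iv (et t)))" unfolding ph_def by (rule abs_Re_le_cmod)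
  also have "... = et t * norm (F (iv (et t))) / norm (1 + of_real ep * (iv (et t)))"
   using pos(3)[OF that] by (simp add: Ph_def norm_mult norm_divide)
  also have "... <= et t * norm (F (iv (et t)))/1" by (rule divide_left_mono[OF 1]) (use pos(3)[OF that] 1 in "auto intro!: mult_nonneg_nonneg")
  finally show ?thesis by simp
 qed
 have domi: "SI S (%t. et t * norm (F (iv (et t))))"
 proof -
  have "SI S (%t. a / (2*pi)*(2*pi*cot (pi*t) * norm (F (iv (et t)))))"
   using subN(1) by (intro SI_mult)
  thus ?thesis by (simp add: et_def mult.assoc)
 qed
 have contph: "continuous_on S (ph ep)" for ep
 proof -
  have "1 + of_real ep * (iv (et t)) ~= (0::complex)" for t by (simp add: complex_eq_iff)
  thus ?thesis unfolding ph_def Ph_def by (intro continuous_intros contF contet) auto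
 qed
 have Sb: "S : sets borel" by (simp add: S_def)
 have intph: "SI S (ph ep)" for ep
  using domi by (rule SI_bound) (use mes[OF contph Sb] bnd in "auto intro!: AE_I2 order_trans[OF bnd]")
 \<comment> \<open>Conjugate symmetry of \<open>F\<close> makes the contributions of
   \<open>t\<close> and \<open>1 - t\<close> equal, so each half of the circle carries half of the
   mean value.\<close>
 have half: "(LBINT t:S. ph ep t) = a*Re (F ?A) / (2*(1 + ep*a))" if ep: "ep > 0" for ep
 proof -
  have refl: "ph ep (1 - t) = ph ep t" if "t : S" for t
  proof -
   have et': "et (1 - t) = - et t" by (simp add: et_def cot_def right_diff_distrib sin_diff cos_diff)
   have "Ph ep (iv (- et t)) = cnj (Ph ep (iv (et t)))"
    using sym[OF pos(3)[OF that]] by (simp add: Ph_def)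
   thus ?thesis unfolding ph_def et' by (simp only: cnj.sel)
  qed
  have i1: "((ph ep) has_integral (LBINT t:S. ph ep t)) {0..1/2}"
  proof -
   have "((ph ep) has_integral (LBINT t:S. ph ep t)) S"
    using SI_HK[OF intph] by (metis has_integral_integral)
   thus ?thesis
    unfolding S_def by (simp add: has_integral_Icc_iff_Ioo)
  qed
  have "((%t. ph ep (-1*t + 1)) has_integral (LBINT t:S. ph ep t)) {1/2..1}"
  proof (rule has_integral_spike_finite[of "{1/2,1}"])
   have "((%t. ph ep ((- 1) *\<^sub>R t + 1)) has_integral (1 / abs (- 1) ^ DIM(real)) *\<^sub>R (LBINT t:S. ph ep t))
    ((%x. (1 / - 1) *\<^sub>R x + - ((1 / - 1) *\<^sub>R 1)) ` cbox 0 (1/2))" by (rule has_integral_affinity) (use i1 in auto)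
   moreover have "((%x. (1 / - 1) *\<^sub>R x + - ((1 / - 1) *\<^sub>R 1)) ` cbox 0 (1/2)) = {1/2..1::real}" by (auto simp: image_iff intro!: bexI[of _ "1 - x" for x])
   ultimately show "((%t. ph ep (-1*t + 1)) has_integral (LBINT t:S. ph ep t)) {1/2..1}" by simp
  qed auto
  hence i2: "((ph ep) has_integral (LBINT t:S. ph ep t)) {1/2..1}"
  proof (rule has_integral_spike_finite[of "{1/2,1}", rotated 2])
   fix t :: real assume "t : {1/2..1} - {1/2, 1}"
   hence "1 - t : S" by (auto simp: S_def)
   from refl[OF this] show "ph ep t = ph ep (- 1*t + 1)" by simp
  qed auto
  have "((ph ep) has_integral ((LBINT t:S. ph ep t) + (LBINT t:S. ph ep t))) {0..1}" by (rule has_integral_combine[OF _ _ i1 i2]) auto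
  from has_integral_unique[OF this mv[OF ep]]
  have "2*(LBINT t:S. ph ep t) = a*Re (F ?A) / (1 + ep*a)" by simp
  hence "(LBINT t:S. ph ep t) = a*Re (F ?A) / (1 + ep*a)/2" by (metis nonzero_mult_div_cancel_left zero_neq_numeral)
  thus ?thesis by simp
 qed
 \<comment> \<open>As \<open>ep\<close> tends to \<open>0\<close>, the real part of
   \<open>i et F\<close> is \<open>- et Im F\<close>; hence only the imaginary part of
   \<open>F\<close> enters the result.\<close>
 have lim: "(%n. LBINT t:S. ph (1 / real (Suc n)) t) \<longlonglongrightarrow> (LBINT t:S. - (et t * Im (F (iv (et t)))))"
  unfolding LB_def
 proof (rule integral_dominated_convergence[where w = "%t. indicator S t *\<^sub>R (et t * norm (F (iv (et t))))"])
  have "continuous_on S (%t. - (et t * Im (F (iv (et t)))))" by (intro continuous_intros contF contet)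
  from mes[OF this Sb]
  show "(%t. indicator S t *\<^sub>R - (et t * Im (F (iv (et t))))) : borel_measurable lborel" by (simp only: SM_def)
  show "(%t. indicator S t *\<^sub>R ph (1 / real (Suc n)) t) : borel_measurable lborel" for n
   using mes[OF contph Sb] by (simp add: SM_def)
  show "integrable lborel (%t. indicator S t *\<^sub>R (et t * norm (F (iv (et t)))))"
   using domi by (simp add: SI_def)
  show "AE t in lborel. norm (indicator S t *\<^sub>R ph (1 / real (Suc n)) t) <= indicator S t *\<^sub>R (et t * norm (F (iv (et t))))" for n
   using bnd by (intro AE_I2) (auto simp: indicator_def)
  show "AE t in lborel. (%n. indicator S t *\<^sub>R ph (1 / real (Suc n)) t) \<longlonglongrightarrow> indicator S t *\<^sub>R - (et t * Im (F (iv (et t))))"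
  proof (rule AE_I2)
   fix t
   have "(%n. 1 / real (Suc n)) \<longlonglongrightarrow> 0" using LIMSEQ_inverse_real_of_nat by (simp add: inverse_eq_divide)
   hence "(%n. ph (1 / real (Suc n)) t) \<longlonglongrightarrow> Re (\<i> * of_real (et t) * F (iv (et t)) / (1 + of_real 0 * (iv (et t))))"
    unfolding ph_def Ph_def by (intro tendsto_intros) auto
   thus "(%n. indicator S t *\<^sub>R ph (1 / real (Suc n)) t) \<longlonglongrightarrow> indicator S t *\<^sub>R - (et t * Im (F (iv (et t))))" by (intro tendsto_intros) simp
  qed
 qed
 have "(%n. a*Re (F ?A) / (2*(1 + 1 / real (Suc n) * a))) \<longlonglongrightarrow> a*Re (F ?A) / (2*(1 + 0*a))"
  using LIMSEQ_inverse_real_of_nat by (intro tendsto_intros) (simp_all add: inverse_eq_divide)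
 hence "(%n. LBINT t:S. ph (1 / real (Suc n)) t) \<longlonglongrightarrow> a*Re (F ?A)/2" by (simp add: half)
 from LIMSEQ_unique[OF this lim]
 have "a*Re (F ?A)/2 = (LBINT t:S. (- a / (2*pi))*(2*pi*cot (pi*t) * Im (F (iv (et t)))))" by (simp add: et_def mult_ac)
 also have "... = (- a / (2*pi))*?B" by (subst subI(2)) (rule LB_mult)
 finally have e: "a*Re (F ?A)/2 = (- a / (2*pi))*?B" .
 have *: "R = - (1 / pi) * lm" if "a*R/2 = (- a / (2*pi)) * lm" for R lm :: real
 proof -
  have "R = (2 / a)*(a*R/2)" using a by simp
  also have "... = (2 / a)*((- a / (2*pi)) * lm)" by (simp only: that)
  also have "... = - (1 / pi) * lm" using a by simp
  finally show ?thesis .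
 qed
 show "Re (F ?A) = - (1 / pi)*?B" by (rule *[OF e])
qed

section \<open>The exact resolvent as a Stieltjes transform\<close>

lemma SI_nonneg:
 fixes f :: "real => real"
 assumes "(f has_integral I) S" "!!x. x : S ==> 0 <= f x" "SM S f"
 shows "SI S f" "(LBINT x:S. f x) = I"
proof -
 have 1: "f absolutely_integrable_on S"
  using assms(1,2) by (intro nonnegative_absolutely_integrable_1) auto
 thus "SI S f"
  using assms(3) by (simp add: SI_def SM_def integrable_completion)
 have "(LBINT x:S. f x) = (LINT x:S|lebesgue. f x)"
  using assms(3) by (simp add: LB_def SM_def integral_completion)
 also have "... = I"
  using set_lebesgue_integral_eq_integral(2)[OF 1] assms(1) by (simp add: integral_unique)
 finally show "(LBINT x:S. f x) = I" .
qed

lemma SM_cont: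
 fixes f :: "real => 'a::real_normed_vector"
 assumes "continuous_on S f" "S : sets borel"
 shows "SM S f"
 using borel_measurable_continuous_on_indicator[OF assms(2,1)] by (simp add: SM_def)

lemma SI_powr_divide:
 assumes "0 < be" "be < 1" "s > 0"
 shows "SI {0<..} (%x::real. x powr (-be) / (x + s))"
proof -
 let ?A = "%x::real. x powr (-be) / (x + s)"
 have c: "continuous_on {0<..} ?A"
  using assms by (auto intro!: continuous_intros)
 have m: "SM S ?A" if "S : sets borel" "S \<subseteq> {0<..}" for S by (rule SM_cont[OF continuous_on_subset[OF c that(2)] that(1)])
 have 1: "SI {0<..<1} (%x::real. x powr (-be))"
 proof (rule SI_nonneg)
  have "((%x::real. x powr (-be)) has_integral 1 powr (-be + 1) / (-be + 1)) {0..1}" by (rule has_integral_powr_from_0) (use assms in auto)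
  thus "((%x::real. x powr (-be)) has_integral 1 powr (-be + 1) / (-be + 1)) {0<..<1}" by (simp only: has_integral_Icc_iff_Ioo)
  show "SM {0<..<1} (%x::real. x powr (-be))" by (rule SM_cont) (auto intro!: continuous_intros)
 qed auto
 have 2: "SI {1..} (%x::real. x powr (-be - 1))"
 proof (rule SI_nonneg)
  show "((%x::real. x powr (-be - 1)) has_integral - (1 powr (-be - 1 + 1)) / (-be - 1 + 1)) {1..}" by (rule has_integral_powr_to_inf) (use assms in auto)
  show "SM {1..} (%x::real. x powr (-be - 1))" by (rule SM_cont) (auto intro!: continuous_intros)
 qed auto
 have "SI {0<..<1} ?A"
 proof (rule SI_bound[OF SI_mult[of "1/s", OF 1]])
  show "AE x in lborel. x : {0<..<1} --> norm (x powr (-be) / (x + s)) <= norm (1 / s*x powr (-be))"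
  proof (intro AE_I2 impI)
   fix x :: real assume "x : {0<..<1}"
   thus "norm (x powr (-be) / (x + s)) <= norm (1 / s*x powr (-be))"
    using assms by (auto intro!: divide_left_mono)
  qed
 qed (rule m, auto)
 moreover have "SI {1..} ?A"
 proof (rule SI_bound[OF 2])
  show "AE x in lborel. x : {1..} --> norm (x powr (-be) / (x + s)) <= norm (x powr (-be - 1))"
  proof (intro AE_I2 impI)
   fix x :: real assume x: "x : {1..}"
   have "x powr (-be - 1) = x powr (-be) / x"
    using x by (simp add: powr_diff)
   thus "norm (x powr (-be) / (x + s)) <= norm (x powr (-be - 1))"
    using x assms by (auto intro!: divide_left_mono)
  qed
 qed (rule m, auto)
 ultimately have "SI ({0<..<1} \<union> {1..}) ?A" by (intro set_integrable_Un) auto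
 moreover have "{0<..<1} \<union> {1..} = {0::real<..}" by auto
 ultimately show ?thesis by simp
qed

text \<open>Times \<open>- pi\<close> this is the imaginary part of
  \<open>1 / (rh cis (pi al) + L)\<close>, the boundary value of a resolvent on the cut when its
  symbol has modulus \<open>rh\<close> and argument \<open>pi al\<close>. The modulus is a separate
  variable because exact and discrete resolvent differ on the cut only through it.\<close>

definition kdens :: "real => real => real => real" where
 "kdens al L rh = sin (pi*al) / pi*rh / (rh\<^sup>2 + 2*L*rh*cos (pi*al) + L\<^sup>2)"

lemma powr_polar:
 fixes u :: complex
 assumes "u ~= 0"
 shows "u powr (of_real b) = of_real (norm u powr b) * cis (b*Im (Ln u))"
  and "u = of_real (norm u) * cis (Im (Ln u))"
proof -
 have lm: "Ln u = of_real (ln (norm u)) + \<i> * of_real (Im (Ln u))"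
  using assms by (simp add: complex_eq_iff Re_Ln)
 have e: "exp (of_real c * Ln u) = of_real (norm u powr c) * cis (c*Im (Ln u))" for c
 proof -
  have "exp (of_real c * Ln u) = exp (of_real (c*ln (norm u)) + \<i> * of_real (c*Im (Ln u)))" by (subst lm) (simp add: algebra_simps)
  also have "... = of_real (exp (c*ln (norm u))) * cis (c*Im (Ln u))" by (simp only: exp_add cis_conv_exp exp_of_real)
  finally show ?thesis using assms by (simp add: powr_def)
 qed
 show "u powr (of_real b) = of_real (norm u powr b) * cis (b*Im (Ln u))"
  using e[of b] assms by (simp add: powr_def)
 show "u = of_real (norm u) * cis (Im (Ln u))"
  using e[of 1] assms by simp
qed

text \<open>Under \<open>w = u^2\<close> the two points are the upper and the lower side of the cut
  at \<open>w = - x\<close>, where \<open>w powr al\<close> has the arguments \<open>pi al\<close>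
  and \<open>- pi al\<close>.\<close>

lemma powr_imaginary_axis:
 assumes "x > 0"
 shows "(iv (sqrt x)) powr (of_real (2*al)) = of_real (x powr al) * cis (pi*al)"
  "(- (iv (sqrt x))) powr (of_real (2*al)) = of_real (x powr al) * cis (- (pi*al))"
proof -
 have s: "sqrt x > 0" "sqrt x powr (2*al) = x powr al"
  using assms by (simp_all add: powr_half_sqrt[symmetric] powr_powr)
 have "Ln (iv (sqrt x)) = of_real (ln (sqrt x)) + \<i> * of_real pi/2"
  using Ln_times_of_real[OF s(1), of \<i>] Ln_of_real[OF s(1)] by (simp add: mult.commute)
 hence "Im (Ln (iv (sqrt x))) = pi/2" by simp
 thus "(iv (sqrt x)) powr (of_real (2*al)) = of_real (x powr al) * cis (pi*al)"
  using assms s powr_polar(1)[of "\<i> * of_real (sqrt x)" "2*al"] by (simp add: norm_mult mult_ac)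
 have "Ln (of_real (sqrt x) * - \<i>) = of_real (ln (sqrt x)) - \<i> * of_real pi/2"
  using Ln_times_of_real[OF s(1), of "- \<i>"] Ln_of_real[OF s(1)] by simp
 hence "Im (Ln (- (iv (sqrt x)))) = - (pi/2)" by (simp add: mult.commute)
 thus "(- (iv (sqrt x))) powr (of_real (2*al)) = of_real (x powr al) * cis (- (pi*al))"
  using assms s powr_polar(1)[of "- (iv (sqrt x))" "2*al"] by (simp add: norm_mult mult_ac)
qed

locale fractional_order =
 fixes al :: real
 assumes al: "0 < al" "al < 1"
begin

lemma sin_pos: "sin (pi*al) > 0"
 using al by (intro sin_gt_zero) auto

lemma abs_cos_less: "abs (cos (pi*al)) < 1"
proof -
 have "(cos (pi*al))\<^sup>2 < 1" using sin_pos sin_cos_squared_add[of "pi*al"] by (smt (verit) zero_less_power)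
 thus ?thesis by (simp add: abs_square_less_1)
qed

text \<open>Since \<open>abs (cos (pi*al)) < 1\<close>, the quadratic form in \<open>rh\<close> and
  \<open>L\<close> is definite. The lower bound treats both variables alike: discarding
  \<open>L^2\<close> gives bounds uniform in \<open>L\<close>, discarding \<open>rh^2\<close> gives
  decay in \<open>L\<close>.\<close>

lemma kdens_denominator:
 "(1 - abs (cos (pi*al)))*(rh\<^sup>2 + L\<^sup>2) <= rh\<^sup>2 + 2*L*rh*cos (pi*al) + L\<^sup>2"
proof -
 have "abs (2*L*rh) <= rh\<^sup>2 + L\<^sup>2"
  using sum_squares_bound[of "abs L" "abs rh"] by (simp add: abs_mult)
 hence "abs (2*L*rh) * abs (cos (pi*al)) <= (rh\<^sup>2 + L\<^sup>2) * abs (cos (pi*al))" by (rule mult_right_mono) simp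
 moreover have "- (2*L*rh*cos (pi*al)) <= abs (2*L*rh) * abs (cos (pi*al))" by (metis abs_ge_minus_self abs_mult)
 ultimately show ?thesis by (simp add: algebra_simps)
qed

lemma norm_cis_add:
 "(norm (of_real rh * cis (pi*al) + of_real L))\<^sup>2 = rh\<^sup>2 + 2*L*rh*cos (pi*al) + L\<^sup>2"
proof -
 have "(norm (of_real rh * cis (pi*al) + of_real L))\<^sup>2
   = (rh*cos (pi*al) + L)\<^sup>2 + (rh * sin (pi*al))\<^sup>2"
  unfolding cmod_power2 by simp
 also have "... = rh\<^sup>2*((sin (pi*al))\<^sup>2 + (cos (pi*al))\<^sup>2) + 2*L*rh*cos (pi*al) + L\<^sup>2" by algebra
 finally show ?thesis by (simp only: sin_cos_squared_add mult_1_right)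
qed

lemma Im_kdens:
 "Im (1 / (of_real rh * cis (pi*al) + of_real L)) = - pi*kdens al L rh"
proof -
 have "Im (1 / z) = - Im z / (norm z)\<^sup>2" for z by (simp add: Im_divide cmod_power2)
 thus ?thesis by (simp add: kdens_def norm_cis_add mult_ac)
qed

lemma norm_cis_add_ge:
 assumes "rh >= 0" "L >= 0"
 shows "norm (of_real rh * cis (pi*al) + of_real L) >= sqrt (1 - abs (cos (pi*al))) * max rh L"
proof (rule power2_le_imp_le)
 have "(max rh L)\<^sup>2 <= rh\<^sup>2 + L\<^sup>2" by (auto simp: max_def)
 thus "(sqrt (1 - abs (cos (pi*al))) * max rh L)\<^sup>2 <= (norm (of_real rh * cis (pi*al) + of_real L))\<^sup>2"
  unfolding norm_cis_add power_mult_distrib using abs_cos_less by (intro order_trans[OF _ kdens_denominator]) (auto intro!: mult_left_mono)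
qed simp

text \<open>For \<open>Re u >= 0\<close> the argument of \<open>u powr (2*al)\<close> is at most
  \<open>pi al\<close> in modulus, hence below \<open>pi\<close>, and the power cannot equal
  \<open>- L\<close>.\<close>

lemma Re_half_plane_powr_ne:
 assumes "Re u >= 0" "L > 0"
 shows "u powr (of_real (2*al)) + of_real L ~= 0"
proof (cases "u = 0")
 case False
 define th where "th = 2*Im (Ln u)"
 have th: "abs th <= pi" using Re_Ln_pos_le[OF False] assms(1) by (simp add: th_def)
 have e: "u powr (of_real (2*al)) = of_real (norm u powr (2*al)) * cis (al*th)"
  using powr_polar(1)[OF False, of "2*al"] by (simp add: th_def mult_ac)
 have r: "norm u powr (2*al) > 0" using False by simp
 show ?thesis
 proof
  assume z: "u powr (of_real (2*al)) + of_real L = 0"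
  hence "Im (u powr (of_real (2*al)) + of_real L) = 0" "Re (u powr (of_real (2*al)) + of_real L) = 0" by simp_all
  hence s: "sin (al*th) = 0" and c: "norm u powr (2*al) * cos (al*th) + L = 0" using r unfolding e by auto
  have "abs (al*th) < pi"
  proof -
   have "al*abs th <= al*pi" using th al by (intro mult_left_mono) auto
   also have "... < 1*pi" using al by (intro mult_strict_right_mono) auto
   finally show ?thesis using al by (simp add: abs_mult)
  qed
  hence "al*th = 0" using sin_eq_0_pi[OF _ _ s] by linarith
  hence "cos (al*th) = 1" by (simp only: cos_zero)
  thus False using c r assms(2) by simp
 qed
qed (use assms in auto)

lemma continuous_on_powr_half_plane: "continuous_on {u. Re u >= 0} (%u::complex. u powr of_real (2*al))"
 using al by (intro continuous_on_powr_complex continuous_intros) auto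

lemma holomorphic_on_powr_half_plane: "(%u::complex. u powr of_real (2*al)) holomorphic_on {u. Re u > 0}" by (intro holomorphic_intros) (auto simp: complex_nonpos_Reals_iff)

text \<open>The variable \<open>u\<close> is a square root of \<open>s\<close>, and the
  representation is taken at \<open>a = sqrt s\<close>. On the cut \<open>norm_cis_add_ge\<close>
  bounds the resolvent by a multiple of \<open>x powr (- al)\<close>, which is integrable against
  \<open>1 / (x + s)\<close> at both ends.\<close>

lemma Stieltjes_powr:
 assumes L: "L > 0" and s: "s > 0"
 shows "SI {0<..} (%x. kdens al L (x powr al) / (x + s))"
  "(LBINT x:{0<..}. kdens al L (x powr al) / (x + s)) = 1 / (s powr al + L)"
proof -
 define F where "F u = 1 / (u powr (of_real (2*al)) + of_real L)" for u :: complex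
 define a where "a = sqrt s"
 have a: "a > 0" "a\<^sup>2 = s" using s by (simp_all add: a_def)
 have ax: "F (iv (sqrt x)) = 1 / (of_real (x powr al) * cis (pi*al) + of_real L)" if "x > 0" for x
  using powr_imaginary_axis(1)[OF that, of al] by (simp add: F_def)
 have c: "continuous_on {u. Re u >= 0} F"
  unfolding F_def using Re_half_plane_powr_ne[OF _ L] by (intro continuous_intros continuous_on_powr_half_plane) auto
 have h: "F holomorphic_on {u. Re u > 0}"
  unfolding F_def using Re_half_plane_powr_ne[OF _ L] by (intro holomorphic_on_divide holomorphic_on_add holomorphic_on_const holomorphic_on_powr_half_plane) auto
 define d where "d = sqrt (1 - abs (cos (pi*al)))"
 have d: "d > 0" using abs_cos_less by (simp add: d_def)
 have i: "EX B. ALL u. Re u >= 0 --> norm u >= B --> norm (F u) < ep" if "ep > 0" for ep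
 proof -
  have "((%r. 1 / (r powr (2*al) - L)) \<longlongrightarrow> 0) at_top" "filterlim (%r. r powr (2*al) - L) at_top at_top"
   using al by real_asymp+
  hence "eventually (%r. 1 / (r powr (2*al) - L) < ep & r powr (2*al) - L > 0) at_top"
   using that by (intro eventually_conj order_tendstoD(2)) (auto simp only: filterlim_at_top_dense)
  then obtain B where B: "!!r. r >= B ==> 1 / (r powr (2*al) - L) < ep & r powr (2*al) - L > 0" by (auto simp: eventually_at_top_linorder)
  show ?thesis
  proof (intro exI[of _ "max B 1"] allI impI)
   fix u assume u: "0 <= Re u" "max B 1 <= norm u"
   hence "u ~= 0" by auto
   hence n: "norm (u powr of_real (2*al)) = norm u powr (2*al)"
    unfolding powr_polar(1)[OF \<open>u ~= 0\<close>] by (simp add: norm_mult)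
   have "norm (u powr of_real (2*al) + of_real L) >= norm u powr (2*al) - L"
    using norm_diff_ineq[of "u powr of_real (2*al)" "of_real L"] L unfolding n by simp
   hence "norm (F u) <= 1 / (norm u powr (2*al) - L)"
    using B[of "norm u"] u unfolding F_def norm_divide by (auto intro!: divide_left_mono mult_pos_pos)
   thus "norm (F u) < ep" using B[of "norm u"] u by auto
  qed
 qed
 have y: "F (- (iv y)) = cnj (F (iv y))" if "y > 0" for y
  using powr_imaginary_axis[of "y\<^sup>2" al] that by (simp add: F_def cis_cnj)
 have int: "SI {0<..} (%x. norm (F (iv (sqrt x))) / (x + a\<^sup>2))"
  unfolding a(2)
 proof (rule SI_bound[OF SI_mult[of "1/d", OF SI_powr_divide[OF al s]]])
  have "continuous_on {0<..} (%x. norm (F (iv (sqrt x))) / (x + s))"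
   using s by (intro continuous_intros continuous_on_compose2[OF c]) auto
  thus "SM {0<..} (%x. norm (F (iv (sqrt x))) / (x + s))" by (rule SM_cont) auto
  show "AE x in lborel. x : {0<..} --> norm (norm (F (iv (sqrt x))) / (x + s)) <= norm (1 / d*(x powr - al / (x + s)))"
  proof (intro AE_I2 impI)
   fix x :: real assume x: "x : {0<..}"
   have "d*x powr al <= norm (of_real (x powr al) * cis (pi*al) + of_real L)"
    using norm_cis_add_ge[of "x powr al" L] L d unfolding d_def[symmetric] by (smt (verit, best) max.cobounded1 mult_left_mono powr_ge_zero)
   moreover have "0 < d*x powr al" using x d by simp
   ultimately have "norm (F (iv (sqrt x))) <= 1 / (d*x powr al)"
    unfolding ax[of x, OF x[simplified]] norm_divide by (auto intro!: divide_left_mono mult_pos_pos)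
   also have "... = 1 / d*x powr (-al)" by (simp add: powr_minus_divide)
   finally show "norm (norm (F (iv (sqrt x))) / (x + s)) <= norm (1 / d*(x powr - al / (x + s)))"
    using x s d by (auto simp: divide_simps mult_right_mono)
  qed
 qed
 have Im: "Im (F (iv (sqrt x))) = - pi*kdens al L (x powr al)" if "x > 0" for x
  unfolding ax[OF that] by (rule Im_kdens)
 note St = Stieltjes_representation[OF c h i a(1) y int]
 have 1: "SI {0<..} (%x. (- 1 / pi)*(Im (F (iv (sqrt x))) / (x + a\<^sup>2)))" by (rule SI_mult) (rule St(1))
 have e: "(- 1 / pi)*(Im (F (iv (sqrt x))) / (x + a\<^sup>2)) = kdens al L (x powr al) / (x + s)" if "x : {0<..}" for x
  using that Im[of x] by (simp add: a(2))
 have "SI {0<..} (%x. (- 1 / pi)*(Im (F (iv (sqrt x))) / (x + a\<^sup>2)))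
   = SI {0<..} (%x. kdens al L (x powr al) / (x + s))" by (rule SI_cong[OF refl refl]) (rule e)
 thus "SI {0<..} (%x. kdens al L (x powr al) / (x + s))"
  using 1 by (simp only:)
 have "a powr (2*al) = s powr al" using s by (simp add: a_def powr_half_sqrt[symmetric] powr_powr)
 hence "F (of_real a) = of_real (1 / (s powr al + L))"
  using a(1) powr_of_real[of a "2*al"] by (simp add: F_def)
 hence "1 / (s powr al + L) = - (1 / pi)*(LBINT x:{0<..}. Im (F (iv (sqrt x))) / (x + a\<^sup>2))"
  using St(2) by simp
 also have "... = (LBINT x:{0<..}. (- 1 / pi)*(Im (F (iv (sqrt x))) / (x + a\<^sup>2)))" by (subst LB_mult) simp
 also have "... = (LBINT x:{0<..}. kdens al L (x powr al) / (x + s))" by (rule LB_cong) (use e in auto)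
 finally show "(LBINT x:{0<..}. kdens al L (x powr al) / (x + s)) = 1 / (s powr al + L)" by simp
qed

end

section \<open>The resolvent of the scheme\<close>

text \<open>In the variable \<open>w = 1 - z\<close> the convolution quadrature scheme has the resolvent
 \<open>(1 - al w / 2) / (w powr al + L (1 - al w / 2))\<close>.  Apart from the cut along the negative axis it has
 exactly one pole, which is real and larger than \<open>2 / al\<close>.\<close>

definition pole :: "real => real => real" where
 "pole al L = (SOME w. w > 2 / al & w powr al + L*(1 - al/2*w) = 0)"

text \<open>Numerator over derivative of the denominator at the simple zero
  \<open>pole al L\<close>: the residue in the variable \<open>w\<close>.\<close>

definition presid :: "real => real => real" where
 "presid al L = (1 - al/2*pole al L) / (al*pole al L powr (al - 1) - L*al/2)"

text \<open>Division of numerator and denominator by \<open>1 - al w / 2\<close> gives the resolvent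
  the form \<open>1 / (symbol + L)\<close>. At \<open>w = - x\<close> this symbol has the modulus
  defined here and still the argument \<open>pi al\<close>, because the divisor is positive
  there.\<close>

definition cut_symbol :: "real => real => real" where
 "cut_symbol al x = x powr al / (1 + al/2*x)"

context fractional_order
begin

text \<open>At \<open>2 / al\<close> the linear term vanishes and the power is positive; since
  \<open>al < 1\<close>, the linear term, which is negative beyond that point, wins for large
  \<open>w\<close>.\<close>

lemma pole:
 assumes "L > 0"
 shows "pole al L > 2 / al" "pole al L powr al + L*(1 - al/2*pole al L) = 0"
proof -
 define f where "f w = w powr al + L*(1 - al/2*w)" for w
 have a: "f (2 / al) > 0" using al by (simp add: f_def)
 have "filterlim (%w. - f w) at_top at_top" unfolding f_def using al assms by real_asymp
 hence "eventually (%w. - f w > 0) at_top" by (simp only: filterlim_at_top_dense)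
 then obtain B where B: "!!w. w >= B ==> - f w > 0" by (auto simp: eventually_at_top_linorder)
 have "EX w>=2/al. w <= max B (2/al) & f w = 0"
 proof (rule IVT2')
  show "f (max B (2 / al)) <= 0" using B[of "max B (2/al)"] by simp
  show "continuous_on {2 / al..max B (2 / al)} f"
   unfolding f_def using al by (intro continuous_intros) auto
 qed (use a in auto)
 then obtain w where w: "w >= 2/al" "f w = 0" by auto
 hence "w > 2/al" using a by (cases "w = 2/al") auto
 hence "EX w. w > 2 / al & w powr al + L*(1 - al/2*w) = 0" using w by (auto simp: f_def)
 from someI_ex[OF this] show "pole al L > 2 / al" "pole al L powr al + L*(1 - al/2*pole al L) = 0" by (simp_all add: pole_def)
qed

lemma two_over_al: "2 / al > 2"
 using al by (simp add: field_simps)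

lemma pole_pos:
 assumes "L > 0"
 shows "pole al L > 2"
 using pole(1)[OF assms] two_over_al by linarith

text \<open>Divided by \<open>w\<close> the equation reads
  \<open>w powr (al - 1) = L * (al/2 - 1/w)\<close>, with a decreasing left and an increasing right
  side.\<close>

lemma pole_unique:
 assumes L: "L > 0" and w: "w > 0" "w powr al + L*(1 - al/2*w) = 0"
 shows "w = pole al L"
proof -
 have *: False if "0 < v" "v < w" "v powr al + L*(1 - al/2 * v) = 0" "w powr al + L*(1 - al/2*w) = 0" for v w
 proof -
  have "v / w < (v / w) powr al"
  proof -
   have "(v / w) powr 1 < (v / w) powr al"
    using that al by (intro powr_less_mono') auto
   thus ?thesis using that by simp
  qed
  hence "v / w < v powr al / w powr al" using that by (simp add: powr_divide)
  hence "v * w powr al < w * v powr al" using that by (simp add: field_simps)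
  moreover have "v powr al = - (L*(1 - al/2 * v))" "w powr al = - (L*(1 - al/2*w))"
   using that(3,4) by linarith+
  hence "v * w powr al = L*(al/2 * v * w - v)" "w * v powr al = L*(al/2 * v * w - w)" by (simp_all only:) (simp_all add: algebra_simps)
  ultimately have "L*w < L * v" by (simp add: algebra_simps)
  thus False using that L by simp
 qed
 show ?thesis
  using *[of w "pole al L"] *[of "pole al L" w] pole[OF L] pole_pos[OF L] w by (cases w "pole al L" rule: linorder_cases) auto
qed

text \<open>The pole equation eliminates \<open>L\<close>, so derivative and residue are expressed
  by the pole alone. The sign of the derivative shows that the zero is simple, and the closed form
  of the residue can be bounded uniformly in \<open>L\<close>.\<close>

lemma pole_residue_eq:
 assumes L: "L > 0"
 defines "w \<equiv> pole al L"
 shows "al*w powr (al - 1) - L*al/2 = - (al*w powr (al - 1))*(((1 - al) * w + 2) / (al*w - 2))"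
  and "al*w powr (al - 1) - L*al/2 < 0"
  and "presid al L = (al*w - 2)\<^sup>2*w powr (1 - al) / (2*al*((1 - al) * w + 2))"
proof -
 have w: "w > 2" "al*w - 2 > 0"
  using pole_pos[OF L] pole(1)[OF L] al by (auto simp: w_def field_simps)
 have p: "w powr al = w powr (al - 1) * w" using w by (simp add: powr_diff)
 have "w powr al = L*((al*w - 2)/2)"
  using pole(2)[OF L] unfolding w_def[symmetric] by (simp add: field_simps)
 hence lm: "L = 2*(w powr (al - 1) * w) / (al*w - 2)"
  using w(2) p by (simp add: divide_simps)
 show 1: "al*w powr (al - 1) - L*al/2 = - (al*w powr (al - 1))*(((1 - al) * w + 2) / (al*w - 2))"
  using w(2) unfolding lm by (simp add: divide_simps) algebra
 have pos: "w powr (al - 1) > 0" "(1 - al) * w + 2 > 0" using w al by (auto intro!: add_pos_pos mult_pos_pos)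
 show "al*w powr (al - 1) - L*al/2 < 0"
  unfolding 1 using pos w(2) al by (auto intro!: mult_pos_pos divide_pos_pos)
 have q: "w powr (1 - al) = 1 / w powr (al - 1)" by (subst powr_minus_divide[symmetric]) simp
 have "presid al L = (1 - al/2*w) / (- (al*w powr (al - 1))*(((1 - al) * w + 2) / (al*w - 2)))"
  unfolding presid_def w_def[symmetric] 1 ..
 also have "... = (al*w - 2)\<^sup>2*w powr (1 - al) / (2*al*((1 - al) * w + 2))"
  unfolding q using pos w(2) al by (simp add: divide_simps power2_eq_square) algebra
 finally show "presid al L = (al*w - 2)\<^sup>2*w powr (1 - al) / (2*al*((1 - al) * w + 2))" .
qed

text \<open>Let \<open>th\<close> be the argument of \<open>u^2\<close> and \<open>r\<close> the
  modulus of \<open>u\<close>. Eliminating the quadratic term between real and imaginary part leaves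
  \<open>L sin th + r powr (2*al) * sin ((1 - al) * th) = 0\<close>. For
  \<open>0 < abs th <= pi\<close> both summands have the sign of \<open>th\<close> or vanish, and
  the second does not vanish; hence \<open>th = 0\<close>.\<close>

lemma Re_half_plane_zero:
 assumes u: "Re u >= 0" and L: "L > 0"
  and z: "u powr (of_real (2*al)) + of_real L * (1 - of_real (al/2) * u\<^sup>2) = 0"
 shows "u = of_real (sqrt (pole al L))"
proof -
 have False if "u = 0" using z that L by simp
 hence u0: "u ~= 0" by auto
 define r where "r = norm u"
 define th where "th = 2*Im (Ln u)"
 have r: "r > 0" using u0 by (simp add: r_def)
 have th: "abs th <= pi" using Re_Ln_pos_le[OF u0] u by (simp add: th_def)
 have e: "u powr (of_real (2*al)) = of_real (r powr (2*al)) * cis (al*th)"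
  using powr_polar(1)[OF u0, of "2*al"] by (simp add: th_def r_def mult_ac)
 have "u\<^sup>2 = (of_real r * cis (th/2))\<^sup>2" by (subst powr_polar(2)[OF u0]) (simp add: r_def th_def)
 also have "... = of_real (r\<^sup>2) * cis th" by (simp add: power_mult_distrib power2_eq_square cis_mult)
 finally have e2: "u\<^sup>2 = of_real (r\<^sup>2) * cis th" .
 let ?P = "r powr (2*al)"
 have I: "?P * sin (al*th) = L*(al/2) * r\<^sup>2 * sin th"
  using arg_cong[OF z, of Im] unfolding e e2 by simp
 have R: "?P*cos (al*th) + L = L*(al/2) * r\<^sup>2*cos th"
  using arg_cong[OF z, of Re] unfolding e e2 by (simp add: algebra_simps)
 have "L * sin th + ?P * sin ((1 - al) * th) = L * sin th + ?P*(sin th * cos (al*th) - cos th * sin (al*th))" by (simp add: left_diff_distrib sin_diff)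
 also have "... = (?P*cos (al*th) + L) * sin th - (?P * sin (al*th)) * cos th" by (simp add: algebra_simps)
 also have "... = 0" unfolding I R by simp
 finally have S: "L * sin th + ?P * sin ((1 - al) * th) = 0" .
 have P: "?P > 0" using r by simp
 have ap: "0 < (1 - al) * t" "(1 - al) * t < pi" if "0 < t" "t <= pi" for t
 proof -
  show "0 < (1 - al) * t" using that al by simp
  have "0 < al*t" using that al by simp
  thus "(1 - al) * t < pi" using that unfolding left_diff_distrib by linarith
 qed
 have key: "L * sin t + ?P * sin ((1 - al) * t) > 0" if t: "0 < t" "t <= pi" for t
  using sin_gt_zero[OF ap[OF t]] sin_ge_zero[of t] t L P by (intro add_nonneg_pos) auto
 have "th = 0"
 proof (rule ccontr)
  assume "th ~= 0"
  then consider "0 < th" | "0 < - th" by linarith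
  thus False
  proof cases
   case 1 thus False using key[of th] S th by auto
  next
   case 2
   have "L * sin (-th) + ?P * sin ((1 - al) * -th) = - (L * sin th + ?P * sin ((1 - al) * th))"
    unfolding mult_minus_right[of "1 - al"] sin_minus by simp
   thus False using key[of "-th"] S th 2 by auto
  qed
 qed
 have "r = sqrt (pole al L)"
 proof -
  have "r\<^sup>2 = pole al L"
  proof (rule pole_unique[OF L])
   have "(r\<^sup>2) powr al = ?P" using r powr_powr[of r 2 al] by (simp only: powr_numeral)
   thus "(r\<^sup>2) powr al + L*(1 - al/2*r\<^sup>2) = 0" using R \<open>th = 0\<close> by (simp add: algebra_simps)
  qed (use r in auto)
  thus ?thesis using r real_sqrt_unique by fastforce
 qed
 moreover have "u = of_real r" using powr_polar(2)[OF u0] \<open>th = 0\<close> by (simp add: r_def th_def)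
 ultimately show ?thesis by simp
qed

lemma cut_symbol_pos: "x > 0 ==> cut_symbol al x > 0"
 using al by (auto simp: cut_symbol_def intro!: divide_pos_pos add_pos_pos)

text \<open>The resolvent tends to \<open>1 / L\<close> at infinity and has its only pole at
  \<open>pole al L\<close>. With both contributions subtracted, the remainder is continuous and
  decays, so it is represented by its boundary values; the subtracted terms are real on the cut and
  leave the density unchanged.\<close>

lemma Stieltjes_scheme:
 assumes L: "L > 0" and s: "0 < s" "s < 2"
 shows "SI {0<..} (%x. kdens al L (cut_symbol al x) / (x + s))"
  "(1 - al/2 * s) / (s powr al + L*(1 - al/2 * s)) = 1 / L + presid al L / (s - pole al L)
    + (LBINT x:{0<..}. kdens al L (cut_symbol al x) / (x + s))"
proof -
 let ?A = "LBINT x:{0<..}. kdens al L (cut_symbol al x) / (x + s)"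
 define w0 where "w0 = pole al L"
 define u0 :: complex where "u0 = of_real (sqrt w0)"
 define H where "H = {u::complex. Re u > 0}"
 define K where "K = {u::complex. Re u >= 0}"
 define M where "M u = 1 - of_real (al/2) * u\<^sup>2" for u :: complex
 define D where "D u = u powr (of_real (2*al)) + of_real L * M u" for u
 define C where "C = presid al L"
 have w0: "w0 > 2" "w0 > 2 / al" "w0 powr al + L*(1 - al/2*w0) = 0"
  using pole_pos[OF L] pole[OF L] by (simp_all add: w0_def)
 have sw: "sqrt w0 > 0" "sqrt w0 powr (2*al) = w0 powr al"
  using w0 by (simp_all add: powr_half_sqrt[symmetric] powr_powr)
 have u0H: "u0 : H" using sw by (simp add: u0_def H_def)
 have opH: "open H" unfolding H_def by (rule open_halfspace_Re_gt)
 have HK: "H \<subseteq> K" by (auto simp: H_def K_def)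
 have Dne: "D u ~= 0" if "u : K" "u ~= u0" for u
  using Re_half_plane_zero[OF _ L, of u] that by (auto simp: D_def M_def K_def u0_def w0_def)
 have pr: "u0 powr (of_real b) = of_real (sqrt w0 powr b)" for b
  using sw(1) unfolding u0_def by (simp add: powr_of_real)
 have u02: "u0\<^sup>2 = of_real w0" using w0 by (simp add: u0_def flip: of_real_power)
 have M0: "M u0 = of_real (1 - al/2*w0)" by (simp add: M_def u02)
 have D0: "D u0 = 0"
 proof -
  have "D u0 = of_real (w0 powr al + L*(1 - al/2*w0))"
   unfolding D_def M0 pr sw(2) by simp
  thus ?thesis by (simp only: w0(3) of_real_0)
 qed
 have holM: "M holomorphic_on X" for X unfolding M_def by (intro holomorphic_intros)
 have holD: "D holomorphic_on H"
  unfolding D_def H_def by (intro holomorphic_intros holomorphic_on_powr_half_plane holM)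
 have contM: "continuous_on X M" for X unfolding M_def by (intro continuous_intros)
 have contD: "continuous_on K D"
  unfolding D_def K_def by (intro continuous_intros continuous_on_powr_half_plane contM)
 define \<delta> where "\<delta> = al*w0 powr (al - 1) - L*al/2"
 have \<delta>: "\<delta> < 0" using pole_residue_eq(2)[OF L] by (simp add: \<delta>_def w0_def)
 have dD: "deriv D u0 = 2*u0 * of_real \<delta>"
 proof -
  have "u0 \<notin> \<real>\<^sub>\<le>\<^sub>0" using sw by (simp add: u0_def)
  hence "((%u. u powr (of_real (2*al)) + of_real L * (1 - of_real (al/2) * u\<^sup>2)) has_field_derivative
    (of_real (2*al) * u0 powr (of_real (2*al) - 1) + of_real L * (0 - of_real (al/2)*(2*u0)))) (at u0)" by (auto intro!: derivative_eq_intros)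
  hence "deriv D u0 = of_real (2*al) * u0 powr (of_real (2*al - 1)) - of_real (L*al) * u0"
   unfolding D_def M_def by (auto dest!: DERIV_imp_deriv)
  also have "u0 powr (of_real (2*al - 1)) = of_real (w0 powr (al - 1)) * u0"
  proof -
   have "sqrt w0 powr (2*al - 1) = w0 powr (al - 1) * sqrt w0"
    using w0 by (simp add: powr_half_sqrt[symmetric] powr_powr diff_divide_distrib flip: powr_add)
   thus ?thesis unfolding pr by (simp add: u0_def)
  qed
  finally show ?thesis by (simp add: \<delta>_def algebra_simps)
 qed
 have u0n: "u0 ~= 0" using sw by (simp add: u0_def)
 \<comment> \<open>In the variable \<open>u\<close> the pole sits at \<open>u0 = sqrt w0\<close>.
   \<open>E\<close> is the denominator with its simple zero divided out, so
   \<open>M / D = G / (u - u0)\<close> with \<open>G\<close> holomorphic; \<open>G2\<close> divides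
   once more and is the regular part.\<close>
 define E where "E u = (if u = u0 then deriv D u0 else (D u - D u0) / (u - u0))" for u
 have holE: "E holomorphic_on H"
  unfolding E_def by (rule pole_lemma[OF holD]) (use u0H opH in "simp add: interior_open")
 have Ene: "E u ~= 0" if "u : H" for u
  using Dne[of u] that HK D0 dD u0n \<delta> by (auto simp: E_def)
 define G where "G u = M u / E u" for u
 have holG: "G holomorphic_on H" unfolding G_def using Ene by (intro holomorphic_intros holM holE) auto
 define G2 where "G2 u = (if u = u0 then deriv G u0 else (G u - G u0) / (u - u0))" for u
 have holG2: "G2 holomorphic_on H"
  unfolding G2_def by (rule pole_lemma[OF holG]) (use u0H opH in "simp add: interior_open")
 \<comment> \<open>The chain rule factor \<open>2 u0\<close> of \<open>w = u^2\<close> relates the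
   residue in \<open>u\<close> to the residue \<open>C\<close> in \<open>w\<close>.\<close>
 have GC: "2*u0*G u0 = of_real C"
 proof -
  have "2*u0*G u0 = M u0 / of_real \<delta>" using dD u0n by (simp add: G_def E_def)
  also have "... = of_real C" unfolding M0 C_def presid_def \<delta>_def w0_def by simp
  finally show ?thesis .
 qed
 define Fb where "Fb u = M u / D u - of_real (1 / L) - of_real C / (u\<^sup>2 - of_real w0)" for u
 \<comment> \<open>The value at \<open>u0\<close> is dictated by the partial fractions
   \<open>2 u0 / (u^2 - w0) = 1 / (u - u0) - 1 / (u + u0)\<close>, the first of which is absorbed by
   \<open>G2\<close>.\<close>
 define F where "F u = (if u = u0 then G2 u0 + G u0 / (u0 + u0) - of_real (1 / L) else Fb u)" for u
 have sqne: "u\<^sup>2 - of_real w0 ~= 0" if "u : K" "u ~= u0" for u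
 proof
  assume "u\<^sup>2 - of_real w0 = 0"
  hence "(u - u0)*(u + u0) = 0" by (simp add: u02[symmetric] power2_eq_square algebra_simps)
  hence "u = - u0" using that(2) by (simp add: eq_neg_iff_add_eq_0)
  thus False using that(1) sw by (auto simp: K_def u0_def)
 qed
 have holF: "F holomorphic_on H"
 proof (rule holomorphic_transform)
  show "(%u. G2 u + G u0 / (u + u0) - of_real (1 / L)) holomorphic_on H"
  proof -
   have "u + u0 ~= 0" if "u : H" for u
   proof
    assume "u + u0 = 0"
    hence "Re (u + u0) = 0" by simp
    thus False using that sw by (simp add: H_def u0_def)
   qed
   thus ?thesis by (intro holomorphic_intros holG2) auto
  qed
  show "G2 u + G u0 / (u + u0) - of_real (1 / L) = F u" if u: "u : H" for u
  proof (cases "u = u0")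
   case False
   have K: "u : K" using u HK by auto
   have n: "u - u0 ~= 0" "u + u0 ~= 0" using sqne[OF K False] False by (auto simp: u02[symmetric] power2_eq_square algebra_simps eq_neg_iff_add_eq_0[symmetric])
   have g: "G u / (u - u0) = M u / D u" using False D0 n(1) by (simp add: G_def E_def)
   have "G2 u + G u0 / (u + u0) = M u / D u - (G u0 / (u - u0) - G u0 / (u + u0))"
    using False g by (simp add: G2_def diff_divide_distrib)
   also have "G u0 / (u - u0) - G u0 / (u + u0) = 2*u0*G u0 / (u\<^sup>2 - of_real w0)"
    unfolding u02[symmetric] diff_frac_eq[OF n] by (rule arg_cong2[of _ _ _ _ "(/)"]) (simp_all add: power2_eq_square algebra_simps)
   finally show ?thesis unfolding GC using False by (simp add: F_def Fb_def)
  qed (simp add: F_def)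
 qed
 have contF: "continuous_on K F"
 proof -
  have 1: "continuous_on (K - {u0}) F"
  proof (rule continuous_on_eq)
   show "continuous_on (K - {u0}) Fb"
    unfolding Fb_def using Dne sqne by (intro continuous_intros contM continuous_on_subset[OF contD]) auto
  qed (simp add: F_def)
  have "continuous_on ((K - {u0}) \<union> H) F"
  proof (rule continuous_on_Un_local_open[OF _ _ 1 holomorphic_on_imp_continuous_on[OF holF]])
   show "openin (top_of_set (K - {u0} \<union> H)) (K - {u0})"
    unfolding openin_open using HK u0H by (intro exI[of _ "- {u0}"]) auto
   show "openin (top_of_set (K - {u0} \<union> H)) H"
    unfolding openin_open using opH by (intro exI[of _ H]) auto
  qed
  moreover have "(K - {u0}) \<union> H = K" using HK u0H by auto
  ultimately show ?thesis by simp
 qed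
 have MD: "M u / D u - of_real (1 / L) = - (u powr (of_real (2*al)) / (of_real L * D u))" if "D u ~= 0" for u
  using that L by (simp add: divide_simps) (simp add: D_def algebra_simps)
 have inf: "EX B. ALL u. Re u >= 0 --> norm u >= B --> norm (F u) < ep" if "ep > 0" for ep
 proof -
  define h1 where "h1 r = L*(al/2*r\<^sup>2 - 1) - r powr (2*al)" for r
  define h2 where "h2 r = r\<^sup>2 - w0" for r
  have "((%r. r powr (2*al) / (L*h1 r) + abs C / h2 r) \<longlongrightarrow> 0) at_top" "filterlim h1 at_top at_top" "filterlim h2 at_top at_top"
   unfolding h1_def h2_def using al L by real_asymp+
  hence "eventually (%r. r powr (2*al) / (L*h1 r) + abs C / h2 r < ep & h1 r > 0 & h2 r > 0) at_top"
   using that by (intro eventually_conj order_tendstoD(2)) (auto simp only: filterlim_at_top_dense)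
  then obtain B where B: "!!r. r >= B ==> r powr (2*al) / (L*h1 r) + abs C / h2 r < ep & h1 r > 0 & h2 r > 0" by (auto simp: eventually_at_top_linorder)
  show ?thesis
  proof (intro exI[of _ "max B (max 1 (norm u0 + 1))"] allI impI)
   fix u :: complex assume "0 <= Re u" and nu: "max B (max 1 (norm u0 + 1)) <= norm u"
   moreover have "norm u >= 1" "norm u >= norm u0 + 1" "norm u >= B"
    using nu norm_ge_zero[of u0] by (simp_all only: max.bounded_iff)
   ultimately have u: "u : K" "u ~= u0" "u ~= 0" "norm u >= B" by (auto simp: K_def)
   define r where "r = norm u"
   have b: "r powr (2*al) / (L*h1 r) + abs C / h2 r < ep" "h1 r > 0" "h2 r > 0" using B[of r] u by (auto simp: r_def)
   have n: "norm (u powr of_real (2*al)) = r powr (2*al)"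
    unfolding powr_polar(1)[OF u(3)] r_def by (simp add: norm_mult)
   have M: "norm (M u) >= al/2*r\<^sup>2 - 1"
   proof -
    have "norm (of_real (al/2) * u\<^sup>2) - norm (1::complex) <= norm (of_real (al/2) * u\<^sup>2 - 1)" by (rule norm_triangle_ineq2)
    thus ?thesis using al by (simp add: M_def r_def norm_mult norm_power norm_minus_commute)
   qed
   have D: "norm (D u) >= h1 r"
   proof -
    have "norm (of_real L * M u) - norm (- (u powr of_real (2*al))) <= norm (of_real L * M u - - (u powr of_real (2*al)))" by (rule norm_triangle_ineq2)
    moreover have "norm (of_real L * M u) >= L*(al/2*r\<^sup>2 - 1)"
     using M L by (simp add: norm_mult)
    ultimately show ?thesis unfolding norm_minus_cancel n by (simp add: D_def h1_def add.commute)
   qed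
   have S: "norm (u\<^sup>2 - of_real w0) >= h2 r"
    using norm_triangle_ineq2[of "u\<^sup>2" "of_real w0"] w0 by (simp add: h2_def r_def norm_power)
   have "norm (F u) <= norm (M u / D u - of_real (1 / L)) + norm (of_real C / (u\<^sup>2 - of_real w0))"
    using u(2) unfolding F_def Fb_def by (simp add: norm_triangle_ineq4)
   also have "... = r powr (2*al) / (L*norm (D u)) + abs C / norm (u\<^sup>2 - of_real w0)"
    unfolding MD[OF Dne[OF u(1,2)]] norm_minus_cancel norm_divide n using L by (simp add: norm_mult)
   also have "... <= r powr (2*al) / (L*h1 r) + abs C / h2 r"
    using b D S L by (intro add_mono divide_left_mono mult_left_mono mult_pos_pos) auto
   finally show "norm (F u) < ep" using b(1) by simp
  qed
 qed
 define rh where "rh x = x powr al" for x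
 define \<omega> where "\<omega> x = 1 + al/2*x" for x
 have ax: "\<i> * of_real (sqrt x) : K" "\<i> * of_real (sqrt x) ~= u0" "- (iv (sqrt x)) : K" "- (iv (sqrt x)) ~= u0" for x
  using sw by (auto simp: K_def u0_def complex_eq_iff)
 have \<omega>: "\<omega> x > 0" if "x > 0" for x using that al by (auto simp: \<omega>_def intro!: add_pos_pos)
 have axM: "M (iv (sqrt x)) = of_real (\<omega> x)" "M (- (iv (sqrt x))) = of_real (\<omega> x)" if "x > 0" for x
  using that by (simp_all add: M_def \<omega>_def power_mult_distrib flip: of_real_power)
 have axS: "(iv (sqrt x))\<^sup>2 = - of_real x" "(- (iv (sqrt x)))\<^sup>2 = - of_real x" if "x > 0" for x
  using that by (simp_all add: power_mult_distrib flip: of_real_power)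
 have axF: "F (iv (sqrt x)) = 1 / (of_real (cut_symbol al x) * cis (pi*al) + of_real L) - of_real (1 / L) + of_real (C / (x + w0))"
  if "x > 0" for x
 proof -
  have "D (iv (sqrt x)) = of_real (\<omega> x)*(of_real (cut_symbol al x) * cis (pi*al) + of_real L)"
   unfolding D_def axM[OF that] powr_imaginary_axis[OF that] cut_symbol_def \<omega>_def[symmetric]
   using \<omega>[OF that] by (simp add: algebra_simps)
  moreover have "of_real C / (- of_real x - of_real w0) = - (of_real (C / (x + w0)) :: complex)"
  proof -
   have "- of_real x - of_real w0 = - (of_real (x + w0) :: complex)" by simp
   thus ?thesis by (simp only: divide_minus_right of_real_divide)
  qed
  ultimately show ?thesis
   using ax(2)[of x] \<omega>[OF that] unfolding F_def Fb_def axM[OF that] axS[OF that] by simp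
 qed
 have sym: "F (- (iv y)) = cnj (F (iv y))" if "y > 0" for y
 proof -
  have y: "y = sqrt (y\<^sup>2)" "y\<^sup>2 > 0" using that by auto
  show ?thesis
   unfolding F_def Fb_def D_def using ax[of "y\<^sup>2"] axM[OF y(2)] axS[OF y(2)] powr_imaginary_axis[OF y(2), of al] y(1) by (simp add: cis_cnj)
 qed
 define d where "d = sqrt (1 - abs (cos (pi*al)))"
 have d: "d > 0" using abs_cos_less by (simp add: d_def)
 define a where "a = sqrt s"
 have a: "a > 0" "a\<^sup>2 = s" using s by (simp_all add: a_def)
 have int: "SI {0<..} (%x. norm (F (iv (sqrt x))) / (x + a\<^sup>2))"
  unfolding a(2)
 proof -
  \<comment> \<open>Both parts of \<open>F\<close> are of order \<open>x powr (al - 1)\<close>: the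
    first because \<open>cut_symbol al x <= (2 / al) * x powr (al - 1)\<close>, the second because
    \<open>x powr (1 - al) * w0 powr al <= x + w0\<close>.\<close>
  define Q where "Q = 2 / (al*d*L\<^sup>2) + abs C / w0 powr al"
  have Q: "Q >= 0" using al d L by (auto simp: Q_def)
  have bnd: "norm (F (iv (sqrt x))) <= Q*x powr (- (1 - al))" if x: "x > 0" for x
  proof -
   let ?z = "of_real (cut_symbol al x) * cis (pi*al) + of_real L"
   have z: "d*L <= norm ?z"
    using norm_cis_add_ge[of "cut_symbol al x" L] cut_symbol_pos[OF x] L d unfolding d_def[symmetric] by (smt (verit, best) max.cobounded2 mult_left_mono)
   have z0: "d*L > 0" using d L by simp
   hence zn: "?z ~= 0" using z by auto
   have "norm (F (iv (sqrt x))) <= norm (1 / ?z - of_real (1 / L)) + norm (of_real (C / (x + w0)) :: complex)"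
    unfolding axF[OF x] by (rule norm_triangle_ineq)
   moreover have "norm (1 / ?z - of_real (1 / L)) <= 2 / (al*d*L\<^sup>2) * x powr (- (1 - al))"
   proof -
    have "1 / ?z - of_real (1 / L) = - (of_real (cut_symbol al x) * cis (pi*al)) / (of_real L * ?z)"
     using zn L by (simp add: divide_simps)
    hence "norm (1 / ?z - of_real (1 / L)) = cut_symbol al x / (L*norm ?z)"
     using cut_symbol_pos[OF x] L by (simp only: norm_divide norm_minus_cancel norm_mult) simp
    also have "... <= cut_symbol al x / (L*(d*L))"
    proof (intro divide_left_mono mult_left_mono mult_pos_pos)
     show "0 < norm ?z" using z z0 by linarith
    qed (use cut_symbol_pos[OF x] L z d in auto)
    also have "... <= (x powr al / (al/2*x)) / (L*(d*L))"
     unfolding cut_symbol_def using x al d L by (intro divide_right_mono divide_left_mono) (auto intro!: mult_pos_pos add_pos_pos)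
    also have "... = 2 / (al*d*L\<^sup>2) * x powr (- (1 - al))"
     using x by (simp add: powr_diff power2_eq_square mult_ac)
    finally show ?thesis .
   qed
   moreover have "norm (of_real (C / (x + w0)) :: complex) <= abs C / w0 powr al * x powr (- (1 - al))"
   proof -
    have "x powr (1 - al) * w0 powr al <= max x w0 powr (1 - al) * max x w0 powr al"
     using x w0 al by (intro mult_mono powr_mono2) auto
    also have "... = max x w0" using x by (simp flip: powr_add)
    also have "... <= x + w0" using x w0 by auto
    finally have "abs C / (x + w0) <= abs C / (x powr (1 - al) * w0 powr al)"
     using x w0 by (intro divide_left_mono) auto
    also have "abs C / (x powr (1 - al) * w0 powr al) = abs C / w0 powr al * x powr (- (1 - al))"
     unfolding powr_minus_divide[of x "1 - al"] by (simp add: mult.commute)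
    finally have "abs C / (x + w0) <= abs C / w0 powr al * x powr (- (1 - al))" .
    moreover have "abs (C / (x + w0)) = abs C / (x + w0)" using x w0(1) by simp
    ultimately show ?thesis by (simp only: norm_of_real)
   qed
   moreover have "Q*x powr (- (1 - al)) = 2 / (al*d*L\<^sup>2) * x powr (- (1 - al)) + abs C / w0 powr al * x powr (- (1 - al))"
    unfolding Q_def by (rule distrib_right)
   ultimately show ?thesis by linarith
  qed
  have b: "0 < 1 - al" "1 - al < 1" using al by auto
  show "SI {0<..} (%x. norm (F (iv (sqrt x))) / (x + s))"
  proof (rule SI_bound[OF SI_mult[of Q, OF SI_powr_divide[OF b s(1)]]])
   have "continuous_on {0<..} (%x. norm (F (iv (sqrt x))) / (x + s))"
    using s ax(1) by (intro continuous_intros continuous_on_compose2[OF contF]) auto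
   thus "SM {0<..} (%x. norm (F (iv (sqrt x))) / (x + s))" by (rule SM_cont) auto
   show "AE x in lborel. x : {0<..} --> norm (norm (F (iv (sqrt x))) / (x + s)) <= norm (Q*(x powr - (1 - al) / (x + s)))"
   proof (intro AE_I2 impI)
    fix x :: real assume "x : {0<..}"
    hence x: "x > 0" by simp
    have "norm (F (iv (sqrt x))) / (x + s) <= Q*x powr (- (1 - al)) / (x + s)"
     using bnd[OF x] x s by (intro divide_right_mono) auto
    thus "norm (norm (F (iv (sqrt x))) / (x + s)) <= norm (Q*(x powr - (1 - al) / (x + s)))"
     using x s Q by simp
   qed
  qed
 qed
 have Im: "Im (F (iv (sqrt x))) = - pi*kdens al L (cut_symbol al x)" if "x > 0" for x
  unfolding axF[OF that] using Im_kdens[of "cut_symbol al x" L] by simp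
 note St = Stieltjes_representation[OF contF[unfolded K_def] holF[unfolded H_def] inf a(1) sym int]
 have 1: "SI {0<..} (%x. (- 1 / pi)*(Im (F (iv (sqrt x))) / (x + a\<^sup>2)))" by (rule SI_mult) (rule St(1))
 have e: "(- 1 / pi)*(Im (F (iv (sqrt x))) / (x + a\<^sup>2)) = kdens al L (cut_symbol al x) / (x + s)" if "x : {0<..}" for x
  using that Im[of x] by (simp add: a(2))
 have "SI {0<..} (%x. (- 1 / pi)*(Im (F (iv (sqrt x))) / (x + a\<^sup>2)))
   = SI {0<..} (%x. kdens al L (cut_symbol al x) / (x + s))" by (rule SI_cong[OF refl refl]) (rule e)
 thus "SI {0<..} (%x. kdens al L (cut_symbol al x) / (x + s))"
  using 1 by (simp only:)
 have "Re (F (of_real a)) = - (1 / pi)*(LBINT x:{0<..}. Im (F (iv (sqrt x))) / (x + a\<^sup>2))" by (rule St(2))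
 also have "... = (LBINT x:{0<..}. (- 1 / pi)*(Im (F (iv (sqrt x))) / (x + a\<^sup>2)))" by (subst LB_mult) simp
 also have "... = ?A" by (rule LB_cong) (use e in auto)
 finally have 2: "Re (F (of_real a)) = ?A" .
 have "a ~= sqrt w0" using s w0 by (simp add: a_def)
 hence an: "of_real a ~= u0" by (simp add: u0_def)
 have ap: "a powr (2*al) = s powr al" using s by (simp add: a_def powr_half_sqrt[symmetric] powr_powr)
 have aM: "M (of_real a) = of_real (1 - al/2 * s)" by (simp add: M_def a(2)[symmetric])
 have aD: "D (of_real a) = of_real (s powr al + L*(1 - al/2 * s))"
  unfolding D_def aM using powr_of_real[of a "2*al"] a(1) ap by simp
 have aS: "(of_real a)\<^sup>2 - of_real w0 = (of_real (s - w0) :: complex)" by (simp add: a(2)[symmetric])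
 have "F (of_real a) = of_real ((1 - al/2 * s) / (s powr al + L*(1 - al/2 * s)) - 1 / L - C / (s - w0))"
  using an unfolding F_def Fb_def aM aD aS by simp
 hence "Re (F (of_real a)) = (1 - al/2 * s) / (s powr al + L*(1 - al/2 * s)) - 1 / L - C / (s - w0)" by (simp only: Re_complex_of_real)
 thus "(1 - al/2 * s) / (s powr al + L*(1 - al/2 * s)) = 1 / L + presid al L / (s - pole al L)
    + ?A"
  unfolding 2 C_def w0_def by linarith
qed

end

section \<open>Bounds for the spectral densities, uniform in L\<close>

text \<open>Turns an asymptotic relation at \<open>0\<close> into one constant on all of
  \<open>(0, 1]\<close>: away from \<open>0\<close> the quotient is continuous on a compact
  interval.\<close>

lemma bigo_at_0_bound:
 fixes f g :: "real => real"
 assumes "continuous_on {0<..1} f" "continuous_on {0<..1} g" "!!y. y : {0<..1} ==> g y > 0"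
  and "f : O[at_right 0](g)"
 shows "EX K>=0. ALL y:{0<..1}. abs (f y) <= K*g y"
proof -
 obtain c where c: "c > 0" "eventually (%y. norm (f y) <= c*norm (g y)) (at_right 0)"
  using landau_o.bigE[OF assms(4)] by blast
 then obtain b where b: "b > 0" "!!y. 0 < y ==> y < b ==> abs (f y) <= c*abs (g y)" by (auto simp: eventually_at_right_field)
 define b' where "b' = min b 1/2"
 have b': "0 < b'" "b' < b" "b' <= 1" using b by (auto simp: b'_def)
 have "continuous_on {b'..1} (%y. abs (f y) / g y)"
 proof (intro continuous_intros)
  show "continuous_on {b'..1} f" "continuous_on {b'..1} g"
   using b' by (auto intro!: continuous_on_subset[OF assms(1)] continuous_on_subset[OF assms(2)])
  show "ALL y:{b'..1}. g y ~= 0"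
  proof
   fix y assume "y : {b'..1}"
   thus "g y ~= 0" using assms(3)[of y] b' by auto
  qed
 qed
 hence "compact ((%y. abs (f y) / g y) ` {b'..1})" by (rule compact_continuous_image) simp
 hence "bounded ((%y. abs (f y) / g y) ` {b'..1})" by (rule compact_imp_bounded)
 then obtain K where K': "ALL x:(%y. abs (f y) / g y) ` {b'..1}. norm x <= K"
  unfolding bounded_iff by blast
 have K: "abs (f y) / g y <= K" if "y : {b'..1}" for y
 proof -
  have "norm (abs (f y) / g y) <= K" by (rule bspec[OF K']) (use that in auto)
  thus ?thesis unfolding real_norm_def by (rule order_trans[OF abs_ge_self])
 qed
 show ?thesis
 proof (intro exI[of _ "max c K"] conjI ballI)
  show "0 <= max c K" using c by auto
  fix y :: real assume y: "y : {0<..1}"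
  hence g: "g y > 0" by (rule assms(3))
  show "abs (f y) <= max c K * g y"
  proof (cases "y < b'")
   case True
   hence "abs (f y) <= c*g y" using b(2)[of y] b' y g by auto
   also have "... <= max c K * g y" using g by (intro mult_right_mono) auto
   finally show ?thesis .
  next
   case False
   hence "abs (f y) / g y <= K" using y by (intro K) auto
   hence "abs (f y) <= K*g y" using g by (simp add: divide_simps)
   also have "... <= max c K * g y" using g by (intro mult_right_mono) auto
   finally show ?thesis .
  qed
 qed
qed

lemma scaled_Gamma_integral:
 assumes b: "b > 0" and t: "t > 0"
 shows "SI {0<..} (%x::real. x powr (b - 1) * exp (- (x*t)))"
  "(LBINT x:{0<..}. x powr (b - 1) * exp (- (x*t))) = Gamma b / t powr b"
proof -
 let ?f = "%x::real. x powr (b - 1) * exp (- x)"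
 have c: "continuous_on {0<..} ?f" by (intro continuous_intros) auto
 have I: "(?f has_integral Gamma b) {0<..}"
 proof -
  have "(?f has_integral Gamma b) {0..}"
   using Gamma_integral_real[OF b] by (simp add: exp_minus divide_inverse)
  moreover have "negligible {x : {0..} - {0<..}. ?f x ~= 0}" "negligible {x : {0<..} - {0..}. ?f x ~= 0}" by (rule negligible_subset[of "{0}"], auto)+
  ultimately show ?thesis by (simp only: has_integral_spike_set_eq[of "{0..}" "{0<..}" ?f])
 qed
 have f: "SI {0<..} ?f" "(LBINT x:{0<..}. ?f x) = Gamma b" by (rule SI_nonneg[OF I], simp, rule SM_cont[OF c], simp)+
 have img: "(%x. t*x) ` {0<..} = {0<..}"
 proof (intro equalityI subsetI)
  fix x :: real assume "x : {0<..}"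
  thus "x : (%x. t*x) ` {0<..}" using t by (intro image_eqI[of _ _ "x / t"]) auto
 qed (use t in auto)
 have e: "abs t * ?f (t*x) = t powr b * (x powr (b - 1) * exp (- (x*t)))" if "x : {0<..}" for x
  using that t by (simp add: powr_mult powr_diff mult_ac)
 have m: "SM {0<..} (%x. abs t * ?f (t*x))" by (rule SM_cont) (use t in "auto intro!: continuous_intros")
 have f': "SI ((%x. t*x) ` {0<..}) ?f" using f(1) img by simp
 note S = LB_subst[where g = "%x. t*x" and g' = "%_. t" and S = "{0<..}" and f = ?f,
   OF _ _ _ _ f' m]
 have 1: "SI {0<..} (%x. abs t * ?f (t*x))" by (rule S(1)) (use t img in "auto intro!: derivative_eq_intros inj_onI")
 have 2: "(LBINT x:(%x. t*x) ` {0<..}. ?f x) = (LBINT x:{0<..}. abs t * ?f (t*x))" by (rule S(2)) (use t img in "auto intro!: derivative_eq_intros inj_onI")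
 have "SI {0<..} (%x. abs t * ?f (t*x)) = SI {0<..} (%x. t powr b * (x powr (b - 1) * exp (- (x*t))))" by (rule SI_cong[OF refl refl]) (rule e)
 with 1 have 3: "SI {0<..} (%x. t powr b * (x powr (b - 1) * exp (- (x*t))))" by (simp only:)
 thus "SI {0<..} (%x::real. x powr (b - 1) * exp (- (x*t)))"
  using t by (simp add: set_integrable_mult_right_iff)
 have "Gamma b = (LBINT x:{0<..}. abs t * ?f (t*x))" using 2 f(2) img by simp
 also have "... = (LBINT x:{0<..}. t powr b * (x powr (b - 1) * exp (- (x*t))))" by (rule LB_cong) (use e in auto)
 also have "... = t powr b * (LBINT x:{0<..}. x powr (b - 1) * exp (- (x*t)))" by (rule LB_mult)
 finally show "(LBINT x:{0<..}. x powr (b - 1) * exp (- (x*t))) = Gamma b / t powr b"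
  using t by (simp add: divide_simps mult.commute)
qed

text \<open>\<open>1 / (x + s)\<close> increases as \<open>s\<close> decreases to \<open>0\<close>,
  so monotone convergence delivers integrability of \<open>\<kappa> x / x\<close> along with the
  value of the integral.\<close>

lemma Stieltjes_limit_at_0:
 fixes \<kappa> Ph :: "real => real"
 assumes m: "SM {0<..} (%x. \<kappa> x / x)" and nn: "!!x. x > 0 ==> \<kappa> x >= 0"
  and i: "!!s. 0 < s ==> s < 2 ==> SI {0<..} (%x. \<kappa> x / (x + s))"
  and e: "!!s. 0 < s ==> s < 2 ==> (LBINT x:{0<..}. \<kappa> x / (x + s)) = Ph s"
  and lim: "(Ph \<longlongrightarrow> lm) (at_right 0)"
 shows "SI {0<..} (%x. \<kappa> x / x)" "(LBINT x:{0<..}. \<kappa> x / x) = lm"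
proof -
 let ?s = "%n. 1 / real (Suc n)"
 let ?f = "%n x. indicator {0<..} x *\<^sub>R (\<kappa> x / (x + ?s n))"
 have s: "?s \<longlonglongrightarrow> 0" using LIMSEQ_inverse_real_of_nat by (simp add: inverse_eq_divide)
 have s2: "0 < ?s n & ?s n < 2" for n by (simp add: divide_simps)
 have 1: "integrable lborel (?f n)" for n using i[of "?s n"] s2 by (simp add: SI_def)
 have 2: "AE x in lborel. mono (%n. ?f n x)"
 proof (rule AE_I2, rule monoI)
  fix x :: real and m n :: nat assume "m <= n"
  hence "?s n <= ?s m" by (simp add: frac_le)
  thus "?f m x <= ?f n x"
   using nn[of x] s2 by (auto simp: indicator_def intro!: divide_left_mono mult_pos_pos add_pos_pos)
 qed
 have 3: "AE x in lborel. (%n. ?f n x) \<longlonglongrightarrow> indicator {0<..} x *\<^sub>R (\<kappa> x / x)"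
 proof (rule AE_I2)
  fix x :: real
  have "(%n. \<kappa> x / (x + ?s n)) \<longlonglongrightarrow> \<kappa> x / (x + 0)" if "x > 0" by (intro tendsto_intros s) (use that in auto)
  thus "(%n. ?f n x) \<longlonglongrightarrow> indicator {0<..} x *\<^sub>R (\<kappa> x / x)" by (auto simp: indicator_def)
 qed
 have "filterlim ?s (at_right 0) sequentially"
  using s s2 by (auto simp: filterlim_at intro!: eventuallyI)
 hence "(%n. Ph (?s n)) \<longlonglongrightarrow> lm" using lim by (rule filterlim_compose[rotated])
 hence 4: "(%n. integral\<^sup>L lborel (?f n)) \<longlonglongrightarrow> lm"
  using e s2 by (simp add: LB_def)
 have 5: "(%x. indicator {0<..} x *\<^sub>R (\<kappa> x / x)) : borel_measurable lborel"
  using m by (simp add: SM_def)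
 show "SI {0<..} (%x. \<kappa> x / x)"
  unfolding SI_def by (rule integrable_monotone_convergence[OF 1 2 3 4 5])
 show "(LBINT x:{0<..}. \<kappa> x / x) = lm"
  unfolding LB_def by (rule integral_monotone_convergence[OF 1 2 3 4 5])
qed

context fractional_order
begin

lemma kdens_nonneg: "rh >= 0 ==> kdens al L rh >= 0"
 unfolding kdens_def using sin_pos abs_cos_less by (intro divide_nonneg_nonneg mult_nonneg_nonneg order_trans[OF _ kdens_denominator]) auto

text \<open>The square stems from \<open>kdens_diff\<close>, where the lower bound of the
  denominator is used twice; it also dominates the first power that occurs in
  \<open>kdens_bound\<close>.\<close>

definition kc :: real where "kc = sin (pi*al) / pi / (1 - abs (cos (pi*al)))\<^sup>2"

lemma kc_pos: "kc > 0"
 unfolding kc_def using sin_pos abs_cos_less by (intro divide_pos_pos) auto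

text \<open>The other bounds follow from the first. The second is free of \<open>L\<close> and
  carries the uniform estimates; the third trades decay in \<open>rh\<close> for a factor
  \<open>1 / L\<close>, which later compensates the factor \<open>L\<close> in
  \<open>1 - L * vx L t\<close>.\<close>

lemma kdens_bound:
 assumes "rh > 0" "L > 0"
 shows "kdens al L rh <= kc*(rh / (rh\<^sup>2 + L\<^sup>2))" "kdens al L rh <= kc / rh" "L*kdens al L rh <= kc"
  "kdens al L rh <= kc*(rh / L\<^sup>2)"
proof -
 let ?A = "rh\<^sup>2 + L\<^sup>2"
 define d where "d = 1 - abs (cos (pi*al))"
 have d: "0 < d" "d <= 1" using abs_cos_less by (auto simp: d_def)
 have p: "0 < rh\<^sup>2 + L\<^sup>2" using assms by (intro add_pos_pos) auto
 have "kdens al L rh <= sin (pi*al) / pi*rh / (d*?A)"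
  unfolding kdens_def using kdens_denominator[of rh L] sin_pos assms d p unfolding d_def[symmetric] by (intro divide_left_mono mult_pos_pos) (auto intro!: less_le_trans[OF _ kdens_denominator[of rh L, folded d_def]] simp: d_def[symmetric])
 also have "... = sin (pi*al) / pi / d*(rh / ?A)" by simp
 also have "... <= kc*(rh / ?A)"
 proof (intro mult_right_mono)
  have "d\<^sup>2 <= d" using d by (simp add: power2_eq_square mult_left_le)
  thus "sin (pi*al) / pi / d <= kc"
   unfolding kc_def d_def[symmetric] using d sin_pos by (intro divide_left_mono) auto
 qed (use assms p in auto)
 finally show 1: "kdens al L rh <= kc*(rh / ?A)" .
 have "rh / ?A <= rh / rh\<^sup>2"
  using assms p by (intro divide_left_mono) auto
 also have "... = 1 / rh" using assms by (simp add: power2_eq_square)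
 finally have "kc*(rh / ?A) <= kc*(1 / rh)" using kc_pos by (intro mult_left_mono) auto
 with 1 show "kdens al L rh <= kc / rh" by simp
 have "rh / ?A <= rh / L\<^sup>2"
  using assms p by (intro divide_left_mono) auto
 hence "kc*(rh / ?A) <= kc*(rh / L\<^sup>2)" using kc_pos by (intro mult_left_mono) auto
 with 1 show "kdens al L rh <= kc*(rh / L\<^sup>2)" by simp
 have "L*rh <= rh\<^sup>2 + L\<^sup>2" using sum_squares_bound[of L rh] assms
mult_pos_pos[OF assms(2,1)] by linarith
 hence "L*(rh / ?A) <= 1" using p by (simp add: divide_simps)
 hence "kc*(L*(rh / ?A)) <= kc*1" using kc_pos by (intro mult_left_mono) auto
 moreover have "L*kdens al L rh <= L*(kc*(rh / ?A))"
  using 1 assms by (intro mult_left_mono) auto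
 ultimately show "L*kdens al L rh <= kc" by (simp add: mult_ac)
qed

text \<open>In the difference of the two fractions the cosine terms cancel: the numerator is
  \<open>(rh - rh') * (L^2 - rh rh')\<close>. By Cauchy-Schwarz the product of the denominators
  dominates \<open>(L^2 + rh rh')^2\<close>; one of these factors absorbs the numerator and the
  other leaves a bound without \<open>L\<close>.\<close>

lemma kdens_diff:
 assumes r: "rh > 0" "rh' > 0" and L: "L > 0"
 shows "abs (kdens al L rh - kdens al L rh') <= kc*abs (rh - rh') / (rh*rh')"
proof -
 let ?A = "L\<^sup>2 + rh*rh'"
 define d where "d = 1 - abs (cos (pi*al))"
 define s where "s = sin (pi*al) / pi"
 define N where "N r = r\<^sup>2 + 2*L*r*cos (pi*al) + L\<^sup>2" for r
 have d: "0 < d" using abs_cos_less by (auto simp: d_def)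
 have s: "s > 0" using sin_pos by (simp add: s_def)
 have Nge: "d*(r\<^sup>2 + L\<^sup>2) <= N r" for r using kdens_denominator[of r L] by (simp add: d_def N_def)
 have q: "r\<^sup>2 + L\<^sup>2 > 0" for r using L by (intro add_nonneg_pos) auto
 have Npos: "N r > 0" for r using Nge[of r] q[of r] d by (meson less_le_trans mult_pos_pos)
 have k: "kdens al L r = s*(r / N r)" for r by (simp add: kdens_def s_def N_def)
 have "kdens al L rh - kdens al L rh' = s*((rh*N rh' - rh'*N rh) / (N rh * N rh'))"
  unfolding k using Npos[of rh] Npos[of rh'] by (simp add: divide_simps) (simp add: algebra_simps)
 also have "rh*N rh' - rh'*N rh = (rh - rh')*(L\<^sup>2 - rh*rh')"
  unfolding N_def by algebra
 finally have 1: "abs (kdens al L rh - kdens al L rh') = s*(abs (rh - rh')*(abs (L\<^sup>2 - rh*rh') / (N rh * N rh')))"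
  using s Npos[of rh] Npos[of rh'] by (simp add: abs_mult)
 have pp: "rh*rh' > 0" using r by simp
 have X: "0 < L\<^sup>2 + rh*rh'" using L pp by (intro add_pos_pos) auto
 have "?A\<^sup>2 <= (rh\<^sup>2 + L\<^sup>2)*(rh'\<^sup>2 + L\<^sup>2)"
 proof -
  have "(rh\<^sup>2 + L\<^sup>2)*(rh'\<^sup>2 + L\<^sup>2) - ?A\<^sup>2 = (L*(rh - rh'))\<^sup>2" by algebra
  thus ?thesis using zero_le_power2[of "L*(rh - rh')"] by linarith
 qed
 hence "d\<^sup>2*?A\<^sup>2 <= d\<^sup>2*((rh\<^sup>2 + L\<^sup>2)*(rh'\<^sup>2 + L\<^sup>2))" by (intro mult_left_mono) auto
 also have "... = (d*(rh\<^sup>2 + L\<^sup>2))*(d*(rh'\<^sup>2 + L\<^sup>2))" by (simp add: power2_eq_square)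
 also have "... <= N rh * N rh'" by (intro mult_mono Nge less_imp_le[OF Npos]) (use d in auto)
 finally have N2: "d\<^sup>2*?A\<^sup>2 <= N rh * N rh'" .
 have "abs (L\<^sup>2 - rh*rh') / (N rh * N rh') <= ?A / (d\<^sup>2*?A\<^sup>2)"
  using N2 X d pp by (intro frac_le) (auto simp: abs_le_iff)
 also have "... = 1 / (d\<^sup>2*?A)" using X by (simp add: power2_eq_square)
 also have "... <= 1 / (d\<^sup>2*(rh*rh'))"
  using d r L X by (intro divide_left_mono mult_left_mono mult_pos_pos) auto
 finally have "s*(abs (rh - rh')*(abs (L\<^sup>2 - rh*rh') / (N rh * N rh'))) <= s*(abs (rh - rh')*(1 / (d\<^sup>2*(rh*rh'))))"
  using s by (intro mult_left_mono) auto
 also have "... = kc*abs (rh - rh') / (rh*rh')" by (simp add: kc_def s_def d_def)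
 finally show ?thesis unfolding 1 .
qed

lemma continuous_on_kdens:
 assumes "continuous_on S f" "L > 0" "!!x. x : S ==> f x > 0"
 shows "continuous_on S (%x. kdens al L (f x))"
proof -
 have "(f x)\<^sup>2 + 2*L*f x * cos (pi*al) + L\<^sup>2 ~= 0" if "x : S" for x
 proof -
  have "0 < (1 - abs (cos (pi*al)))*((f x)\<^sup>2 + L\<^sup>2)"
   using abs_cos_less assms(2) assms(3)[OF that] by (intro mult_pos_pos add_pos_pos) auto
  thus ?thesis using kdens_denominator[of "f x" L] by linarith
 qed
 thus ?thesis unfolding kdens_def by (intro continuous_intros assms(1)) auto
qed

lemma continuous_on_cut_symbol: "continuous_on {0<..} (cut_symbol al)"
 unfolding cut_symbol_def by (intro continuous_intros) (use al in "auto simp: add_pos_pos less_imp_neq[symmetric]")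

text \<open>The densities of the exact and of the discrete resolvent, both in the variable \<open>y = ln z\<close> on the cut.\<close>

definition edens :: "real => real => real" where
 "edens L y = kdens al L (y powr al) / y"

definition ddens :: "real => real => real" where
 "ddens L y = kdens al L (cut_symbol al (exp y - 1))*(exp y * (3 - exp y) / (2*(exp y - 1)))"

text \<open>At time \<open>n + th\<close> linear interpolation of the discrete solution replaces
  \<open>exp (- (n + th) y)\<close> by \<open>exp (- n y)\<close> times
  \<open>(1 - th) + th exp (- y)\<close>. The common factor \<open>exp (- n y)\<close> is left
  out.\<close>

definition dens_error :: "real => real => real => real" where
 "dens_error L th y = ddens L y * ((1 - th) + th*exp (- y)) - edens L y * exp (- (th*y))"

text \<open>Both expressions have value 1 and slope \<open>- th\<close> at \<open>y = 0\<close>, so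
  the difference is of second order.\<close>

lemma interpolation_factor:
 assumes "0 <= th" "th <= 1" "0 <= (y::real)"
 shows "abs ((1 - th) + th*exp (- y) - exp (- (th*y))) <= y\<^sup>2"
proof -
 have upper: "exp (- x) <= 1 - x + x\<^sup>2/2" if "x >= 0" for x :: real
 proof -
  define f where "f x = 1 - x + x\<^sup>2/2 - exp (- x)" for x :: real
  have "f 0 <= f x"
  proof (rule DERIV_nonneg_imp_nondecreasing[OF that])
   fix z :: real assume "0 <= z" "z <= x"
   have "(f has_real_derivative (- 1 + z + exp (- z))) (at z)"
    unfolding f_def by (auto intro!: derivative_eq_intros)
   moreover have "- 1 + z + exp (- z) >= 0" using exp_ge_add_one_self[of "- z"] by linarith
   ultimately show "EX y. (f has_real_derivative y) (at z) & 0 <= y" by blast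
  qed
  thus ?thesis by (simp add: f_def)
 qed
 have l: "1 - x <= exp (- x)" for x :: real using exp_ge_add_one_self[of "- x"] by linarith
 have t2: "th*(y\<^sup>2/2) <= 1*(y\<^sup>2/2)" using assms by (intro mult_right_mono) auto
 have t3: "(th*y)\<^sup>2/2 <= 1*(y\<^sup>2/2)"
  using assms by (simp add: power_mult_distrib mult_left_le_one_le power_le_one)
 have "th*exp (- y) <= th*(1 - y + y\<^sup>2/2)" "th*(1 - y) <= th*exp (- y)"
  using assms upper[of y] l[of y] by (auto intro!: mult_left_mono)
 moreover have "exp (- (th*y)) <= 1 - th*y + (th*y)\<^sup>2/2" "1 - th*y <= exp (- (th*y))"
  using assms upper[of "th*y"] l by auto
 moreover have "0 <= y\<^sup>2" by simp
 moreover have "th*(1 - y + y\<^sup>2/2) = th - th*y + th*(y\<^sup>2/2)" "th*(1 - y) = th - th*y" by (simp_all add: algebra_simps)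
 moreover have "abs ((1 - th) + a - b) <= q"
  if "a <= c1" "c2 <= a" "b <= 1 - ty + r" "1 - ty <= b" "0 <= q" "c1 = th - ty + p" "c2 = th - ty" "p <= 1*(q/2)" "r <= 1*(q/2)"
  for a b q c1 c2 ty r p :: real
  unfolding abs_le_iff using that by auto
 ultimately show ?thesis using t2 t3 by blast
qed

lemma cut_symbol_lower:
 assumes "0 < y" "y <= 1"
 shows "cut_symbol al (exp y - 1) >= y powr al/2"
proof -
 have y: "y <= exp y - 1" using exp_ge_add_one_self[of y] by linarith
 have "exp y <= exp 1" using assms by simp
 hence "exp y - 1 <= 2" using exp_le by linarith
 hence "al*(exp y - 1) <= 1*2" using al y assms by (intro mult_mono) auto
 hence "1 + al/2*(exp y - 1) <= 2" by simp
 moreover have "1 + al/2*(exp y - 1) > 0" using al y assms by (intro add_pos_nonneg) auto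
 ultimately show ?thesis
  unfolding cut_symbol_def using y assms al by (intro frac_le powr_mono2) auto
qed

text \<open>The gain of two powers of \<open>y\<close> is the effect of the weights
  \<open>1 - al/2\<close> and \<open>al/2\<close>: \<open>(exp y - 1) powr al\<close> is
  \<open>y powr al * (1 + al y / 2 + ...)\<close>, and the denominator of \<open>cut_symbol\<close>
  cancels the first-order term.\<close>

lemma cut_symbol_close: "EX K>=0. ALL y:{0<..1}. abs (cut_symbol al (exp y - 1) - y powr al) <= K*y powr (al + 2)"
proof (rule bigo_at_0_bound)
 have e: "exp y - 1 > 0" if "y : {0<..1}" for y :: real using that by auto
 show "continuous_on {0<..1} (%y. cut_symbol al (exp y - 1) - y powr al)"
  using e by (intro continuous_intros continuous_on_compose2[OF continuous_on_cut_symbol]) auto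
 show "(%y. cut_symbol al (exp y - 1) - y powr al) : O[at_right 0](%y. y powr (al + 2))"
  unfolding cut_symbol_def using al by real_asymp
qed (auto intro!: continuous_intros)

text \<open>The expansion at \<open>0\<close> has no constant term. This is the second order of
  BDF2, whose symbol \<open>(1 - z) (3 - z) / 2\<close> enters at \<open>z = exp y\<close>.\<close>

lemma disc_factor_close: "EX K>=0. ALL y:{0<..1::real}. abs (exp y * (3 - exp y) / (2*(exp y - 1)) - 1 / y) <= K*y"
proof (rule bigo_at_0_bound)
 show "continuous_on {0<..1} (%y::real. exp y * (3 - exp y) / (2*(exp y - 1)) - 1 / y)" by (intro continuous_intros) auto
 show "(%y::real. exp y * (3 - exp y) / (2*(exp y - 1)) - 1 / y) : O[at_right 0](%y. y)" by real_asymp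
qed (auto intro!: continuous_intros)

text \<open>Near \<open>0\<close> the moduli agree to relative order \<open>y^2\<close>, the BDF2
  factor agrees with \<open>1 / y\<close> up to \<open>O(y)\<close>, and interpolation costs
  \<open>y^2\<close>; as \<open>kdens\<close> is at most \<open>kc / y powr al\<close> there, each
  defect produces \<open>y powr (1 - al)\<close>. For \<open>y > 1\<close> only growth matters:
  \<open>kc / rh\<close> and the BDF2 factor are each at most a multiple of \<open>exp y\<close>,
  whence \<open>exp (2*y)\<close>.\<close>

lemma dens_error_bound:
 "EX K>=0. ALL L>0. ALL th:{0..1}. ALL y>0. abs (dens_error L th y) <= K*(y powr (1 - al) * exp (2*y))"
proof -
 obtain K1 where K1: "K1 >= 0" "!!y. y : {0<..1} ==> abs (cut_symbol al (exp y - 1) - y powr al) <= K1*y powr (al + 2)"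
  using cut_symbol_close by blast
 obtain K2 where K2: "K2 >= 0" "!!y::real. y : {0<..1} ==> abs (exp y * (3 - exp y) / (2*(exp y - 1)) - 1 / y) <= K2*y"
  using disc_factor_close by blast
 define K where "K = 2*kc*K1*(1 + K2) + kc*(K2 + 1) + 4*kc"
 have K0: "K >= 0" "K >= 4*kc" using K1(1) K2(1) kc_pos by (auto simp: K_def)
 show ?thesis
 proof (intro exI[of _ K] conjI allI impI ballI)
  fix L th y :: real assume L: "L > 0" and th: "th : {0..1}" and y: "y > 0"
  define rh where "rh = cut_symbol al (exp y - 1)"
  define m where "m = exp y * (3 - exp y) / (2*(exp y - 1))"
  define I where "I = (1 - th) + th*exp (- y)"
  have x: "exp y - 1 > 0" using y by simp
  have rh: "rh > 0" using cut_symbol_pos[OF x] by (simp add: rh_def)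
  have I: "0 <= I" "I <= 1"
  proof -
   have "th*exp (- y) <= th*1" using th y by (intro mult_left_mono) auto
   thus "I <= 1" by (simp add: I_def)
  qed (use th in "auto simp: I_def")
  have de: "dens_error L th y = kdens al L rh * m*I - kdens al L (y powr al) / y*exp (- (th*y))" by (simp add: dens_error_def ddens_def edens_def rh_def m_def I_def)
  have kn: "0 <= kdens al L rh" "0 <= kdens al L (y powr al)" using rh by (auto intro!: kdens_nonneg)
  have kb: "kdens al L (y powr al) <= kc / y powr al" using kdens_bound(2)[of "y powr al" L] y L by simp
  have ex1: "exp (- (th*y)) <= 1" using th y by simp
  show "abs (dens_error L th y) <= K*(y powr (1 - al) * exp (2*y))"
  proof (cases "y <= 1")
   case True
   hence yy: "y : {0<..1}" using y by simp
   have lo: "y powr al/2 <= rh" using cut_symbol_lower[OF y True] by (simp add: rh_def)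
   have p: "y powr al > 0" "y powr (1 - al) > 0" using y by simp_all
   have d: "abs (kdens al L rh - kdens al L (y powr al)) <= 2*kc*K1*(y*y powr (1 - al))"
   proof -
    have "abs (kdens al L rh - kdens al L (y powr al)) <= kc*abs (rh - y powr al) / (rh*y powr al)" by (rule kdens_diff[OF rh p(1) L])
    also have "... <= kc*(K1*y powr (al + 2)) / (y powr al/2*y powr al)"
     using kc_pos K1(2)[OF yy] lo p rh K1(1) unfolding rh_def[symmetric] by (intro frac_le mult_left_mono mult_right_mono mult_pos_pos) auto
    also have "... = 2*kc*K1*(y powr (al + 2) / (y powr al * y powr al))" by simp
    also have "y powr (al + 2) / (y powr al * y powr al) = y powr (1 + (1 - al))"
     using y by (simp flip: powr_add powr_diff)
    also have "... = y*y powr (1 - al)" using y by (subst powr_add) simp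
    finally show ?thesis .
   qed
   have mb: "abs (m - 1 / y) <= K2*y" using K2(2)[OF yy] by (simp add: m_def)
   have "abs m <= K2*y + 1 / y" using mb divide_pos_pos[OF zero_less_one y] by linarith
   also have "... <= (1 + K2) / y"
   proof -
    have "y <= 1 / y" using True y by (simp add: divide_simps mult_le_one)
    hence "K2*y <= K2*(1 / y)" using K2(1) by (intro mult_left_mono)
    thus ?thesis by (simp add: add_divide_distrib)
   qed
   finally have m1: "abs m <= (1 + K2) / y" .
   have i1: "abs (m*I - exp (- (th*y)) / y) <= (K2 + 1) * y"
   proof -
    have "m*I - exp (- (th*y)) / y = (m - 1 / y) * I + (I - exp (- (th*y))) / y"
     using y by (simp add: algebra_simps diff_divide_distrib)
    moreover have "abs ((m - 1 / y) * I) <= K2*y"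
     unfolding abs_mult using mult_mono[OF mb, of "abs I" 1] I K2(1) y by simp
    moreover have "abs ((I - exp (- (th*y))) / y) <= y"
    proof -
     have "abs (I - exp (- (th*y))) <= y*y"
      using interpolation_factor[of th y] th y by (simp add: I_def power2_eq_square)
     thus ?thesis using y by (simp add: abs_divide divide_simps)
    qed
    ultimately show ?thesis unfolding distrib_right abs_le_iff by (smt (verit) mult_1)
   qed
   have "dens_error L th y = (kdens al L rh - kdens al L (y powr al))*(m*I) + kdens al L (y powr al)*(m*I - exp (- (th*y)) / y)"
    unfolding de by (simp add: algebra_simps)
   hence "abs (dens_error L th y) <= abs (kdens al L rh - kdens al L (y powr al))*(abs m * abs I) + abs (kdens al L (y powr al)) * abs (m*I - exp (- (th*y)) / y)" by (metis abs_mult abs_triangle_ineq)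
   also have "... <= (2*kc*K1*(y*y powr (1 - al)))*((1 + K2) / y*1) + kc / y powr al * ((K2 + 1) * y)"
    using d m1 i1 kb kn I K1(1) K2(1) kc_pos y by (intro add_mono mult_mono) (auto intro!: mult_nonneg_nonneg divide_nonneg_nonneg)
   also have "... = (2*kc*K1*(1 + K2) + kc*(K2 + 1)) * y powr (1 - al)"
    using y by (simp add: powr_diff divide_simps) (simp add: algebra_simps)
   also have "... <= K*y powr (1 - al)"
    using kc_pos p by (intro mult_right_mono) (auto simp: K_def)
   also have "... = K*(y powr (1 - al) * 1)" by simp
   also have "... <= K*(y powr (1 - al) * exp (2*y))"
    using K0 p y by (intro mult_left_mono) auto
   finally show ?thesis .
  next
   case False
   hence y1: "y >= 1" by simp
   have e2: "exp y >= 2" using exp_ge_add_one_self[of y] y1 by linarith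
   have x1: "(exp y - 1) powr al >= 1" using e2 al by (intro ge_one_powr_ge_zero) auto
   have k1: "kdens al L rh <= kc*exp y"
   proof -
    have "kdens al L rh <= kc / rh" by (rule kdens_bound(2)[OF rh L])
    also have "... = kc*((1 + al/2*(exp y - 1)) / (exp y - 1) powr al)" by (simp add: rh_def cut_symbol_def)
    also have "... <= kc*(exp y/1)"
    proof (intro mult_left_mono frac_le)
     have "al/2*(exp y - 1) <= 1*(exp y - 1)" using al x by (intro mult_right_mono) auto
     thus "1 + al/2*(exp y - 1) <= exp y" by simp
    qed (use x1 kc_pos in auto)
    finally show ?thesis by simp
   qed
   have m3: "abs m <= 3*exp y"
   proof -
    define D where "D = 2*(exp y - 1)"
    have D: "D > 0" using x by (simp add: D_def)
    have "abs m = exp y * abs (3 - exp y) / D" unfolding m_def D_def using x by (simp add: abs_mult)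
    also have "... <= exp y * (3*D) / D"
     using e2 x D by (intro divide_right_mono mult_left_mono) (auto simp: D_def)
    also have "... = 3*exp y" using D by simp
    finally show ?thesis .
   qed
   have "abs (dens_error L th y) <= kdens al L rh * abs m * I + kdens al L (y powr al) / y*exp (- (th*y))"
    unfolding de using kn I y by (intro order_trans[OF abs_triangle_ineq4]) (simp add: abs_mult)
   also have "... <= (kc*exp y)*(3*exp y) * 1 + kc*1"
   proof (intro add_mono mult_mono)
    have "y powr al * y >= 1*1" using y1 al by (intro mult_mono ge_one_powr_ge_zero) auto
    hence "kc / y powr al / y <= kc/1" using kc_pos y by (simp add: divide_simps)
    thus "kdens al L (y powr al) / y <= kc" using kb y divide_right_mono[OF kb, of y] by simp
   qed (use k1 m3 I kn kc_pos ex1 y in auto)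
   also have "... = 3*kc*exp (2*y) + kc" by (simp add: exp_double power2_eq_square)
   also have "... <= 4*kc*exp (2*y)" using y kc_pos by simp
   also have "... <= K*(1*exp (2*y))" using K0 by simp
   also have "... <= K*(y powr (1 - al) * exp (2*y))"
    using K0 y1 al by (intro mult_left_mono mult_right_mono ge_one_powr_ge_zero) auto
   finally show ?thesis .
  qed
 qed (rule K0)
qed

end

section \<open>The exact response to the source 1\<close>

lemma set_integral_Fubini:
 fixes f :: "real => real => real"
 assumes m: "(%(x, y). indicator A x * (indicator B y * f x y)) : borel_measurable (lborel \<Otimes>\<^sub>M lborel)"
  and b: "!!x y. x : A ==> y : B ==> abs (f x y) <= g x * h y"
  and g: "SI A g" and h: "SI B h"
 shows "(LBINT x:A. LBINT y:B. f x y) = (LBINT y:B. LBINT x:A. f x y)"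
  and "SI A (%x. LBINT y:B. f x y)"
  and "SI B (%y. LBINT x:A. f x y)"
proof -
 let ?F = "%x y. indicator A x * (indicator B y * f x y) :: real"
 have gh: "integrable lborel (%x. indicator A x * g x)" "integrable lborel (%y. indicator B y * h y)"
  using g h by (simp_all add: SI_def)
 have gh': "integrable (lborel \<Otimes>\<^sub>M lborel) (%(x, y). (indicator A x * g x)*(indicator B y * h y))"
 proof (rule lborel_pair.Fubini_integrable)
  have [measurable]: "(%x. indicator A x * g x) : borel_measurable lborel" "(%x. indicator B x * h x) : borel_measurable lborel"
   using gh by auto
  show "(%(x, y). (indicator A x * g x)*(indicator B y * h y)) : borel_measurable (lborel \<Otimes>\<^sub>M lborel)" by measurable
  have "integrable lborel (%x. norm (indicator A x * g x)*(LBINT y. norm (indicator B y * h y)))" by (intro integrable_mult_left integrable_norm gh)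
  thus "integrable lborel (%x. LBINT y. norm (case (x, y) of (x, y) => (indicator A x * g x)*(indicator B y * h y)))" by (simp add: abs_mult)
  show "AE x in lborel. integrable lborel (%y. case (x, y) of (x, y) => (indicator A x * g x)*(indicator B y * h y))"
   using gh(2) by simp
 qed
 have F: "integrable (lborel \<Otimes>\<^sub>M lborel) (%(x, y). ?F x y)"
 proof (rule Bochner_Integration.integrable_bound[OF gh' m])
  show "AE z in lborel \<Otimes>\<^sub>M lborel. norm (case z of (x, y) => ?F x y) <= norm (case z of (x, y) => (indicator A x * g x)*(indicator B y * h y))"
  proof (rule AE_I2)
   fix z :: "real \<times> real"
   show "norm (case z of (x, y) => ?F x y) <= norm (case z of (x, y) => (indicator A x * g x)*(indicator B y * h y))"
    using b[of "fst z" "snd z"] by (auto simp: indicator_def split: prod.splits)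
  qed
 qed
 have F': "integrable (lborel \<Otimes>\<^sub>M lborel) (%(y, x). ?F x y)"
  using lborel_pair.integrable_product_swap[OF F] by (simp add: case_prod_unfold)
 have e1: "(LBINT y. ?F x y) = indicator A x *\<^sub>R (LBINT y:B. f x y)" for x by (simp add: LB_def)
 have e2: "(LBINT x. ?F x y) = indicator B y *\<^sub>R (LBINT x:A. f x y)" for y
 proof -
  have "(LBINT x. ?F x y) = (LBINT x. indicator B y * (indicator A x * f x y))" by (simp add: mult.left_commute)
  thus ?thesis by (simp add: LB_def)
 qed
 have "(LBINT y. LBINT x. ?F x y) = (LBINT x. LBINT y. ?F x y)" by (rule lborel_pair.Fubini_integral[OF F])
 thus "(LBINT x:A. LBINT y:B. f x y) = (LBINT y:B. LBINT x:A. f x y)"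
  unfolding e1 e2 by (simp add: LB_def)
 show "SI A (%x. LBINT y:B. f x y)"
  using lborel_pair.integrable_fst'[OF F] unfolding SI_def e1[symmetric] by simp
 show "SI B (%y. LBINT x:A. f x y)"
  using lborel_pair.integrable_fst'[OF F'] unfolding SI_def e2[symmetric] by simp
qed

lemma powser_coeff_unique:
 fixes a :: "nat => real"
 assumes "!!z. abs z < 1 ==> (%n. a n * z ^ n) sums 0"
 shows "a n = 0"
proof (rule ccontr)
 assume "a n ~= 0"
 define m where "m = (LEAST m. a m ~= 0)"
 have m: "a m ~= 0" unfolding m_def using \<open>a n ~= 0\<close> by (rule LeastI)
 have lt: "a k = 0" if "k < m" for k using that not_less_Least unfolding m_def by blast
 have "(%n. a (n + m) * z ^ n) sums 0" if z: "abs z < 1" "z ~= 0" for z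
 proof -
  have "(%n. a (n + m) * z ^ (n + m)) sums (0 - (\<Sum>k<m. a k * z ^ k))" by (rule sums_split_initial_segment[OF assms[OF z(1)]])
  hence "(%n. a (n + m) * z ^ (n + m)) sums 0" using lt by simp
  hence "(%n. (1 / z ^ m)*(a (n + m) * z ^ (n + m))) sums ((1 / z ^ m) * 0)" by (rule sums_mult)
  thus ?thesis using z(2) by (simp add: power_add)
 qed
 hence "((%z::real. 0) \<longlongrightarrow> a (0 + m)) (at 0)" by (intro powser_limit_0_strong[of 1 "%n. a (n + m)"]) auto
 hence "a (0 + m) = 0" by (rule tendsto_unique[OF at_neq_bot _ tendsto_const])
 with m show False by simp
qed

context fractional_order
begin

definition cut_dens :: "real => real => real" where
 "cut_dens L x = kdens al L (cut_symbol al x)"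

lemma continuous_on_cut_dens: "L > 0 ==> continuous_on {0<..} (cut_dens L)"
 unfolding cut_dens_def by (intro continuous_on_kdens continuous_on_cut_symbol cut_symbol_pos) auto

lemma cut_dens_nonneg: "x > 0 ==> cut_dens L x >= 0"
 unfolding cut_dens_def using cut_symbol_pos[of x] by (intro kdens_nonneg) auto

lemma continuous_on_exact_dens: "L > 0 ==> continuous_on {0<..} (edens L)"
 unfolding edens_def by (intro continuous_intros continuous_on_kdens) auto

lemma exact_dens_nonneg: "y > 0 ==> edens L y >= 0"
 unfolding edens_def by (intro divide_nonneg_pos kdens_nonneg) auto

lemma exact_dens_integral:
 assumes L: "L > 0"
 shows "SI {0<..} (edens L)" "(LBINT y:{0<..}. edens L y) = 1 / L"
proof -
 have m: "SM {0<..} (%y. kdens al L (y powr al) / y)"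
  using SM_cont[OF continuous_on_exact_dens[OF L]] by (simp add: edens_def[abs_def])
 have lim: "((%s. 1 / (s powr al + L)) \<longlongrightarrow> 1 / L) (at_right 0)"
 proof -
  have "((%s. s powr al) \<longlongrightarrow> 0) (at_right 0)" using al by real_asymp
  hence "((%s. 1 / (s powr al + L)) \<longlongrightarrow> 1 / (0 + L)) (at_right 0)" by (intro tendsto_intros) (use L in auto)
  thus ?thesis by simp
 qed
 show "SI {0<..} (edens L)"
  unfolding edens_def by (rule Stieltjes_limit_at_0(1)[OF m _ Stieltjes_powr(1)[OF L] Stieltjes_powr(2)[OF L] lim]) (auto intro: kdens_nonneg)
 show "(LBINT y:{0<..}. edens L y) = 1 / L"
  unfolding edens_def by (rule Stieltjes_limit_at_0(2)[OF m _ Stieltjes_powr(1)[OF L] Stieltjes_powr(2)[OF L] lim]) (auto intro: kdens_nonneg)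
qed

lemma SI_bounded_factor:
 fixes f g :: "real => real"
 assumes "SI {0<..} f" "continuous_on {0<..} g" "!!y. y > 0 ==> abs (g y) <= B"
 shows "SI {0<..} (%y. f y * g y)"
proof (rule SI_bound[OF set_integrable_mult_left[of B, OF assms(1)]])
 have "SM {0<..} f" using assms(1) by (simp add: SI_def SM_def)
 moreover have "SM {0<..} g" by (rule SM_cont[OF assms(2)]) simp
 ultimately have "(%x. (indicator {0<..} x *\<^sub>R f x)*(indicator {0<..} x *\<^sub>R g x)) : borel_measurable lborel"
  unfolding SM_def by measurable
 moreover have "(%x. (indicator {0<..} x *\<^sub>R f x)*(indicator {0<..} x *\<^sub>R g x)) = (%x. indicator {0<..} x *\<^sub>R (f x * g x))" by (auto simp: indicator_def)
 ultimately show "SM {0<..} (%y. f y * g y)" by (simp add: SM_def)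
 show "AE y in lborel. y : {0<..} --> norm (f y * g y) <= norm (f y * B)"
  using assms(3) by (intro AE_I2) (auto simp: abs_mult intro!: mult_left_mono order_trans[OF assms(3)])
qed

text \<open>The solution with zero initial value, source 1 and eigenvalue \<open>L\<close>; in terms
  of the Mittag-Leffler function it is \<open>(1 - E_al (- L t^al)) / L\<close>. The spectral
  integral with nonnegative density makes bounds immediate, and the extension by \<open>0\<close>
  lets \<open>vx L\<close> act as a convolution kernel.\<close>

definition vx :: "real => real => real" where
 "vx L t = (if t <= 0 then 0 else 1 / L - (LBINT y:{0<..}. edens L y * exp (- (t*y))))"

lemma exact_dens_exp:
 assumes L: "L > 0" and t: "t >= 0"
 shows "SI {0<..} (%y. edens L y * exp (- (t*y)))"
  "SI {0<..} (%y. edens L y * (1 - exp (- (t*y))))"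
  "vx L t = (LBINT y:{0<..}. edens L y * (1 - exp (- (t*y))))"
proof -
 show 1: "SI {0<..} (%y. edens L y * exp (- (t*y)))" by (rule SI_bounded_factor[OF exact_dens_integral(1)[OF L], where B = 1])
    (use t in "auto intro!: continuous_intros")
 show 2: "SI {0<..} (%y. edens L y * (1 - exp (- (t*y))))"
  using LB_diff(1)[OF exact_dens_integral(1)[OF L] 1] by (simp add: algebra_simps)
 have "(LBINT y:{0<..}. edens L y * (1 - exp (- (t*y)))) = 1 / L - (LBINT y:{0<..}. edens L y * exp (- (t*y)))"
  using LB_diff(2)[OF exact_dens_integral(1)[OF L] 1] exact_dens_integral(2)[OF L] by (simp add: algebra_simps)
 thus "vx L t = (LBINT y:{0<..}. edens L y * (1 - exp (- (t*y))))"
  using t exact_dens_integral(2)[OF L] by (cases "t = 0") (auto simp: vx_def)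
qed

lemma LB_nonneg:
 fixes f :: "real => real"
 assumes "!!x. x : A ==> 0 <= f x"
 shows "0 <= (LBINT x:A. f x)"
 unfolding LB_def using assms by (intro integral_nonneg_AE AE_I2) (auto simp: indicator_def)

lemma LB_mono:
 fixes f g :: "real => real"
 assumes "SI A f" "SI A g" "!!x. x : A ==> f x <= g x"
 shows "(LBINT x:A. f x) <= (LBINT x:A. g x)"
 using assms by (intro set_integral_mono) auto

lemma vx_bounds:
 assumes L: "L > 0"
 shows "0 <= vx L t" "vx L t <= 1 / L" "L * vx L t <= 1"
proof -
 show "0 <= vx L t"
 proof (cases "t <= 0")
  case False
  hence "0 <= (LBINT y:{0<..}. edens L y * (1 - exp (- (t*y))))" by (intro LB_nonneg mult_nonneg_nonneg exact_dens_nonneg) auto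
  thus ?thesis using exact_dens_exp(3)[OF L, of t] False by simp
 qed (simp add: vx_def)
 have "0 <= (LBINT y:{0<..}. edens L y * exp (- (t*y)))" by (intro LB_nonneg mult_nonneg_nonneg exact_dens_nonneg) auto
 thus "vx L t <= 1 / L" using L by (auto simp: vx_def)
 thus "L * vx L t <= 1" using L by (simp add: pos_le_divide_eq mult.commute)
qed

lemma continuous_on_vx:
 assumes L: "L > 0"
 shows "continuous_on UNIV (vx L)"
proof -
 have e: "vx L t = (LBINT y:{0<..}. edens L y * (1 - exp (- (max 0 t * y))))" for t
 proof (cases "t <= 0")
  case False thus ?thesis using exact_dens_exp(3)[OF L, of t] by (simp add: max_def)
 qed (simp add: vx_def max_def)
 show ?thesis
  unfolding continuous_on_sequentially
 proof (intro allI impI ballI, elim conjE)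
  fix x :: "nat => real" and a assume x: "x \<longlonglongrightarrow> a"
  have "(%n. LBINT y:{0<..}. edens L y * (1 - exp (- (max 0 (x n) * y))))
    \<longlonglongrightarrow> (LBINT y:{0<..}. edens L y * (1 - exp (- (max 0 a * y))))"
   unfolding LB_def
  proof (rule integral_dominated_convergence[where w = "%y. indicator {0<..} y *\<^sub>R edens L y"])
   show "integrable lborel (%y. indicator {0<..} y *\<^sub>R edens L y)"
    using exact_dens_integral(1)[OF L] by (simp add: SI_def)
   have m: "(%y. indicator {0<..} y *\<^sub>R (edens L y * (1 - exp (- (max 0 b * y))))) : borel_measurable lborel" for b
    using exact_dens_exp(2)[OF L, of "max 0 b"] by (simp add: SI_def)
   show "(%y. indicator {0<..} y *\<^sub>R (edens L y * (1 - exp (- (max 0 a * y))))) : borel_measurable lborel"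
    "!!i. (%y. indicator {0<..} y *\<^sub>R (edens L y * (1 - exp (- (max 0 (x i) * y))))) : borel_measurable lborel" by (rule m)+
   show "AE y in lborel. (%n. indicator {0<..} y *\<^sub>R (edens L y * (1 - exp (- (max 0 (x n) * y)))))
     \<longlonglongrightarrow> indicator {0<..} y *\<^sub>R (edens L y * (1 - exp (- (max 0 a * y))))" by (intro AE_I2 tendsto_intros x)
   show "AE y in lborel. norm (indicator {0<..} y *\<^sub>R (edens L y * (1 - exp (- (max 0 (x n) * y)))))
     <= indicator {0<..} y *\<^sub>R edens L y" for n
    using exact_dens_nonneg by (intro AE_I2) (auto simp: indicator_def abs_mult intro!: mult_left_le)
  qed
  thus "(vx L \<circ> x) \<longlonglongrightarrow> vx L a" unfolding o_def e .
 qed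
qed

text \<open>Fubini leaves the integral of \<open>edens L y * (1 / s - 1 / (s + y))\<close>. The
  bracket contains a factor \<open>y\<close> that cancels the \<open>1 / y\<close> in
  \<open>edens\<close>, and the Stieltjes transform of the resolvent reappears.\<close>

lemma vx_Laplace:
 assumes L: "L > 0" and s: "s > 0"
 shows "SI {0<..} (%t. exp (- (s*t)) * vx L t)"
  "(LBINT t:{0<..}. exp (- (s*t)) * vx L t) = 1 / (s*(s powr al + L))"
proof -
 let ?f = "%t y. exp (- (s*t))*(edens L y * (1 - exp (- (t*y))))"
 have es: "SI {0<..} (%t. exp (- (r*t)))" "(LBINT t:{0<..}. exp (- (r*t))) = 1 / r" if "r > 0" for r :: real
 proof -
  have e: "x powr (1 - 1) * exp (- (x*r)) = exp (- (r*x))" if "x : {0<..}" for x :: real using that by (simp add: mult.commute)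
  have "SI {0<..} (%x. x powr (1 - 1) * exp (- (x*r))) = SI {0<..} (%t. exp (- (r*t)))" by (rule SI_cong[OF refl refl]) (rule e)
  thus "SI {0<..} (%t. exp (- (r*t)))" using scaled_Gamma_integral(1)[of 1 r] that by simp
  have "(LBINT x:{0<..}. x powr (1 - 1) * exp (- (x*r))) = (LBINT t:{0<..}. exp (- (r*t)))" by (rule LB_cong) (use e in auto)
  thus "(LBINT t:{0<..}. exp (- (r*t))) = 1 / r" using scaled_Gamma_integral(2)[of 1 r] that by simp
 qed
 have em: "(%y. indicator {0<..} y * edens L y) : borel_measurable lborel"
  using exact_dens_integral(1)[OF L] by (simp add: SI_def)
 have m: "(%(t, y). indicator {0<..} t * (indicator {0<..} y * ?f t y)) : borel_measurable (lborel \<Otimes>\<^sub>M lborel)"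
 proof -
  have "(%(t, y). indicator {0<..} t * exp (- (s*t))*((indicator {0<..} y * edens L y)*(1 - exp (- (t*y))))) : borel_measurable (lborel \<Otimes>\<^sub>M lborel)"
   using em by measurable
  thus ?thesis by (simp add: mult_ac)
 qed
 have b: "abs (?f t y) <= exp (- (s*t)) * edens L y" if "t : {0<..}" "y : {0<..}" for t y
  using that exact_dens_nonneg[of y L] by (simp add: abs_mult mult_left_le)
 note F = set_integral_Fubini[OF m b es(1)[OF s] exact_dens_integral(1)[OF L]]
 have e: "(LBINT y:{0<..}. ?f t y) = exp (- (s*t)) * vx L t" if "t : {0<..}" for t
  using that exact_dens_exp(3)[OF L, of t] by simp
 have "SI {0<..} (%t. LBINT y:{0<..}. ?f t y) = SI {0<..} (%t. exp (- (s*t)) * vx L t)" by (rule SI_cong[OF refl refl]) (rule e)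
 thus "SI {0<..} (%t. exp (- (s*t)) * vx L t)" using F(2) by blast
 have i: "(LBINT t:{0<..}. ?f t y) = 1 / s*(kdens al L (y powr al) / (y + s))" if "y : {0<..}" for y
 proof -
  have y: "y > 0" using that by simp
  have "?f t y = edens L y * (exp (- (s*t)) - exp (- ((s + y) * t)))" for t by (simp add: algebra_simps flip: exp_add)
  hence "(LBINT t:{0<..}. ?f t y) = (LBINT t:{0<..}. edens L y * (exp (- (s*t)) - exp (- ((s + y) * t))))" by (simp only:)
  also have "... = edens L y * ((LBINT t:{0<..}. exp (- (s*t))) - (LBINT t:{0<..}. exp (- ((s + y) * t))))"
   unfolding LB_mult by (subst LB_diff(2)[OF es(1)[OF s] es(1)[of "s + y"]]) (use y s in auto)
  also have "... = edens L y * (1 / s - 1 / (s + y))" using es(2) y s by simp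
  also have "... = 1 / s*(kdens al L (y powr al) / (y + s))"
  proof -
   have "1 / s - 1 / (s + y) = y / (s*(s + y))" using y s by (simp add: divide_simps)
   thus ?thesis using y by (simp add: edens_def add.commute)
  qed
  finally show ?thesis .
 qed
 have "(LBINT t:{0<..}. exp (- (s*t)) * vx L t) = (LBINT t:{0<..}. LBINT y:{0<..}. ?f t y)" by (rule LB_cong) (use e in auto)
 also have "... = (LBINT y:{0<..}. LBINT t:{0<..}. ?f t y)" by (rule F(1))
 also have "... = (LBINT y:{0<..}. 1 / s*(kdens al L (y powr al) / (y + s)))" by (rule LB_cong) (use i in auto)
 also have "... = 1 / s*(1 / (s powr al + L))"
  unfolding LB_mult Stieltjes_powr(2)[OF L s] ..
 finally show "(LBINT t:{0<..}. exp (- (s*t)) * vx L t) = 1 / (s*(s powr al + L))" by simp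
qed

text \<open>\<open>edens L y\<close> is at most \<open>kc * y powr (- al - 1)\<close>, without
  \<open>L\<close>, and \<open>1 - exp (- (t*y))\<close> is at most
  \<open>2 t y / (t y + 1)\<close>. Scaling \<open>y\<close> by \<open>t\<close> produces
  \<open>t powr al\<close> times an absolute integral. The summand 1 only makes the constant
  positive.\<close>

lemma vx_growth: "EX K>0. ALL L>0. ALL t>0. vx L t <= K*t powr al"
proof -
 define J where "J = (LBINT x:{0<..}. x powr (-al) / (x + (1::real)))"
 have J: "SI {0<..} (%x. x powr (-al) / (x + (1::real)))" by (rule SI_powr_divide) (use al in auto)
 have J0: "J >= 0" unfolding J_def by (intro LB_nonneg) auto
 show ?thesis
 proof (intro exI[of _ "2*kc*J + 1"] conjI allI impI)
  show "2*kc*J + 1 > 0" using J0 kc_pos by (intro add_nonneg_pos) auto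
  fix L t :: real assume L: "L > 0" and t: "t > 0"
  let ?f = "%x::real. x powr (-al) / (x + 1)"
  have img: "(%x. t*x) ` {0<..} = {0<..}"
  proof (intro equalityI subsetI)
   fix x :: real assume "x : {0<..}"
   thus "x : (%x. t*x) ` {0<..}" using t by (intro image_eqI[of _ _ "x / t"]) auto
  qed (use t in auto)
  have c: "continuous_on {0<..} (%x. abs t * ?f (t*x))"
  proof -
   have "t*x + 1 ~= 0" if "x > 0" for x using t that by (metis add_pos_pos less_irrefl mult_pos_pos zero_less_one)
   thus ?thesis using t by (intro continuous_intros) auto
  qed
  have m: "SM {0<..} (%x. abs t * ?f (t*x))" by (rule SM_cont[OF c]) simp
  have f': "SI ((%x. t*x) ` {0<..}) ?f" using J img by simp
  note S = LB_subst[where g = "%x. t*x" and g' = "%_. t" and S = "{0<..}" and f = ?f,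
   OF _ _ _ _ f' m]
  have 1: "SI {0<..} (%x. abs t * ?f (t*x))" by (rule S(1)) (use t img in "auto intro!: derivative_eq_intros inj_onI")
  have "(LBINT x:(%x. t*x) ` {0<..}. ?f x) = (LBINT x:{0<..}. abs t * ?f (t*x))" by (rule S(2)) (use t img in "auto intro!: derivative_eq_intros inj_onI")
  hence 2: "J = (LBINT x:{0<..}. abs t * ?f (t*x))" by (simp only: img J_def)
  have "vx L t = (LBINT y:{0<..}. edens L y * (1 - exp (- (t*y))))"
   using exact_dens_exp(3)[OF L] t by simp
  also have "... <= (LBINT y:{0<..}. 2*kc*t powr al * (abs t * ?f (t*y)))"
  proof (rule LB_mono[OF exact_dens_exp(2)[OF L] SI_mult[OF 1]])
   fix y :: real assume "y : {0<..}"
   hence y: "y > 0" by simp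
   have ty: "t*y > 0" using t y by simp
   have "1 - exp (- (t*y)) <= 2*(t*y) / (t*y + 1)"
   proof -
    have "1 - exp (- (t*y)) <= t*y" "1 - exp (- (t*y)) <= 1"
     using exp_ge_add_one_self[of "- (t*y)"] by auto
    moreover have "z <= 2*u / (u + 1)" if "z <= u" "z <= 1" "u > 0" for z u :: real
    proof -
     have "z*u <= 1*u" using that by (intro mult_right_mono) auto
     hence "z*(u + 1) <= 2*u" unfolding distrib_left using that by linarith
     thus ?thesis using that by (simp add: pos_le_divide_eq)
    qed
    ultimately show ?thesis using ty by blast
   qed
   moreover have "edens L y <= kc / y powr al / y"
    unfolding edens_def using y L kdens_bound(2)[of "y powr al" L] by (intro divide_right_mono) auto
   ultimately have "edens L y * (1 - exp (- (t*y))) <= (kc / y powr al / y)*(2*(t*y) / (t*y + 1))"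
    using y ty exact_dens_nonneg[OF y] kc_pos by (intro mult_mono) auto
   also have "... = 2*kc*t powr al * (abs t * ?f (t*y))"
    using y t ty by (simp add: powr_mult powr_minus divide_simps)
   finally show "edens L y * (1 - exp (- (t*y))) <= 2*kc*t powr al * (abs t * ?f (t*y))" .
  qed (use t in auto)
  also have "... = 2*kc*t powr al * J" unfolding LB_mult 2 ..
  also have "... <= (2*kc*J + 1) * t powr al" by (simp add: algebra_simps)
  finally show "vx L t <= (2*kc*J + 1) * t powr al" .
 qed
qed

end

section \<open>Power series coefficients of the discrete resolvent\<close>

context fractional_order
begin

text \<open>As \<open>s\<close> tends to \<open>0\<close> the resolvent of the scheme tends to
  \<open>1 / L\<close>, which cancels the constant of its representation. What remains says that the
  mass of the cut balances the pole; the start of the induction in \<open>Ix_tail\<close> lives on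
  this cancellation.\<close>

lemma cut_dens_integrable:
 assumes L: "L > 0"
 shows "SI {0<..} (%x. cut_dens L x / x)"
  "(LBINT x:{0<..}. cut_dens L x / x) = presid al L / pole al L"
proof -
 define Ph where "Ph s = (1 - al/2 * s) / (s powr al + L*(1 - al/2 * s)) - 1 / L - presid al L / (s - pole al L)" for s
 have m: "SM {0<..} (%x. cut_dens L x / x)" by (rule SM_cont) (auto intro!: continuous_intros continuous_on_cut_dens L)
 have lim: "(Ph \<longlongrightarrow> presid al L / pole al L) (at_right 0)"
 proof -
  have s0: "((%s. s powr al) \<longlongrightarrow> 0) (at_right 0)" using al by real_asymp
  have s1: "((%s::real. s) \<longlongrightarrow> 0) (at_right 0)" by real_asymp
  have "(Ph \<longlongrightarrow> (1 - al/2*0) / (0 + L*(1 - al/2*0)) - 1 / L - presid al L / (0 - pole al L)) (at_right 0)"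
   unfolding Ph_def by (intro tendsto_intros s0 s1) (use L pole_pos[OF L] in auto)
  thus ?thesis by simp
 qed
 have i: "SI {0<..} (%x. cut_dens L x / (x + s))" "(LBINT x:{0<..}. cut_dens L x / (x + s)) = Ph s"
  if "0 < s" "s < 2" for s
  using Stieltjes_scheme[OF L that] by (simp_all add: cut_dens_def Ph_def)
 show "SI {0<..} (%x. cut_dens L x / x)" by (rule Stieltjes_limit_at_0(1)[OF m cut_dens_nonneg i lim])
 show "(LBINT x:{0<..}. cut_dens L x / x) = presid al L / pole al L" by (rule Stieltjes_limit_at_0(2)[OF m cut_dens_nonneg i lim])
qed

definition cut_coeff :: "real => nat => real" where
 "cut_coeff L n = (LBINT x:{0<..}. cut_dens L x / (1 + x) ^ n)"

text \<open>Geometric expansion of the representation at \<open>w = 1 - z\<close>: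
  \<open>1 / (x + 1 - z)\<close> contributes \<open>1 / (1 + x)^(n+1)\<close>, the pole term
  contributes \<open>1 / (1 - pole)^(n+1)\<close>.\<close>

definition rcoeff :: "real => nat => real" where
 "rcoeff L n = (if n = 0 then 1 / L else 0) + presid al L / (1 - pole al L) ^ Suc n + cut_coeff L (Suc n)"

lemma cut_coeff_integrable:
 assumes L: "L > 0" and n: "n >= 1"
 shows "SI {0<..} (%x. cut_dens L x / (1 + x) ^ n)"
proof -
 have "SI {0<..} (%x. (cut_dens L x / x)*(x / (1 + x) ^ n))"
 proof (rule SI_bounded_factor[OF cut_dens_integrable(1)[OF L], where B = 1])
  show "continuous_on {0<..} (%x::real. x / (1 + x) ^ n)" by (intro continuous_intros) auto
  show "abs (y / (1 + y) ^ n) <= 1" if "y > 0" for y :: real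
  proof -
   have "y <= (1 + y) ^ 1" by simp
   also have "... <= (1 + y) ^ n" using that n by (intro power_increasing) auto
   finally show ?thesis using that by (simp add: abs_mult divide_simps)
  qed
 qed
 moreover have "SI {0<..} (%x. (cut_dens L x / x)*(x / (1 + x) ^ n))
   = SI {0<..} (%x. cut_dens L x / (1 + x) ^ n)" by (rule SI_cong[OF refl refl]) simp
 ultimately show ?thesis by (simp only:)
qed

lemma cut_coeff_nonneg: "cut_coeff L n >= 0"
 unfolding cut_coeff_def using cut_dens_nonneg by (intro LB_nonneg divide_nonneg_nonneg) auto

lemma cut_coeff_antimono:
 assumes "L > 0" "1 <= m" "m <= n"
 shows "cut_coeff L n <= cut_coeff L m"
 unfolding cut_coeff_def using assms cut_dens_nonneg by (intro LB_mono cut_coeff_integrable) (auto intro!: divide_left_mono power_increasing)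

text \<open>The pole tends to infinity as \<open>L\<close> tends to \<open>0\<close>, and the
  residue grows with it, but at most like its square. Two of the \<open>n\<close> factors
  \<open>1 - pole\<close> absorb this growth; the others have modulus at least
  \<open>(2 - al) / al > 1\<close>, because the pole exceeds \<open>2 / al\<close>.\<close>

lemma pole_bound:
 "EX K>0. ALL L>0. ALL n>=2. abs (presid al L / (1 - pole al L) ^ n) <= K*(al / (2 - al)) ^ (n - 2)"
proof (intro exI[of _ "2 / (al*(1 - al))"] conjI allI impI)
 show "2 / (al*(1 - al)) > 0" using al by simp
 fix L :: real and n :: nat assume L: "L > 0" and n: "n >= 2"
 define w where "w = pole al L"
 have w: "w > 2" "w > 2 / al" using pole_pos[OF L] pole(1)[OF L] by (simp_all add: w_def)
 have aw: "al*w > 2" using w(2) al by (simp add: field_simps)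
 have r: "abs (1 - w) = w - 1" using w by simp
 have q: "abs (1 - w) >= (2 - al) / al" unfolding r using w al by (simp add: field_simps)
 have half: "w <= 2*abs (1 - w)" unfolding r using w by simp
 have "abs (presid al L) = (al*w - 2)\<^sup>2*w powr (1 - al) / (2*al*((1 - al) * w + 2))"
  unfolding pole_residue_eq(3)[OF L] w_def[symmetric] using w al by (simp add: abs_mult)
 also have "... <= w\<^sup>2*w / (2*al*((1 - al) * w))"
 proof (intro frac_le mult_mono power_mono mult_left_mono)
  show "al*w - 2 <= w" using al w mult_right_mono[of al 1 w] by linarith
  show "w powr (1 - al) <= w" using powr_mono[of "1 - al" 1 w] w al by simp
 qed (use w aw al in auto)
 also have "... = w\<^sup>2 / (2*al*(1 - al))" using w by simp
 also have "... <= (2*abs (1 - w))\<^sup>2 / (2*al*(1 - al))"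
  using half w al by (intro divide_right_mono power_mono) auto
 also have "... = 2 / (al*(1 - al)) * \<bar>1 - w\<bar>\<^sup>2" by (simp add: power2_eq_square)
 finally have C: "abs (presid al L) <= 2 / (al*(1 - al)) * \<bar>1 - w\<bar>\<^sup>2" .
 have rp: "abs (1 - w) > 0" using w by simp
 have "abs (1 - w) ^ n = \<bar>1 - w\<bar>\<^sup>2*abs (1 - w) ^ (n - 2)"
  using n power_add[of "abs (1 - w)" 2 "n - 2"] by (simp only: le_add_diff_inverse)
 hence "abs (presid al L / (1 - pole al L) ^ n) = abs (presid al L) / (\<bar>1 - w\<bar>\<^sup>2*abs (1 - w) ^ (n - 2))" by (simp only: abs_divide power_abs w_def[symmetric])
 also have "... <= 2 / (al*(1 - al)) * \<bar>1 - w\<bar>\<^sup>2 / (\<bar>1 - w\<bar>\<^sup>2*abs (1 - w) ^ (n - 2))"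
  using C rp by (intro divide_right_mono) auto
 also have "... = 2 / (al*(1 - al))*(1 / abs (1 - w)) ^ (n - 2)"
  using rp by (simp add: power_divide)
 also have "... <= 2 / (al*(1 - al))*(al / (2 - al)) ^ (n - 2)"
 proof (intro mult_left_mono power_mono)
  have "1 / abs (1 - w) <= 1 / ((2 - al) / al)" using q al rp by (intro divide_left_mono mult_pos_pos divide_pos_pos) auto
  thus "1 / abs (1 - w) <= al / (2 - al)" by simp
 qed (use al in auto)
 finally show "abs (presid al L / (1 - pole al L) ^ n) <= 2 / (al*(1 - al))*(al / (2 - al)) ^ (n - 2)" .
qed

lemma resolvent_coeff_sums:
 assumes L: "L > 0" and z: "abs z < 1"
 shows "(%n. rcoeff L n * z ^ n) sums
   ((1 - al/2*(1 - z)) / ((1 - z) powr al + L*(1 - al/2*(1 - z))))"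
  and "summable (%n. norm (rcoeff L n * z ^ n))"
proof -
 define w where "w = pole al L"
 define C where "C = presid al L"
 have w: "w > 2" using pole_pos[OF L] by (simp add: w_def)
 have s: "0 < 1 - z" "1 - z < 2" using z by auto
 have 1: "(%n. (if n = 0 then 1 / L else 0) * z ^ n) sums (1 / L)"
  using sums_single[of 0 "%n. 1 / L*z ^ n"] by (simp add: if_distrib[of "%x. x*_"] cong: if_cong)
 have g1: "summable (%n. norm ((if n = 0 then 1 / L else 0) * z ^ n))" by (rule summable_finite[of "{0}"]) auto
 have zw: "norm (z / (1 - w)) < 1"
 proof -
  have "abs (1 - w) > 1" using w by simp
  hence "abs z < abs (1 - w)" using z by linarith
  thus ?thesis using w by (simp add: abs_divide divide_simps)
 qed
 have e2: "C / (1 - w) ^ Suc n * z ^ n = C / (1 - w)*(z / (1 - w)) ^ n" for n by (simp add: power_divide)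
 have 2: "(%n. C / (1 - w) ^ Suc n * z ^ n) sums (C / (1 - z - w))"
 proof -
  have "(%n. C / (1 - w)*(z / (1 - w)) ^ n) sums (C / (1 - w)*(1 / (1 - z / (1 - w))))" by (intro sums_mult geometric_sums zw)
  moreover have "C / (1 - w)*(1 / (1 - z / (1 - w))) = C / (1 - z - w)"
  proof -
   have "1 - z / (1 - w) = (1 - z - w) / (1 - w)" using w by (simp add: divide_simps)
   thus ?thesis using w by simp
  qed
  ultimately show ?thesis unfolding e2 by (simp only:)
 qed
 have g2: "summable (%n. norm (C / (1 - w) ^ Suc n * z ^ n))"
  unfolding e2 norm_mult norm_power using zw by (intro summable_mult summable_geometric) auto
 let ?f = "%n x. indicator {0<..} x *\<^sub>R (cut_dens L x / (1 + x) ^ Suc n * z ^ n)"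
 have fi: "integrable lborel (?f n)" for n
  using set_integrable_mult_left[OF cut_coeff_integrable[OF L, of "Suc n"], of "z ^ n"] by (simp add: SI_def)
 have fn: "(LBINT x. norm (?f n x)) = cut_coeff L (Suc n) * abs z ^ n" for n
 proof -
  have "norm (?f n x) = indicator {0<..} x *\<^sub>R (cut_dens L x / (1 + x) ^ Suc n) * abs z ^ n" for x
   using cut_dens_nonneg[of x L] by (auto simp: indicator_def abs_mult power_abs)
  hence "(LBINT x. norm (?f n x)) = (LBINT x. indicator {0<..} x *\<^sub>R (cut_dens L x / (1 + x) ^ Suc n) * abs z ^ n)" by (simp only:)
  thus ?thesis unfolding cut_coeff_def LB_def integral_mult_left_zero .
 qed
 have g3: "summable (%n. cut_coeff L (Suc n) * abs z ^ n)"
 proof (rule summable_comparison_test')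
  show "summable (%n. cut_coeff L 1 * abs z ^ n)" using z by (intro summable_mult summable_geometric) auto
  show "norm (cut_coeff L (Suc n) * abs z ^ n) <= cut_coeff L 1 * abs z ^ n" if "n >= 0" for n
   using cut_coeff_nonneg[of L "Suc n"] cut_coeff_antimono[OF L, of 1 "Suc n"] by (auto simp: abs_mult power_abs intro!: mult_right_mono)
 qed
 have gs: "(%n. cut_dens L x / (1 + x) ^ Suc n * z ^ n) sums (cut_dens L x / (x + (1 - z)))" if x: "x > 0" for x
 proof -
  have "norm (z / (1 + x)) < 1" using x z by (simp add: abs_divide divide_simps)
  hence "(%n. cut_dens L x / (1 + x)*(z / (1 + x)) ^ n) sums (cut_dens L x / (1 + x)*(1 / (1 - z / (1 + x))))" by (intro sums_mult geometric_sums)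
  moreover have "cut_dens L x / (1 + x)*(1 / (1 - z / (1 + x))) = cut_dens L x / (x + (1 - z))"
  proof -
   have "1 - z / (1 + x) = (x + (1 - z)) / (1 + x)" using x by (simp add: divide_simps)
   thus ?thesis using x by simp
  qed
  moreover have "cut_dens L x / (1 + x) ^ Suc n * z ^ n = cut_dens L x / (1 + x)*(z / (1 + x)) ^ n" for n by (simp add: power_divide)
  ultimately show ?thesis by (simp only:)
 qed
 have gs': "summable (%n. norm (?f n x))" for x
 proof (cases "x > 0")
  case True
  have "norm (z / (1 + x)) < 1" using True z by (simp add: abs_divide divide_simps)
  hence "summable (%n. norm (cut_dens L x / (1 + x)) * norm (z / (1 + x)) ^ n)" by (intro summable_mult summable_geometric) auto
  moreover have "norm (?f n x) = norm (cut_dens L x / (1 + x)) * norm (z / (1 + x)) ^ n" for n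
   using True by (simp add: power_divide abs_mult power_abs)
  ultimately show ?thesis by (simp only:)
 qed simp
 have "(%n. integral\<^sup>L lborel (?f n)) sums (LBINT x. (\<Sum>n. ?f n x))" by (rule sums_integral[OF fi AE_I2[OF gs']]) (simp only: fn g3)
 moreover have "(\<Sum>n. ?f n x) = indicator {0<..} x *\<^sub>R (cut_dens L x / (x + (1 - z)))" for x
  using sums_unique[OF gs[of x]] by (auto simp: indicator_def)
 moreover have "integral\<^sup>L lborel (?f n) = cut_coeff L (Suc n) * z ^ n" for n
 proof -
  have "integral\<^sup>L lborel (?f n) = (LBINT x. indicator {0<..} x *\<^sub>R (cut_dens L x / (1 + x) ^ Suc n) * z ^ n)" by (simp only: real_scaleR_def mult.assoc)
  thus ?thesis unfolding cut_coeff_def LB_def integral_mult_left_zero .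
 qed
 ultimately have 3: "(%n. cut_coeff L (Suc n) * z ^ n) sums (LBINT x:{0<..}. cut_dens L x / (x + (1 - z)))" by (simp only: LB_def)
 have "(%n. (if n = 0 then 1 / L else 0) * z ^ n + C / (1 - w) ^ Suc n * z ^ n + cut_coeff L (Suc n) * z ^ n) sums
   (1 / L + C / (1 - z - w) + (LBINT x:{0<..}. cut_dens L x / (x + (1 - z))))" by (intro sums_add 1 2 3)
 moreover have r: "rcoeff L n * z ^ n = (if n = 0 then 1 / L else 0) * z ^ n + C / (1 - w) ^ Suc n * z ^ n + cut_coeff L (Suc n) * z ^ n" for n
  unfolding rcoeff_def C_def[symmetric] w_def[symmetric] distrib_right ..
 ultimately show "(%n. rcoeff L n * z ^ n) sums
   ((1 - al/2*(1 - z)) / ((1 - z) powr al + L*(1 - al/2*(1 - z))))"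
  unfolding Stieltjes_scheme(2)[OF L s] C_def w_def cut_dens_def by (simp only:)
 have s3: "summable (%n. norm (cut_coeff L (Suc n) * z ^ n))"
  using g3 cut_coeff_nonneg by (simp add: abs_mult power_abs)
 show "summable (%n. norm (rcoeff L n * z ^ n))"
 proof (rule summable_comparison_test')
  show "summable (%n. norm ((if n = 0 then 1 / L else 0) * z ^ n) + norm (C / (1 - w) ^ Suc n * z ^ n) + norm (cut_coeff L (Suc n) * z ^ n))" by (intro summable_add g1 g2 s3)
  show "norm (norm (rcoeff L n * z ^ n)) <= norm ((if n = 0 then 1 / L else 0) * z ^ n) + norm (C / (1 - w) ^ Suc n * z ^ n) + norm (cut_coeff L (Suc n) * z ^ n)" if "n >= 0" for n
  proof -
   have "norm (rcoeff L n * z ^ n) <= norm ((if n = 0 then 1 / L else 0) * z ^ n) + norm (C / (1 - w) ^ Suc n * z ^ n) + norm (cut_coeff L (Suc n) * z ^ n)"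
    unfolding r by (intro order_trans[OF norm_triangle_ineq] add_mono norm_triangle_ineq order_refl)
   thus ?thesis by (simp only: real_norm_def abs_idempotent)
  qed
 qed
qed

lemma cq_weight_gchoose: "cq_weight al j = (al gchoose j)*(-1) ^ j"
proof (induction j)
 case (Suc j)
 have "(al - real j)*(al gchoose j) = real (Suc j)*(al gchoose Suc j)"
  using gbinomial_mult_1[of al j] unfolding left_diff_distrib by linarith
 hence "(al gchoose Suc j) = (al - real j) / real (Suc j)*(al gchoose j)" by (simp add: field_simps)
 moreover have "1 - (al + 1) / real (Suc j) = - ((al - real j) / real (Suc j))" by (simp add: field_simps)
 ultimately show ?case using Suc by simp
qed simp

lemma cq_weight_sums:
 assumes "abs z < 1"
 shows "(%n. cq_weight al n * z ^ n) sums (1 - z) powr al" "summable (%n. norm (cq_weight al n * z ^ n))"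
proof -
 have e: "(al gchoose n)*(- x) ^ n = cq_weight al n * x ^ n" for n x
  unfolding cq_weight_gchoose by (simp add: power_minus[of x] mult_ac)
 have *: "(%n. cq_weight al n * x ^ n) sums (1 - x) powr al" if "abs x < 1" for x
  using gen_binomial_real[of "- x" al] that unfolding e by simp
 show "(%n. cq_weight al n * z ^ n) sums (1 - z) powr al" by (rule *[OF assms])
 define r where "r = (abs z + 1)/2"
 have "abs z < r" "abs r < 1" using assms by (auto simp: r_def)
 thus "summable (%n. norm (cq_weight al n * z ^ n))"
  using powser_insidea[of "cq_weight al" r z] sums_summable[OF *[of r]] by auto
qed

definition crank :: "nat => real" where
 "crank n = (if n = 0 then 1 - al/2 else if n = 1 then al/2 else 0)"

lemma crank_sums:
 shows "(%n. crank n * z ^ n) sums (1 - al/2*(1 - z))" "summable (%n. norm (crank n * z ^ n))"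
proof -
 have "(%n. crank n * z ^ n) sums (SUM n:{0,1}. crank n * z ^ n)" by (rule sums_finite) (auto simp: crank_def)
 moreover have "(SUM n:{0,1::nat}. crank n * z ^ n) = 1 - al/2*(1 - z)" by (simp add: crank_def right_diff_distrib)
 ultimately show "(%n. crank n * z ^ n) sums (1 - al/2*(1 - z))" by simp
 show "summable (%n. norm (crank n * z ^ n))" by (rule summable_finite[of "{0,1}"]) (auto simp: crank_def)
qed

text \<open>A Cauchy product gives the identity as one of functions on \<open>abs z < 1\<close>;
  uniqueness of power series passes it to the coefficients, so that the scheme can be treated by
  formal power series.\<close>

lemma resolvent_coeff_recurrence:
 assumes L: "L > 0"
 shows "(SUM j<=n. (cq_weight al j + L*crank j) * rcoeff L (n - j)) = crank n"
proof -
 define b where "b j = cq_weight al j + L*crank j" for j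
 have "(%n. ((SUM j<=n. b j * rcoeff L (n - j)) - crank n) * z ^ n) sums 0" if z: "abs z < 1" for z
 proof -
  let ?W = "1 - al/2*(1 - z)"
  have b1: "(%n. b n * z ^ n) sums ((1 - z) powr al + L*?W)"
   unfolding b_def distrib_right mult.assoc by (intro sums_add sums_mult cq_weight_sums(1)[OF z] crank_sums(1))
  have b2: "summable (%n. norm (b n * z ^ n))"
  proof (rule summable_comparison_test')
   show "summable (%n. norm (cq_weight al n * z ^ n) + L*norm (crank n * z ^ n))" by (intro summable_add summable_mult cq_weight_sums(2)[OF z] crank_sums(2))
   show "norm (norm (b n * z ^ n)) <= norm (cq_weight al n * z ^ n) + L*norm (crank n * z ^ n)" if "n >= 0" for n
   proof -
    have "norm (b n * z ^ n) <= norm (cq_weight al n * z ^ n) + norm (L*(crank n * z ^ n))"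
     unfolding b_def distrib_right mult.assoc by (rule norm_triangle_ineq)
    thus ?thesis using L by (simp add: abs_mult)
   qed
  qed
  have "(%k. SUM i<=k. (b i * z ^ i)*(rcoeff L (k - i) * z ^ (k - i))) sums
    ((\<Sum>n. b n * z ^ n)*(\<Sum>n. rcoeff L n * z ^ n))" by (rule Cauchy_product_sums[OF b2 resolvent_coeff_sums(2)[OF L z]])
  moreover have "(SUM i<=k. (b i * z ^ i)*(rcoeff L (k - i) * z ^ (k - i))) = (SUM i<=k. b i * rcoeff L (k - i)) * z ^ k" for k
  proof -
   have "(b i * z ^ i)*(rcoeff L (k - i) * z ^ (k - i)) = b i * rcoeff L (k - i) * z ^ k" if "i <= k" for i

   proof -
    have "z ^ i * z ^ (k - i) = z ^ k" using that power_add[of z i "k - i"] by (simp only: le_add_diff_inverse)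
    moreover have "(b i * z ^ i)*(rcoeff L (k - i) * z ^ (k - i)) = b i * rcoeff L (k - i)*(z ^ i * z ^ (k - i))" by (simp only: mult_ac)
    ultimately show ?thesis by (simp only:)
   qed
   thus ?thesis unfolding sum_distrib_right by (intro sum.cong refl) simp
  qed
  moreover have "(\<Sum>n. b n * z ^ n)*(\<Sum>n. rcoeff L n * z ^ n) = ?W"
  proof -
   have "al/2*(1 - z) < 1"
   proof -
    have "al/2*(1 - z) <= al/2*2" using z al by (intro mult_left_mono) auto
    thus ?thesis using al by linarith
   qed
   hence "(1 - z) powr al + L*?W > 0" using L by (intro add_nonneg_pos mult_pos_pos) auto
   thus ?thesis unfolding sums_unique[OF b1, symmetric] sums_unique[OF resolvent_coeff_sums(1)[OF L z], symmetric] by simp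
  qed
  ultimately have "(%k. (SUM i<=k. b i * rcoeff L (k - i)) * z ^ k) sums ?W" by (simp only:)
  from sums_diff[OF this crank_sums(1)[of z]] show ?thesis by (simp add: left_diff_distrib)
 qed
 from powser_coeff_unique[OF this] show ?thesis by (simp add: b_def)
qed

text \<open>For \<open>n = 0\<close> the parts of \<open>rcoeff\<close> are not bounded uniformly
  one by one, but the recurrence gives their sum as
  \<open>(1 - al/2) / (1 + L * (1 - al/2))\<close>. For \<open>n >= 1\<close> there are at least two
  factors \<open>1 + x\<close> in the denominator: one compensates the growth of
  \<open>1 / cut_symbol\<close>, the other makes the integral converge.\<close>

lemma resolvent_coeff_bound: "EX K>0. ALL L>0. ALL n. abs (rcoeff L n) <= K"
proof -
 obtain P where P: "P > 0" "!!L n. L > 0 ==> n >= 2 ==> abs (presid al L / (1 - pole al L) ^ n) <= P*(al / (2 - al)) ^ (n - 2)"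
  using pole_bound by blast
 define J where "J = (LBINT x:{0<..}. kc*(x powr (-al) / (x + 1)))"
 have J: "SI {0<..} (%x. kc*(x powr (-al) / (x + 1)))" by (intro SI_mult SI_powr_divide) (use al in auto)
 have J0: "J >= 0" unfolding J_def using kc_pos by (intro LB_nonneg) auto
 show ?thesis
 proof (intro exI[of _ "1 + P + J"] conjI allI impI)
  show "1 + P + J > 0" using P J0 by auto
  fix L :: real and n assume L: "L > 0"
  show "abs (rcoeff L n) <= 1 + P + J"
  proof (cases "n = 0")
   case True
   have "(1 + L*(1 - al/2)) * rcoeff L 0 = 1 - al/2"
    using resolvent_coeff_recurrence[OF L, of 0] by (simp add: crank_def)
   moreover have "1 + L*(1 - al/2) >= 1" using L al by simp
   ultimately have "rcoeff L 0 = (1 - al/2) / (1 + L*(1 - al/2))" by (simp add: eq_divide_eq mult.commute)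
   also have "abs (...) <= 1"
   proof -
    have "abs (1 - al/2) <= 1" "abs (1 + L*(1 - al/2)) >= 1" using al \<open>1 + L * (1 - al / 2) >= 1\<close> by linarith+
    thus ?thesis unfolding abs_divide by (simp add: divide_le_eq)
   qed
   finally show ?thesis using True P J0 by simp
  next
   case False
   hence n: "Suc n >= 2" by simp
   have "cut_coeff L (Suc n) <= J"
    unfolding cut_coeff_def J_def
   proof (rule LB_mono[OF cut_coeff_integrable[OF L] J])
    fix x :: real assume "x : {0<..}"
    hence x: "x > 0" by simp
    have "cut_dens L x <= kc / cut_symbol al x"
     unfolding cut_dens_def by (rule kdens_bound(2)[OF cut_symbol_pos[OF x] L])
    also have "... = kc*((1 + al/2*x) * x powr (-al))" by (simp add: cut_symbol_def powr_minus_divide)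
    also have "... <= kc*((1 + x) * x powr (-al))"
    proof (intro mult_left_mono mult_right_mono)
     have "al/2*x <= 1*x" using al x by (intro mult_right_mono) auto
     thus "1 + al/2*x <= 1 + x" by simp
    qed (use kc_pos in auto)
    finally have c: "cut_dens L x <= kc*((1 + x) * x powr (-al))" .
    have "cut_dens L x / (1 + x) ^ Suc n <= kc*((1 + x) * x powr (-al)) / (1 + x) ^ 2"
     using c x n kc_pos cut_dens_nonneg[OF x] by (intro frac_le power_increasing) auto
    also have "... = kc*(x powr (-al) / (x + 1))" using x by (simp add: power2_eq_square add.commute)
    finally show "cut_dens L x / (1 + x) ^ Suc n <= kc*(x powr (-al) / (x + 1))" .
   qed simp
   moreover have "abs (presid al L / (1 - pole al L) ^ Suc n) <= P"
   proof -
    have "(al / (2 - al)) ^ (Suc n - 2) <= 1" using al by (intro power_le_one) auto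
    hence "P*(al / (2 - al)) ^ (Suc n - 2) <= P*1" using P by (intro mult_left_mono) auto
    thus ?thesis using P(2)[OF L n] by linarith
   qed
   ultimately show ?thesis using False cut_coeff_nonneg[of L "Suc n"] unfolding rcoeff_def if_not_P[OF False] by linarith
  qed
 qed
qed

end

section \<open>Error for the source 1 in spectral form\<close>

context fractional_order
begin

text \<open>Coefficients of \<open>3/2 - 2 z + z^2/2\<close> times the resolvent: for step size 1,
  the map from samples of the integrated source to the discrete solution.\<close>

definition res_diff :: "real => nat => real" where
 "res_diff L n = 3/2*rcoeff L n - 2*(if n >= 1 then rcoeff L (n - 1) else 0)
   + 1/2*(if n >= 2 then rcoeff L (n - 2) else 0)"

text \<open>At integers this is the discrete solution with step 1 and source 1, whose primitive has
  the samples \<open>0, 1, 2, ...\<close>; in between it is linear. The ramps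
  \<open>max 0 (y - m)\<close> are translates of the kernel \<open>jf 2\<close>, which later lets
  sums of kernel samples be read as convolutions with \<open>Ix\<close>.\<close>

definition Ix :: "real => real => real" where
 "Ix L y = (SUM m<=nat \<lceil>y\<rceil>. res_diff L m * max 0 (y - real m))"

text \<open>The error for the source \<open>1\<close> and its piecewise linear interpolation.  All other errors are
 obtained from it by convolution.\<close>

definition ex :: "real => real => real" where
 "ex L y = Ix L y - vx L y"

lemma Ix_eq:
 assumes "y <= real N + 1"
 shows "Ix L y = (SUM m<=N. res_diff L m * max 0 (y - real m))"
 unfolding Ix_def
proof (rule sum.mono_neutral_cong)
 show "res_diff L m * max 0 (y - real m) = 0" if "m : {..N} - {..nat \<lceil>y\<rceil>}" for m
 proof -
  have "y <= real (nat \<lceil>y\<rceil>)" by (rule real_nat_ceiling_ge)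
  also have "real (nat \<lceil>y\<rceil>) <= real m" using that unfolding Diff_iff atMost_iff by linarith
  finally show ?thesis by simp
 qed
 show "res_diff L m * max 0 (y - real m) = 0" if "m : {..nat \<lceil>y\<rceil>} - {..N}" for m
 proof -
  have "real N + 1 <= real m" using that by simp
  thus ?thesis using assms by simp
 qed
qed auto

text \<open>Division by \<open>1 - z\<close> turns \<open>(1 - z) (3 - z) / 2\<close> into
  \<open>(3 - z) / 2\<close>.\<close>

lemma res_diff_sum: "(SUM m<=n. res_diff L m) = (3*rcoeff L n - (if n >= 1 then rcoeff L (n - 1) else 0))/2"
proof (induction n)
 case 0
 thus ?case by (simp add: res_diff_def)
next
 case (Suc n)
 thus ?case by (cases n) (simp_all add: res_diff_def field_simps)
qed

lemma Ix_Suc: "Ix L (real (Suc n)) = Ix L (real n) + (SUM m<=n. res_diff L m)"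
proof -
 have "Ix L (real (Suc n)) = (SUM m<=n. res_diff L m * max 0 (real (Suc n) - real m))" by (rule Ix_eq) simp
 also have "... = (SUM m<=n. res_diff L m * max 0 (real n - real m) + res_diff L m)" by (rule sum.cong) (auto simp: max_def algebra_simps)
 also have "... = Ix L (real n) + (SUM m<=n. res_diff L m)" by (subst Ix_eq[of "real n" n]) (simp_all add: sum.distrib)
 finally show ?thesis .
qed

lemma Ix_interpolates:
 assumes "0 <= th" "th <= 1"
 shows "Ix L (real n + th) = (1 - th) * Ix L (real n) + th*Ix L (real (Suc n))"
proof -
 have "Ix L (real n + th) = (SUM m<=n. res_diff L m * max 0 (real n + th - real m))" by (rule Ix_eq) (use assms in simp)
 also have "... = (SUM m<=n. res_diff L m * max 0 (real n - real m) + th*res_diff L m)" by (rule sum.cong) (use assms in "auto simp: max_def algebra_simps")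
 also have "... = Ix L (real n) + th*(SUM m<=n. res_diff L m)" by (subst Ix_eq[of "real n" n]) (simp_all add: sum.distrib sum_distrib_left)
 also have "... = (1 - th) * Ix L (real n) + th*Ix L (real (Suc n))"
  unfolding Ix_Suc by (simp add: algebra_simps)
 finally show ?thesis .
qed

lemma Ix_0: "Ix L 0 = 0" by (simp add: Ix_def)

text \<open>The generating function of \<open>Ix L n\<close> is
  \<open>z (3 - z) / (2 (1 - z))\<close> times that of \<open>rcoeff\<close>. The last fraction here
  is, up to sign, \<open>(3 - z) / (2 (1 - z))\<close> at the cut point \<open>z = 1 + x\<close>;
  \<open>pole_tail\<close> contains its value at \<open>z = 1 - pole\<close>.\<close>

definition cut_tail :: "real => nat => real" where
 "cut_tail L n = (LBINT x:{0<..}. cut_dens L x / (1 + x) ^ n * ((2 - x) / (2*x)))"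

definition pole_tail :: "real => nat => real" where
 "pole_tail L n = presid al L / (1 - pole al L) ^ n * ((2 + pole al L) / (2*pole al L))"

lemma cut_tail_integrable:
 assumes L: "L > 0" and n: "n >= 1"
 shows "SI {0<..} (%x. cut_dens L x / (1 + x) ^ n * ((2 - x) / (2*x)))"
proof -
 have "SI {0<..} (%x. (cut_dens L x / x)*((2 - x) / (2*(1 + x) ^ n)))"
 proof (rule SI_bounded_factor[OF cut_dens_integrable(1)[OF L], where B = 1])
  show "continuous_on {0<..} (%x::real. (2 - x) / (2*(1 + x) ^ n))" by (intro continuous_intros) auto
  show "abs ((2 - y) / (2*(1 + y) ^ n)) <= 1" if "y > 0" for y :: real
  proof -
   have "abs (2 - y) <= 2*(1 + y) ^ 1" using that by auto
   also have "... <= 2*(1 + y) ^ n" using that n by (intro mult_left_mono power_increasing) auto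
   finally show ?thesis using that by (simp add: abs_mult abs_divide divide_simps)
  qed
 qed
 moreover have "SI {0<..} (%x. (cut_dens L x / x)*((2 - x) / (2*(1 + x) ^ n)))
   = SI {0<..} (%x. cut_dens L x / (1 + x) ^ n * ((2 - x) / (2*x)))" by (rule SI_cong[OF refl refl]) (simp add: mult_ac)
 ultimately show ?thesis by (simp only:)
qed

lemma cut_tail_diff:
 assumes L: "L > 0" and n: "n >= 1"
 shows "cut_tail L n - cut_tail L (Suc n) = (3*cut_coeff L (Suc n) - cut_coeff L n)/2"
proof -
 have n': "Suc n >= 1" by simp
 have "cut_tail L n - cut_tail L (Suc n) = (LBINT x:{0<..}. cut_dens L x / (1 + x) ^ n * ((2 - x) / (2*x)) - cut_dens L x / (1 + x) ^ Suc n * ((2 - x) / (2*x)))"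
  unfolding cut_tail_def by (rule LB_diff(2)[OF cut_tail_integrable[OF L n] cut_tail_integrable[OF L n'], symmetric])
 also have "... = (LBINT x:{0<..}. 3/2*(cut_dens L x / (1 + x) ^ Suc n) - 1/2*(cut_dens L x / (1 + x) ^ n))"
 proof (rule LB_cong, simp, intro allI impI)
  fix x :: real assume "x : {0<..}"
  hence x: "x > 0" by simp
  define p where "p = (1 + x) ^ n"
  have p: "p > 0" using x by (simp add: p_def)
  show "cut_dens L x / (1 + x) ^ n * ((2 - x) / (2*x)) - cut_dens L x / (1 + x) ^ Suc n * ((2 - x) / (2*x))
   = 3/2*(cut_dens L x / (1 + x) ^ Suc n) - 1/2*(cut_dens L x / (1 + x) ^ n)"
   unfolding power_Suc p_def[symmetric] using x p by (simp add: divide_simps) (simp add: algebra_simps)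
 qed
 also have "... = (LBINT x:{0<..}. 3/2*(cut_dens L x / (1 + x) ^ Suc n)) - (LBINT x:{0<..}. 1/2*(cut_dens L x / (1 + x) ^ n))" by (rule LB_diff(2)[OF SI_mult[OF cut_coeff_integrable[OF L n']] SI_mult[OF cut_coeff_integrable[OF L n]]])
 also have "... = 3/2*cut_coeff L (Suc n) - 1/2*cut_coeff L n"
  unfolding cut_coeff_def LB_mult ..
 finally show ?thesis by simp
qed

lemma cut_tail_1:
 assumes L: "L > 0"
 shows "cut_tail L 1 = presid al L / pole al L - 3/2*cut_coeff L 1"
proof -
 have "cut_tail L 1 = (LBINT x:{0<..}. cut_dens L x / x - 3/2*(cut_dens L x / (1 + x) ^ 1))"
  unfolding cut_tail_def
 proof (rule LB_cong, simp, intro allI impI)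
  fix x :: real assume "x : {0<..}"
  thus "cut_dens L x / (1 + x) ^ 1 * ((2 - x) / (2*x)) = cut_dens L x / x - 3/2*(cut_dens L x / (1 + x) ^ 1)" by (simp add: divide_simps) (simp add: algebra_simps)
 qed
 also have "... = (LBINT x:{0<..}. cut_dens L x / x) - (LBINT x:{0<..}. 3/2*(cut_dens L x / (1 + x) ^ 1))" by (rule LB_diff(2)[OF cut_dens_integrable(1)[OF L] SI_mult[OF cut_coeff_integrable[OF L order_refl]]])
 also have "... = presid al L / pole al L - 3/2*cut_coeff L 1"
  unfolding cut_coeff_def LB_mult cut_dens_integrable(2)[OF L] ..
 finally show ?thesis .
qed

lemma pole_tail_diff:
 assumes L: "L > 0"
 shows "pole_tail L (Suc n) - pole_tail L n = (3*(presid al L / (1 - pole al L) ^ Suc n) - presid al L / (1 - pole al L) ^ n)/2"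
  and "pole_tail L 1 = 3/2*(presid al L / (1 - pole al L)) + presid al L / pole al L"
proof -
 have w: "pole al L > 2" by (rule pole_pos[OF L])
 have *: "c / (q*p)*((2 + w) / (2*w)) - c / p*((2 + w) / (2*w)) = (3*(c / (q*p)) - c / p)/2"
  if "q = 1 - w" "w > 2" "p ~= 0" for c p q w :: real
  using that by (simp add: divide_simps) (simp add: algebra_simps)
 show "pole_tail L (Suc n) - pole_tail L n = (3*(presid al L / (1 - pole al L) ^ Suc n) - presid al L / (1 - pole al L) ^ n)/2"
  unfolding pole_tail_def power_Suc by (rule *[OF refl w]) (use w in simp)
 have "c / q*((2 + w) / (2*w)) = 3/2*(c / q) + c / w" if "q = 1 - w" "w > 2" for c q w :: real
  using that by (simp add: divide_simps) (simp add: algebra_simps)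
 thus "pole_tail L 1 = 3/2*(presid al L / (1 - pole al L)) + presid al L / pole al L"
  unfolding pole_tail_def power_one_right using w by simp
qed

text \<open>The differences of both tails reproduce the increments of \<open>Ix\<close>; at the
  start the terms \<open>presid / pole\<close> coming from \<open>cut_tail_1\<close> and from
  \<open>pole_tail\<close> cancel. The formula begins at \<open>n = 2\<close> because the factor of
  \<open>1 / L\<close>, the series \<open>z (3 - z) / (2 (1 - z))\<close>, has coefficient 3/2 at
  \<open>z\<close> and 1 from \<open>z^2\<close> on.\<close>

lemma Ix_tail:
 assumes L: "L > 0" and n: "n >= 2"
 shows "Ix L (real n) = 1 / L - cut_tail L n + pole_tail L n"
 using n
proof (induction n rule: dec_induct)
 case base
 have "Ix L (real 2) = Ix L (real (Suc (Suc 0)))" by (simp add: numeral_2_eq_2)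
 also have "... = (3*rcoeff L 1 - rcoeff L 0)/2 + 3/2*rcoeff L 0"
  unfolding Ix_Suc res_diff_sum by (simp add: Ix_0)
 also have "... = 1 / L - cut_tail L 2 + pole_tail L 2"
 proof -
  have "rcoeff L 0 = 1 / L + presid al L / (1 - pole al L) + cut_coeff L 1"
   "rcoeff L 1 = presid al L / (1 - pole al L) ^ 2 + cut_coeff L 2" by (simp_all add: rcoeff_def numeral_2_eq_2)
  moreover have "cut_tail L 1 - cut_tail L 2 = (3*cut_coeff L 2 - cut_coeff L 1)/2"
   using cut_tail_diff[OF L, of 1] by (simp add: numeral_2_eq_2)
  moreover have "pole_tail L 2 - pole_tail L 1 = (3*(presid al L / (1 - pole al L) ^ 2) - presid al L / (1 - pole al L))/2"
   using pole_tail_diff(1)[OF L, of 1] by (simp add: numeral_2_eq_2)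
  moreover have "(3*r1 - r0)/2 + 3/2*r0 = l - t2 + u2"
   if "r0 = l + c1 + k1" "r1 = c2 + k2" "t1 - t2 = (3*k2 - k1)/2" "u2 - u1 = (3*c2 - c1)/2" "t1 = w - 3/2*k1" "u1 = 3/2*c1 + w"
   for r0 r1 l c1 c2 k1 k2 t1 t2 u1 u2 w :: real
   using that by (simp add: field_simps)
  ultimately show ?thesis using cut_tail_1[OF L] pole_tail_diff(2)[OF L] by blast
 qed
 finally show ?case .
next
 case (step n)
 have n1: "n >= 1" "n ~= 0" "n - 1 ~= 0" using step by auto
 have "Ix L (real (Suc n)) = 1 / L - cut_tail L n + pole_tail L n + (3*rcoeff L n - rcoeff L (n - 1))/2"
  unfolding Ix_Suc res_diff_sum step.IH using n1 by simp
 moreover have "rcoeff L n = presid al L / (1 - pole al L) ^ Suc n + cut_coeff L (Suc n)"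
  using n1 by (simp add: rcoeff_def)
 moreover have "rcoeff L (n - 1) = presid al L / (1 - pole al L) ^ n + cut_coeff L n"
  unfolding rcoeff_def if_not_P[OF n1(3)] using n1 by simp
 moreover have "x = l - t' + u'"
  if "x = l - t + u + (3*r - r')/2" "r = c + k" "r' = c' + k'" "t - t' = (3*k - k')/2" "u' - u = (3*c - c')/2"
  for x l t u r r' c k c' k' t' u' :: real
  using that by (simp add: field_simps)
 ultimately show ?case
  using cut_tail_diff[OF L n1(1)] pole_tail_diff(1)[OF L, of n] by blast
qed

text \<open>The substitution \<open>x = exp y - 1\<close> turns the powers of \<open>1 + x\<close>
  into exponentials, so the discrete tail becomes a Laplace integral comparable with that of
  \<open>vx\<close>.\<close>

lemma cut_tail_exp:
 assumes L: "L > 0" and n: "n >= 1"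
 shows "SI {0<..} (%y. ddens L y * exp (- (real n * y)))"
  "cut_tail L n = (LBINT y:{0<..}. ddens L y * exp (- (real n * y)))"
proof -
 let ?A = "%y::real. exp y - 1"
 let ?f = "%x. cut_dens L x / (1 + x) ^ n * ((2 - x) / (2*x))"
 have img: "?A ` {0<..} = {0<..}"
 proof (intro equalityI subsetI)
  fix x :: real assume "x : {0<..}"
  thus "x : ?A ` {0<..}" by (intro image_eqI[of _ _ "ln (1 + x)"]) auto
 qed auto
 have inj: "inj_on ?A {0<..}" by (auto intro: inj_onI)
 have der: "(?A has_field_derivative exp x) (at x)" for x :: real by (auto intro!: derivative_eq_intros)
 have e: "abs (exp y) * ?f (exp y - 1) = ddens L y * exp (- (real n * y))" if "y : {0<..}" for y
 proof -
  have y: "exp y > 1" using that by simp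
  have "exp (- (real n * y)) = 1 / exp y ^ n" by (simp add: exp_minus divide_inverse exp_of_nat_mult)
  thus ?thesis using y by (simp add: ddens_def cut_dens_def divide_simps)
 qed
 have c: "continuous_on {0<..} (%y. abs (exp y) * ?f (exp y - 1))" by (intro continuous_intros continuous_on_compose2[OF continuous_on_cut_dens[OF L]]) auto
 have m: "SM {0<..} (%y. abs (exp y) * ?f (exp y - 1))" by (rule SM_cont[OF c]) simp
 have f': "SI (?A ` {0<..}) ?f" unfolding img by (rule cut_tail_integrable[OF L n])
 have b: "{0::real<..} : sets borel" "?A ` {0<..} : sets borel" by (simp, simp add: img)
 note S = LB_subst[OF b der inj f' m]
 have "SI {0<..} (%y. abs (exp y) * ?f (exp y - 1)) = SI {0<..} (%y. ddens L y * exp (- (real n * y)))" by (rule SI_cong[OF refl refl]) (rule e)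
 thus "SI {0<..} (%y. ddens L y * exp (- (real n * y)))" using S(1) by blast
 have "cut_tail L n = (LBINT x:?A ` {0<..}. ?f x)" by (simp add: cut_tail_def img)
 also have "... = (LBINT y:{0<..}. abs (exp y) * ?f (exp y - 1))" by (rule S(2))
 also have "... = (LBINT y:{0<..}. ddens L y * exp (- (real n * y)))" by (rule LB_cong) (use e in auto)
 finally show "cut_tail L n = (LBINT y:{0<..}. ddens L y * exp (- (real n * y)))" .
qed

text \<open>The steady state \<open>1 / L\<close>, which is not bounded uniformly, occurs in both
  solutions and cancels; the pole and the Laplace integral of \<open>dens_error\<close>
  remain.\<close>

lemma ex_spectral:
 assumes L: "L > 0" and n: "n >= 2" and th: "0 <= th" "th <= 1"
 shows "SI {0<..} (%y. dens_error L th y * exp (- (real n * y)))"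
  "ex L (real n + th) = (1 - th) * pole_tail L n + th*pole_tail L (Suc n) - (LBINT y:{0<..}. dens_error L th y * exp (- (real n * y)))"
proof -
 let ?A = "LBINT y:{0<..}. dens_error L th y * exp (- (real n * y))"
 have n1: "n >= 1" "Suc n >= 1" "Suc n >= 2" using n by auto
 let ?a = "%y. (1 - th)*(ddens L y * exp (- (real n * y)))"
 let ?b = "%y. th*(ddens L y * exp (- (real (Suc n) * y)))"
 let ?c = "%y. edens L y * exp (- ((real n + th) * y))"
 have ia: "SI {0<..} ?a" by (rule SI_mult) (rule cut_tail_exp(1)[OF L n1(1)])
 have ib: "SI {0<..} ?b" by (rule SI_mult) (rule cut_tail_exp(1)[OF L n1(2)])
 have ic: "SI {0<..} ?c" by (rule exact_dens_exp(1)[OF L]) (use th in simp)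
 have e: "dens_error L th y * exp (- (real n * y)) = ?a y + ?b y - ?c y" for y
 proof -
  have "exp (- (real (Suc n) * y)) = exp (- y) * exp (- (real n * y))" "exp (- ((real n + th) * y)) = exp (- (th*y)) * exp (- (real n * y))" by (simp_all add: algebra_simps flip: exp_add)
  thus ?thesis unfolding dens_error_def by (simp add: algebra_simps)
 qed
 show "SI {0<..} (%y. dens_error L th y * exp (- (real n * y)))"
  unfolding e by (intro LB_diff(1) LB_add(1) ia ib ic)
 have "?A = (LBINT y:{0<..}. ?a y + ?b y) - (LBINT y:{0<..}. ?c y)"
  unfolding e by (rule LB_diff(2)[OF LB_add(1)[OF ia ib] ic])
 also have "(LBINT y:{0<..}. ?a y + ?b y) = (LBINT y:{0<..}. ?a y) + (LBINT y:{0<..}. ?b y)" by (rule LB_add(2)[OF ia ib])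
 also have "... = (1 - th) * cut_tail L n + th*cut_tail L (Suc n)"
  unfolding LB_mult cut_tail_exp(2)[OF L n1(1)] cut_tail_exp(2)[OF L n1(2)] ..
 finally have I: "?A = (1 - th) * cut_tail L n + th*cut_tail L (Suc n) - (LBINT y:{0<..}. ?c y)" .
 have v: "vx L (real n + th) = 1 / L - (LBINT y:{0<..}. ?c y)" using n th by (simp add: vx_def)
 have *: "(1 - th)*(p - a + b) + th*(p - c + d) - (p - i) = (1 - th) * b + th*d - ((1 - th) * a + th*c - i)" for p a b c d i :: real by (simp add: algebra_simps)
 show "ex L (real n + th) = (1 - th) * pole_tail L n + th*pole_tail L (Suc n) - ?A"
  unfolding ex_def Ix_interpolates[OF th] Ix_tail[OF L n] Ix_tail[OF L n1(3)] I v by (rule *)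
qed

lemma continuous_on_Ix: "continuous_on UNIV (Ix L)"
proof -
 have "isCont (Ix L) y" for y
 proof -
  obtain N :: nat where N: "y < real N" using reals_Archimedean2 by blast
  have "continuous_on {..<real N} (Ix L)"
  proof (rule continuous_on_eq)
   show "continuous_on {..<real N} (%y. SUM m<=N. res_diff L m * max 0 (y - real m))" by (intro continuous_intros)
  qed (use Ix_eq[of _ N, symmetric] in auto)
  thus ?thesis using N by (simp add: continuous_on_eq_continuous_at)
 qed
 thus ?thesis by (simp add: continuous_on_eq_continuous_at)
qed

lemma continuous_on_ex: "L > 0 ==> continuous_on UNIV (ex L)"
 unfolding ex_def by (intro continuous_intros continuous_on_Ix continuous_on_vx)

lemma ex_nonpos: "y <= 0 ==> ex L y = 0"
 unfolding ex_def Ix_def vx_def by (simp add: max_def sum.neutral)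

lemma res_diff_bound: "EX K>0. ALL L>0. ALL n. abs (res_diff L n) <= K"
proof -
 obtain K where K: "K > 0" "!!L n. L > 0 ==> abs (rcoeff L n) <= K" using resolvent_coeff_bound by blast
 show ?thesis
 proof (intro exI[of _ "4*K"] conjI allI impI)
  fix L :: real and n assume L: "L > 0"
  show "abs (res_diff L n) <= 4*K"
   using K(2)[OF L, of n] K(2)[OF L, of "n - 1"] K(2)[OF L, of "n - 2"] K(1) unfolding res_diff_def by (auto simp: abs_le_iff)
 qed (use K in simp)
qed

text \<open>Geometric decay beats every power. The exponent \<open>al - 3\<close> is the strongest
  one wanted, for the BDF2 differences of the error.\<close>

lemma pole_tail_bound: "EX K>0. ALL L>0. ALL n>=2. abs (pole_tail L n) <= K*(real n + 1) powr (al - 3)"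
proof -
 obtain P where P: "P > 0" "!!L n. L > 0 ==> n >= 2 ==> abs (presid al L / (1 - pole al L) ^ n) <= P*(al / (2 - al)) ^ (n - 2)"
  using pole_bound by blast
 define q where "q = al / (2 - al)"
 have q: "0 < q" "q < 1" using al by (auto simp: q_def)
 have "(%n::nat. q ^ n * (real n + 3) powr (3 - al)) \<longlonglongrightarrow> 0" using q by real_asymp
 hence "Bseq (%n::nat. q ^ n * (real n + 3) powr (3 - al))" by (intro convergent_imp_Bseq convergentI)
 then obtain M where M: "M > 0" "!!n::nat. norm (q ^ n * (real n + 3) powr (3 - al)) <= M" by (auto elim: BseqE)
 show ?thesis
 proof (intro exI[of _ "P*M"] conjI allI impI)
  show "P*M > 0" using P M by simp
  fix L :: real and n :: nat assume L: "L > 0" and n: "n >= 2"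
  have w: "pole al L > 2" by (rule pole_pos[OF L])
  have "abs (pole_tail L n) = abs (presid al L / (1 - pole al L) ^ n)*((2 + pole al L) / (2*pole al L))"
   using w by (simp add: pole_tail_def abs_mult abs_divide)
  also have "... <= (P*q ^ (n - 2)) * 1"
  proof (rule mult_mono)
   show "(2 + pole al L) / (2*pole al L) <= 1" "0 <= (2 + pole al L) / (2*pole al L)" using w by (auto simp: divide_simps)
  qed (use P(2)[OF L n] P(1) q in "auto simp: q_def")
  also have "q ^ (n - 2) <= M*(real n + 1) powr (al - 3)"
  proof -
   have "q ^ (n - 2)*(real n + 1) powr (3 - al) <= M" using M(2)[of "n - 2"] n q by (simp add: of_nat_diff abs_mult add.commute)
   moreover have "(real n + 1) powr (al - 3) = 1 / (real n + 1) powr (3 - al)"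
    using powr_minus_divide[of "real n + 1" "3 - al"] by simp
   ultimately show ?thesis by (simp add: pos_le_divide_eq)
  qed
  finally show "abs (pole_tail L n) <= P*M*(real n + 1) powr (al - 3)"
   using P by (simp add: mult.assoc mult_left_mono)
 qed
qed

lemma spectral_integral_bound:
 fixes f :: "real => real" and b t K :: real
 assumes f: "SI {0<..} f" and b: "!!y. y > 0 ==> abs (f y) <= K*(y powr (b - 1) * exp (- (y*t)))"
  and t: "t > 0" "b > 0"
 shows "abs (LBINT y:{0<..}. f y) <= K*Gamma b * t powr (- b)"
proof -
 have g: "SI {0<..} (%y. K*(y powr (b - 1) * exp (- (y*t))))" by (rule SI_mult) (rule scaled_Gamma_integral(1)[OF t(2) t(1)])
 have "abs (LBINT y:{0<..}. f y) <= (LBINT y:{0<..}. abs (f y))"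
  using set_integral_norm_bound[OF f] by simp
 also have "... <= (LBINT y:{0<..}. K*(y powr (b - 1) * exp (- (y*t))))"
  using b by (intro LB_mono set_integrable_abs f g) auto
 also have "... = K*Gamma b * t powr (- b)"
  unfolding LB_mult scaled_Gamma_integral(2)[OF t(2) t(1)] by (simp add: powr_minus_divide)
 finally show ?thesis .
qed

text \<open>Integrating \<open>y powr (1 - al) * exp (2*y)\<close> against
  \<open>exp (- n y)\<close> gives \<open>Gamma (2 - al) * (n - 2) powr (al - 2)\<close>: the order
  of the density at \<open>0\<close> becomes decay in time, and its growth costs a shift by
  2.\<close>

lemma ex_floor_decay:
 "EX K>0. ALL L>0. ALL th:{0..1}. ALL n>=3. abs (ex L (real n + th)) <= K*(real n - 2) powr (al - 2)"
proof -
 obtain P where P: "P > 0" "!!L n. L > 0 ==> n >= 2 ==> abs (pole_tail L n) <= P*(real n + 1) powr (al - 3)"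
  using pole_tail_bound by blast
 obtain H where H: "H >= 0" "!!L th y. L > 0 ==> th : {0..1} ==> y > 0 ==> abs (dens_error L th y) <= H*(y powr (1 - al) * exp (2*y))"
  using dens_error_bound by blast
 have G: "Gamma (2 - al) > 0" using al by simp
 show ?thesis
 proof (intro exI[of _ "P + H*Gamma (2 - al)"] conjI allI impI ballI)
  show "P + H*Gamma (2 - al) > 0" using P(1) H(1) G by (intro add_pos_nonneg) auto
  fix L th :: real and n :: nat assume L: "L > 0" and th: "th : {0..1}" and n: "n >= 3"
  have n2: "n >= 2" "Suc n >= 2" and th': "0 <= th" "th <= 1" using n th by auto
  have p: "abs (pole_tail L m) <= P*(real n - 2) powr (al - 2)" if "m >= n" for m
  proof -
   have "abs (pole_tail L m) <= P*(real m + 1) powr (al - 3)" using P(2)[OF L, of m] that n by simp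
   also have "(real m + 1) powr (al - 3) <= (real m + 1) powr (al - 2)" using n that by (intro powr_mono) auto
   also have "(real m + 1) powr (al - 2) <= (real n - 2) powr (al - 2)" using n that al by (intro powr_mono2') auto
   finally show ?thesis using P(1) by (simp add: mult_left_mono)
  qed
  have i: "abs (LBINT y:{0<..}. dens_error L th y * exp (- (real n * y))) <= H*Gamma (2 - al)*(real n - 2) powr (- (2 - al))"
  proof (rule spectral_integral_bound[OF ex_spectral(1)[OF L n2(1) th']])
   fix y :: real assume y: "y > 0"
   have "abs (dens_error L th y * exp (- (real n * y))) <= H*(y powr (1 - al) * exp (2*y)) * exp (- (real n * y))"
    unfolding abs_mult using H(2)[OF L th y] by (simp add: mult_right_mono)
   also have "... = H*(y powr (2 - al - 1) * exp (- (y*(real n - 2))))" by (simp add: mult.assoc algebra_simps flip: exp_add)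
   finally show "abs (dens_error L th y * exp (- (real n * y))) <= H*(y powr (2 - al - 1) * exp (- (y*(real n - 2))))" .
  qed (use n al in auto)
  have "abs ((1 - th) * pole_tail L n + th*pole_tail L (Suc n)) <= (1 - th)*(P*(real n - 2) powr (al - 2)) + th*(P*(real n - 2) powr (al - 2))"
   using p[of n] p[of "Suc n"] th' by (intro order_trans[OF abs_triangle_ineq] add_mono) (auto simp: abs_mult intro!: mult_left_mono)
  also have "... = P*(real n - 2) powr (al - 2)" by (simp add: algebra_simps)
  finally have "abs ((1 - th) * pole_tail L n + th*pole_tail L (Suc n)) <= P*(real n - 2) powr (al - 2)" .
  moreover have "abs (LBINT y:{0<..}. dens_error L th y * exp (- (real n * y))) <= H*Gamma (2 - al)*(real n - 2) powr (al - 2)"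
   using i by simp
  ultimately show "abs (ex L (real n + th)) <= (P + H*Gamma (2 - al))*(real n - 2) powr (al - 2)"
   unfolding ex_spectral(2)[OF L n2(1) th'] distrib_right by (intro order_trans[OF abs_triangle_ineq4] add_mono)
 qed
qed

text \<open>\<open>3/2 - 2 z + z^2/2\<close> has a simple zero at \<open>z = 1\<close>; at
  \<open>z = exp y\<close> the factor \<open>exp y - 1\<close> supplies the power of
  \<open>y\<close>.\<close>

lemma bdf2_exp_bound: "abs (3/2 - 2*exp y + 1/2*exp (2*y)) <= y*exp (2*y)" if "y > 0" for y :: real
proof -
 have 1: "3/2 - 2*exp y + 1/2*exp (2*y) = (exp y - 1)*(exp y - 3)/2"
  unfolding exp_double power2_eq_square by (simp add: algebra_simps)
 have "exp y - 1 <= y*exp y"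
 proof -
  have "1 - y <= exp (- y)" using exp_ge_add_one_self[of "-y"] by simp
  hence "exp y * (1 - y) <= exp y * exp (- y)" by (intro mult_left_mono) auto
  thus ?thesis by (simp add: algebra_simps flip: exp_add)
 qed
 moreover have "abs (exp y - 3) <= 2*exp y" using exp_ge_add_one_self[of y] that by linarith
 moreover have "exp y >= 1" using that by simp
 ultimately have "abs (exp y - 1) * abs (exp y - 3) <= (y*exp y)*(2*exp y)" by (intro mult_mono) auto
 thus ?thesis unfolding 1 abs_divide abs_mult by (simp add: exp_double power2_eq_square)
qed

text \<open>Under the integral a BDF2 difference is multiplication by the factor of
  \<open>bdf2_exp_bound\<close>: one more power of \<open>y\<close>, hence one more power of decay,
  and one more \<open>exp (2*y)\<close>, hence the shift by 4.\<close>

lemma ex_bdf2_floor_decay: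
 "EX K>0. ALL L>0. ALL th:{0..1}. ALL n>=5.
   abs (3/2*ex L (real n + th) - 2*ex L (real (n - 1) + th) + 1/2*ex L (real (n - 2) + th)) <= K*(real n - 4) powr (al - 3)"
proof -
 obtain P where P: "P > 0" "!!L n. L > 0 ==> n >= 2 ==> abs (pole_tail L n) <= P*(real n + 1) powr (al - 3)"
  using pole_tail_bound by blast
 obtain H where H: "H >= 0" "!!L th y. L > 0 ==> th : {0..1} ==> y > 0 ==> abs (dens_error L th y) <= H*(y powr (1 - al) * exp (2*y))"
  using dens_error_bound by blast
 have G: "Gamma (3 - al) > 0" using al by simp
 show ?thesis
 proof (intro exI[of _ "4*P + H*Gamma (3 - al)"] conjI allI impI ballI)
  show "4*P + H*Gamma (3 - al) > 0" using P(1) H(1) G by (intro add_pos_nonneg) auto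
  fix L th :: real and n :: nat assume L: "L > 0" and th: "th : {0..1}" and n: "n >= 5"
  have n2: "n >= 2" "n - 1 >= 2" "n - 2 >= 2" and th': "0 <= th" "th <= 1" using n th by auto
  define X where "X = P*(real n - 4) powr (al - 3)"
  define p where "p m = (1 - th) * pole_tail L m + th*pole_tail L (Suc m)" for m
  have p: "abs (p m) <= X" if "m >= n - 2" for m
  proof -
   have *: "abs (pole_tail L k) <= X" if "k >= n - 2" for k
   proof -
    have "abs (pole_tail L k) <= P*(real k + 1) powr (al - 3)" using P(2)[OF L, of k] that n by simp
    also have "(real k + 1) powr (al - 3) <= (real n - 4) powr (al - 3)" using n that al by (intro powr_mono2') auto
    finally show ?thesis using P(1) by (simp add: X_def mult_left_mono)
   qed
   have "abs (p m) <= (1 - th) * X + th*X"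
    unfolding p_def using *[of m] *[of "Suc m"] that th' by (intro order_trans[OF abs_triangle_ineq] add_mono) (auto simp: abs_mult intro!: mult_left_mono)
   thus ?thesis by (simp add: algebra_simps)
  qed
  let ?f = "%m y. dens_error L th y * exp (- (real m * y))"
  note si = ex_spectral(1)[OF L n2(1) th'] ex_spectral(1)[OF L n2(2) th'] ex_spectral(1)[OF L n2(3) th']
  have s1: "SI {0<..} (%y. 3/2*?f n y - 2*?f (n - 1) y)" by (intro LB_diff(1) SI_mult si)
  have s2: "SI {0<..} (%y. 1/2*?f (n - 2) y)" by (intro SI_mult si)
  have s: "SI {0<..} (%y. 3/2*?f n y - 2*?f (n - 1) y + 1/2*?f (n - 2) y)" by (rule LB_add(1)[OF s1 s2])
  have S: "(LBINT y:{0<..}. 3/2*?f n y - 2*?f (n - 1) y + 1/2*?f (n - 2) y)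
    = 3/2*(LBINT y:{0<..}. ?f n y) - 2*(LBINT y:{0<..}. ?f (n - 1) y) + 1/2*(LBINT y:{0<..}. ?f (n - 2) y)"
   unfolding LB_add(2)[OF s1 s2]
    LB_diff(2)[OF SI_mult[OF si(1)] SI_mult[OF si(2)]] LB_mult ..
  have b: "abs (LBINT y:{0<..}. 3/2*?f n y - 2*?f (n - 1) y + 1/2*?f (n - 2) y) <= H*Gamma (3 - al)*(real n - 4) powr (- (3 - al))"
  proof (rule spectral_integral_bound[OF s])
   fix y :: real assume y: "y > 0"
   have "exp (- (real (n - 1) * y)) = exp y * exp (- (real n * y))" "exp (- (real (n - 2) * y)) = exp (2*y) * exp (- (real n * y))"
    using n by (simp_all add: of_nat_diff algebra_simps flip: exp_add)
   hence "3/2*?f n y - 2*?f (n - 1) y + 1/2*?f (n - 2) y = dens_error L th y * exp (- (real n * y))*(3/2 - 2*exp y + 1/2*exp (2*y))" by (simp add: algebra_simps)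
   hence "abs (3/2*?f n y - 2*?f (n - 1) y + 1/2*?f (n - 2) y) = abs (dens_error L th y) * exp (- (real n * y)) * abs (3/2 - 2*exp y + 1/2*exp (2*y))" by (simp only: abs_mult) simp
   also have "... <= (H*(y powr (1 - al) * exp (2*y))) * exp (- (real n * y))*(y*exp (2*y))"
    using H(2)[OF L th y] bdf2_exp_bound[OF y] H(1) by (intro mult_mono mult_right_mono) auto
   also have "... = H*((y powr (1 - al) * y)*(exp (2*y) * exp (- (real n * y)) * exp (2*y)))" by (simp only: mult_ac)
   also have "y powr (1 - al) * y = y powr (3 - al - 1)" using y powr_add[of y "1 - al" 1] by simp
   also have "exp (2*y) * exp (- (real n * y)) * exp (2*y) = exp (- (y*(real n - 4)))" by (simp add: algebra_simps flip: exp_add)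
   finally show "abs (3/2*?f n y - 2*?f (n - 1) y + 1/2*?f (n - 2) y) <= H*(y powr (3 - al - 1) * exp (- (y*(real n - 4))))" .
  qed (use n al in auto)
  have E: "3/2*ex L (real n + th) - 2*ex L (real (n - 1) + th) + 1/2*ex L (real (n - 2) + th)
   = 3/2*p n - 2*p (n - 1) + 1/2*p (n - 2) - (LBINT y:{0<..}. 3/2*?f n y - 2*?f (n - 1) y + 1/2*?f (n - 2) y)"
   unfolding S ex_spectral(2)[OF L n2(1) th'] ex_spectral(2)[OF L n2(2) th'] ex_spectral(2)[OF L n2(3) th'] p_def[symmetric] by (simp add: algebra_simps)
  moreover have "- (3 - al) = al - 3" by simp
  moreover have "abs (p n) <= X" "abs (p (n - 1)) <= X" "abs (p (n - 2)) <= X" by (rule p, simp)+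
  ultimately show "abs (3/2*ex L (real n + th) - 2*ex L (real (n - 1) + th) + 1/2*ex L (real (n - 2) + th))
    <= (4*P + H*Gamma (3 - al))*(real n - 4) powr (al - 3)"
  proof -
   have "abs (3/2*a - 2*b + 1/2*c - i) <= 4*x + j" if "abs a <= x" "abs b <= x" "abs c <= x" "abs i <= j" for a b c i j x :: real
    using that by linarith
   note * = this[OF \<open>abs (p n) <= X\<close> \<open>abs (p (n - 1)) <= X\<close> \<open>abs (p (n - 2)) <= X\<close> b]
   show ?thesis
    unfolding E by (rule order_trans[OF *]) (simp add: X_def distrib_right)
  qed
 qed
qed

end

section \<open>Decay at all times and the vanishing integral\<close>

context fractional_order
begin

text \<open>For \<open>y < 3\<close> smallness comes from \<open>vx_growth\<close> and the first
  four ramps, for \<open>y >= 3\<close> from \<open>ex_floor_decay\<close> at the integer part. On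
  either range one of the two bounds implies the other.\<close>

lemma ex_decay: "EX K>0. ALL L>0. ALL y>0. abs (ex L y) <= K*y powr al & abs (ex L y) <= K*y powr (al - 2)"
proof -
 let ?A = "al - 2"
 obtain K1 where K1: "K1 > 0" "!!L th n. L > 0 ==> th : {0..1} ==> n >= 3 ==> abs (ex L (real n + th)) <= K1*(real n - 2) powr ?A"
  using ex_floor_decay by blast
 obtain K2 where K2: "K2 > 0" "!!L n. L > 0 ==> abs (res_diff L n) <= K2" using res_diff_bound by blast
 obtain K3 where K3: "K3 > 0" "!!L t. L > 0 ==> t > 0 ==> vx L t <= K3*t powr al" using vx_growth by blast
 \<comment> \<open>\<open>12 = 4 * 3\<close> combines four ramps with
   \<open>y <= 3 * y powr al\<close>; \<open>9 = 3^2\<close> passes from \<open>y powr al\<close> to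
   \<open>y powr (al - 2)\<close> for \<open>y < 3\<close>; \<open>16 = 4^2\<close> bounds
   \<open>4 powr (2 - al)\<close>, the price of \<open>n - 2 >= y/4\<close>.\<close>
 define K where "K = 16*K1 + 9*(12*K2 + K3)"
 have K: "K > 0" "K >= 9*(12*K2 + K3)" "K >= 16*K1" "K >= 12*K2 + K3" using K1 K2 K3 by (simp_all add: K_def)
 show ?thesis
 proof (intro exI[of _ K] conjI allI impI)
  fix L y :: real assume L: "L > 0" and y: "y > 0"
  have y2: "y powr al = y powr ?A * y\<^sup>2"
   using y powr_add[of y "al - 2" 2] by (simp add: powr_numeral)
  have *: "abs (ex L y) <= K*y powr al & abs (ex L y) <= K*y powr ?A"
  proof (cases "y < 3")
   case True
   have yy: "y <= 3*y powr al"
   proof -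
    have "y = y powr (1 - al) * y powr al" using y by (simp flip: powr_add)
    also have "... <= 3 powr 1 * y powr al"
    proof (rule mult_right_mono)
     have "y powr (1 - al) <= 3 powr (1 - al)" using True y al by (intro powr_mono2) auto
     also have "(3::real) powr (1 - al) <= 3 powr 1" using al by (intro powr_mono) auto
     finally show "y powr (1 - al) <= 3 powr 1" .
    qed simp
    finally show ?thesis by simp
   qed
   have "Ix L y = (SUM m<=3. res_diff L m * max 0 (y - real m))" by (rule Ix_eq) (use True in simp)
   also have "abs (...) <= (SUM m<=3::nat. K2*y)"
    using y K2(2)[OF L] K2(1) by (intro order_trans[OF sum_abs] sum_mono) (auto simp: abs_mult intro!: mult_mono)
   also have "... = 4*K2*y" by simp
   also have "... <= 4*K2*(3*y powr al)" using yy K2(1) by (intro mult_left_mono) auto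
   finally have I: "abs (Ix L y) <= 12*K2*y powr al" by simp
   have "abs (ex L y) <= abs (Ix L y) + abs (vx L y)" unfolding ex_def by (rule abs_triangle_ineq4)
   also have "... <= (12*K2 + K3) * y powr al"
    using I K3(2)[OF L y] vx_bounds(1)[OF L, of y] by (simp add: distrib_right)
   finally have e: "abs (ex L y) <= (12*K2 + K3) * y powr al" .
   also have "... <= K*y powr al" using K by (intro mult_right_mono) auto
   finally have 1: "abs (ex L y) <= K*y powr al" .
   have "abs (ex L y) <= (12*K2 + K3)*(y powr ?A * y\<^sup>2)" using e unfolding y2 .
   also have "... <= (12*K2 + K3)*(y powr ?A * 3\<^sup>2)"
    using K2(1) K3(1) True y by (intro mult_left_mono power_mono) auto
   also have "... = 9*(12*K2 + K3) * y powr ?A" by simp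
   also have "... <= K*y powr ?A" using K by (intro mult_right_mono) auto
   finally show ?thesis using 1 by simp
  next
   case False
   define n where "n = nat \<lfloor>y\<rfloor>"
   have nle: "real n <= y" "y < real n + 1" using y by (auto simp: n_def)
   hence n3: "n >= 3" using False by linarith
   have "abs (ex L (real n + (y - real n))) <= K1*(real n - 2) powr ?A" by (rule K1(2)[OF L]) (use nle n3 in auto)
   also have "... <= K1*(y/4) powr ?A"
    using nle n3 y K1 al by (intro mult_left_mono powr_mono2') auto
   also have "... = K1*(y powr ?A/4 powr ?A)" using y by (simp add: powr_divide)
   also have "1 / (4::real) powr ?A = 4 powr (2 - al)" using powr_minus_divide[of "4::real" "al - 2"] by simp
   hence "K1*(y powr ?A/4 powr ?A) = K1*4 powr (2 - al) * y powr ?A" by (simp add: divide_inverse)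
   also have "... <= K1*4 powr 2 * y powr ?A"
    using K1 al by (intro mult_right_mono mult_left_mono powr_mono) auto
   also have "... = 16*K1*y powr ?A" by simp
   also have "... <= K*y powr ?A" using K by (intro mult_right_mono) auto
   finally have 1: "abs (ex L y) <= K*y powr ?A" by simp
   also have "... <= K*y powr al" using K False by (intro mult_left_mono powr_mono) auto
   finally show ?thesis using 1 by simp
  qed
  show "abs (ex L y) <= K*y powr al" "abs (ex L y) <= K*y powr ?A" using * by auto
 qed (use K in simp)
qed

definition bdf_ex :: "real => real => real" where
 "bdf_ex L y = 3/2*ex L y - 2*ex L (y - 1) + 1/2*ex L (y - 2)"

text \<open>As in \<open>ex_decay\<close>: for \<open>y >= 8\<close> the integer part
  \<open>n\<close> satisfies \<open>n - 4 >= y/4\<close>.\<close>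

lemma bdf_ex_decay: "EX K>0. ALL L>0. ALL y>=8. abs (bdf_ex L y) <= K*y powr (al - 3)"
proof -
 obtain K1 where K1: "K1 > 0" "!!L th n. L > 0 ==> th : {0..1} ==> n >= 5 ==>
   abs (3/2*ex L (real n + th) - 2*ex L (real (n - 1) + th) + 1/2*ex L (real (n - 2) + th)) <= K1*(real n - 4) powr (al - 3)"
  using ex_bdf2_floor_decay by blast
 show ?thesis
 proof (intro exI[of _ "K1*4 powr (3 - al)"] conjI allI impI)
  fix L y :: real assume L: "L > 0" and y: "y >= 8"
  define n where "n = nat \<lfloor>y\<rfloor>"
  have nle: "real n <= y" "y < real n + 1" using y by (auto simp: n_def)
  hence n8: "n >= 8" using y by linarith
  define th where "th = y - real n"
  have e: "real n + th = y" "real (n - 1) + th = y - 1" "real (n - 2) + th = y - 2"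
   using n8 by (auto simp: th_def of_nat_diff)
  have "abs (3/2*ex L (real n + th) - 2*ex L (real (n - 1) + th) + 1/2*ex L (real (n - 2) + th)) <= K1*(real n - 4) powr (al - 3)" by (rule K1(2)[OF L]) (use nle n8 in "auto simp: th_def")
  also have "... <= K1*(y/4) powr (al - 3)"
   using nle n8 y K1 al by (intro mult_left_mono powr_mono2') auto
  also have "... = K1*(y powr (al - 3)/4 powr (al - 3))" using y by (simp add: powr_divide)
  also have "1 / (4::real) powr (al - 3) = 4 powr (3 - al)" using powr_minus_divide[of "4::real" "al - 3"] by simp
  hence "K1*(y powr (al - 3)/4 powr (al - 3)) = K1*4 powr (3 - al) * y powr (al - 3)" by (simp add: divide_inverse)
  finally show "abs (bdf_ex L y) <= K1*4 powr (3 - al) * y powr (al - 3)" unfolding bdf_ex_def e .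
 qed (use K1 in simp)
qed

lemma ex_integrable_tail:
 assumes L: "L > 0" and K: "!!y. y > 0 ==> abs (ex L y) <= K*y powr (al - 2)" and t: "t > 0"
 shows "SI {t..} (ex L)" "abs (LBINT y:{t..}. ex L y) <= K / (1 - al) * t powr (al - 1)"
proof -
 have h: "((%x. x powr (al - 2)) has_integral - (t powr (al - 2 + 1)) / (al - 2 + 1)) {t..}" by (rule has_integral_powr_to_inf) (use al t in auto)
 have m: "SM {t..} (%x. x powr (al - 2))"
  unfolding SM_def by measurable
 have nn: "0 <= x powr (al - 2)" for x by simp
 note P = SI_nonneg[OF h nn m]
 have mex: "SM {t..} (ex L)" by (rule SM_cont[OF continuous_on_subset[OF continuous_on_ex[OF L]]]) auto
 show i: "SI {t..} (ex L)"
 proof (rule SI_bound[OF SI_mult[of K, OF P(1)] mex])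
  show "AE x in lborel. x : {t..} --> norm (ex L x) <= norm (K*x powr (al - 2))"
  proof (intro AE_I2 impI)
   fix x assume "x : {t..}"
   hence "abs (ex L x) <= K*x powr (al - 2)" using K[of x] t by auto
   thus "norm (ex L x) <= norm (K*x powr (al - 2))" by simp
  qed
 qed
 have "abs (LBINT y:{t..}. ex L y) <= (LBINT y:{t..}. abs (ex L y))" using set_integral_norm_bound[OF i] by simp
 also have "... <= (LBINT y:{t..}. K*y powr (al - 2))"
  using K t by (intro LB_mono set_integrable_abs i SI_mult P(1)) auto
 also have "... = K*(- (t powr (al - 2 + 1)) / (al - 2 + 1))" unfolding LB_mult P(2) ..
 also have "... = K / (1 - al) * t powr (al - 1)" using al by (simp add: divide_simps) (simp add: algebra_simps)
 finally show "abs (LBINT y:{t..}. ex L y) <= K / (1 - al) * t powr (al - 1)" .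
qed

lemma ex_integrable:
 assumes L: "L > 0"
 shows "SI {0<..} (ex L)"
proof -
 obtain K where K: "!!y. y > 0 ==> abs (ex L y) <= K*y powr (al - 2)" using ex_decay L by blast
 have 1: "SI {1..} (ex L)" by (rule ex_integrable_tail(1)[OF L K]) auto
 have "SI {0..1} (ex L)" by (rule SI_Icc) (use continuous_on_subset[OF continuous_on_ex[OF L]] in auto)
 hence 2: "SI {0<..1} (ex L)" by (rule SI_subset) auto
 have "{0<..} = {0<..1} \<union> {1::real..}" by auto
 thus ?thesis using set_integrable_Un[OF 2 1] by simp
qed

text \<open>Each ramp has the transform \<open>exp (- m s) / s^2\<close>, so the transform of
  \<open>Ix\<close> is the generating function of \<open>res_diff\<close> at
  \<open>z = exp (- s)\<close>, divided by \<open>s^2\<close>.\<close>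

lemma Ix_Laplace:
 assumes L: "L > 0" and s: "s > 0"
 shows "SI {0<..} (%y. exp (- (s*y)) * Ix L y)"
  "(LBINT y:{0<..}. exp (- (s*y)) * Ix L y) = 1 / s\<^sup>2*(\<Sum>m. res_diff L m * exp (- s) ^ m)"
proof -
 obtain K where K: "K > 0" "!!n. abs (res_diff L n) <= K" using res_diff_bound L by blast
 let ?f = "%m y. indicator {0<..} y *\<^sub>R (exp (- (s*y))*(res_diff L m * max 0 (y - real m)))"
 let ?g = "%m y. indicator {0<..} y * (exp (- (s*y)) * max 0 (y - real m))"
 have g: "integrable lborel (?g m)" "(LBINT y. ?g m y) = exp (- s) ^ m / s\<^sup>2" for m
 proof -
  let ?h = "%y. indicator {0<..} y *\<^sub>R (y powr (2 - 1) * exp (- (y * s)))"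
  have h: "integrable lborel ?h" "(LBINT y. ?h y) = 1 / s\<^sup>2"
   using scaled_Gamma_integral[of 2 s] s by (simp_all add: SI_def LB_def powr_numeral Gamma_numeral)
  have e: "?g m y = exp (- s) ^ m * ?h (- real m + 1*y)" for y
  proof (cases "y > real m")
   case True
   have "exp (- s) ^ m * exp (- ((y - real m) * s)) = exp (- (s*y))" by (simp add: algebra_simps flip: exp_add exp_of_nat_mult)
   thus ?thesis using True by (simp add: algebra_simps)
  next
   case False thus ?thesis by (auto simp: indicator_def)
  qed
  show "integrable lborel (?g m)"
   unfolding e by (intro integrable_mult_right lborel_integrable_real_affine h) auto
  show "(LBINT y. ?g m y) = exp (- s) ^ m / s\<^sup>2"
   unfolding e using lborel_integral_real_affine[of 1 ?h "- real m"] h(2) by simp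
 qed
 have fe: "?f m y = res_diff L m * ?g m y" for m y by simp
 have fi: "integrable lborel (?f m)" for m unfolding fe by (intro integrable_mult_right g)
 have fn: "(LBINT y. norm (?f m y)) = abs (res_diff L m)*(exp (- s) ^ m / s\<^sup>2)" for m
 proof -
  have "norm (?f m y) = abs (res_diff L m) * ?g m y" for y by (simp add: abs_mult)
  thus ?thesis using g(2)[of m] by simp
 qed
 have es: "norm (exp (- s)) < 1" using s by simp
 have sm: "summable (%m. LBINT y. norm (?f m y))"
  unfolding fn
 proof (rule summable_comparison_test')
  show "summable (%m. K / s\<^sup>2*exp (- s) ^ m)" by (intro summable_mult summable_geometric es)
  show "norm (abs (res_diff L m)*(exp (- s) ^ m / s\<^sup>2)) <= K / s\<^sup>2*exp (- s) ^ m" if "m >= 0" for m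
   using mult_right_mono[OF K(2)[of m], of "exp (- s) ^ m / s\<^sup>2"] by simp
 qed
 have fs: "(%m. ?f m y) sums (indicator {0<..} y *\<^sub>R (exp (- (s*y)) * Ix L y))" for y
 proof -
  have "(%m. ?f m y) sums (SUM m<=nat \<lceil>y\<rceil>. ?f m y)"
  proof (rule sums_finite)
   fix m assume "m \<notin> {..nat \<lceil>y\<rceil>}"
   hence "nat \<lceil>y\<rceil> < m" by (simp only: atMost_iff not_le)
   hence "y <= real m" using real_nat_ceiling_ge[of y] by linarith
   thus "?f m y = 0" by simp
  qed simp
  thus ?thesis by (simp add: Ix_def sum_distrib_left)
 qed
 have sn: "summable (%m. norm (?f m y))" for y
 proof (rule summable_finite[of "{..nat \<lceil>y\<rceil>}"])
  fix m assume "m \<notin> {..nat \<lceil>y\<rceil>}"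
  hence "nat \<lceil>y\<rceil> < m" by (simp only: atMost_iff not_le)
  hence "y <= real m" using real_nat_ceiling_ge[of y] by linarith
  thus "norm (?f m y) = 0" by simp
 qed simp
 have u: "(\<Sum>m. ?f m y) = indicator {0<..} y *\<^sub>R (exp (- (s*y)) * Ix L y)" for y
  using sums_unique[OF fs[of y]] by simp
 show "SI {0<..} (%y. exp (- (s*y)) * Ix L y)"
  using integrable_suminf[OF fi AE_I2[OF sn] sm] unfolding u SI_def .
 have "(%m. LBINT y. ?f m y) sums (LBINT y. (\<Sum>m. ?f m y))" by (rule sums_integral[OF fi AE_I2[OF sn] sm])
 moreover have "(LBINT y. ?f m y) = res_diff L m * (exp (- s) ^ m / s\<^sup>2)" for m
  using g(2)[of m] unfolding fe by simp
 ultimately have "(%m. res_diff L m * (exp (- s) ^ m / s\<^sup>2)) sums (LBINT y:{0<..}. exp (- (s*y)) * Ix L y)" by (simp only: u LB_def)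
 hence S: "(LBINT y:{0<..}. exp (- (s*y)) * Ix L y) = (\<Sum>m. 1 / s\<^sup>2*(res_diff L m * exp (- s) ^ m))" by (simp add: sums_iff)
 have "summable (%m. res_diff L m * exp (- s) ^ m)"
 proof (rule summable_comparison_test')
  show "summable (%m. K*exp (- s) ^ m)" by (intro summable_mult summable_geometric es)
  show "norm (res_diff L m * exp (- s) ^ m) <= K*exp (- s) ^ m" if "m >= 0" for m
   using mult_right_mono[OF K(2)[of m], of "exp (- s) ^ m"] by (simp add: abs_mult)
 qed
 thus "(LBINT y:{0<..}. exp (- (s*y)) * Ix L y) = 1 / s\<^sup>2*(\<Sum>m. res_diff L m * exp (- s) ^ m)"
  unfolding S by (rule suminf_mult)
qed

lemma res_diff_sums:
 assumes L: "L > 0" and z: "abs z < 1"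
 shows "(%m. res_diff L m * z ^ m) sums ((3/2 - 2*z + z\<^sup>2/2)*((1 - al/2*(1 - z)) / ((1 - z) powr al + L*(1 - al/2*(1 - z)))))"
proof -
 let ?R = "(1 - al/2*(1 - z)) / ((1 - z) powr al + L*(1 - al/2*(1 - z)))"
 have 0: "(%n. rcoeff L n * z ^ n) sums ?R" by (rule resolvent_coeff_sums(1)[OF L z])
 have 1: "(%n. (if n >= 1 then rcoeff L (n - 1) else 0) * z ^ n) sums (z*?R)"
 proof -
  have "(%n. (if Suc n >= 1 then rcoeff L (Suc n - 1) else 0) * z ^ Suc n) sums (z*?R)"
   using sums_mult[OF 0, of z] by (simp add: mult_ac)
  from sums_Suc[OF this] show ?thesis by simp
 qed
 have 2: "(%n. (if n >= 2 then rcoeff L (n - 2) else 0) * z ^ n) sums (z*(z*?R))"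
 proof -
  have "(%n. (if Suc n >= 2 then rcoeff L (Suc n - 2) else 0) * z ^ Suc n) sums (z*(z*?R))"
  proof -
   have "(if Suc n >= 2 then rcoeff L (Suc n - 2) else 0) * z ^ Suc n = z*((if n >= 1 then rcoeff L (n - 1) else 0) * z ^ n)" for n by (cases n) auto
   thus ?thesis using sums_mult[OF 1, of z] by (simp only:)
  qed
  from sums_Suc[OF this] show ?thesis by simp
 qed
 have "(%n. 3/2*(rcoeff L n * z ^ n) - 2*((if n >= 1 then rcoeff L (n - 1) else 0) * z ^ n)
   + 1/2*((if n >= 2 then rcoeff L (n - 2) else 0) * z ^ n)) sums (3/2*?R - 2*(z*?R) + 1/2*(z*(z*?R)))" by (intro sums_add sums_diff sums_mult 0 1 2)
 moreover have "3/2*R - 2*(z*R) + 1/2*(z*(z*R)) = (3/2 - 2*z + z\<^sup>2/2) * R" for R by (simp add: algebra_simps power2_eq_square)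
 moreover have "res_diff L n * z ^ n = 3/2*(rcoeff L n * z ^ n) - 2*((if n >= 1 then rcoeff L (n - 1) else 0) * z ^ n)
   + 1/2*((if n >= 2 then rcoeff L (n - 2) else 0) * z ^ n)" for n
  unfolding res_diff_def by (simp only: left_diff_distrib distrib_right mult.assoc)
 ultimately show ?thesis by (simp only:)
qed

text \<open>The Laplace transform of the error vanishes at \<open>0\<close> because the scheme is of second order.\<close>

lemma ex_integral_zero:
 assumes L: "L > 0"
 shows "(LBINT y:{0<..}. ex L y) = 0"
proof -
 define lm where "lm s = 1 / s\<^sup>2*((3/2 - 2*exp (-s) + (exp (-s))\<^sup>2/2)*((1 - al/2*(1 - exp (-s))) / ((1 - exp (-s)) powr al + L*(1 - al/2*(1 - exp (-s)))))) - 1 / (s*(s powr al + L))" for s :: real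
 have lm: "(LBINT y:{0<..}. exp (- (s*y)) * ex L y) = lm s" if s: "s > 0" for s
 proof -
  have "abs (exp (-s)) < 1" using s by simp
  hence "(\<Sum>m. res_diff L m * exp (- s) ^ m) = (3/2 - 2*exp (-s) + (exp (-s))\<^sup>2/2)*((1 - al/2*(1 - exp (-s))) / ((1 - exp (-s)) powr al + L*(1 - al/2*(1 - exp (-s)))))"
   using sums_unique[OF res_diff_sums[OF L, of "exp (-s)"]] by simp
  moreover have "(LBINT y:{0<..}. exp (- (s*y)) * ex L y) = (LBINT y:{0<..}. exp (- (s*y)) * Ix L y) - (LBINT y:{0<..}. exp (- (s*y)) * vx L y)"
   unfolding ex_def right_diff_distrib by (rule LB_diff(2)[OF Ix_Laplace(1)[OF L s] vx_Laplace(1)[OF L s]])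
  ultimately show ?thesis unfolding Ix_Laplace(2)[OF L s] vx_Laplace(2)[OF L s] lm_def by (simp only:)
 qed
 have lim: "(lm \<longlongrightarrow> 0) (at_right 0)"
 proof (rule Lim_transform_eventually)
  \<comment> \<open>At \<open>z = exp (- s)\<close>, \<open>?a\<close> is the BDF2 symbol,
    \<open>?b\<close> the averaging symbol and \<open>?p\<close> that of the fractional difference.
    The identity \<open>alg\<close> below splits the transform into two defects:
    \<open>?a s - s\<close> is of third order, and \<open>?a s * ?b s * s powr al - s * ?p s\<close>
    is \<open>s powr al\<close> times a quantity of third order, thanks to the averaging weights.
    Divided by \<open>s^2\<close> both tend to \<open>0\<close>.\<close>
  let ?a = "%s::real. 3/2 - 2*exp (-s) + (exp (-s))\<^sup>2/2" and ?b = "%s. 1 - al/2*(1 - exp (-s))" and ?p = "%s. (1 - exp (-s)) powr al"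
  have 1: "((%s. (?a s - s) / s\<^sup>2) \<longlongrightarrow> 0) (at_right 0)" by real_asymp
  have 2: "((%s. (?a s * ?b s * s powr al - s*?p s) / s\<^sup>2) \<longlongrightarrow> 0) (at_right 0)"
  proof (rule Lim_transform_eventually)
   have 1: "((%s. (?a s * ?b s - s*((1 - exp (-s)) / s) powr al) / s\<^sup>2) \<longlongrightarrow> 0) (at_right 0)" by real_asymp
   have "((%s. s powr al) \<longlongrightarrow> 0) (at_right 0)" using al by real_asymp
   from tendsto_mult[OF this 1]
   show "((%s. s powr al * ((?a s * ?b s - s*((1 - exp (-s)) / s) powr al) / s\<^sup>2)) \<longlongrightarrow> 0) (at_right 0)" by simp
   show "\<forall>\<^sub>F s in at_right 0. s powr al * ((?a s * ?b s - s*((1 - exp (-s)) / s) powr al) / s\<^sup>2) = (?a s * ?b s * s powr al - s*?p s) / s\<^sup>2"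
    unfolding eventually_at_right_field
   proof (intro exI[of _ 1] conjI allI impI)
    fix s :: real assume "s > 0"
    hence "s powr al * ((1 - exp (-s)) / s) powr al = ?p s" by (simp add: powr_divide)
    hence "s powr al * (?a s * ?b s - s*((1 - exp (-s)) / s) powr al) = ?a s * ?b s * s powr al - s*?p s" by (simp only: right_diff_distrib mult_ac)
    thus "s powr al * ((?a s * ?b s - s*((1 - exp (-s)) / s) powr al) / s\<^sup>2) = (?a s * ?b s * s powr al - s*?p s) / s\<^sup>2" by (simp only: times_divide_eq_right)
   qed simp
  qed
  have 3: "(?b \<longlongrightarrow> 1) (at_right 0)" "(?p \<longlongrightarrow> 0) (at_right 0)" "((%s. s powr al) \<longlongrightarrow> 0) (at_right 0)" using al by real_asymp+
  have "((%s. (L*?b s * ((?a s - s) / s\<^sup>2) + (?a s * ?b s * s powr al - s*?p s) / s\<^sup>2) / ((?p s + L*?b s)*(s powr al + L)))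
    \<longlongrightarrow> (L*1*0 + 0) / ((0 + L*1)*(0 + L))) (at_right 0)"
   using L by (intro tendsto_intros 1 2 3) auto
  thus "((%s. (L*?b s * ((?a s - s) / s\<^sup>2) + (?a s * ?b s * s powr al - s*?p s) / s\<^sup>2) / ((?p s + L*?b s)*(s powr al + L))) \<longlongrightarrow> 0) (at_right 0)" by simp
  have alg: "(L*b*((a - s) / s\<^sup>2) + (a*b*q - s*p) / s\<^sup>2) / ((p + L*b)*(q + L)) = 1 / s\<^sup>2*(a*(b / (p + L*b))) - 1 / (s*(q + L))"
   if "s > 0" "b > 0" "p >= 0" "q >= 0" for a b p q s
  proof -
   have "p + L*b > 0" "q + L > 0" using that L by (simp_all add: add_nonneg_pos)
   moreover obtain X where "X = p + L*b" by blast
   moreover obtain Y where "Y = q + L" by blast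
   moreover have "(L*b*((a - s) / s\<^sup>2) + (a*b*q - s*p) / s\<^sup>2) = (a*b*(q + L) - s*(p + L*b)) / s\<^sup>2" by (simp add: diff_divide_distrib add_divide_distrib algebra_simps)
   ultimately have "(L*b*((a - s) / s\<^sup>2) + (a*b*q - s*p) / s\<^sup>2) / ((p + L*b)*(q + L)) = (a*b*Y - s*X) / s\<^sup>2 / (X*Y)" "X > 0" "Y > 0" by simp_all
   moreover have "(a*b*Y - s*X) / s\<^sup>2 / (X*Y) = 1 / s\<^sup>2*(a*(b / X)) - 1 / (s*Y)" if "X > 0" "Y > 0" for X Y
    using that \<open>s > 0\<close> by (simp add: field_simps power2_eq_square)
   ultimately show ?thesis using \<open>X = _\<close> \<open>Y = _\<close> by simp
  qed
  show "\<forall>\<^sub>F s in at_right 0. (L*?b s * ((?a s - s) / s\<^sup>2) + (?a s * ?b s * s powr al - s*?p s) / s\<^sup>2) / ((?p s + L*?b s)*(s powr al + L)) = lm s"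
   unfolding eventually_at_right_field
  proof (intro exI[of _ 1] conjI allI impI)
   fix s :: real assume s: "s > 0"
   have "al/2*(1 - exp (-s)) < 1*1" using al s by (intro mult_strict_mono) auto
   thus "(L*?b s * ((?a s - s) / s\<^sup>2) + (?a s * ?b s * s powr al - s*?p s) / s\<^sup>2) / ((?p s + L*?b s)*(s powr al + L)) = lm s"
    unfolding lm_def by (intro alg s) auto
  qed simp
 qed
 let ?s = "%n. 1 / real (Suc n)"
 have s: "?s \<longlonglongrightarrow> 0" using LIMSEQ_inverse_real_of_nat by (simp add: inverse_eq_divide)
 have "filterlim ?s (at_right 0) sequentially"
  using s by (auto simp: filterlim_at intro!: eventuallyI)
 hence 1: "(%n. lm (?s n)) \<longlonglongrightarrow> 0" using lim by (rule filterlim_compose[rotated])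
 have "(%n. LBINT y:{0<..}. exp (- (?s n * y)) * ex L y) \<longlonglongrightarrow> (LBINT y:{0<..}. exp (- (0*y)) * ex L y)"
  unfolding LB_def
 proof (rule integral_dominated_convergence[where w = "%y. indicator {0<..} y *\<^sub>R \<bar>ex L y\<bar>"])
  show "integrable lborel (%y. indicator {0<..} y *\<^sub>R \<bar>ex L y\<bar>)"
   using set_integrable_abs[OF ex_integrable[OF L]] by (simp add: SI_def)
  have [measurable]: "ex L : borel_measurable borel" by (rule borel_measurable_continuous_onI[OF continuous_on_ex[OF L]])
  show "(%y. indicator {0<..} y *\<^sub>R (exp (- (0*y)) * ex L y)) : borel_measurable lborel" by measurable
  show "(%y. indicator {0<..} y *\<^sub>R (exp (- (?s n * y)) * ex L y)) : borel_measurable lborel" for n by measurable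
  show "AE y in lborel. (%n. indicator {0<..} y *\<^sub>R (exp (- (?s n * y)) * ex L y)) \<longlonglongrightarrow> indicator {0<..} y *\<^sub>R (exp (- (0*y)) * ex L y)" by (intro AE_I2 tendsto_intros s)
  show "AE y in lborel. norm (indicator {0<..} y *\<^sub>R (exp (- (?s n * y)) * ex L y)) <= indicator {0<..} y *\<^sub>R \<bar>ex L y\<bar>" for n by (intro AE_I2) (auto simp: indicator_def abs_mult intro!: mult_left_le_one_le)
 qed
 moreover have "(LBINT y:{0<..}. exp (- (?s n * y)) * ex L y) = lm (?s n)" for n by (rule lm) simp
 ultimately have "(%n. lm (?s n)) \<longlonglongrightarrow> (LBINT y:{0<..}. ex L y)" by (simp only: mult_zero_left minus_zero exp_zero mult_1)
 from LIMSEQ_unique[OF this 1] show ?thesis .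
qed

definition ex_int :: "real => real => real" where
 "ex_int L t = (LBINT y:{0..t}. ex L y)"

text \<open>As the whole integral vanishes, the integral up to \<open>t\<close> is minus the tail
  and inherits its decay; integrability of \<open>ex\<close> alone would only make it
  bounded.\<close>

lemma ex_int_decay: "EX K>0. ALL L>0. ALL t>0. abs (ex_int L t) <= K*t powr (al - 1)"
proof -
 obtain K where K: "K > 0" "!!L y. L > 0 ==> y > 0 ==> abs (ex L y) <= K*y powr (al - 2)" using ex_decay by blast
 show ?thesis
 proof (intro exI[of _ "K / (1 - al)"] conjI allI impI)
  fix L t :: real assume L: "L > 0" and t: "t > 0"
  note T = ex_integrable_tail[OF L K(2)[OF L] t]
  have i: "SI {0<..<t} (ex L)" by (rule SI_subset[OF ex_integrable[OF L]]) auto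
  have "(LBINT y:{0<..<t} \<union> {t..}. ex L y) = (LBINT y:{0<..<t}. ex L y) + (LBINT y:{t..}. ex L y)" by (rule set_integral_Un[OF _ i T(1)]) auto
  moreover have "{0<..<t} \<union> {t..} = {0<..}" using t by auto
  moreover have "(LBINT y:{0<..<t}. ex L y) = ex_int L t"
   unfolding ex_int_def LB_def
  proof (rule integral_cong_AE)
   have [measurable]: "ex L : borel_measurable borel" by (rule borel_measurable_continuous_onI[OF continuous_on_ex[OF L]])
   show "(%x. indicator {0<..<t} x *\<^sub>R ex L x) : borel_measurable lborel" by measurable
   show "(%x. indicator {0..t} x *\<^sub>R ex L x) : borel_measurable lborel" by measurable
   have "AE s in lborel. s ~= 0 & s ~= t" using AE_lborel_singleton[of 0] AE_lborel_singleton[of t] by eventually_elim simp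
   thus "AE s in lborel. indicator {0<..<t} s *\<^sub>R ex L s = indicator {0..t} s *\<^sub>R ex L s" by eventually_elim (auto simp: indicator_def)
  qed
  ultimately have "ex_int L t = - (LBINT y:{t..}. ex L y)" using ex_integral_zero[OF L] by simp
  thus "abs (ex_int L t) <= K / (1 - al) * t powr (al - 1)" using T(2) by simp
 qed (use K al in simp)
qed

end

section \<open>Fractional integral kernels and convolution\<close>

text \<open>The kernel of the fractional integral of order \<open>q\<close>; \<open>jf 1\<close> is
  the Heaviside function and \<open>jf 2\<close> the ramp. The cutoff makes it causal: a translate
  vanishes before its start.\<close>

definition jf :: "real => real => real" where
 "jf q x = (if x <= 0 then 0 else x powr (q - 1) / Gamma q)"

definition conv :: "(real => real) => (real => real) => real => real" where
 "conv f g t = (LBINT s:{0..t}. f (t - s) * g s)"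

lemma measurable_jf [measurable]: "jf q : borel_measurable borel"
 unfolding jf_def by measurable

lemma jf_nonneg: "q > 0 ==> jf q x >= 0" by (auto simp: jf_def)

lemma jf_integral:
 assumes q: "q > 0" and M: "M >= 0"
 shows "SI {0..M} (jf q)" "(LBINT x:{0..M}. jf q x) = jf (q + 1) M"
proof -
 have G: "Gamma q > 0" using q by simp
 have "((%x. x powr (q - 1)) has_integral (M powr (q - 1 + 1) / (q - 1 + 1))) {0..M}" by (rule has_integral_powr_from_0) (use q M in auto)
 hence "((%x. x powr (q - 1)*(1 / Gamma q)) has_integral (M powr q / q*(1 / Gamma q))) {0..M}" by (intro has_integral_mult_left) simp
 hence "((%x. jf q x) has_integral (M powr q / q*(1 / Gamma q))) {0..M}" by (rule has_integral_spike_finite[of "{0}", rotated 2]) (auto simp: jf_def)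
 moreover have "M powr q / q*(1 / Gamma q) = jf (q + 1) M"
 proof -
  have "q \<notin> \<int>\<^sub>\<le>\<^sub>0" using q by (auto dest: nonpos_Ints_nonpos)
  from Gamma_plus1[OF this] show ?thesis using q M by (auto simp: jf_def)
 qed
 ultimately have I: "((%x. jf q x) has_integral jf (q + 1) M) {0..M}" by simp
 have m: "SM {0..M} (jf q)" unfolding SM_def by measurable
 show "SI {0..M} (jf q)" by (rule SI_nonneg(1)[OF I jf_nonneg[OF q] m])
 show "(LBINT x:{0..M}. jf q x) = jf (q + 1) M" by (rule SI_nonneg(2)[OF I jf_nonneg[OF q] m])
qed

lemma line_convolution:
 fixes b h :: "real => real"
 assumes b: "integrable lborel b" and h: "integrable lborel h"
 shows "integrable (lborel \<Otimes>\<^sub>M lborel) (%(t, y). b (t - y) * h y)"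
  "integrable lborel (%t. LBINT y. b (t - y) * h y)"
  "(LBINT t. LBINT y. b (t - y) * h y) = (LBINT t. b t)*(LBINT y. h y)"
proof -
 have [measurable]: "b : borel_measurable borel" "h : borel_measurable borel"
  using b h by (auto simp: borel_measurable_integrable)
 have sh: "(LBINT t. f (t - y)) = (LBINT t. f t)" for f :: "real => real" and y
  using lborel_integral_real_affine[of 1 f "- y"] by simp
 have shi: "integrable lborel (%t. f (t - y))" if "integrable lborel f" for f :: "real => real" and y
  using lborel_integrable_real_affine[OF that, of 1 "- y"] by simp
 have F: "integrable (lborel \<Otimes>\<^sub>M lborel) (%(y, t). b (t - y) * h y)"
 proof (rule lborel_pair.Fubini_integrable)
  show "(%(y, t). b (t - y) * h y) : borel_measurable (lborel \<Otimes>\<^sub>M lborel)" by measurable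
  have "(LBINT t. norm (case (y, t) of (y, t) => b (t - y) * h y)) = (LBINT t. norm (b t)) * norm (h y)" for y
   using sh[of "%t. abs (b t)" y] by (simp add: abs_mult)
  thus "integrable lborel (%y. LBINT t. norm (case (y, t) of (y, t) => b (t - y) * h y))"
   using h by (simp only:) (intro integrable_mult_right integrable_norm)
  show "AE y in lborel. integrable lborel (%t. case (y, t) of (y, t) => b (t - y) * h y)"
   using shi[OF b] by simp
 qed
 show F': "integrable (lborel \<Otimes>\<^sub>M lborel) (%(t, y). b (t - y) * h y)"
  using lborel_pair.integrable_product_swap[OF F] by (simp add: case_prod_unfold)
 show "integrable lborel (%t. LBINT y. b (t - y) * h y)"
  using lborel_pair.integrable_fst'[OF F'] by simp
 have "(LBINT t. LBINT y. b (t - y) * h y) = (LBINT y. LBINT t. b (t - y) * h y)" by (rule lborel_pair.Fubini_integral[OF F])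
 also have "... = (LBINT y. (LBINT t. b t) * h y)"
  using sh[of b] by (simp del: integral_mult_right_zero)
 finally show "(LBINT t. LBINT y. b (t - y) * h y) = (LBINT t. b t)*(LBINT y. h y)" by simp
qed

lemma conv_commute: "conv f g t = conv g f t"
proof -
 have "conv f g t = (LBINT s. indicator {0..t} (t + (- 1) * s)*(f (t - (t + (- 1) * s)) * g (t + (- 1) * s)))"
  unfolding conv_def LB_def by (subst lborel_integral_real_affine[of "-1" _ t]) simp_all
 also have "... = conv g f t"
  unfolding conv_def LB_def by (rule Bochner_Integration.integral_cong) (auto simp: indicator_def mult.commute)
 finally show ?thesis .
qed

text \<open>The endpoints form a null set, so values such as \<open>jf 1 0 = 0\<close> may differ
  there; this is how \<open>jf 1\<close> is exchanged for the constant 1.\<close>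

lemma conv_cong:
 assumes "!!s. 0 < s ==> s < t ==> f (t - s) * g s = f' (t - s) * g' s"
 shows "conv f g t = conv f' g' t"
 unfolding conv_def LB_def by (rule integral_discrete_difference[of "{0, t}"]) (use assms in "auto simp: indicator_def")

text \<open>Fubini on the triangle \<open>0 <= z <= s <= t\<close>. With the factors cut off to
  \<open>[0, M]\<close>, boundedness of \<open>a\<close> leaves the convolution of two integrable
  functions as majorant.\<close>

lemma conv_assoc:
 fixes a b h :: "real => real"
 assumes a: "SM {0..M} a" "!!x. x : {0..M} ==> abs (a x) <= B"
  and b: "SI {0..M} b" and h: "SI {0..M} h" and t: "t <= M"
 shows "conv a (conv b h) t = conv (conv a b) h t"
  and "SI {0..t} (%s. a (t - s) * conv b h s)"
proof -
 define A where "A x = indicator {0..M} x * a x" for x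
 define b' where "b' x = indicator {0..M} x * b x" for x
 define h' where "h' x = indicator {0..M} x * h x" for x
 have [measurable]: "A : borel_measurable borel" "b' : borel_measurable borel" "h' : borel_measurable borel"
  using a b h by (auto simp: A_def[abs_def] b'_def[abs_def] h'_def[abs_def] SM_def SI_def borel_measurable_integrable)
 have bi: "integrable lborel b'" "integrable lborel h'" using b h by (simp_all add: SI_def b'_def[abs_def] h'_def[abs_def])
 define F where "F s z = indicator {0..t} s * A (t - s)*(indicator {0..s} z * (b' (s - z) * h' z))" for s z :: real
 have Fm: "(%(s, z). F s z) : borel_measurable (lborel \<Otimes>\<^sub>M lborel)"
 proof -
  have "(%(s, z). indicator {0..t} s * A (t - s)*((if 0 <= z & z <= s then 1 else 0)*(b' (s - z) * h' z))) : borel_measurable (lborel \<Otimes>\<^sub>M lborel)" by measurable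
  moreover have "F s z = indicator {0..t} s * A (t - s)*((if 0 <= z & z <= s then 1 else 0)*(b' (s - z) * h' z))" for s z by (auto simp: F_def indicator_def)
  ultimately show ?thesis by (simp only:)
 qed
 have Ab: "abs (A x) <= abs B" for x using a(2)[of x] by (auto simp: A_def indicator_def)
 have FI: "integrable (lborel \<Otimes>\<^sub>M lborel) (%(s, z). F s z)"
 proof (rule Bochner_Integration.integrable_bound[OF integrable_mult_right[where c = "abs B"] Fm])
  show "integrable (lborel \<Otimes>\<^sub>M lborel) (%(t, y). b' (t - y) * h' y)" by (rule line_convolution(1)[OF bi])
  show "AE x in lborel \<Otimes>\<^sub>M lborel. norm (case x of (s, z) => F s z) <= norm (abs B * (case x of (t, y) => b' (t - y) * h' y))"
  proof (rule AE_I2)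
   fix x :: "real \<times> real"
   obtain s z where x: "x = (s, z)" using surj_pair[of x] by blast
   have "abs (F s z) = indicator {0..t} s * abs (A (t - s))*(indicator {0..s} z * abs (b' (s - z) * h' z))" by (simp add: F_def abs_mult)
   also have "... <= (1*abs B)*(1*abs (b' (s - z) * h' z))"
    using Ab by (intro mult_mono) (auto simp: indicator_def)
   finally show "norm (case x of (s, z) => F s z) <= norm (abs B * (case x of (t, y) => b' (t - y) * h' y))"
    unfolding x by (simp add: abs_mult)
  qed
 qed
 have e1: "(LBINT z. F s z) = indicator {0..t} s *\<^sub>R (a (t - s) * conv b h s)" for s
 proof (cases "s : {0..t}")
  case True
  hence "A (t - s) = a (t - s)" using t by (auto simp: A_def)
  moreover have "(LBINT z. indicator {0..s} z * (b' (s - z) * h' z)) = conv b h s"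
   unfolding conv_def LB_def by (rule Bochner_Integration.integral_cong) (use True t in "auto simp: indicator_def b'_def h'_def")
  ultimately show ?thesis using True by (simp add: F_def)
 qed (simp add: F_def)
 have e2: "(LBINT s. F s z) = indicator {0..t} z *\<^sub>R (conv a b (t - z) * h z)" for z
 proof (cases "z : {0..t}")
  case True
  have "(LBINT s. F s z) = (LBINT r. F (z + 1*r) z)"
   using lborel_integral_real_affine[of 1 "%s. F s z" z] by simp
  also have "... = (LBINT r. (indicator {0..t-z} r * (a (t - z - r) * b r)) * h z)"
  proof (rule Bochner_Integration.integral_cong[OF refl])
   fix r :: real
   show "F (z + 1*r) z = (indicator {0..t-z} r * (a (t - z - r) * b r)) * h z"
    using True t by (auto simp: F_def indicator_def A_def b'_def h'_def algebra_simps)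
  qed
  also have "... = conv a b (t - z) * h z"
   unfolding conv_def LB_def by simp
  finally show ?thesis using True by simp
 next
  case False
  hence "F s z = 0" for s by (auto simp: F_def indicator_def)
  thus ?thesis using False by simp
 qed
 have "(LBINT z. LBINT s. F s z) = (LBINT s. LBINT z. F s z)" by (rule lborel_pair.Fubini_integral[OF FI])
 thus "conv a (conv b h) t = conv (conv a b) h t"
  unfolding e1 e2 by (simp add: conv_def LB_def)
 show "SI {0..t} (%s. a (t - s) * conv b h s)"
  using lborel_pair.integrable_fst'[OF FI] unfolding SI_def e1[symmetric] by simp
qed

lemma set_integrable_conv:
 fixes b h :: "real => real"
 assumes "SI {0..M} b" "SI {0..M} h"
 shows "SI {0..M} (conv b h)"
proof -
 have "SI {0..M} (%s. (%_. 1) (M - s) * conv b h s)" by (rule conv_assoc(2)[where B = 1 and M = M]) (use assms in "auto simp: SM_def")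
 thus ?thesis by simp
qed

text \<open>Since \<open>ph\<close> vanishes on the negative axis, the variable upper limit can be
  replaced by \<open>M\<close>, and dominated convergence works on a fixed domain.\<close>

lemma continuous_on_conv:
 fixes ph h :: "real => real"
 assumes ph: "continuous_on UNIV ph" "!!x. x <= 0 ==> ph x = 0" and h: "SI {0..M} h"
 shows "continuous_on {0..M} (conv ph h)"
proof -
 have "bounded (ph ` {-M..M})" by (intro compact_imp_bounded compact_continuous_image continuous_on_subset[OF ph(1)]) auto
 then obtain B where "ALL x:ph ` {-M..M}. norm x <= B" unfolding bounded_iff by blast
 hence B: "abs (ph x) <= B" if "x : {-M..M}" for x using that by simp
 have [measurable]: "ph : borel_measurable borel" by (rule borel_measurable_continuous_onI[OF ph(1)])
 define h' where "h' x = indicator {0..M} x * h x" for x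
 have hi: "integrable lborel h'" using h by (simp add: SI_def h'_def[abs_def])
 hence [measurable]: "h' : borel_measurable borel" by (simp add: borel_measurable_integrable)
 have e: "conv ph h t = (LBINT s. ph (t - s) * h' s)" if "t : {0..M}" for t
  unfolding conv_def LB_def by (rule Bochner_Integration.integral_cong) (use that ph(2) in "auto simp: indicator_def h'_def")
 show ?thesis
  unfolding continuous_on_sequentially
 proof (intro allI impI ballI, elim conjE)
  fix x :: "nat => real" and c assume c: "c : {0..M}" and x: "ALL n. x n : {0..M}" "x \<longlonglongrightarrow> c"
  have "(%n. LBINT s. ph (x n - s) * h' s) \<longlonglongrightarrow> (LBINT s. ph (c - s) * h' s)"
  proof (rule integral_dominated_convergence[where w = "%s. B*abs (h' s)"])
   show "integrable lborel (%s. B*abs (h' s))" using hi by (intro integrable_mult_right integrable_abs)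
   show "AE s in lborel. (%n. ph (x n - s) * h' s) \<longlonglongrightarrow> ph (c - s) * h' s"
   proof (intro AE_I2 tendsto_mult tendsto_const)
    fix s
    have "isCont ph (c - s)" using ph(1) by (simp add: continuous_on_eq_continuous_at)
    moreover have "(%n. x n - s) \<longlonglongrightarrow> c - s" by (intro tendsto_intros x(2))
    ultimately show "(%n. ph (x n - s)) \<longlonglongrightarrow> ph (c - s)" by (rule isCont_tendsto_compose)
   qed
   show "AE s in lborel. norm (ph (x n - s) * h' s) <= B*abs (h' s)" for n
   proof (rule AE_I2)
    fix s
    show "norm (ph (x n - s) * h' s) <= B*abs (h' s)"
    proof (cases "s : {0..M}")
     case True
     hence "abs (ph (x n - s)) <= B" using x(1)[rule_format, of n] by (intro B) auto
     thus ?thesis by (simp add: abs_mult mult_right_mono)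
    qed (simp add: h'_def)
   qed
  qed measurable
  thus "(conv ph h \<circ> x) \<longlonglongrightarrow> conv ph h c" using e c x(1) by (simp add: o_def)
 qed
qed

text \<open>The semigroup law of fractional integration; scaling to \<open>[0, 1]\<close> exposes
  the Beta integral.\<close>

lemma conv_jf:
 assumes p: "p > 0" and q: "q > 0"
 shows "conv (jf p) (jf q) t = jf (p + q) t"
proof (cases "t <= 0")
 case True
 hence "indicator {0..t} s *\<^sub>R (jf p (t - s) * jf q s) = 0" for s by (auto simp: jf_def indicator_def)
 hence "conv (jf p) (jf q) t = 0" unfolding conv_def LB_def by (simp only: integral_zero)
 thus ?thesis using True by (simp add: jf_def[of "p + q"])
next
 case False
 hence t: "t > 0" by simp
 let ?f = "%x::real. x powr (q - 1)*(1 - x) powr (p - 1)"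
 have B: "(?f has_integral Beta q p) {0..1}" by (rule has_integral_Beta_real[OF q p])
 have m: "SM {0..1} ?f" unfolding SM_def by measurable
 have I: "SI {0..1} ?f" "(LBINT x:{0..1}. ?f x) = Beta q p"
  using SI_nonneg[OF B _ m] by auto
 have "conv (jf p) (jf q) t = t *\<^sub>R (LBINT x. indicator {0..t} (0 + t*x)*(jf p (t - (0 + t*x)) * jf q (0 + t*x)))"
  unfolding conv_def LB_def by (subst lborel_integral_real_affine[of t _ 0]) (use t in simp_all)
 also have "(LBINT x. indicator {0..t} (0 + t*x)*(jf p (t - (0 + t*x)) * jf q (0 + t*x)))
  = (LBINT x. (t powr (p - 1) * t powr (q - 1) / (Gamma p * Gamma q))*(indicator {0..1} x * ?f x))"
 proof (rule Bochner_Integration.integral_cong[OF refl])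
  fix x :: real
  have i: "indicator {0..t} (0 + t*x) = (indicator {0..1} x :: real)" using t by (auto simp: indicator_def zero_le_mult_iff mult_le_cancel_left2)
  have "jf p (t - (0 + t*x)) * jf q (0 + t*x) = (t powr (p - 1) * t powr (q - 1) / (Gamma p * Gamma q)) * ?f x" if x: "x : {0..1}"
  proof (cases "x = 0 \<or> x = 1")
   case True thus ?thesis by (auto simp: jf_def)
  next
   case False
   hence x': "0 < x" "x < 1" using x by auto
   have e: "t - (0 + t*x) = t*(1 - x)" by (simp add: algebra_simps)
   show ?thesis unfolding e jf_def using t x' by (simp add: powr_mult mult_le_0_iff)
  qed
  thus "indicator {0..t} (0 + t*x)*(jf p (t - (0 + t*x)) * jf q (0 + t*x)) = (t powr (p - 1) * t powr (q - 1) / (Gamma p * Gamma q))*(indicator {0..1} x * ?f x)"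
   unfolding i by (auto simp: indicator_def)
 qed
 also have "... = (t powr (p - 1) * t powr (q - 1) / (Gamma p * Gamma q)) * Beta q p"
  using I(2) by (simp add: LB_def)
 also have "t *\<^sub>R ... = (t*t powr (p - 1) * t powr (q - 1)) / Gamma (p + q)"
 proof -
  have "Gamma p ~= 0" "Gamma q ~= 0" using Gamma_real_pos[OF p] Gamma_real_pos[OF q] by linarith+
  thus ?thesis by (simp add: Beta_def add.commute)
 qed
 also have "t*t powr (p - 1) * t powr (q - 1) = t powr (p + q - 1)"
 proof -
  have "t powr 1 * t powr (p - 1) * t powr (q - 1) = t powr (1 + (p - 1) + (q - 1))" by (simp only: powr_add)
  thus ?thesis using t by (simp add: algebra_simps)
 qed
 finally show ?thesis using t by (simp add: jf_def[of "p + q"])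
qed

section \<open>Uniqueness of the Laplace transform and elementary estimates\<close>

text \<open>Under \<open>x = exp (- t)\<close> the values of the transform at integers become the
  moments of \<open>ph x = x * H (- ln x)\<close>, which the hypothesis \<open>lim\<close> makes
  continuous at \<open>0\<close>. Weierstrass approximation then shows that \<open>ph^2\<close> has
  integral zero. The factor \<open>x\<close> together with the Jacobian accounts for the integers
  starting at 2.\<close>

lemma Lerch:
 fixes H :: "real => real"
 assumes c: "continuous_on {0..} H" and lim: "((%t. exp (- t) * H t) \<longlongrightarrow> 0) at_top"
  and i: "!!n. n >= 2 ==> SI {0<..} (%t. exp (- (real n * t)) * H t)"
  and z: "!!n. n >= 2 ==> (LBINT t:{0<..}. exp (- (real n * t)) * H t) = 0"
  and t: "t >= 0"
 shows "H t = 0"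
proof -
 let ?A = "%t::real. exp (- t)"
 define ph where "ph x = (if x <= 0 then 0 else x * H (- ln x))" for x :: real
 have cph: "continuous_on {0..1} ph"
  unfolding continuous_on_eq_continuous_within
 proof
  fix x :: real assume x: "x : {0..1}"
  show "continuous (at x within {0..1}) ph"
  proof (cases "x = 0")
   case True
   have "((%x. exp (- (- ln x)) * H (- ln x)) \<longlongrightarrow> 0) (at_right 0)" by (rule filterlim_compose[OF lim]) real_asymp
   hence "(ph \<longlongrightarrow> 0) (at_right 0)" by (rule Lim_transform_eventually) (auto simp: eventually_at_right_field ph_def intro!: exI[of _ 1])
   hence "(ph \<longlongrightarrow> 0) (at 0 within {0..1})" by (simp add: at_within_Icc_at_right)
   thus ?thesis using True by (simp add: continuous_within ph_def)
  next
   case False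
   hence x0: "x > 0" "x <= 1" using x by auto
   have "continuous_on {0<..1} (%x. x*H (- ln x))" by (intro continuous_intros continuous_on_compose2[OF c]) auto
   hence "continuous_on {0<..1} ph" by (rule continuous_on_eq) (auto simp: ph_def)
   hence "continuous (at x within {0<..1}) ph" using x0 by (auto simp: continuous_on_eq_continuous_within)
   moreover have "at x within {0<..1} = at x within {0..1}" by (rule at_within_nhd[of _ "{0<..}"]) (use x0 in auto)
   ultimately show ?thesis by (simp add: continuous_within)
  qed
 qed
 have mom: "((%x. x ^ k * ph x) has_integral 0) {0..1}" for k
 proof -
  let ?f = "%x. x ^ k * (x*H (- ln x))"
  have img: "?A ` {0<..} = {0<..<1}"
  proof (intro equalityI subsetI)
   fix x :: real assume "x : {0<..<1}"
   thus "x : ?A ` {0<..}" by (intro image_eqI[of _ _ "- ln x"]) auto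
  qed auto
  have e: "abs (- exp (- t)) * ?f (exp (- t)) = exp (- (real (k + 2) * t)) * H t" for t :: real
  proof -
   have "exp (- (real (k + 2) * t)) = exp (- t) ^ k * exp (- t) * exp (- t)" by (simp add: algebra_simps flip: exp_add exp_of_nat_mult)
   thus ?thesis by simp
  qed
  have cf: "continuous_on {0..1} (%x. x ^ k * ph x)" by (intro continuous_intros cph)
  hence ab: "(%x. x ^ k * ph x) absolutely_integrable_on {0..1}" by (rule absolutely_integrable_continuous_real)
  have hi: "((%x. x ^ k * ph x) has_integral integral {0..1} (%x. x ^ k * ph x)) {0..1}"
   using integrable_continuous_real[OF cf] by (rule integrable_integral)
  have cf': "continuous_on {0<..<1} ?f" by (intro continuous_intros continuous_on_compose2[OF c]) auto
  have sb: "SM {0<..<1} ?f" by (rule SM_cont[OF cf']) simp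
  have "(%x. x ^ k * ph x) absolutely_integrable_on {0<..<1}" by (rule SI_subset[OF ab]) auto
  hence "?f absolutely_integrable_on {0<..<1}" by (rule absolutely_integrable_spike[of _ _ "{}"]) (auto simp: ph_def)
  hence si: "SI {0<..<1} ?f"
   using sb by (simp add: SI_def SM_def integrable_completion)
  have m: "SM {0<..} (%t. abs (- exp (- t)) * ?f (exp (- t)))"
   unfolding e using i[of "k + 2"] by (simp add: SI_def SM_def)
  have der: "(?A has_field_derivative - exp (- x)) (at x)" for x :: real by (auto intro!: derivative_eq_intros)
  have inj: "inj_on ?A {0<..}" by (auto intro: inj_onI)
  have b: "{0::real<..} : sets borel" "?A ` {0<..} : sets borel" by (simp, simp add: img)
  have si': "SI (?A ` {0<..}) ?f" using si img by simp
  have "(LBINT x:{0<..<1}. ?f x) = (LBINT t:{0<..}. exp (- (real (k + 2) * t)) * H t)"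
   using LB_subst(2)[OF b der inj si' m] unfolding img e .
  also have "... = 0" by (rule z) simp
  finally have 0: "(LBINT x:{0<..<1}. ?f x) = 0" .
  have "integral {0<..<1} ?f = 0" using SI_HK(2)[OF si] 0 by simp
  hence "(?f has_integral 0) {0<..<1}" using SI_HK(1)[OF si] by (metis has_integral_integral)
  hence "((%x. x ^ k * ph x) has_integral 0) {0<..<1}" by (rule has_integral_eq[rotated]) (auto simp: ph_def)
  thus ?thesis by (simp add: has_integral_Icc_iff_Ioo)
 qed
 have poly: "((%x. p x * ph x) has_integral 0) {0..1}" if rp: "real_polynomial_function p" for p
 proof -
  obtain a n where p: "p = (%x. SUM i<=n. a i * x ^ i)" using rp by (auto simp: real_polynomial_function_iff_sum)
  have "((%x. SUM i<=n. a i * (x ^ i * ph x)) has_integral (SUM i<=n. a i * 0)) {0..1}" by (intro has_integral_sum has_integral_mult_right mom) auto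
  thus ?thesis by (simp add: p sum_distrib_right mult.assoc)
 qed
 have cs: "continuous_on {0..1} (%x. ph x * ph x)" by (intro continuous_intros cph)
 define I where "I = integral {0..1} (%x. ph x * ph x)"
 have I: "((%x. ph x * ph x) has_integral I) {0..1}" unfolding I_def by (rule integrable_integral[OF integrable_continuous_real[OF cs]])
 have I0: "I >= 0" by (rule has_integral_nonneg[OF I]) simp
 obtain B where B: "!!x. x : {0..1} ==> abs (ph x) <= B" "B > 0"
 proof -
  have "bounded (ph ` {0..1})" by (intro compact_imp_bounded compact_continuous_image cph) auto
  then obtain b where "ALL x:ph ` {0..1}. norm x <= b" "b > 0" unfolding bounded_pos by auto
  thus ?thesis using that by force
 qed
 have "I <= B*e" if e: "e > 0" for e
 proof -
  obtain p where p: "polynomial_function p" "!!x. x : {0..1} ==> norm (ph x - p x) < e"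
   using Stone_Weierstrass_polynomial_function[OF compact_Icc cph e] by blast
  have "real_polynomial_function p" using p(1) by (simp add: real_polynomial_function_eq)
  hence "((%x. ph x * ph x - p x * ph x) has_integral (I - 0)) {0..1}" by (intro has_integral_diff I poly)
  moreover have "((%x::real. B*e) has_integral (1 - 0) *\<^sub>R (B*e)) {0..1}"
   using has_integral_const_real[of "B*e" 0 1] by simp
  ultimately have "I - 0 <= (1 - 0) *\<^sub>R (B*e)"
  proof (rule has_integral_le)
   fix x :: real assume x: "x : {0..1}"
   have "ph x * ph x - p x * ph x = (ph x - p x) * ph x" by (simp add: algebra_simps)
   also have "... <= abs (ph x - p x) * abs (ph x)" by (simp flip: abs_mult)
   also have "... <= e*B" using p(2)[OF x] B(1)[OF x] e by (intro mult_mono) auto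
   finally show "ph x * ph x - p x * ph x <= B*e" by (simp add: mult.commute)
  qed
  thus ?thesis by simp
 qed
 hence "I <= 0 + e" if "e > 0" for e
  using that B(2) by (metis add_0 divide_pos_pos nonzero_mult_div_cancel_left order_less_irrefl times_divide_eq_right)
 hence I_0: "I = 0" using I0 field_le_epsilon[of I 0] by force
 have "ph x * ph x = 0" if "x : {0..1}" for x
 proof (rule has_integral_0_cbox_imp_0[of 0 1 "%x. ph x * ph x"])
  show "((%x. ph x * ph x) has_integral 0) (cbox 0 1)" using I I_0 by simp
 qed (use cs that in auto)
 from this[of "exp (- t)"] t show "H t = 0" by (simp add: ph_def)
qed

lemma set_integral_split:
 fixes f :: "real => real"
 assumes "SI {a..b} f" "a <= m" "m <= b"
 shows "(LBINT y:{a..b}. f y) = (LBINT y:{a..m}. f y) + (LBINT y:{m..b}. f y)"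
proof -
 have i: "SI {a..m} f" "SI {m..b} f" by (rule SI_subset[OF assms(1)]; use assms(2,3) in auto)+
 show ?thesis
  unfolding SI_HK(2)[OF assms(1)] SI_HK(2)[OF i(1)] SI_HK(2)[OF i(2)] by (rule Henstock_Kurzweil_Integration.integral_combine[OF assms(2,3) SI_HK(1)[OF assms(1)], symmetric])
qed

lemma set_integral_shift:
 fixes f :: "real => real"
 shows "(LBINT y:{a..b}. f y) = (LBINT y:{a + l..b + l}. f (y - l))"
proof -
 have "(LBINT y:{a..b}. f y) = (LBINT y. indicator {a..b} (- l + 1*y) *\<^sub>R f (- l + 1*y))"
  unfolding LB_def by (subst lborel_integral_real_affine[of 1 _ "- l"]) simp_all
 also have "... = (LBINT y:{a + l..b + l}. f (y - l))"
  unfolding LB_def by (rule Bochner_Integration.integral_cong[OF refl]) (auto simp: indicator_def)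
 finally show ?thesis .
qed

lemma jf_reflect:
 assumes q: "q > 0" and "a <= c"
 shows "SI {a..b} (%y. jf q (c - y))" "(LBINT y:{a..b}. jf q (c - y)) <= jf (q + 1) (c - a)"
proof -
 let ?f = "%x. indicator {0..c - a} x *\<^sub>R jf q x"
 have f: "integrable lborel ?f" "(LBINT x. ?f x) = jf (q + 1) (c - a)"
  using jf_integral[OF q, of "c - a"] assms by (simp_all add: SI_def LB_def)
 have g: "integrable lborel (%y. ?f (c + (- 1) * y))" by (rule lborel_integrable_real_affine[OF f(1)]) simp
 have e: "indicator {a..b} y *\<^sub>R jf q (c - y) = indicator {a..b} y *\<^sub>R ?f (c + (- 1) * y)" for y by (auto simp: indicator_def jf_def)
 show i: "SI {a..b} (%y. jf q (c - y))"
  unfolding SI_def e by (rule integrable_mult_indicator[OF _ g]) simp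
 have "(LBINT y:{a..b}. jf q (c - y)) <= (LBINT y. ?f (c + (- 1) * y))"
  unfolding LB_def
 proof (rule integral_mono[OF i[unfolded SI_def] g])
  show "indicator {a..b} y *\<^sub>R jf q (c - y) <= ?f (c + (- 1) * y)" for y
   unfolding e using jf_nonneg[OF q] by (auto simp: indicator_def)
 qed
 also have "... = (LBINT x. ?f x)" using lborel_integral_real_affine[of "- 1" ?f c] by simp
 finally show "(LBINT y:{a..b}. jf q (c - y)) <= jf (q + 1) (c - a)" unfolding f(2) .
qed

text \<open>The window may reach beyond \<open>c\<close>, where the kernel vanishes, so the bound
  depends only on the distance \<open>c - a\<close>.\<close>

lemma jf_window:
 assumes q: "q > 0" and ac: "a <= c" and g: "continuous_on {a..b} g"
 shows "SI {a..b} (%y. jf q (c - y) * g y)"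
  "(!!y. y : {a..b} ==> abs (g y) <= B) ==> 0 <= B ==> abs (LBINT y:{a..b}. jf q (c - y) * g y) <= B*jf (q + 1) (c - a)"
proof -
 have "bounded (g ` {a..b})" by (intro compact_imp_bounded compact_continuous_image g) auto
 then obtain M where M: "!!y. y : {a..b} ==> abs (g y) <= M" unfolding bounded_iff by force
 note J = jf_reflect[OF q ac, of b]
 have m: "SM {a..b} (%y. jf q (c - y) * g y)"
 proof -
  have "SM {a..b} g" by (rule SM_cont[OF g]) simp
  hence "(%y. jf q (c - y)*(indicator {a..b} y *\<^sub>R g y)) : borel_measurable lborel"
   unfolding SM_def by measurable
  thus ?thesis unfolding SM_def by (simp add: mult_ac)
 qed
 show i: "SI {a..b} (%y. jf q (c - y) * g y)"
 proof (rule SI_bound[OF set_integrable_mult_left[of M, OF J(1)] m], intro AE_I2 impI)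
  fix y assume "y : {a..b}"
  hence "abs (g y) <= abs M" using M[of y] by linarith
  thus "norm (jf q (c - y) * g y) <= norm (jf q (c - y) * M)" by (simp add: abs_mult mult_left_mono)
 qed
 assume B: "!!y. y : {a..b} ==> abs (g y) <= B" "0 <= B"
 have "abs (LBINT y:{a..b}. jf q (c - y) * g y) <= (LBINT y:{a..b}. abs (jf q (c - y) * g y))"
  using set_integral_norm_bound[OF i] by simp
 also have "... <= (LBINT y:{a..b}. jf q (c - y) * B)"
  using jf_nonneg[OF q] B(1) by (intro set_integral_mono set_integrable_abs i set_integrable_mult_left J(1)) (auto simp: abs_mult intro!: mult_left_mono)
 also have "... <= jf (q + 1) (c - a) * B" unfolding set_integral_mult_left using J(2) B(2) by (rule mult_right_mono)
 finally show "abs (LBINT y:{a..b}. jf q (c - y) * g y) <= B*jf (q + 1) (c - a)" by (simp add: mult.commute)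
qed

lemma conv_Laplace:
 fixes b h :: "real => real"
 assumes b: "SI {0<..} (%t. exp (- (s*t)) * b t)" and h: "SI {0<..} (%t. exp (- (s*t)) * h t)"
  and 0: "!!x. x <= 0 ==> b x = 0" "!!x. x <= 0 ==> h x = 0"
 shows "SI {0<..} (%t. exp (- (s*t)) * conv b h t)"
  "(LBINT t:{0<..}. exp (- (s*t)) * conv b h t) = (LBINT t:{0<..}. exp (- (s*t)) * b t)*(LBINT t:{0<..}. exp (- (s*t)) * h t)"
proof -
 let ?b = "%t. indicator {0<..} t *\<^sub>R (exp (- (s*t)) * b t)" and ?h = "%t. indicator {0<..} t *\<^sub>R (exp (- (s*t)) * h t)"
 have e: "(LBINT y. ?b (t - y) * ?h y) = indicator {0<..} t *\<^sub>R (exp (- (s*t)) * conv b h t)" for t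
 proof -
  have "?b (t - y) * ?h y = indicator {0<..} t * exp (- (s*t))*(indicator {0..t} y * (b (t - y) * h y))" for y
  proof (cases "0 < y & y < t")
   case True
   hence "exp (- (s*(t - y))) * exp (- (s*y)) = exp (- (s*t))" by (simp add: algebra_simps flip: exp_add)
   thus ?thesis using True by (simp add: mult_ac)
  next
   case False
   thus ?thesis using 0(1)[of "t - y"] 0(2)[of y] by (auto simp: indicator_def)
  qed
  hence "(LBINT y. ?b (t - y) * ?h y) = (LBINT y. indicator {0<..} t * exp (- (s*t))*(indicator {0..t} y * (b (t - y) * h y)))" by (simp only:)
  thus ?thesis by (simp add: conv_def LB_def)
 qed
 note lm = line_convolution[OF b[unfolded SI_def] h[unfolded SI_def]]
 show "SI {0<..} (%t. exp (- (s*t)) * conv b h t)"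
  using lm(2) unfolding e SI_def .
 show "(LBINT t:{0<..}. exp (- (s*t)) * conv b h t) = (LBINT t:{0<..}. exp (- (s*t)) * b t)*(LBINT t:{0<..}. exp (- (s*t)) * h t)"
  using lm(3) unfolding e LB_def .
qed

lemma jf_Laplace:
 assumes "q > 0" "s > 0"
 shows "SI {0<..} (%t. exp (- (s*t)) * jf q t)" "(LBINT t:{0<..}. exp (- (s*t)) * jf q t) = s powr (- q)"
proof -
 have G: "Gamma q > 0" using assms by simp
 have e: "indicator {0<..} t *\<^sub>R (exp (- (s*t)) * jf q t) = indicator {0<..} t *\<^sub>R (1 / Gamma q * (t powr (q - 1) * exp (- (t * s))))" for t by (auto simp: jf_def indicator_def mult.commute)
 show "SI {0<..} (%t. exp (- (s*t)) * jf q t)"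
  using SI_mult[of "1 / Gamma q", OF scaled_Gamma_integral(1)[OF assms]] unfolding SI_def e .
 show "(LBINT t:{0<..}. exp (- (s*t)) * jf q t) = s powr (- q)"
  using scaled_Gamma_integral(2)[OF assms] G unfolding LB_def e by (simp add: powr_minus_divide LB_def mult.left_commute[of "indicator _ _"])
qed

text \<open>On \<open>[t/2, t]\<close> a power is controlled by its value at \<open>t\<close>; the
  constant \<open>2 powr abs p\<close> serves both signs of the exponent.\<close>

lemma powr_half_le:
 fixes t x p :: real
 assumes "0 < t" "t/2 <= x" "x <= t"
 shows "x powr p <= 2 powr abs p * t powr p"
proof (cases "p >= 0")
 case True
 have "x powr p <= t powr p" using assms True by (intro powr_mono2) auto
 also have "... <= 2 powr abs p * t powr p" using mult_right_mono[of 1 "2 powr abs p" "t powr p"] True by (simp add: ge_one_powr_ge_zero)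
 finally show ?thesis .
next
 case False
 have "x powr p <= (t/2) powr p" using assms False by (intro powr_mono2') auto
 also have "... = 2 powr abs p * t powr p" using assms False powr_minus_divide[of 2 p] by (simp add: powr_divide)
 finally show ?thesis .
qed

text \<open>The coefficients sum to zero, so the combination is
  \<open>3/2 (a - b) - 1/2 (b - c)\<close> for consecutive values \<open>a\<close>,
  \<open>b\<close>, \<open>c\<close>, and the mean value theorem gains one power.\<close>

lemma bdf2_powr_bound:
 fixes s p :: real
 assumes s: "s > 2" and p: "p > 0"
 shows "abs (3/2 * s powr (-p) - 2*(s - 1) powr (-p) + 1/2*(s - 2) powr (-p)) <= 2*p*(s - 2) powr (-p - 1)"
proof -
 have *: "abs ((x + 1) powr (-p) - x powr (-p)) <= p*(s - 2) powr (-p - 1)" if x: "x >= s - 2" for x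
 proof -
  have "EX z>x. z < x + 1 & (x + 1) powr (-p) - x powr (-p) = (x + 1 - x)*(- p*z powr (- p - 1))"
   using x s by (intro MVT2) (auto intro!: derivative_eq_intros)
  then obtain z where z: "z > x" "(x + 1) powr (-p) - x powr (-p) = (x + 1 - x)*(- p*z powr (- p - 1))" by blast
  have "abs ((x + 1) powr (-p) - x powr (-p)) = p*z powr (- p - 1)" using z p by (simp add: abs_mult abs_minus_cancel)
  also have "... <= p*(s - 2) powr (-p - 1)" using p z x s by (intro mult_left_mono powr_mono2') auto
  finally show ?thesis .
 qed
 have "abs (3/2*a - 2*b + 1/2*c) <= 2*p*d" if "abs (a - b) <= p*d" "abs (b - c) <= p*d" for a b c d :: real
  using that by (simp add: abs_le_iff)
 from this[of "s powr (-p)" "(s - 1) powr (-p)" "(s - 2) powr (-p - 1)" "(s - 2) powr (-p)"] show ?thesis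
  using *[of "s - 1"] *[of "s - 2"] by (simp add: mult.assoc)
qed

text \<open>The error of the linear function through the values of \<open>exp (s*y)\<close> at
  \<open>s = 0\<close> and \<open>s = 1\<close>; both pieces of the proof are second-order Taylor
  remainders.\<close>

lemma exp_second_order: "abs (exp (s*y) - 1 - s*(exp y - 1)) <= 2*y\<^sup>2*exp (2*y)" if y: "y > 0" and s: "0 <= s" "s <= 2" for s y :: real
proof -
 have R: "0 <= exp x - 1 - x & exp x - 1 - x <= x\<^sup>2/2*exp x" if x: "x >= 0" for x :: real
 proof -
  obtain t where t: "abs t <= abs x" "exp x = (\<Sum>m<2. x ^ m / fact m) + exp t / fact 2 * x ^ 2" using Maclaurin_exp_le[of x 2] by blast
  have "exp x = 1 + x + exp t/2*x\<^sup>2" using t(2) by (simp add: numeral_2_eq_2)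
  moreover have "exp t/2*x\<^sup>2 <= exp x/2*x\<^sup>2" using t(1) x by (intro mult_right_mono divide_right_mono) auto
  moreover have "0 <= exp t/2*x\<^sup>2" by simp
  ultimately show ?thesis by (simp add: mult.commute)
 qed
 have 1: "0 <= exp (s*y) - 1 - s*y" "exp (s*y) - 1 - s*y <= 2*y\<^sup>2*exp (2*y)"
 proof -
  have "(s*y)\<^sup>2/2*exp (s*y) <= (2*y)\<^sup>2/2*exp (2*y)"
   using s y by (intro mult_mono divide_right_mono power_mono) auto
  also have "... = 2*y\<^sup>2*exp (2*y)" by (simp add: power_mult_distrib)
  finally show "exp (s*y) - 1 - s*y <= 2*y\<^sup>2*exp (2*y)" using R[of "s*y"] s y by (meson mult_nonneg_nonneg less_imp_le order_trans)
 qed (use R[of "s*y"] s y in simp)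
 have 2: "0 <= s*(exp y - 1 - y)" "s*(exp y - 1 - y) <= 2*y\<^sup>2*exp (2*y)"
 proof -
  have "s*(exp y - 1 - y) <= 2*(y\<^sup>2/2*exp y)" using R[of y] s y by (intro mult_mono) auto
  also have "... <= 2*y\<^sup>2*exp (2*y)" using y by (simp add: mult_mono)
  finally show "s*(exp y - 1 - y) <= 2*y\<^sup>2*exp (2*y)" .
 qed (use R[of y] s y in simp)
 have "exp (s*y) - 1 - s*(exp y - 1) = (exp (s*y) - 1 - s*y) - s*(exp y - 1 - y)" by (simp add: algebra_simps)
 thus ?thesis using 1 2 by linarith
qed

section \<open>Error for power sources\<close>

context fractional_order
begin

text \<open>The fractional equation with source 1, integrated once:
  \<open>conv (jf (1 - al)) (vx L)\<close> is the primitive of the Caputo derivative of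
  \<open>vx L\<close>. On transforms it reads
  \<open>(s powr al + L) / (s^2 * (s powr al + L)) = 1 / s^2\<close>; \<open>Lerch\<close> returns
  to time, since all terms grow at most linearly.\<close>

lemma vx_jf_conv:
 assumes L: "L > 0" and t: "t >= 0"
 shows "conv (jf (1 - al)) (vx L) t = jf 2 t - L*conv (jf 1) (vx L) t"
proof -
 have q: "1 - al > 0" "(1::real) > 0" "(2::real) > 0" using al by auto
 have v0: "vx L x = 0" if "x <= 0" for x using that by (simp add: vx_def)
 have j0: "jf q x = 0" if "x <= 0" for x q using that by (simp add: jf_def)
 note cv = continuous_on_vx[OF L]
 let ?H = "%t. conv (jf (1 - al)) (vx L) t + L*conv (jf 1) (vx L) t - jf 2 t"
 have b: "abs (conv (jf q) (vx L) t) <= 1 / L*jf (q + 1) t" if "q > 0" "t >= 0" for q t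
  using jf_window(2)[OF that continuous_on_subset[OF cv], of t "1 / L"] vx_bounds(1,2)[OF L] L unfolding conv_def by (simp add: abs_le_iff)
 have "?H t = 0"
 proof (rule Lerch[OF _ _ _ _ t])
  have c: "continuous_on {0..} (conv (jf q) (vx L))" if "q > 0" for q
   unfolding continuous_on_eq_continuous_within
  proof
   fix x :: real assume "x : {0..}"
   hence x: "x >= 0" by simp
   have "continuous_on {0..x + 1} (conv (vx L) (jf q))" by (rule continuous_on_conv[OF cv v0 jf_integral(1)[OF that]]) (use x in auto)
   hence "continuous_on {0..x + 1} (conv (jf q) (vx L))" by (subst conv_commute[abs_def])
   hence "continuous (at x within {0..x + 1}) (conv (jf q) (vx L))" using x by (simp add: continuous_on_eq_continuous_within)
   moreover have "at x within {0..x + 1} = at x within {0..}" by (rule at_within_nhd[of x "{..<x + 1}"]) auto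
   ultimately show "continuous (at x within {0..}) (conv (jf q) (vx L))" by simp
  qed
  have "continuous_on {0..} (jf 2)" by (rule continuous_on_eq[of _ "%x. x"]) (auto simp: jf_def Gamma_numeral)
  thus "continuous_on {0..} ?H" by (intro continuous_intros c q)
  have "((%t. exp (- t)*(1 / L*jf (1 - al + 1) t + L*(1 / L*jf (1 + 1) t) + jf 2 t)) \<longlongrightarrow> 0) at_top"
  proof (rule Lim_transform_eventually)
   have "((%t. exp (- t) * t powr (1 - al)) \<longlongrightarrow> 0) at_top" "((%t::real. exp (- t) * t) \<longlongrightarrow> 0) at_top" by real_asymp+
   from tendsto_add[OF tendsto_mult[OF tendsto_const[of "1 / L / Gamma (2 - al)"] this(1)] tendsto_mult[OF tendsto_const[of 2] this(2)]]
   show "((%t. exp (- t)*(1 / L*(t powr (1 - al) / Gamma (2 - al)) + L*(1 / L*t) + t)) \<longlongrightarrow> 0) at_top"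
    using L by (simp add: algebra_simps)
   show "\<forall>\<^sub>F t in at_top. exp (- t)*(1 / L*(t powr (1 - al) / Gamma (2 - al)) + L*(1 / L*t) + t) = exp (- t)*(1 / L*jf (1 - al + 1) t + L*(1 / L*jf (1 + 1) t) + jf 2 t)"
    using eventually_gt_at_top[of 0] by eventually_elim (simp add: jf_def Gamma_numeral)
  qed
  thus "((%t. exp (- t) * ?H t) \<longlongrightarrow> 0) at_top"
  proof (rule Lim_null_comparison[rotated])
   show "\<forall>\<^sub>F t in at_top. norm (exp (- t) * ?H t) <= exp (- t)*(1 / L*jf (1 - al + 1) t + L*(1 / L*jf (1 + 1) t) + jf 2 t)"
    using eventually_ge_at_top[of 0]
   proof eventually_elim
    case (elim t)
    have "abs (L*conv (jf 1) (vx L) t) <= L*(1 / L*jf (1 + 1) t)"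
     unfolding abs_mult using b[OF q(2) elim] L by (simp add: mult_left_mono del: times_divide_eq_left)
    hence "abs (?H t) <= 1 / L*jf (1 - al + 1) t + L*(1 / L*jf (1 + 1) t) + jf 2 t"
     using b[OF q(1) elim] jf_nonneg[OF q(3), of t] by linarith
    thus ?case by (simp add: abs_mult del: times_divide_eq_left)
   qed
  qed
  fix n :: nat assume n: "n >= 2"
  hence n0: "real n > 0" by simp
  note C1 = conv_Laplace[OF jf_Laplace(1)[OF q(1) n0] vx_Laplace(1)[OF L n0] j0 v0]
  note C2 = conv_Laplace[OF jf_Laplace(1)[OF q(2) n0] vx_Laplace(1)[OF L n0] j0 v0]
  note C2' = SI_mult[of L, OF C2(1)]
  note S1 = LB_add[OF C1(1) C2']
  note S2 = LB_diff[OF S1(1) jf_Laplace(1)[OF q(3) n0]]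
  have e: "exp (- (real n * t)) * ?H t = exp (- (real n * t)) * conv (jf (1 - al)) (vx L) t + L*(exp (- (real n * t)) * conv (jf 1) (vx L) t) - exp (- (real n * t)) * jf 2 t" for t by (simp add: algebra_simps)
  show "SI {0<..} (%t. exp (- (real n * t)) * ?H t)" unfolding e by (rule S2(1))
  have "(LBINT t:{0<..}. exp (- (real n * t)) * ?H t) = real n powr (- (1 - al))*(1 / (real n * (real n powr al + L))) + L*(real n powr - 1*(1 / (real n * (real n powr al + L)))) - real n powr - 2"
   unfolding e using S2(2) S1(2) C1(2) C2(2) by (simp only: LB_mult jf_Laplace(2)[OF q(1) n0] jf_Laplace(2)[OF q(2) n0] jf_Laplace(2)[OF q(3) n0] vx_Laplace(2)[OF L n0])
  also have "... = 0"
  proof -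
   have p: "real n powr (- (1 - al)) = real n powr al / real n" "real n powr - 1 = 1 / real n" "real n powr - 2 = 1 / (real n * real n)"
    using n0 powr_diff[of "real n" al 1] by (simp_all add: powr_minus_divide powr_numeral power2_eq_square)
   have "real n powr al + L > 0" using L by (simp add: add_nonneg_pos)
   moreover have "A / r*(1 / (r*X)) + lm*(1 / r*(1 / (r*X))) - 1 / (r*r) = 0" if "X = A + lm" "X > 0" "r > 0" for A lm X r :: real
   proof -
    have "A / r*(1 / (r*X)) + lm*(1 / r*(1 / (r*X))) = (A + lm) / X / (r*r)" by (simp add: add_divide_distrib mult_ac)
    thus ?thesis using that by simp
   qed
   ultimately show ?thesis unfolding p using n0 by simp
  qed
  finally show "(LBINT t:{0<..}. exp (- (real n * t)) * ?H t) = 0" .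
 qed
 thus ?thesis by simp
qed

text \<open>Integration by parts replaces \<open>ex\<close> by \<open>ex_int\<close>, which decays
  thanks to the vanishing integral, at the cost of one derivative of \<open>ph\<close>. The
  singularity \<open>y powr (al - 1)\<close> at \<open>0\<close> is integrable and yields the factor
  \<open>1 / al\<close>.\<close>

lemma near_bound:
 assumes L: "L > 0" and K: "K > 0" "!!t. t > 0 ==> abs (ex_int L t) <= K*t powr (al - 1)" and h: "h > 0"
  and ph: "!!y. y : {0..h} ==> (ph has_real_derivative ph' y) (at y)" "continuous_on {0..h} ph'"
  and B: "abs (ph h) <= B0" "!!y. y : {0..h} ==> abs (ph' y) <= B1"
 shows "abs (LBINT y:{0..h}. ph y * ex L y) <= K*B0*h powr (al - 1) + K*B1 / al*h powr al"
proof -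
 have ce: "continuous_on {0..h} (ex L)" by (rule continuous_on_subset[OF continuous_on_ex[OF L]]) auto
 have S: "ex_int L y = integral {0..y} (ex L)" for y
  unfolding ex_int_def by (rule SI_HK(2)[OF SI_Icc])
   (rule continuous_on_subset[OF continuous_on_ex[OF L]], simp)
 have dS: "(ex_int L has_real_derivative ex L y) (at y within {0..h})" if "y : {0..h}" for y
  using integral_has_vector_derivative[OF ce that] unfolding S[abs_def] has_real_derivative_iff_has_vector_derivative .
 hence cS: "continuous_on {0..h} (ex_int L)" by (meson DERIV_continuous_on)
 have cph: "continuous_on {0..h} ph" using ph(1) by (meson DERIV_continuous_on has_field_derivative_at_within)
 have S0: "ex_int L 0 = 0" unfolding S by simp
 have "((%y. ph' y * ex_int L y + ex L y * ph y) has_integral (ph h * ex_int L h - ph 0 * ex_int L 0)) {0..h}"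
 proof (rule fundamental_theorem_of_calculus)
  show "((%y. ph y * ex_int L y) has_vector_derivative (ph' y * ex_int L y + ex L y * ph y)) (at y within {0..h})" if "y : {0..h}" for y
   unfolding has_real_derivative_iff_has_vector_derivative[symmetric] by (rule DERIV_mult[OF has_field_derivative_at_within[OF ph(1)[OF that]] dS[OF that]])
 qed (use h in simp)
 moreover have i: "(%y. ph' y * ex_int L y) integrable_on {0..h}" by (intro integrable_continuous_real continuous_intros ph(2) cS)
 ultimately have "((%y. ph' y * ex_int L y + ex L y * ph y - ph' y * ex_int L y) has_integral (ph h * ex_int L h - ph 0 * ex_int L 0 - integral {0..h} (%y. ph' y * ex_int L y))) {0..h}" by (intro has_integral_diff integrable_integral)
 hence "integral {0..h} (%y. ph y * ex L y) = ph h * ex_int L h - integral {0..h} (%y. ph' y * ex_int L y)" by (intro integral_unique) (simp add: S0 mult.commute)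
 moreover have "(LBINT y:{0..h}. ph y * ex L y) = integral {0..h} (%y. ph y * ex L y)" by (intro SI_HK(2) SI_Icc continuous_intros cph ce)
 moreover have "abs (ph h * ex_int L h) <= B0*(K*h powr (al - 1))"
  unfolding abs_mult using B(1) K(2)[OF h] by (intro mult_mono) auto
 moreover have "abs (integral {0..h} (%y. ph' y * ex_int L y)) <= K*B1*(h powr al / al)"
 proof -
  have p: "((%y. y powr (al - 1)) has_integral (h powr (al - 1 + 1) / (al - 1 + 1))) {0..h}" by (rule has_integral_powr_from_0) (use al h in auto)
  hence p': "((%y. K*B1*y powr (al - 1)) has_integral K * B1*(h powr al / al)) {0..h}" by (intro has_integral_mult_right) simp
  have "norm (integral {0..h} (%y. ph' y * ex_int L y)) <= integral {0..h} (%y. K*B1*y powr (al - 1))"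
  proof (rule integral_norm_bound_integral[OF i has_integral_integrable[OF p']])
   fix y assume y: "y : {0..h}"
   show "norm (ph' y * ex_int L y) <= K*B1*y powr (al - 1)"
   proof (cases "y = 0")
    case False
    hence "abs (ph' y) * abs (ex_int L y) <= B1*(K*y powr (al - 1))"
     using B(2)[OF y] K(2)[of y] y by (intro mult_mono) auto
    thus ?thesis by (simp add: abs_mult mult_ac)
   qed (simp add: S0)
  qed
  thus ?thesis unfolding integral_unique[OF p'] by simp
 qed
 ultimately show ?thesis by (simp add: mult_ac)
qed

lemma DERIV_jf: "x > 0 ==> (jf q has_real_derivative ((q - 1) * x powr (q - 2) / Gamma q)) (at x)"
proof -
 assume x: "x > 0"
 have "((%x. x powr (q - 1) / Gamma q) has_real_derivative ((q - 1) * x powr (q - 2) / Gamma q)) (at x)" by (rule DERIV_cdivide) (use x in "auto intro!: derivative_eq_intros")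
 moreover have "\<forall>\<^sub>F y in nhds x. jf q y = y powr (q - 1) / Gamma q"
  using eventually_nhds_in_open[of "{0<..}" x] x by (auto elim!: eventually_mono simp: jf_def)
 ultimately show ?thesis by (subst DERIV_cong_ev) auto
qed

text \<open>The integral is split at \<open>t/2\<close>. On the first half the kernel
  \<open>jf q (t - y)\<close> is smooth and \<open>near_bound\<close> applies; a mere bound for the
  integral of \<open>abs (ex L y)\<close> would give only \<open>t powr (q - 1)\<close>. On the
  second half the kernel may be singular, but there \<open>ex\<close> is already of size
  \<open>t powr (al - 2)\<close>.\<close>

lemma source_error_bound:
 assumes q: "q > 0"
 shows "EX C>0. ALL L>0. ALL t>0. abs (conv (jf q) (ex L) t) <= C*t powr (q + al - 2)"
proof -
 let ?A = "q - 1"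
 obtain K where K: "K > 0" "!!L y. L > 0 ==> y > 0 ==> abs (ex L y) <= K*y powr (al - 2)" using ex_decay by blast
 obtain K' where K': "K' > 0" "!!L y. L > 0 ==> y > 0 ==> abs (ex_int L y) <= K'*y powr (al - 1)" using ex_int_decay by blast
 have G: "Gamma q > 0" "Gamma (q + 1) > 0" using q by auto
 define c where "c p = 2 powr abs p" for p :: real
 have c: "c p > 0" "0 < t ==> t/2 <= x ==> x <= t ==> x powr p <= c p * t powr p" for p t x
  using powr_half_le[of t x p] by (auto simp: c_def)
 define C where "C = K'*(c ?A / Gamma q) * c (al - 1) + K'*(abs ?A * c (q - 2) / Gamma q) / al*c al + K*c (al - 2) * c q / Gamma (q + 1)"
 show ?thesis
 proof (intro exI[of _ C] conjI allI impI)
  show "C > 0" unfolding C_def using K K' G c(1) al by (intro add_nonneg_pos add_nonneg_nonneg) (auto simp: less_imp_le)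
  fix L t :: real assume L: "L > 0" and t: "t > 0"
  let ?h = "t/2"
  have ce: "continuous_on A (ex L)" for A by (rule continuous_on_subset[OF continuous_on_ex[OF L]]) auto
  have w: "w powr (x + y) = w powr x * w powr y" for w x y :: real by (rule powr_add)
  have "abs (LBINT y:{0..?h}. jf q (t - y) * ex L y) <= K'*(c ?A / Gamma q * t powr ?A) * ?h powr (al - 1) + K'*(abs ?A * c (q - 2) / Gamma q * t powr (q - 2)) / al*?h powr al"
  proof (rule near_bound[OF L K'(1) K'(2)[OF L], where ph' = "%y. - (?A*(t - y) powr (q - 2) / Gamma q)"])
   fix y assume y: "y : {0..?h}"
   hence ty: "t - y > 0" "?h <= t - y" "t - y <= t" using t by auto
   show "((%y. jf q (t - y)) has_real_derivative - (?A*(t - y) powr (q - 2) / Gamma q)) (at y)"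
    using DERIV_chain2[where f = "jf q" and g = "%y. t - y" and x = y and s = UNIV, OF DERIV_jf[OF ty(1), of q], of "-1"] by (simp add: DERIV_diff[OF DERIV_const DERIV_ident, simplified])
   have "abs ?A*(t - y) powr (q - 2) / Gamma q <= abs ?A*(c (q - 2) * t powr (q - 2)) / Gamma q"
    using c(2)[OF t ty(2,3)] G by (intro divide_right_mono mult_left_mono) auto
   thus "abs (- (?A*(t - y) powr (q - 2) / Gamma q)) <= abs ?A * c (q - 2) / Gamma q * t powr (q - 2)"
    using G by (simp add: abs_mult)
  next
   show "continuous_on {0..?h} (%y. - (?A*(t - y) powr (q - 2) / Gamma q))"
    using t G by (intro continuous_intros) auto
   show "abs (jf q (t - ?h)) <= c ?A / Gamma q * t powr ?A"
    using c(2)[OF t, of ?h "q - 1"] t G by (simp add: jf_def divide_right_mono)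
  qed (use t in auto)
  also have "... <= K'*(c ?A / Gamma q * t powr ?A)*(c (al - 1) * t powr (al - 1)) + K'*(abs ?A * c (q - 2) / Gamma q * t powr (q - 2)) / al*(c al * t powr al)"
   using c(2)[OF t, of ?h] t K' G c(1)[THEN less_imp_le] al by (intro add_mono mult_left_mono) auto
  also have "... = (K'*(c ?A / Gamma q) * c (al - 1) + K'*(abs ?A * c (q - 2) / Gamma q) / al*c al) * t powr (q + al - 2)"
   using w[of t "q - 1" "al - 1"] w[of t "q - 2" al] by (simp add: algebra_simps)
  finally have 1: "abs (LBINT y:{0..?h}. jf q (t - y) * ex L y) <= (K'*(c ?A / Gamma q) * c (al - 1) + K'*(abs ?A * c (q - 2) / Gamma q) / al*c al) * t powr (q + al - 2)" .
  have "abs (LBINT y:{?h..t}. jf q (t - y) * ex L y) <= K*(c (al - 2) * t powr (al - 2)) * jf (q + 1) (t - ?h)"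
  proof (rule jf_window(2)[OF q _ ce])
   fix y assume y: "y : {?h..t}"
   have "abs (ex L y) <= K*y powr (al - 2)" using K(2)[OF L, of y] y t by auto
   also have "... <= K*(c (al - 2) * t powr (al - 2))" using c(2)[OF t, of y] y K(1) by (intro mult_left_mono) auto
   finally show "abs (ex L y) <= K*(c (al - 2) * t powr (al - 2))" .
  qed (use t K c(1)[THEN less_imp_le] in auto)
  also have "... <= K*(c (al - 2) * t powr (al - 2))*(c q * t powr q / Gamma (q + 1))"
   using c(2)[OF t, of ?h q] t K(1) G c(1)[THEN less_imp_le] by (intro mult_left_mono) (auto simp: jf_def divide_right_mono)
  also have "... = K*c (al - 2) * c q / Gamma (q + 1) * t powr (q + al - 2)"
   using w[of t q "al - 2"] by (simp add: algebra_simps)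
  finally have 2: "abs (LBINT y:{?h..t}. jf q (t - y) * ex L y) <= K*c (al - 2) * c q / Gamma (q + 1) * t powr (q + al - 2)" .
  have "conv (jf q) (ex L) t = (LBINT y:{0..?h}. jf q (t - y) * ex L y) + (LBINT y:{?h..t}. jf q (t - y) * ex L y)"
   unfolding conv_def using t by (intro set_integral_split jf_window(1) q ce) auto
  thus "abs (conv (jf q) (ex L) t) <= C*t powr (q + al - 2)" using 1 2 unfolding C_def distrib_right[of _ _ "t powr (q + al - 2)"] by linarith
 qed
qed

end

section \<open>Error for the initial value\<close>

context fractional_order
begin

text \<open>By \<open>vx_jf_conv\<close> this is \<open>t - L * conv (jf 1) (vx L) t\<close>, a
  primitive of the homogeneous solution \<open>1 - L * vx L t\<close>. Its BDF2 difference is what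
  the starting term of the scheme would give if \<open>Ix\<close> were exact.\<close>

definition W :: "real => real => real" where
 "W L t = conv (jf (1 - al)) (vx L) t"

text \<open>The third part of \<open>kdens_bound\<close> provides the factor \<open>1 / L\<close>.
  Of the power \<open>y^2\<close> from \<open>exp_second_order\<close> one factor cancels the
  \<open>1 / y\<close> in \<open>edens\<close>, and the other integrates to
  \<open>(n - 2) powr - 2\<close>.\<close>

lemma vx_linear_interpolation:
 assumes L: "L > 0" and n: "n >= 3" and s: "0 <= s" "s <= 2"
 shows "abs (vx L (n - s) - (vx L n + s*(vx L (n - 1) - vx L n))) <= 2*kc / L*(n - 2) powr - 2"
proof -
 let ?f = "%t y. edens L y * exp (- (t*y))"
 have v: "vx L t = 1 / L - (LBINT y:{0<..}. ?f t y)" if "t > 0" for t using that by (simp add: vx_def)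
 note i = exact_dens_exp(1)[OF L]
 have i1: "SI {0<..} (?f (n - s))" "SI {0<..} (?f n)" "SI {0<..} (?f (n - 1))"
  using n s by (auto intro!: i)
 have i2: "SI {0<..} (%y. s*(?f (n - 1) y - ?f n y))"
  "SI {0<..} (%y. ?f (n - s) y - ?f n y)" by (intro SI_mult LB_diff(1) i1)+
 have i3: "SI {0<..} (%y. ?f (n - s) y - ?f n y - s*(?f (n - 1) y - ?f n y))" by (rule LB_diff(1)[OF i2(2) i2(1)])
 have "(LBINT y:{0<..}. ?f (n - s) y - ?f n y - s*(?f (n - 1) y - ?f n y))
   = (LBINT y:{0<..}. ?f (n - s) y) - (LBINT y:{0<..}. ?f n y) - s*((LBINT y:{0<..}. ?f (n - 1) y) - (LBINT y:{0<..}. ?f n y))"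
  using LB_diff(2)[OF i2(2) i2(1)] LB_diff(2)[OF i1(1,2)] LB_diff(2)[OF i1(3,2)] by (simp only: LB_mult)
 hence "vx L (n - s) - (vx L n + s*(vx L (n - 1) - vx L n)) = - (LBINT y:{0<..}. ?f (n - s) y - ?f n y - s*(?f (n - 1) y - ?f n y))"
  using n s by (simp add: v algebra_simps)
 moreover have "abs (LBINT y:{0<..}. ?f (n - s) y - ?f n y - s*(?f (n - 1) y - ?f n y)) <= 2*kc / L*Gamma 2 * (n - 2) powr - 2"
 proof (rule spectral_integral_bound[OF i3])
  fix y :: real assume y: "y > 0"
  have e: "exp (- ((n - s) * y)) = exp (- (n*y)) * exp (s*y)" "exp (- ((n - 1) * y)) = exp (- (n*y)) * exp y" by (simp_all add: algebra_simps flip: exp_add)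
  have "?f (n - s) y - ?f n y - s*(?f (n - 1) y - ?f n y) = edens L y * exp (- (n*y))*(exp (s*y) - 1 - s*(exp y - 1))"
   unfolding e by (simp add: algebra_simps)
  also have "abs (...) <= (kc / L / y) * exp (- (n*y))*(2*y\<^sup>2*exp (2*y))"
  proof -
   have "kdens al L (y powr al) <= kc / L" using kdens_bound(3)[of "y powr al" L] y L by (simp add: pos_le_divide_eq mult.commute)
   hence "edens L y <= kc / L / y" unfolding edens_def using y by (intro divide_right_mono) auto
   thus ?thesis
    unfolding abs_mult using exp_second_order[OF y s] exact_dens_nonneg[OF y, of L] y L kc_pos by (intro mult_mono) auto
  qed
  also have "... = 2*kc / L*(y*(exp (- (n*y)) * exp (2*y)))" using y L by (simp add: power2_eq_square)
  also have "exp (- (n*y)) * exp (2*y) = exp (- (y*(n - 2)))" by (simp add: algebra_simps flip: exp_add)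
  finally show "abs (?f (n - s) y - ?f n y - s*(?f (n - 1) y - ?f n y)) <= 2*kc / L*(y powr (2 - 1) * exp (- (y*(n - 2))))"
   using y by simp
 qed (use n in auto)
 ultimately show ?thesis by (simp add: Gamma_numeral)
qed

text \<open>On the primitive of \<open>vx L\<close> the BDF2 difference is
  \<open>3/2 I1 - 1/2 I2\<close>, with the integrals over the last two unit intervals; for a linear
  integrand this is exactly its value at \<open>n\<close>. The interpolation error carries
  \<open>1 / L\<close>, which cancels the factor \<open>L\<close>.\<close>

lemma W_bdf2:
 assumes L: "L > 0" and n: "n >= 3"
 shows "abs (3/2*W L n - 2*W L (n - 1) + 1/2*W L (n - 2) - (1 - L * vx L n)) <= 4*kc*(n - 2) powr - 2"
proof -
 define B where "B = 2*kc / L*(n - 2) powr - 2"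
 have B0: "B >= 0" using kc_pos L by (simp add: B_def)
 define v d where "v = vx L n" and "d = vx L (n - 1) - vx L n"
 have c: "continuous_on A (vx L)" for A by (rule continuous_on_subset[OF continuous_on_vx[OF L]]) auto
 have V: "conv (jf 1) (vx L) t = (LBINT s:{0..t}. vx L s)" for t
 proof -
  have "conv (jf 1) (vx L) t = conv (%_. 1) (vx L) t" by (rule conv_cong) (simp add: jf_def)
  thus ?thesis by (simp add: conv_def)
 qed
 have i: "SI {a..b} (vx L)" for a b by (rule SI_Icc[OF c])
 define I1 I2 where "I1 = integral {n - 1..n} (vx L)" and "I2 = integral {n - 2..n - 1} (vx L)"
 have I: "conv (jf 1) (vx L) n = conv (jf 1) (vx L) (n - 1) + I1" "conv (jf 1) (vx L) (n - 1) = conv (jf 1) (vx L) (n - 2) + I2"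
  using set_integral_split[OF i, of 0 "n - 1" n] set_integral_split[OF i, of 0 "n - 2" "n - 1"] n
  unfolding V I1_def I2_def by (simp_all add: SI_HK(2)[OF i])
 have b: "abs (integral {a..a + 1} (vx L) - (v + (n - a - 1/2) * d)) <= B" if a: "n - 2 <= a" "a <= n - 1" for a
 proof -
  have "((%y. v + (n - y) * d) has_integral (v * (a + 1) - (n - (a + 1))\<^sup>2/2*d - (v * a - (n - a)\<^sup>2/2*d))) {a..a + 1}" by (rule fundamental_theorem_of_calculus)
    (auto intro!: derivative_eq_intros simp: has_real_derivative_iff_has_vector_derivative[symmetric] algebra_simps diff_divide_distrib)
  also have "v * (a + 1) - (n - (a + 1))\<^sup>2/2*d - (v * a - (n - a)\<^sup>2/2*d) = v + (n - a - 1/2) * d" by (simp add: power2_eq_square algebra_simps add_divide_distrib diff_divide_distrib)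
  finally have "((%y. vx L y - (v + (n - y) * d)) has_integral (integral {a..a + 1} (vx L) - (v + (n - a - 1/2) * d))) {a..a + 1}" by (intro has_integral_diff integrable_integral integrable_continuous_real c)
  hence "norm (integral {a..a + 1} (vx L) - (v + (n - a - 1/2) * d)) <= B*Henstock_Kurzweil_Integration.content {a..a + 1}"
  proof (rule has_integral_bound_real[OF B0 finite.emptyI])
   show "norm (vx L y - (v + (n - y) * d)) <= B" if "y : {a..a + 1} - {}" for y
    using vx_linear_interpolation[OF L n, of "n - y"] a that unfolding v_def d_def B_def by simp
  qed
  thus ?thesis by simp
 qed
 have b1: "abs (I1 - (v + 1/2*d)) <= B" using b[of "n - 1"] unfolding I1_def by simp
 have b2: "abs (I2 - (v + 3/2*d)) <= B" using b[of "n - 2"] unfolding I2_def by simp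
 have w: "W L x = x - L*conv (jf 1) (vx L) x" if "x > 0" for x
  unfolding W_def using vx_jf_conv[OF L, of x] that by (simp add: jf_def Gamma_numeral)
 have "3/2*W L n - 2*W L (n - 1) + 1/2*W L (n - 2) - (1 - L * vx L n) = - L*(3/2*(I1 - (v + 1/2*d)) - 1/2*(I2 - (v + 3/2*d)))"
  using n I by (simp add: w algebra_simps v_def)
 also have "abs (...) <= L*(2*B)"
 proof -
  have "abs (3/2*x - 1/2*y) <= 2*B" if "abs x <= B" "abs y <= B" for x y using that by (simp add: abs_le_iff)
  from this[OF b1 b2] show ?thesis using L unfolding abs_mult by (simp add: mult_left_mono)
 qed
 also have "... = 4*kc*(n - 2) powr - 2" using L by (simp add: B_def)
 finally show ?thesis .
qed

definition bdf_conv_ex :: "real => real => real" where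
 "bdf_conv_ex L n = 3/2*conv (jf (1 - al)) (ex L) n - 2*conv (jf (1 - al)) (ex L) (n - 1) + 1/2*conv (jf (1 - al)) (ex L) (n - 2)"

text \<open>With \<open>h = n/2\<close> the difference is placed where it helps. On
  \<open>[0, h]\<close> it falls on the kernel, and \<open>near_bound\<close> gives
  \<open>h powr (- al - 1) * h powr (al - 1)\<close>; on \<open>[h, n]\<close> a translation moves
  it to \<open>ex\<close>, giving \<open>h powr (al - 3) * h powr (1 - al)\<close>. Both are
  \<open>h powr - 2\<close>.\<close>

lemma bdf_conv_ex_decay: "EX C>0. ALL L>0. ALL n>=20. abs (bdf_conv_ex L n) <= C*n powr - 2"
proof -
 let ?C = "al - 2"
 let ?B = "al + 1"
 let ?A = "1 - al"
 obtain K1 where K1: "K1 > 0" "!!L y. L > 0 ==> y > 0 ==> abs (ex L y) <= K1*y powr ?C" using ex_decay by blast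
 obtain K2 where K2: "K2 > 0" "!!L y. L > 0 ==> y > 0 ==> abs (ex_int L y) <= K2*y powr (al - 1)" using ex_int_decay by blast
 obtain K3 where K3: "K3 > 0" "!!L y. L > 0 ==> y >= 8 ==> abs (bdf_ex L y) <= K3*y powr (al - 3)" using bdf_ex_decay by blast
 have q: "1 - al > 0" using al by simp
 have G: "Gamma ?A > 0" "Gamma (2 - al) > 0" using al by auto
 define g where "g = 1 / Gamma ?A"
 have g: "g > 0" using G by (simp add: g_def)
 define c where "c p = 2 powr abs p" for p :: real
 have c: "c p > 0" "0 < t ==> t/2 <= x ==> x <= t ==> x powr p <= c p * t powr p" for p t x
  using powr_half_le[of t x p] by (auto simp: c_def)
 define A where "A = K3 / Gamma (2 - al)"
 define B where "B = K1*c ?C*(g*c (- al)) * 2"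
 define D where "D = K2*(2*g*al*c (- al - 1)) + K2*(2*g*al*?B * c (- al - 2)) / al"
 have j: "jf ?A x = g*x powr (- al)" if "x > 0" for x using that by (simp add: jf_def g_def)
 have D0: "D >= 0" unfolding D_def using K2 g c(1)[THEN less_imp_le] al by (intro add_nonneg_nonneg divide_nonneg_nonneg mult_nonneg_nonneg) auto
 have AB0: "A > 0" "B > 0" using K1 K3 G g c(1) by (simp_all add: A_def B_def)
 show ?thesis
 \<comment> \<open>\<open>4*B\<close> comes from \<open>3/2 + 2 + 1/2\<close>, the moduli of the
   BDF2 coefficients; the outer 4 converts \<open>h powr - 2\<close> into
   \<open>n powr - 2\<close>.\<close>
 proof (intro exI[of _ "4*(A + 4*B + D)"] conjI allI impI)
  show "4*(A + 4*B + D) > 0" using AB0 D0 by simp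
  fix L n :: real assume L: "L > 0" and n: "n >= 20"
  define h where "h = n/2"
  have h: "h >= 10" "n = 2*h" using n by (auto simp: h_def)
  have ce: "continuous_on S (%y. ex L (y - l))" for S l by (rule continuous_on_compose2[OF continuous_on_ex[OF L]]) (auto intro!: continuous_intros)
  have ce0: "continuous_on S (ex L)" for S using ce[of S 0] by simp
  let ?N = "%l. LBINT y:{0..h}. jf ?A (n - l - y) * ex L y"
  let ?F = "%l. LBINT y:{h..n}. jf ?A (n - y) * ex L (y - l)"
  let ?E = "%l. LBINT y:{h..h + l}. jf ?A (n - y) * ex L (y - l)"
  \<comment> \<open>Translation by \<open>l\<close> moves the lower limit from \<open>h\<close> to
    \<open>h + l\<close>. Extending the three far integrals to the common domain
    \<open>[h, n]\<close> adds the strips \<open>?E l\<close>, which are small by mere size: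
    \<open>h powr (- al) * h powr (al - 2)\<close>.\<close>
  have split: "conv (jf ?A) (ex L) (n - l) = ?N l + (?F l - ?E l)" if l: "0 <= l" "l <= 2" for l
  proof -
   have "conv (jf ?A) (ex L) (n - l) = ?N l + (LBINT y:{h..n - l}. jf ?A (n - l - y) * ex L y)"
    unfolding conv_def using l h by (intro set_integral_split jf_window(1) q ce0) auto
   also have "(LBINT y:{h..n - l}. jf ?A (n - l - y) * ex L y) = (LBINT y:{h + l..n}. jf ?A (n - y) * ex L (y - l))" by (subst set_integral_shift[of _ _ _ l]) (simp add: algebra_simps)
   also have "... = ?F l - ?E l"
    using set_integral_split[OF jf_window(1)[OF q _ ce, of h n n l], of "h + l"] l h by simp
   finally show ?thesis .
  qed
  have Eb: "abs (?E l) <= B*h powr - 2" if l: "0 <= l" "l <= 2" for l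
  proof -
   have "abs (?E l) <= (LBINT y:{h..h + l}. abs (jf ?A (n - y) * ex L (y - l)))"
    using set_integral_norm_bound[OF jf_window(1)[OF q _ ce, of h n "h + l" l]] h by simp
   also have "... <= (LBINT y:{h..h + l}. (g*(c (- al) * h powr (- al)))*(K1*(c ?C * h powr ?C)))"
   proof (rule set_integral_mono)
    fix y assume y: "y : {h..h + l}"
    have "jf ?A (n - y) <= g*(c (- al) * h powr (- al))"
     using c(2)[of h "n - y" "- al"] y l h g by (simp add: j)
    moreover have "abs (ex L (y - l)) <= K1*(c ?C * h powr ?C)"
    proof -
     have "abs (ex L (y - l)) <= K1*(y - l) powr ?C" using y l h by (intro K1(2) L) auto
     also have "(y - l) powr ?C <= c ?C * h powr ?C" using y l h by (intro c(2)) auto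
     finally show ?thesis using K1(1) by (simp add: mult_left_mono)
    qed
    ultimately show "abs (jf ?A (n - y) * ex L (y - l)) <= (g*(c (- al) * h powr (- al)))*(K1*(c ?C * h powr ?C))"
     using jf_nonneg[OF q, of "n - y"] unfolding abs_mult by (intro mult_mono) auto
   qed (rule set_integrable_abs[OF jf_window(1)[OF q _ ce]], use h in simp, rule SI_Icc[OF continuous_on_const])
   also have "... = (g*(c (- al) * h powr (- al)))*(K1*(c ?C * h powr ?C)) * l"
    using l by (simp add: set_integral_const mult.commute)
   also have "... <= (g*(c (- al) * h powr (- al)))*(K1*(c ?C * h powr ?C)) * 2"
    using l g K1 c(1)[THEN less_imp_le] by (intro mult_left_mono mult_nonneg_nonneg) auto
   also have "... = B*(h powr (- al) * h powr ?C)" by (simp add: B_def)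
   also have "h powr (- al) * h powr ?C = h powr - 2" by (simp flip: powr_add)
   finally show ?thesis .
  qed
  have Fi: "SI {h..n} (%y. jf ?A (n - y) * ex L (y - l))" for l by (rule jf_window(1)[OF q _ ce]) (use h in auto)
  have F: "3/2*?F 0 - 2*?F 1 + 1/2*?F 2 = (LBINT y:{h..n}. jf ?A (n - y) * bdf_ex L y)"
  proof -
   have e: "jf ?A (n - y) * bdf_ex L y = 3/2*(jf ?A (n - y) * ex L (y - 0)) - 2*(jf ?A (n - y) * ex L (y - 1)) + 1/2*(jf ?A (n - y) * ex L (y - 2))" for y by (simp add: bdf_ex_def algebra_simps)
   have a: "SI {h..n} (%y. r*(jf ?A (n - y) * ex L (y - l)))" for l r by (intro SI_mult Fi)
   show ?thesis
    unfolding e using LB_add(2)[OF LB_diff(1)[OF a[of "3/2" 0] a[of 2 1]] a[of "1/2" 2]] LB_diff(2)[OF a[of "3/2" 0] a[of 2 1]] by (simp only: LB_mult)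
  qed
  have Fb: "abs (3/2*?F 0 - 2*?F 1 + 1/2*?F 2) <= A*h powr - 2"
  proof -
   have "abs (3/2*?F 0 - 2*?F 1 + 1/2*?F 2) <= K3*h powr (al - 3) * jf (1 - al + 1) (n - h)"
    unfolding F
   proof (rule jf_window(2)[OF q])
    show "continuous_on {h..n} (bdf_ex L)" unfolding bdf_ex_def by (intro continuous_intros ce ce0)
    fix y assume y: "y : {h..n}"
    have "abs (bdf_ex L y) <= K3*y powr (al - 3)" using y h by (intro K3(2) L) auto
    also have "... <= K3*h powr (al - 3)" using y h K3(1) al by (intro mult_left_mono powr_mono2') auto
    finally show "abs (bdf_ex L y) <= K3*h powr (al - 3)" .
   qed (use h K3 in auto)
   also have "... = A*(h powr (al - 3) * h powr ?A)" using h by (simp add: jf_def A_def)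
   also have "h powr (al - 3) * h powr ?A = h powr - 2" by (simp flip: powr_add)
   finally show ?thesis .
  qed
  have N: "3/2*?N 0 - 2*?N 1 + 1/2*?N 2 = (LBINT y:{0..h}. (3/2*jf ?A (n - y) - 2*jf ?A (n - 1 - y) + 1/2*jf ?A (n - 2 - y)) * ex L y)"
  proof -
   have e: "(3/2*jf ?A (n - y) - 2*jf ?A (n - 1 - y) + 1/2*jf ?A (n - 2 - y)) * ex L y
     = 3/2*(jf ?A (n - 0 - y) * ex L y) - 2*(jf ?A (n - 1 - y) * ex L y) + 1/2*(jf ?A (n - 2 - y) * ex L y)" for y by (simp add: algebra_simps)
   have a: "SI {0..h} (%y. r*(jf ?A (n - l - y) * ex L y))" if "l <= 2" for l r
    using that h by (intro SI_mult jf_window(1) q ce0) auto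
   have a': "SI {0..h} (%y. 3/2*(jf ?A (n - 0 - y) * ex L y))" "SI {0..h} (%y. 2*(jf ?A (n - 1 - y) * ex L y))"
    "SI {0..h} (%y. 1/2*(jf ?A (n - 2 - y) * ex L y))" by (rule a, simp)+
   show ?thesis
    unfolding e using LB_add(2)[OF LB_diff(1)[OF a'(1,2)] a'(3)] LB_diff(2)[OF a'(1,2)] by (simp only: LB_mult)
  qed
  have Nb: "abs (3/2*?N 0 - 2*?N 1 + 1/2*?N 2) <= D*h powr - 2"
  proof -
   let ?ph = "%y. 3/2*jf ?A (n - y) - 2*jf ?A (n - 1 - y) + 1/2*jf ?A (n - 2 - y)"
   let ?s = "%p y. 3/2*(n - y) powr (- p) - 2*(n - y - 1) powr (- p) + 1/2*(n - y - 2) powr (- p)"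
   have s: "abs (?s p y) <= 2*p*(c (- p - 1) * h powr (- p - 1))" if y: "y : {0..h}" and p: "p > 0" for p y
   proof -
    have "abs (?s p y) <= 2*p*(n - y - 2) powr (- p - 1)" by (rule bdf2_powr_bound) (use y h p in auto)
    also have "... <= 2*p*(h - 2) powr (- p - 1)" using y h p by (intro mult_left_mono powr_mono2') auto
    also have "... <= 2*p*(c (- p - 1) * h powr (- p - 1))" using h p by (intro mult_left_mono c(2)) auto
    finally show ?thesis .
   qed
   have "abs (LBINT y:{0..h}. ?ph y * ex L y) <= K2*(g*(2*al*(c (- al - 1) * h powr (- al - 1)))) * h powr (al - 1)
     + K2*(g*al*(2*?B*(c (- ?B - 1) * h powr (- ?B - 1)))) / al*h powr al"
   proof (rule near_bound[OF L K2(1) K2(2)[OF L], where ph' = "%y. g*al*?s ?B y"])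
    fix y assume y: "y : {0..h}"
    have d: "((%y. jf ?A (n - l - y)) has_real_derivative g * al*(n - y - l) powr (- ?B)) (at y)" if "l <= 2" for l
    proof -
     have p: "n - l - y > 0" using y h that by auto
     have "((%y. n - l - y) has_real_derivative - 1) (at y)" by (auto intro!: derivative_eq_intros)
     from DERIV_chain2[where f = "jf ?A" and g = "%y. n - l - y" and x = y and s = UNIV, OF DERIV_jf[OF p, of "1 - al"] this]
     show ?thesis by (simp add: g_def algebra_simps)
    qed
    have d': "((%y. jf ?A (n - y)) has_real_derivative g * al*(n - y) powr (- ?B)) (at y)" using d[of 0] by simp
    show "(?ph has_real_derivative g * al*?s ?B y) (at y)"
     using DERIV_add[OF DERIV_diff[OF DERIV_cmult[OF d', of "3/2"] DERIV_cmult[OF d[of 1], of 2]] DERIV_cmult[OF d[of 2], of "1/2"]] by (simp add: algebra_simps)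
    have "abs (?s ?B y) <= 2*?B*(c (- ?B - 1) * h powr (- ?B - 1))" using s[OF y, of "al + 1"] al by simp
    thus "abs (g*al*?s ?B y) <= g*al*(2*?B*(c (- ?B - 1) * h powr (- ?B - 1)))"
     using g al unfolding abs_mult[of "g*al"] by (simp add: mult_left_mono del: minus_add_distrib)
   next
    show "continuous_on {0..h} (%y. g*al*?s ?B y)" using h by (intro continuous_intros) auto
    have "?ph h = g*?s al h" using h by (simp add: j algebra_simps)
    hence "abs (?ph h) = g*abs (?s al h)" using g by (simp only: abs_mult abs_of_pos)
    also have "... <= g*(2*al*(c (- al - 1) * h powr (- al - 1)))" using s[of h al] h g al by (intro mult_left_mono) auto
    finally show "abs (?ph h) <= g*(2*al*(c (- al - 1) * h powr (- al - 1)))" .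
   qed (use h in auto)
   also have "... = K2*(2*g*al*c (- al - 1))*(h powr (- al - 1) * h powr (al - 1)) + K2*(2*g*al*?B * c (- al - 2)) / al*(h powr (- al - 2) * h powr al)"
   proof -
    have e: "- ?B - 1 = - al - 2" by simp
    show ?thesis unfolding e by (simp add: mult_ac)
   qed
   also have "h powr (- al - 1) * h powr (al - 1) = h powr - 2" by (simp flip: powr_add)
   also have "h powr (- al - 2) * h powr al = h powr - 2" by (simp flip: powr_add)
   also have "K2*(2*g*al*c (- al - 1)) * h powr - 2 + K2*(2*g*al*?B * c (- al - 2)) / al*h powr - 2 = D*h powr - 2" by (simp only: D_def distrib_right)
   finally show ?thesis unfolding N .
  qed
  have "bdf_conv_ex L n = (3/2*?N 0 - 2*?N 1 + 1/2*?N 2) + (3/2*?F 0 - 2*?F 1 + 1/2*?F 2) - (3/2*?E 0 - 2*?E 1 + 1/2*?E 2)"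
   using split[of 0] split[of 1] split[of 2] unfolding bdf_conv_ex_def by (simp add: add_divide_distrib diff_divide_distrib)
  also have "abs (...) <= (A + 4*B + D) * h powr - 2"
  proof -
   have "abs (x + y - (3/2*a - 2*b + 1/2*e)) <= (A + 4*B + D) * k" if "abs x <= D*k" "abs y <= A*k" "abs a <= B*k" "abs b <= B*k" "abs e <= B*k" for x y a b e k
    using that by (simp add: distrib_right abs_le_iff)
   from this[OF Nb Fb Eb[of 0] Eb[of 1] Eb[of 2]] show ?thesis by simp
  qed
  also have "h powr - 2 = 4*n powr - 2" using h by (simp add: powr_minus powr_numeral power_mult_distrib)
  finally show "abs (bdf_conv_ex L n) <= 4*(A + 4*B + D) * n powr - 2" by (simp only: mult_ac)
 qed
qed

text \<open>From 20 on both differences are of order \<open>n powr - 2\<close>. Below 20 every term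
  is bounded uniformly in \<open>L\<close> and \<open>n powr - 2 >= 1/400\<close>, whence the factor
  400 in \<open>C2\<close>; negative arguments \<open>n - 1\<close>, \<open>n - 2\<close> contribute
  zero.\<close>

lemma homogeneous_error_bound:
 "EX C>0. ALL L>0. ALL n>=1. abs (bdf_conv_ex L n + (3/2*W L n - 2*W L (n - 1) + 1/2*W L (n - 2)) - (1 - L * vx L n)) <= C*n powr - 2"
proof -
 obtain K1 where K1: "K1 > 0" "!!L y. L > 0 ==> y > 0 ==> abs (ex L y) <= K1*y powr al" using ex_decay by blast
 obtain K2 where K2: "K2 > 0" "!!L y. L > 0 ==> y > 0 ==> vx L y <= K2*y powr al" using vx_growth by blast
 obtain C1 where C1: "C1 > 0" "!!L n. L > 0 ==> n >= 20 ==> abs (bdf_conv_ex L n) <= C1*n powr - 2" using bdf_conv_ex_decay by blast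
 have q: "1 - al > 0" using al by simp
 define M where "M = 20 powr (1 - al) / Gamma (2 - al)"
 have M: "M > 0" using al by (simp add: M_def)
 define C2 where "C2 = (4*(K1*20 powr al * M) + 4*(K2*20 powr al * M) + 1) * 400"
 have C2: "C2 > 0" using K1 K2 M by (simp add: C2_def add_pos_pos)
 have kc0: "kc > 0" by (rule kc_pos)
 show ?thesis
 proof (intro exI[of _ "C1 + 16*kc + C2"] conjI allI impI)
  show "C1 + 16*kc + C2 > 0" using C1 C2 kc0 by simp
  fix L n :: real assume L: "L > 0" and n: "n >= 1"
  let ?W = "3/2*W L n - 2*W L (n - 1) + 1/2*W L (n - 2)"
  have n2: "n powr - 2 >= 0" by simp
  show "abs (bdf_conv_ex L n + ?W - (1 - L * vx L n)) <= (C1 + 16*kc + C2) * n powr - 2"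
  proof (cases "n >= 20")
   case True
   have "(n - 2) powr - 2 <= 4*n powr - 2"
   proof -
    have "(n - 2) powr - 2 <= (n/2) powr - 2" using True by (intro powr_mono2') auto
    also have "... = 4*n powr - 2" using True by (simp add: powr_minus powr_numeral power_divide) (simp add: divide_inverse)
    finally show ?thesis .
   qed
   hence "4*kc*(n - 2) powr - 2 <= 16*kc*n powr - 2" using kc0 by simp
   hence "abs (?W - (1 - L * vx L n)) <= 16*kc*n powr - 2" using W_bdf2[OF L, of n] True by linarith
   moreover have "0 <= C2*n powr - 2" using C2 by simp
   ultimately show ?thesis using C1(2)[OF L True] unfolding distrib_right by linarith
  next
   case False
   have b: "abs (conv (jf (1 - al)) f x) <= K*20 powr al * M" if f: "continuous_on UNIV f" "!!y. y > 0 ==> abs (f y) <= K*y powr al" "f 0 = 0" and K: "K > 0" and x: "x <= 20" for f K x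
   proof (cases "x < 0")
    case True
    thus ?thesis using K M by (simp add: conv_def LB_def)
   next
    case False
    hence x0: "x >= 0" by simp
    have "abs (conv (jf (1 - al)) f x) <= K*20 powr al * jf (1 - al + 1) (x - 0)"
     unfolding conv_def
    proof (rule jf_window(2)[OF q x0 continuous_on_subset[OF f(1)]])
     fix y assume y: "y : {0..x}"
     show "abs (f y) <= K*20 powr al"
     proof (cases "y = 0")
      case False
      hence "abs (f y) <= K*y powr al" using y by (intro f(2)) auto
      also have "... <= K*20 powr al" using y x K al by (intro mult_left_mono powr_mono2) auto
      finally show ?thesis .
     qed (use f(3) K in simp)
    qed (use K in auto)
    also have "jf (1 - al + 1) (x - 0) <= M"
     using x x0 al M by (cases "x = 0") (auto simp: jf_def M_def intro!: divide_right_mono powr_mono2)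
    finally show ?thesis using K by simp
   qed
   have e: "abs (conv (jf (1 - al)) (ex L) x) <= K1*20 powr al * M" if "x <= 20" for x by (rule b[OF continuous_on_ex[OF L] K1(2)[OF L] ex_nonpos K1(1) that]) auto
   have w: "abs (W L x) <= K2*20 powr al * M" if "x <= 20" for x
    unfolding W_def
   proof (rule b[OF continuous_on_vx[OF L] _ _ K2(1) that])
    show "abs (vx L y) <= K2*y powr al" if "y > 0" for y using K2(2)[OF L that] vx_bounds(1)[OF L, of y] by simp
   qed (simp add: vx_def)
   have E: "abs (1 - L * vx L n) <= 1" using vx_bounds[OF L, of n] L by simp
   have *: "abs ((3/2*a - 2*b + 1/2*c) + (3/2*a' - 2*b' + 1/2*c') - z) <= 4*X + 4*Y + 1"
    if "abs a <= X" "abs b <= X" "abs c <= X" "abs a' <= Y" "abs b' <= Y" "abs c' <= Y" "abs z <= 1" for a b c a' b' c' X Y z :: real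
    using that by (simp add: abs_le_iff)
   have "abs (bdf_conv_ex L n + ?W - (1 - L * vx L n)) <= 4*(K1*20 powr al * M) + 4*(K2*20 powr al * M) + 1"
    unfolding bdf_conv_ex_def using False by (intro * e w E) auto
   also have "... = C2*(1/400)" by (simp add: C2_def)
   also have "1/400 <= n powr - 2"
   proof -
    have "(20::real) powr - 2 <= n powr - 2" using n False by (intro powr_mono2') auto
    thus ?thesis by (simp add: powr_minus powr_numeral)
   qed
   hence "C2*(1/400) <= C2*n powr - 2" using C2 by (intro mult_left_mono) auto
   also have "C2*n powr - 2 <= (C1 + 16*kc + C2) * n powr - 2" using C1 kc0 by (intro mult_right_mono) auto
   finally show ?thesis .
  qed
 qed
qed

end

section \<open>Scaling and the exact solution of a mode\<close>

lemma jf_scale: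
 assumes "ta > 0" shows "jf q (ta*x) = ta powr (q - 1) * jf q x"
 using assms by (auto simp: jf_def powr_mult zero_less_mult_iff mult_le_0_iff not_le)

lemma conv_scale:
 assumes ta: "ta > 0" shows "conv f g (ta*t) = ta*conv (%x. f (ta*x)) (%x. g (ta*x)) t"
proof -
 have i: "indicator {0..ta * t} (ta*x) = (indicator {0..t} x :: real)" for x
  using ta by (auto simp: indicator_def zero_le_mult_iff)
 show ?thesis
  unfolding conv_def LB_def by (subst lborel_integral_real_affine[of ta _ 0]) (use ta i in "simp_all add: right_diff_distrib")
qed

lemma SI_reflect:
 fixes a h :: "real => real"
 assumes a: "continuous_on {0..t} a" and h: "SI {0..t} h"
 shows "SI {0..t} (%s. a (t - s) * h s)"
proof -
 have c: "continuous_on {0..t} (%s. a (t - s))" by (rule continuous_on_compose2[OF a]) (auto intro!: continuous_intros)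
 have "bounded ((%s. a (t - s)) ` {0..t})" by (intro compact_imp_bounded compact_continuous_image c) auto
 then obtain B where B: "!!s. s : {0..t} ==> abs (a (t - s)) <= B" unfolding bounded_iff by force
 show ?thesis
 proof (rule SI_bound[OF SI_mult[of B, OF h]])
  have "(%s. (indicator {0..t} s *\<^sub>R a (t - s))*(indicator {0..t} s *\<^sub>R h s)) : borel_measurable lborel"
   using borel_measurable_integrable[OF h[unfolded SI_def]] SM_cont[OF c] unfolding SM_def by (intro borel_measurable_times) auto
  thus "SM {0..t} (%s. a (t - s) * h s)"
   unfolding SM_def by (rule subst[of _ _ "%f. f : _", rotated]) (auto simp: indicator_def)
  show "AE s in lborel. s : {0..t} --> norm (a (t - s) * h s) <= norm (B*h s)"
  proof (intro AE_I2 impI)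
   fix s assume "s : {0..t}"
   hence "abs (a (t - s)) <= abs B" using B[of s] by linarith
   thus "norm (a (t - s) * h s) <= norm (B*h s)" by (simp add: abs_mult mult_right_mono)
  qed
 qed
qed

lemma conv_linear:
 assumes "SI {0..t} (%s. f (t - s) * g s)" "SI {0..t} (%s. f (t - s) * h s)"
 shows "conv f (%s. a*g s + b*h s) t = a*conv f g t + b*conv f h t"
proof -
 have "f (t - s)*(a*g s + b*h s) = a*(f (t - s) * g s) + b*(f (t - s) * h s)" for s by (simp add: algebra_simps)
 thus ?thesis
  unfolding conv_def using LB_add(2)[OF SI_mult[of a, OF assms(1)] SI_mult[of b, OF assms(2)]] by (simp only: LB_mult)
qed

lemma jf_bounded:
 assumes "p >= 1" "x <= M"
 shows "abs (jf p x) <= M powr (p - 1) / Gamma p"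
 using assms by (auto simp: jf_def intro!: divide_right_mono powr_mono2)

text \<open>The semigroup law acting on a merely integrable \<open>g\<close>; \<open>p >= 1\<close>
  makes \<open>jf p\<close> bounded, as \<open>conv_assoc\<close> demands.\<close>

lemma conv_jf_jf:
 assumes p: "p >= 1" and q: "q > 0" and g: "SI {0..M} g" and t: "t <= M"
 shows "conv (jf p) (conv (jf q) g) t = conv (jf (p + q)) g t"
  "conv (jf q) (conv (jf p) g) t = conv (jf (p + q)) g t"
proof -
 have m: "SM {0..M} (jf p)" unfolding SM_def by measurable
 have jq: "SI {0..M} (jf q)" by (cases "M >= 0") (use jf_integral(1)[OF q, of M] in "simp_all add: not_le SI_def")
 have B: "abs (jf p x) <= M powr (p - 1) / Gamma p" if "x : {0..M}" for x using jf_bounded[OF p] that by simp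
 have pq: "conv (jf p) (jf q) = jf (p + q)" using conv_jf[of p q] p q by auto
 show 1: "conv (jf p) (conv (jf q) g) t = conv (jf (p + q)) g t"
  unfolding pq[symmetric] by (rule conv_assoc(1)[OF m B jq g t])
 have "conv (jf q) (conv (jf p) g) t = conv (conv (jf p) g) (jf q) t" by (rule conv_commute)
 also have "... = conv (jf p) (conv g (jf q)) t" by (rule conv_assoc(1)[OF m B g jq t, symmetric])
 also have "conv g (jf q) = conv (jf q) g" by (rule ext) (rule conv_commute)
 finally show "conv (jf q) (conv (jf p) g) t = conv (jf (p + q)) g t" unfolding 1 .
qed

lemma primitive_zero_imp_zero:
 fixes z :: "real => real"
 assumes z: "continuous_on {0..T} z" and 0: "!!t. t : {0..T} ==> conv (jf 1) z t = 0" and t: "t : {0..T}" and T: "T > 0"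
 shows "z t = 0"
proof -
 have I: "integral {0..x} z = 0" if x: "x : {0..T}" for x
 proof -
  have "conv (jf 1) z x = conv (%_. 1) z x" by (rule conv_cong) (simp add: jf_def)
  thus ?thesis
   using 0[OF x] SI_HK(2)[OF SI_Icc[OF continuous_on_subset[OF z]], of 0 x] x by (simp add: conv_def)
 qed
 have d: "((%x. integral {0..x} z) has_vector_derivative z t) (at t within {0..T})" by (rule integral_has_vector_derivative[OF z t])
 have "((%x. 0) has_vector_derivative z t) (at t within {0..T})" by (rule has_vector_derivative_transform[OF t _ d]) (simp add: I)
 thus ?thesis using vector_derivative_unique_within_closed_interval[of 0 T t "%x. 0" "z t" 0] t T by simp
qed

context fractional_order
begin

text \<open>Scaling of time turns the eigenvalue \<open>l\<close> into the dimensionless parameter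
  \<open>l * ta powr al\<close>; in the spectral integral it is the substitution of
  \<open>y / ta\<close> for \<open>y\<close>.\<close>

lemma vx_scale:
 assumes ta: "ta > 0" and l: "l > 0"
 shows "vx l (ta*t) = ta powr al * vx (l*ta powr al) t"
proof (cases "t > 0")
 case False thus ?thesis using ta by (simp add: vx_def mult_nonneg_nonpos)
next
 case True
 define c where "c = ta powr al"
 have c: "c > 0" using ta by (simp add: c_def)
 have K: "kdens al l (y / c) = c*kdens al (l*c) y" if "y > 0" for y
 proof -
  have "(y / c)\<^sup>2 + 2*l*(y / c) * cos (pi*al) + l\<^sup>2 = (y\<^sup>2 + 2*(l*c) * y*cos (pi*al) + (l*c)\<^sup>2) / c\<^sup>2"
   using c by (simp add: field_simps power2_eq_square)
  thus ?thesis using c unfolding kdens_def by (simp add: power2_eq_square)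
 qed
 have "(LBINT y:{0<..}. edens l y * exp (- (ta*t*y))) = (1 / ta)*(LBINT y. indicator {0<..} (0 + 1 / ta*y) *\<^sub>R (edens l (0 + 1 / ta*y) * exp (- (ta*t*(0 + 1 / ta*y)))))"
  unfolding LB_def using ta by (subst lborel_integral_real_affine[of "1 / ta" _ 0]) simp_all
 also have "... = (LBINT y. c*(indicator {0<..} y *\<^sub>R (edens (l*c) y * exp (- (t*y)))))"
  unfolding integral_mult_right_zero[symmetric]
 proof (rule Bochner_Integration.integral_cong[OF refl])
  fix y :: real
  show "(1 / ta)*(indicator {0<..} (0 + 1 / ta*y) *\<^sub>R (edens l (0 + 1 / ta*y) * exp (- (ta*t*(0 + 1 / ta*y))))) = c*(indicator {0<..} y *\<^sub>R (edens (l*c) y * exp (- (t*y))))"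
  proof (cases "y > 0")
   case True
   have "(y / ta) powr al = y powr al / c" using True ta by (simp add: powr_divide c_def)
   thus ?thesis using True ta K[of "y powr al"] by (simp add: edens_def)
  qed (use ta in "simp add: divide_nonpos_pos not_less zero_less_divide_iff")
 qed
 also have "... = c*(LBINT y:{0<..}. edens (l*c) y * exp (- (t*y)))"
  unfolding LB_def by (rule integral_mult_right_zero)
 finally have "(LBINT y:{0<..}. edens l y * exp (- (ta*t*y))) = c*(LBINT y:{0<..}. edens (l*c) y * exp (- (t*y)))" .
 moreover have "ta*t > 0" using True ta by simp
 ultimately show ?thesis using True c l unfolding vx_def c_def[symmetric] by (simp add: right_diff_distrib not_le)
qed

lemma vx_jf_scale:
 assumes ta: "ta > 0" and l: "l > 0"
 shows "conv (vx l) (jf q) (ta*t) = ta powr (al + q) * conv (jf q) (vx (l*ta powr al)) t"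
proof -
 have "conv (vx l) (jf q) (ta*t) = ta*conv (%x. ta powr al * vx (l*ta powr al) x) (%x. ta powr (q - 1) * jf q x) t"
  unfolding conv_scale[OF ta] vx_scale[OF ta l] jf_scale[OF ta] ..
 also have "... = ta*(ta powr al * ta powr (q - 1)) * conv (vx (l*ta powr al)) (jf q) t"
  unfolding conv_def LB_mult[symmetric] by (simp add: mult_ac)
 also have "ta*(ta powr al * ta powr (q - 1)) = ta powr (al + q)"
  using ta powr_add[of ta "al + (q - 1)" 1] by (simp add: powr_add[symmetric])
 finally show ?thesis unfolding conv_commute[of "vx _"] .
qed

text \<open>Variation of constants in integrated form. The equation is convolved with
  \<open>vx l\<close>, and \<open>vx_jf_conv\<close> replaces
  \<open>conv (vx l) (jf (1 - al))\<close>; the outcome is the claim after one integration,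
  \<open>conv (jf 1) z = 0\<close>. As \<open>z\<close> is continuous, the integration can be
  undone.\<close>

lemma mode_exact:
 fixes y y' f g2 :: "real => real" and y0 g0 g1 mu T l :: real
 assumes l: "l > 0" and T: "T > 0" and mu: "mu > -1"
  and y': "SI {0..T} y'" and g2: "SI {0..T} g2"
  and y: "continuous_on {0..T} y" "!!t. t : {0..T} ==> y t = y0 + conv (jf 1) y' t"
  and f: "!!t. t : {0<..<T} ==> f t = g0*jf (mu + 2) t + g1*jf (mu + 3) t + conv (jf (mu + 3)) g2 t"
  and eq: "!!t. t : {0<..<T} ==> conv (jf (1 - al)) y' t + l*y t = f t"
  and t: "t : {0..T}"
 shows "y t = y0*(1 - l * vx l t) + (g0*conv (vx l) (jf (mu + 1)) t + g1*conv (vx l) (jf (mu + 2)) t + conv (conv (vx l) (jf (mu + 2))) g2 t)"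
proof -
 let ?C = "%s. y s - y0"
 let ?B = "jf (mu + 2)"
 let ?A = "jf 1"
 let ?v = "vx l" and ?j = "jf (1 - al)"
 have q: "1 - al > 0" "mu + 1 > 0" "mu + 2 > 0" "mu + 2 >= 1" "mu + 3 >= 1" using al mu by auto
 note cv = continuous_on_vx[OF l]
 have cvA: "continuous_on A ?v" for A by (rule continuous_on_subset[OF cv]) simp
 have mv: "SM {0..M} ?v" for M by (rule SM_cont[OF cvA]) simp
 have Bv: "abs (?v x) <= 1 / l" for x using vx_bounds(1,2)[OF l, of x] by simp
 have v0: "?v x = 0" if "x <= 0" for x using that by (simp add: vx_def)
 have mo: "SM {0..M} ?A" for M unfolding SM_def by measurable
 have Bo: "abs (jf 1 x) <= 1" for x by (simp add: jf_def)
 have ji: "SI {0..T} (jf p)" if "p > 0" for p using jf_integral(1)[OF that] T by simp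
 have vi: "SI {0..T} ?v" by (rule SI_Icc[OF cvA])
 have yi: "SI {0..T} y" by (rule SI_Icc[OF y(1)])
 have ci: "SI {0..T} (%_. c :: real)" for c by (rule SI_Icc[OF continuous_on_const])
 have sub: "SI {0..x} h" if "SI {0..T} h" "x : {0..T}" for h :: "real => real" and x by (rule SI_subset[OF that(1)]) (use that(2) in auto)
 have vh: "SI {0..x} (%s. ?v (x - s) * h s)" if "SI {0..T} h" "x : {0..T}" for h x by (rule SI_reflect[OF cvA sub[OF that]])
 \<comment> \<open>The derivative of the source, one order lower in every kernel, so that
   \<open>f = conv (jf 1) f'\<close>; near \<open>0\<close> it is in general only
   integrable.\<close>
 define f' where "f' s = g0*jf (mu + 1) s + 1*(g1*jf (mu + 2) s + 1*conv ?B g2 s)" for s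
 have cg: "SI {0..T} (conv ?B g2)" by (rule set_integrable_conv[OF ji g2]) (use q in simp)
 have f'2i: "SI {0..T} (%s. g1*jf (mu + 2) s + 1*conv ?B g2 s)" by (intro LB_add(1) SI_mult ji cg) (use q in simp)
 have f'i: "SI {0..T} f'"
  unfolding f'_def by (intro LB_add(1) SI_mult ji f'2i) (use q in simp)
 have oh: "SI {0..x} (%s. jf 1 (x - s) * h s)" if h: "SI {0..T} h" "x : {0..T}" for h x
 proof -
  have "SI {0..x} (%s. (%_. 1) (x - s) * h s)" by (rule SI_reflect[OF continuous_on_const sub[OF h]])
  thus ?thesis
   unfolding SI_def by (subst integrable_discrete_difference[of "{x}"]) (auto simp: indicator_def jf_def)
 qed
 have ff': "f s = conv ?A f' s" if s: "s : {0<..<T}" for s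
 proof -
  have s': "s : {0..T}" using s by auto
  have "conv ?A f' s = g0*conv ?A (jf (mu + 1)) s + 1*(g1*conv ?A ?B s + 1*conv ?A (conv ?B g2) s)"
   unfolding f'_def by (subst conv_linear conv_linear, (intro oh ji cg f'2i s'; use q in simp)+)+ simp
  also have "... = f s"
   using f[OF s] q conv_jf_jf(1)[of 1 "mu + 2" T g2 s, OF _ _ g2] s by (simp add: conv_jf add.commute add.left_commute)
  finally show ?thesis by simp
 qed
 have oy: "y s - y0 = conv ?A y' s" if "s : {0..T}" for s using y(2)[OF that] by simp
 define z where "z s = (y s - y0 + l*y0*?v s) - conv ?v f' s" for s
 have "continuous_on {0..T} z"
  unfolding z_def by (intro continuous_intros y(1) cvA continuous_on_conv[OF cv v0 f'i]) auto
 moreover have "conv ?A z s = 0" if s: "s : {0..T}" for s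
 proof -
  have s1: "s <= T" "s >= 0" using s by auto
  have yy: "conv ?A (conv ?A y') s = conv ?A ?C s" "conv ?v (conv ?A y') s = conv ?v ?C s"
   using s1 by (auto intro!: conv_cong simp: oy)
  have "conv ?v (conv ?j y') s = conv (conv ?v ?j) y' s" by (rule conv_assoc(1)[OF mv Bv ji[OF q(1)] y' s1(1)])
  also have "... = conv (%x. 1*jf 2 x + (- l) * conv ?A ?v x) y' s"
  proof (rule conv_cong)
   fix x assume "0 < x" "x < s"
   thus "conv ?v ?j (s - x) * y' x = (1*jf 2 (s - x) + (- l) * conv ?A ?v (s - x)) * y' x"
    using vx_jf_conv[OF l, of "s - x"] unfolding conv_commute[of ?v ?j] by simp
  qed
  also have "... = conv y' (%x. 1*jf 2 x + (- l) * conv ?A ?v x) s" by (rule conv_commute)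
  also have "... = 1*conv y' (jf 2) s + (- l) * conv y' (conv ?A ?v) s"
  proof (rule conv_linear)
   have r: "SI {0..s} (%x. y' (s - x) * a x)" if a: "continuous_on {0..s} a" for a
   proof -
    have "integrable lborel (%x. indicator {0..s} (s + (- 1) * x) *\<^sub>R (a (s - (s + (- 1) * x)) * y' (s + (- 1) * x)))"
     using SI_reflect[OF a sub[OF y' s]] unfolding SI_def by (intro lborel_integrable_real_affine) auto
    thus ?thesis unfolding SI_def by (rule subst[of _ _ "integrable lborel", rotated]) (auto simp: indicator_def fun_eq_iff)
   qed
   show "SI {0..s} (%x. y' (s - x) * jf 2 x)" by (rule r, rule continuous_on_eq[of _ "%x. x"]) (auto simp: jf_def Gamma_numeral)
   have "continuous_on {0..s} (conv ?v ?A)" by (rule continuous_on_conv[OF cv v0]) (use sub[OF ji s, of 1] in auto)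
   moreover have "conv ?A ?v = conv ?v ?A" by (rule ext) (rule conv_commute)
   ultimately show "SI {0..s} (%x. y' (s - x) * conv ?A ?v x)" by (intro r) (simp only:)
  qed
  also have "conv y' (jf 2) s = conv ?A ?C s"
   using conv_jf_jf(1)[of 1 1 T y' s, OF _ _ y' s1(1)] unfolding yy(1)[symmetric] conv_commute[of y'] by simp
  also have "conv y' (conv ?A ?v) s = conv ?v ?C s"
  proof -
   have "conv y' (conv ?A ?v) s = conv (conv ?v ?A) y' s"
    unfolding conv_commute[of y'] by (rule conv_cong) (simp only: conv_commute[of "jf 1"])
   also have "... = conv ?v (conv ?A y') s" by (rule conv_assoc(1)[OF mv Bv ji y' s1(1), symmetric]) simp
   finally show ?thesis unfolding yy(2) .
  qed
  finally have A: "conv ?v (conv ?j y') s = conv ?A ?C s - l*conv ?v ?C s" by simp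
  have fi: "SI {0..T} (conv ?A f')" by (rule set_integrable_conv[OF ji f'i]) simp
  have "conv ?v (conv ?j y') s = conv ?v (%x. 1*conv ?A f' x + (- l) * y x) s"
  proof (rule conv_cong)
   fix x assume "0 < x" "x < s"
   hence "x : {0<..<T}" using s1 by auto
   hence "conv ?j y' x = 1*conv ?A f' x + (- l) * y x" using eq[of x] ff'[of x] by simp
   thus "?v (s - x) * conv ?j y' x = ?v (s - x)*(1*conv ?A f' x + (- l) * y x)" by (simp only:)
  qed
  also have "... = 1*conv ?v (conv ?A f') s + (- l) * conv ?v y s" by (rule conv_linear[OF vh[OF fi s] vh[OF yi s]])
  finally have B: "conv ?v (conv ?j y') s = conv ?v (conv ?A f') s - l*conv ?v y s" by simp
  have C: "conv ?v ?C s = conv ?v y s - y0*conv ?A ?v s"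
  proof -
   have "conv ?v (%s. 1*y s + (- y0) * 1) s = 1*conv ?v y s + (- y0) * conv ?v (%_. 1) s" by (rule conv_linear[OF vh[OF yi s] vh[OF ci s]])
   moreover have "conv ?v (%_. 1) s = conv ?v ?A s" by (rule conv_cong) (simp add: jf_def)
   ultimately show ?thesis unfolding conv_commute[of ?v "jf 1"] by simp
  qed
  have D: "conv ?v (conv ?A f') s = conv ?A (conv ?v f') s"
  proof -
   have "conv ?v (conv ?A f') s = conv (conv ?v ?A) f' s" by (rule conv_assoc(1)[OF mv Bv ji f'i s1(1)]) simp
   also have "... = conv (conv ?A ?v) f' s" by (rule conv_cong) (simp only: conv_commute[of ?v])
   also have "... = conv ?A (conv ?v f') s" by (rule conv_assoc(1)[OF mo Bo vi f'i s1(1), symmetric])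
   finally show ?thesis .
  qed
  have yd: "SI {0..T} ?C" by (intro LB_diff(1) yi ci)
  have vf: "SI {0..T} (conv ?v f')" by (rule set_integrable_conv[OF vi f'i])
  have "conv ?A z s = conv ?A (%s. 1*(1*(y s - y0) + (l*y0) * ?v s) + (- 1) * conv ?v f' s) s"
   unfolding z_def by simp
  also have "... = 1*(1*conv ?A ?C s + (l*y0) * conv ?A ?v s) + (- 1) * conv ?A (conv ?v f') s"
  proof -
   have "SI {0..T} (%s. 1*(y s - y0) + (l*y0) * ?v s)" by (intro LB_add(1) SI_mult yd vi)
   from conv_linear[OF oh[OF this s] oh[OF vf s]] conv_linear[OF oh[OF yd s] oh[OF vi s]] show ?thesis by (simp only:)
  qed
  also have "... = 0" using A B C D by (simp add: algebra_simps)
  finally show ?thesis .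
 qed
 ultimately have "z t = 0" using t T by (rule primitive_zero_imp_zero)
 moreover have "conv ?v f' t = g0*conv ?v (jf (mu + 1)) t + 1*(g1*conv ?v ?B t + 1*conv ?v (conv ?B g2) t)"
 proof -
  have "conv ?v f' t = g0*conv ?v (jf (mu + 1)) t + 1*conv ?v (%s. g1*jf (mu + 2) s + 1*conv ?B g2 s) t"
   unfolding f'_def by (rule conv_linear[OF vh[OF ji t] vh[OF f'2i t]]) (use q in simp)
  also have "conv ?v (%s. g1*jf (mu + 2) s + 1*conv ?B g2 s) t = g1*conv ?v ?B t + 1*conv ?v (conv ?B g2) t" by (rule conv_linear[OF vh[OF ji t] vh[OF cg t]]) (use q in simp)
  finally show ?thesis .
 qed
 moreover have "conv ?v (conv ?B g2) t = conv (conv ?v ?B) g2 t" by (rule conv_assoc(1)[OF mv Bv ji g2]) (use q t in auto)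
 ultimately show ?thesis unfolding z_def by (simp add: algebra_simps)
qed

end

section \<open>Solution of the scheme and error of a mode\<close>

context fractional_order
begin

text \<open>\<open>jf (q + 2)\<close> is \<open>jf q\<close> convolved with the ramp
  \<open>jf 2\<close>, and translation by \<open>m\<close> commutes with convolution; summation
  assembles the ramps to \<open>Ix\<close>. Sums of samples thus become a genuine convolution, also
  at non-integer \<open>x\<close>.\<close>

lemma res_diff_jf_sum:
 assumes q: "q > 0" and x: "0 <= x" "x <= real n + 1"
 shows "(SUM m<=n. res_diff L m * jf (q + 2) (x - real m)) = conv (jf q) (Ix L) x"
proof -
 have J: "SI {0..x} (%s. jf q (x - s) * max 0 (s - real m))" for m by (rule jf_window(1)[OF q x(1)]) (intro continuous_intros)
 have h: "conv (jf q) (%s. max 0 (s - real m)) x = jf (q + 2) (x - real m)" for m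
 proof (cases "real m <= x")
  case True
  have e: "max 0 (s - real m) = jf 2 (s - real m)" for s by (simp add: jf_def Gamma_numeral)
  have "conv (jf q) (%s. max 0 (s - real m)) x = (LBINT s:{0..real m}. jf q (x - s) * max 0 (s - real m)) + (LBINT s:{real m..x}. jf q (x - s) * max 0 (s - real m))"
   unfolding conv_def by (rule set_integral_split[OF J]) (use True in auto)
  also have "(LBINT s:{0..real m}. jf q (x - s) * max 0 (s - real m)) = (LBINT s:{0..real m}. 0)" by (rule LB_cong) auto
  also have "(LBINT s:{real m..x}. jf q (x - s) * max 0 (s - real m)) = conv (jf q) (jf 2) (x - real m)"
   unfolding conv_def e by (subst set_integral_shift[of 0 "x - real m" _ "real m"]) (simp add: algebra_simps)
  finally show ?thesis using q by (simp add: conv_jf)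
 next
  case False
  have "conv (jf q) (%s. max 0 (s - real m)) x = conv (%_. 0) (%_. 0) x" by (rule conv_cong) (use False in auto)
  thus ?thesis using False by (simp add: conv_def jf_def)
 qed
 have "conv (jf q) (Ix L) x = conv (jf q) (%s. SUM m<=n. res_diff L m * max 0 (s - real m)) x"
 proof (rule conv_cong)
  fix s assume "0 < s" "s < x"
  thus "jf q (x - s) * Ix L s = jf q (x - s)*(SUM m<=n. res_diff L m * max 0 (s - real m))" using x by (subst Ix_eq[of s n]) auto
 qed
 also have "... = (SUM m<=n. res_diff L m * conv (jf q) (%s. max 0 (s - real m)) x)"
 proof -
  have "jf q (x - s)*(SUM m<=n. res_diff L m * max 0 (s - real m)) = (SUM m<=n. res_diff L m * (jf q (x - s) * max 0 (s - real m)))" for s by (simp add: sum_distrib_left mult_ac)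
  hence "conv (jf q) (%s. SUM m<=n. res_diff L m * max 0 (s - real m)) x = (LBINT s:{0..x}. SUM m<=n. res_diff L m * (jf q (x - s) * max 0 (s - real m)))"
   unfolding conv_def by (simp only:)
  also have "... = (SUM m<=n. LBINT s:{0..x}. res_diff L m * (jf q (x - s) * max 0 (s - real m)))"
   using SI_mult[OF J] unfolding LB_def SI_def scaleR_sum_right by (intro Bochner_Integration.integral_sum) auto
  finally show ?thesis unfolding LB_mult conv_def .
 qed
 finally show ?thesis unfolding h by simp
qed

lemma conv_Ix:
 assumes L: "L > 0" and q: "q > 0"
 shows "conv (jf q) (Ix L) x = conv (jf q) (ex L) x + conv (jf q) (vx L) x"
proof (cases "x >= 0")
 case True
 have "SI {0..x} (%s. jf q (x - s) * ex L s)" "SI {0..x} (%s. jf q (x - s) * vx L s)"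
  using continuous_on_subset[OF continuous_on_ex[OF L]] continuous_on_subset[OF continuous_on_vx[OF L]] by (auto intro!: jf_window(1) q True)
 from conv_linear[OF this, of 1 1] show ?thesis by (simp add: ex_def[abs_def])
qed (simp add: conv_def LB_def)

text \<open>The generating functions turn the scheme into a division of power series.\<close>

lemma scheme_solution:
 fixes U :: "int => real" and R :: "nat => real"
 assumes l: "l > 0" and ta: "ta > 0" and U0: "!!k. k <= 0 ==> U k = 0" and R0: "R 0 = 0"
  and eq: "!!n. n : {1..N} ==> ta powr (- al)*(SUM j<=n. cq_weight al j * U (int n - int j)) + (1 - al/2)*(l*U (int n)) + al/2*(l*U (int n - 1))
    = (1 - al/2) * R n + al/2*R (n - 1)"
  and n: "n <= N"
 shows "(3/2*U (int n) - 2*U (int n - 1) + 1/2*U (int n - 2)) / ta = ta powr (al - 1)*(SUM m<=n. res_diff (l*ta powr al) m * R (n - m))"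
proof -
 define L where "L = l*ta powr al"
 have L: "L > 0" using l ta by (simp add: L_def)
 define b where "b j = cq_weight al j + L*crank j" for j
 \<comment> \<open>The candidate obtained by division of power series: \<open>rcoeff L\<close> is
   the quotient of \<open>crank\<close> and \<open>b\<close>.\<close>
 define V where "V n = ta powr al * (SUM m<=n. rcoeff L m * R (n - m))" for n
 have fm: "(Abs_fps f * Abs_fps g) = Abs_fps (%n. SUM m<=n. f m * g (n - m))" for f g :: "nat => real" by (rule fps_ext) (simp add: fps_mult_nth atMost_atLeast0)
 have cR: "(SUM m<=n. crank m * X (n - m)) = (1 - al/2) * X n + al/2*X (n - 1)" if "X 0 = 0" for n and X :: "nat => real"
 proof (cases n)
  case 0 thus ?thesis by (simp add: crank_def that)
 next
  case (Suc k)
  have "(SUM m<=n. crank m * X (n - m)) = (SUM m:{0, 1}. crank m * X (n - m))" by (rule sum.mono_neutral_right) (auto simp: Suc crank_def)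
  thus ?thesis by (simp add: crank_def)
 qed
 have bV: "(SUM j<=n. b j * V (n - j)) = ta powr al * ((1 - al/2) * R n + al/2*R (n - 1))" for n
 proof -
  have "Abs_fps b * Abs_fps V = Abs_fps b * (fps_const (ta powr al)*(Abs_fps (rcoeff L) * Abs_fps R))" by (rule arg_cong[where f = "(*) _"], rule fps_ext) (simp add: fm V_def)
  also have "... = fps_const (ta powr al)*((Abs_fps b * Abs_fps (rcoeff L)) * Abs_fps R)" by (simp add: mult_ac)
  also have "Abs_fps b * Abs_fps (rcoeff L) = Abs_fps crank"
   unfolding fm b_def resolvent_coeff_recurrence[OF L] ..
  finally have "(Abs_fps b * Abs_fps V) $ n = (fps_const (ta powr al)*(Abs_fps crank * Abs_fps R)) $ n" by simp
  thus ?thesis unfolding fm by (simp add: cR[of R, OF R0])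
 qed
 \<comment> \<open>\<open>V\<close> satisfies the same recurrence, and the leading coefficient
   \<open>b 0 = 1 + L * (1 - al/2)\<close> is positive, so each value is determined by the earlier
   ones.\<close>
 have UV: "U (int n) = V n" if "n <= N" for n
  using that
 proof (induction n rule: less_induct)
  case (less n)
  show ?case
  proof (cases "n = 0")
   case True thus ?thesis using U0[of 0] by (simp add: V_def R0)
  next
   case False
   define X where "X k = U (int k)" for k
   have X0: "X 0 = 0" using U0[of 0] by (simp add: X_def)
   have t: "ta powr al * ta powr (- al) = 1" using ta by (simp flip: powr_add)
   have n1: "int n - 1 = int (n - 1)" using False by simp
   have s: "(SUM j<=n. cq_weight al j * U (int n - int j)) = (SUM j<=n. cq_weight al j * X (n - j))" by (rule sum.cong) (simp_all add: X_def of_nat_diff)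
   have "(SUM j<=n. b j * X (n - j)) = (SUM j<=n. cq_weight al j * X (n - j)) + L*((1 - al/2) * X n + al/2*X (n - 1))"
    unfolding cR[of X, OF X0, symmetric] by (simp add: b_def distrib_right sum.distrib sum_distrib_left mult.assoc)
   also have "... = ta powr al * (ta powr (- al)*(SUM j<=n. cq_weight al j * X (n - j)) + (1 - al/2)*(l*X n) + al/2*(l*X (n - 1)))"
    using t by (simp add: L_def algebra_simps)
   also have "... = ta powr al * ((1 - al/2) * R n + al/2*R (n - 1))"
    using eq[of n] False less.prems unfolding s n1 X_def by simp
   finally have "(SUM j<=n. b j * X (n - j)) = (SUM j<=n. b j * V (n - j))" unfolding bV .
   moreover have "(SUM j<=n. b j * Y (n - j)) = b 0 * Y n + (SUM j:{1..n}. b j * Y (n - j))" for Y :: "nat => real" by (simp add: atMost_atLeast0 sum.atLeast_Suc_atMost)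
   moreover have "(SUM j:{1..n}. b j * X (n - j)) = (SUM j:{1..n}. b j * V (n - j))" by (rule sum.cong[OF refl]) (use less False in "simp add: X_def del: of_nat_diff")
   ultimately have "b 0 * X n = b 0 * V n" by simp
   moreover have "b 0 > 0" using L al by (simp add: b_def crank_def add_pos_pos)
   ultimately show ?thesis by (simp add: X_def)
  qed
 qed
 have U: "U (int n - int k) = (if k <= n then V (n - k) else 0)" for k
  using UV[of "n - k"] n U0[of "int n - int k"] by (auto simp: of_nat_diff)
 have "3/2*U (int n) - 2*U (int n - 1) + 1/2*U (int n - 2) = 3/2*V n - 2*(if n >= 1 then V (n - 1) else 0) + 1/2*(if n >= 2 then V (n - 2) else 0)"
  using U[of 0] U[of 1] U[of 2] by simp
 also have "... = ta powr al * (SUM m<=n. res_diff L m * R (n - m))"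
 proof -
  let ?d = "[3/2, -2, 1/2] :: real list"
  define d where "d k = (if k = 0 then 3/2 else if k = 1 then -2 else if k = 2 then 1/2 else 0 :: real)" for k :: nat
  have dX: "(SUM m<=n. d m * X (n - m)) = 3/2*X n - 2*(if n >= 1 then X (n - 1) else 0) + 1/2*(if n >= 2 then X (n - 2) else 0)" for X and n
  proof -
   have "(SUM m<=n. d m * X (n - m)) = (SUM m:{0,1,2} \<inter> {..n}. d m * X (n - m))" by (rule sum.mono_neutral_right) (auto simp: d_def)
   also have "{0,1,2} \<inter> {..n} = {0} \<union> (if n >= 1 then {1} else {}) \<union> (if n >= 2 then {2} else {})" by auto
   finally show ?thesis by (simp add: d_def)
  qed
  have "Abs_fps d * (fps_const (ta powr al)*(Abs_fps (rcoeff L) * Abs_fps R)) = fps_const (ta powr al)*((Abs_fps d * Abs_fps (rcoeff L)) * Abs_fps R)" by (simp add: mult_ac)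
  moreover have "fps_const (ta powr al)*(Abs_fps (rcoeff L) * Abs_fps R) = Abs_fps V" by (rule fps_ext) (simp add: fm V_def)
  moreover have "Abs_fps d * Abs_fps (rcoeff L) = Abs_fps (res_diff L)"
   unfolding fm dX by (simp add: res_diff_def[abs_def])
  ultimately have "(Abs_fps d * Abs_fps V) $ n = (fps_const (ta powr al)*(Abs_fps (res_diff L) * Abs_fps R)) $ n" by (simp only:)
  thus ?thesis unfolding fm by (simp add: dX)
 qed
 finally show ?thesis using ta unfolding L_def by (simp add: powr_diff)
qed

text \<open>\<open>start_kernel\<close> is \<open>jf (3 - al)\<close>, two orders above
  \<open>jf (1 - al)\<close>, so \<open>res_diff_jf_sum\<close> with \<open>q = 1 - al\<close>
  applies to each of the three translates in \<open>bdf2\<close>. The powers of \<open>ta\<close>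
  cancel, leaving an expression in \<open>L\<close> and \<open>n\<close> alone.\<close>

lemma scheme_start_term:
 assumes L: "L > 0" and ta: "ta > 0"
 shows "ta powr (al - 1)*(SUM m<=n. res_diff L m * bdf2 ta (start_kernel al) (real (n - m) * ta))
  = bdf_conv_ex L (real n) + (3/2*W L (real n) - 2*W L (real n - 1) + 1/2*W L (real n - 2))"
proof -
 let ?A = "1 - al + 2"
 have q: "1 - al > 0" using al by simp
 have k: "start_kernel al t = jf ?A t" for t by (simp add: start_kernel_def jf_def)
 have b: "bdf2 ta (start_kernel al) (real (n - m) * ta) = ta powr (1 - al)*(3/2*jf ?A (real n - real m) - 2*jf ?A (real n - 1 - real m) + 1/2*jf ?A (real n - 2 - real m))" if "m <= n" for m
 proof -
  have j: "jf ?A (real (n - m) * ta - c*ta) = ta powr (1 - al + 2 - 1) * jf ?A (real n - c - real m)" for c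
   using jf_scale[OF ta, of "1 - al + 2" "real n - c - real m"] that by (simp add: of_nat_diff algebra_simps)
  have "(1 / ta) * ta powr (1 - al + 2 - 1) = ta powr (1 - al)" using ta powr_diff[of ta "1 - al + 2 - 1" 1] by simp
  moreover have "(1 / ta) *\<^sub>R ((3/2) *\<^sub>R (p*a) - 2 *\<^sub>R (p*b) + (1/2) *\<^sub>R (p*c)) = ((1 / ta) * p)*(3/2*a - 2*b + 1/2*c)" for p a b c :: real by (simp add: algebra_simps)
  ultimately show ?thesis unfolding bdf2_def k using j[of 0] j[of 1] j[of 2] by (simp only: mult_1 mult_zero_left diff_0_right)
 qed
 have S: "(SUM m<=n. res_diff L m * jf ?A (x - real m)) = conv (jf (1 - al)) (ex L) x + W L x" if "x <= real n" for x
 proof (cases "x >= 0")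
  case True thus ?thesis using res_diff_jf_sum[OF q True, of n L] conv_Ix[OF L q, of x] that by (simp add: W_def)
 next
  case False thus ?thesis by (simp add: W_def conv_def jf_def LB_def)
 qed
 have "ta powr (al - 1)*(SUM m<=n. res_diff L m * bdf2 ta (start_kernel al) (real (n - m) * ta))
  = (ta powr (al - 1) * ta powr (1 - al))*(SUM m<=n. res_diff L m * (3/2*jf ?A (real n - real m) - 2*jf ?A (real n - 1 - real m) + 1/2*jf ?A (real n - 2 - real m)))"
  unfolding mult.assoc sum_distrib_left by (rule sum.cong[OF refl]) (simp only: atMost_iff b, simp only: mult_ac)
 also have "ta powr (al - 1) * ta powr (1 - al) = 1" using ta by (simp flip: powr_add)
 also have "(SUM m<=n. res_diff L m * (3/2*jf ?A (real n - real m) - 2*jf ?A (real n - 1 - real m) + 1/2*jf ?A (real n - 2 - real m)))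
  = 3/2*(SUM m<=n. res_diff L m * jf ?A (real n - real m)) - 2*(SUM m<=n. res_diff L m * jf ?A (real n - 1 - real m))
   + 1/2*(SUM m<=n. res_diff L m * jf ?A (real n - 2 - real m))"
  unfolding sum_distrib_left sum.distrib[symmetric] sum_subtractf[symmetric] by (rule sum.cong) (simp_all add: algebra_simps)
 finally show ?thesis using S[of "real n"] S[of "real n - 1"] S[of "real n - 2"] unfolding bdf_conv_ex_def by (simp add: add_divide_distrib)
qed

lemma scheme_source_term:
 assumes ta: "ta > 0" and q: "q > 0"
 shows "ta powr (al - 1)*(SUM m<=n. res_diff L m * jf (q + 2) (real (n - m) * ta)) = ta powr (al + q) * conv (jf q) (Ix L) (real n)"
proof -
 have "jf (q + 2) (real (n - m) * ta) = ta powr (q + 1) * jf (q + 2) (real n - real m)" if "m <= n" for m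
  using jf_scale[OF ta, of "q + 2" "real n - real m"] that by (simp add: of_nat_diff mult.commute add.commute)
 hence "ta powr (al - 1)*(SUM m<=n. res_diff L m * jf (q + 2) (real (n - m) * ta)) = (ta powr (al - 1) * ta powr (q + 1))*(SUM m<=n. res_diff L m * jf (q + 2) (real n - real m))"
  unfolding mult.assoc sum_distrib_left by (intro sum.cong) (simp_all add: mult_ac)
 also have "ta powr (al - 1) * ta powr (q + 1) = ta powr (al + q)" by (simp flip: powr_add)
 finally show ?thesis using res_diff_jf_sum[OF q, of "real n" n L] by simp
qed

text \<open>As \<open>jf\<close> vanishes at negative arguments, all samples of the convolution are
  integrals over the same interval. The finite sum then moves under the integral, where
  \<open>res_diff_jf_sum\<close> is used at the points \<open>real n - s / ta\<close>.\<close>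

lemma scheme_source_conv:
 assumes ta: "ta > 0" and q: "q > 0" and g: "SI {0..real n * ta} g"
 shows "ta powr (al - 1)*(SUM m<=n. res_diff L m * conv (jf (q + 2)) g (real (n - m) * ta))
  = (LBINT s:{0..real n * ta}. ta powr (al + q) * conv (jf q) (Ix L) (real n - s / ta) * g s)"
proof -
 have cj: "continuous_on UNIV (jf (q + 2))"
 proof -
  define c where "c = 1 / Gamma (q + 2)"
  have "jf (q + 2) x = max 0 x powr (q + 1) * c" for x using q by (auto simp: c_def jf_def max_def add.commute)
  hence "jf (q + 2) = (%x. max 0 x powr (q + 1) * c)" by auto
  thus ?thesis using q by (auto intro!: continuous_intros continuous_on_powr')
 qed
 have c: "conv (jf (q + 2)) g (real (n - m) * ta) = (LBINT s:{0..real n * ta}. jf (q + 2) (real (n - m) * ta - s) * g s)" for m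
  unfolding conv_def LB_def
 proof (rule Bochner_Integration.integral_cong[OF refl])
  fix s
  have "real (n - m) * ta <= real n * ta" using ta by (intro mult_right_mono) auto
  thus "indicator {0..real (n - m) * ta} s *\<^sub>R (jf (q + 2) (real (n - m) * ta - s) * g s) = indicator {0..real n * ta} s *\<^sub>R (jf (q + 2) (real (n - m) * ta - s) * g s)" by (auto simp: indicator_def jf_def)
 qed
 have i: "SI {0..real n * ta} (%s. jf (q + 2) (real (n - m) * ta - s) * g s)" for m
 proof -
  have "continuous_on {0..real n * ta} (%x. jf (q + 2) (x + (real (n - m) * ta - real n * ta)))" by (rule continuous_on_compose2[OF cj]) (auto intro!: continuous_intros)
  from SI_reflect[OF this g] show ?thesis by (simp add: algebra_simps)
 qed
 have i': "SI {0..real n * ta} (%s. r*(jf (q + 2) (real (n - m) * ta - s) * g s))" for m r by (rule SI_mult[OF i])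
 have "ta powr (al - 1)*(SUM m<=n. res_diff L m * conv (jf (q + 2)) g (real (n - m) * ta))
   = (SUM m<=n. LBINT s:{0..real n * ta}. (ta powr (al - 1) * res_diff L m)*(jf (q + 2) (real (n - m) * ta - s) * g s))"
  unfolding c LB_mult sum_distrib_left mult.assoc ..
 also have "... = (LBINT s:{0..real n * ta}. SUM m<=n. (ta powr (al - 1) * res_diff L m)*(jf (q + 2) (real (n - m) * ta - s) * g s))"
  unfolding LB_def scaleR_sum_right by (rule Bochner_Integration.integral_sum[symmetric]) (rule i'[unfolded SI_def])
 also have "... = (LBINT s:{0..real n * ta}. ta powr (al + q) * conv (jf q) (Ix L) (real n - s / ta) * g s)"
 proof (rule LB_cong, simp, intro allI impI)
  fix s assume s: "s : {0..real n * ta}"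
  let ?x = "real n - s / ta"
  have "0 <= s / ta" "s / ta <= real n" using s ta by (auto simp: pos_divide_le_eq)
  hence x: "0 <= ?x" "?x <= real n + 1" by linarith+
  have "jf (q + 2) (real (n - m) * ta - s) = ta powr (q + 1) * jf (q + 2) (?x - real m)" if "m <= n" for m
  proof -
   have "real (n - m) * ta - s = ta*(?x - real m)" using that ta by (simp add: of_nat_diff algebra_simps)
   thus ?thesis by (simp add: jf_scale[OF ta] add.commute)
  qed
  hence "(SUM m<=n. (ta powr (al - 1) * res_diff L m)*(jf (q + 2) (real (n - m) * ta - s) * g s))
   = (ta powr (al - 1) * ta powr (q + 1))*(SUM m<=n. res_diff L m * jf (q + 2) (?x - real m)) * g s"
   unfolding sum_distrib_left sum_distrib_right by (intro sum.cong) (simp_all add: mult_ac)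
  also have "ta powr (al - 1) * ta powr (q + 1) = ta powr (al + q)" by (simp flip: powr_add)
  finally show "(SUM m<=n. (ta powr (al - 1) * res_diff L m)*(jf (q + 2) (real (n - m) * ta - s) * g s)) = ta powr (al + q) * conv (jf q) (Ix L) ?x * g s"
   unfolding res_diff_jf_sum[OF q x] .
 qed
 finally show ?thesis .
qed

text \<open>Exact minus discrete solution for the initial value 1 without source; the last bracket
  is the discrete one.\<close>

definition errA :: "real => real => real" where
 "errA L n = 1 - L * vx L n - (bdf_conv_ex L n + (3/2*W L n - 2*W L (n - 1) + 1/2*W L (n - 2)))"

text \<open>Exact minus discrete response to the source \<open>jf (q + 1)\<close>. It is defined
  between grid points as well, because it also serves as convolution kernel against the second
  derivative of \<open>g\<close>.\<close>

definition errS :: "real => real => real => real => real" where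
 "errS ta q L x = - (ta powr (al + q) * conv (jf q) (ex L) (x / ta))"

lemma errA_bound: "EX C>0. ALL L>0. ALL ta>0. ALL n>=1. abs (errA L n) <= C*(ta\<^sup>2*(n*ta) powr - 2)"
proof -
 obtain C where C: "C > 0" "!!L n. L > 0 ==> n >= 1 ==> abs (- errA L n) <= C*n powr - 2"
  using homogeneous_error_bound unfolding errA_def minus_diff_eq by blast
 have "ta\<^sup>2*(n*ta) powr - 2 = n powr - 2" if "ta > 0" "n >= 1" for ta n :: real
  using that by (simp add: powr_mult powr_minus_divide)
 thus ?thesis using C by (metis abs_minus_cancel)
qed

lemma errS_bound:
 assumes "q > 0"
 shows "EX C>0. ALL L>0. ALL ta>0. ALL x>0. abs (errS ta q L x) <= C*(ta\<^sup>2*x powr (q + al - 2))"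
proof -
 obtain C where C: "C > 0" "!!L t. L > 0 ==> t > 0 ==> abs (conv (jf q) (ex L) t) <= C*t powr (q + al - 2)"
  using source_error_bound[OF assms] by blast
 show ?thesis
 proof (intro exI[of _ C] conjI allI impI)
  fix L ta x :: real assume *: "L > 0" "ta > 0" "x > 0"
  have "abs (errS ta q L x) <= ta powr (al + q)*(C*(x / ta) powr (q + al - 2))"
   using C(2)[of L "x / ta"] * by (simp add: errS_def abs_mult mult_left_mono)
  also have "... = C*((ta powr (al + q) / ta powr (q + al - 2)) * x powr (q + al - 2))" using * by (simp add: powr_divide)
  also have "ta powr (al + q) / ta powr (q + al - 2) = ta\<^sup>2" using * by (simp add: powr_diff[symmetric] powr_numeral)
  finally show "abs (errS ta q L x) <= C*(ta\<^sup>2*x powr (q + al - 2))" .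
 qed (rule C)
qed

text \<open>Both solutions are superpositions of the responses to \<open>y0\<close>,
  \<open>g0\<close>, \<open>g1\<close> and \<open>g2\<close>. Splitting \<open>Ix\<close> into
  \<open>ex\<close> and \<open>vx\<close> in the discrete one, the parts with \<open>vx\<close>
  cancel, after scaling, against \<open>mode_exact\<close>.\<close>

lemma mode_error:
 fixes y y' f g2 :: "real => real" and U :: "int => real"
 assumes l: "l > 0" and ta: "ta > 0" and T: "T > 0" and mu: "mu > -1"
  and y': "SI {0..T} y'" and g2: "SI {0..T} g2"
  and y: "continuous_on {0..T} y" "!!t. t : {0..T} ==> y t = y0 + conv (jf 1) y' t"
  and f: "!!t. t : {0<..<T} ==> f t = g0*jf (mu + 2) t + g1*jf (mu + 3) t + conv (jf (mu + 3)) g2 t"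
  and eq: "!!t. t : {0<..<T} ==> conv (jf (1 - al)) y' t + l*y t = f t"
  and U0: "!!k. k <= 0 ==> U k = 0"
  and F: "!!k. k <= N ==> F k = g0*jf (mu + 3) (real k * ta) + g1*jf (mu + 4) (real k * ta) + conv (jf (mu + 4)) g2 (real k * ta)"
  and sch: "!!n. n : {1..N} ==> ta powr (- al)*(SUM j<=n. cq_weight al j * U (int n - int j)) + (1 - al/2)*(l*U (int n)) + al/2*(l*U (int n - 1))
    = (1 - al/2)*(F n + bdf2 ta (start_kernel al) (real n * ta) * y0) + al/2*(F (n - 1) + bdf2 ta (start_kernel al) (real (n - 1) * ta) * y0)"
  and n: "n <= N" "real n * ta : {0..T}"
 shows "y (real n * ta) - (3/2*U (int n) - 2*U (int n - 1) + 1/2*U (int n - 2)) / ta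
  = y0*errA (l*ta powr al) (real n) + g0*errS ta (mu + 1) (l*ta powr al) (real n * ta) + g1*errS ta (mu + 2) (l*ta powr al) (real n * ta)
   + conv (errS ta (mu + 2) (l*ta powr al)) g2 (real n * ta)"
proof -
 let ?A = "jf (mu + 2)"
 define L where "L = l*ta powr al"
 define t where "t = real n * ta"
 have L: "L > 0" using l ta by (simp add: L_def)
 have q: "mu + 1 > 0" "mu + 2 > 0" using mu by auto
 have gt: "SI {0..t} g2" by (rule SI_subset[OF g2]) (use n in "auto simp: t_def")
 have tt: "t / ta = real n" using ta by (simp add: t_def)
 define R where "R k = F k + bdf2 ta (start_kernel al) (real k * ta) * y0" for k
 have "conv (jf (mu + 4)) g2 0 = conv (%_. 0) (%_. 0) 0" by (rule conv_cong) simp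
 hence "R 0 = 0" using ta by (simp add: R_def F jf_def bdf2_def start_kernel_def conv_def[of "%_. 0"])
 hence "(3/2*U (int n) - 2*U (int n - 1) + 1/2*U (int n - 2)) / ta = ta powr (al - 1)*(SUM m<=n. res_diff L m * R (n - m))"
  unfolding L_def by (intro scheme_solution[OF l ta U0 _ _ n(1)] sch[folded R_def])
 also have "(SUM m<=n. res_diff L m * R (n - m)) = (SUM m<=n. res_diff L m * bdf2 ta (start_kernel al) (real (n - m) * ta)) * y0
   + g0*(SUM m<=n. res_diff L m * jf (mu + 1 + 2) (real (n - m) * ta)) + g1*(SUM m<=n. res_diff L m * jf (mu + 2 + 2) (real (n - m) * ta))
   + (SUM m<=n. res_diff L m * conv (jf (mu + 2 + 2)) g2 (real (n - m) * ta))"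
  unfolding sum_distrib_left sum_distrib_right sum.distrib[symmetric] by (rule sum.cong[OF refl]) (use n in "simp add: R_def F algebra_simps del: of_nat_diff")
 finally have ut: "(3/2*U (int n) - 2*U (int n - 1) + 1/2*U (int n - 2)) / ta
  = (1 - L * vx L (real n) - errA L (real n)) * y0 + g0*(ta powr (al + (mu + 1)) * conv (jf (mu + 1)) (Ix L) (real n)) + g1*(ta powr (al + (mu + 2)) * conv ?A (Ix L) (real n))
   + (LBINT s:{0..t}. ta powr (al + (mu + 2)) * conv ?A (Ix L) (real n - s / ta) * g2 s)"
  using scheme_start_term[OF L ta, of n] scheme_source_term[OF ta q(1), where n = n and L = L] scheme_source_term[OF ta q(2), where n = n and L = L] scheme_source_conv[OF ta q(2) gt[unfolded t_def], where L = L]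
  unfolding errA_def t_def by (simp add: distrib_left right_diff_distrib mult_ac)
 have sc: "conv (vx l) (jf p) (t - s) = ta powr (al + p) * conv (jf p) (vx L) (real n - s / ta)" for p s
  using vx_jf_scale[OF ta l, of p "real n - s / ta"] ta by (simp add: L_def t_def algebra_simps)
 have E: "errS ta p L (t - s) = conv (vx l) (jf p) (t - s) - ta powr (al + p) * conv (jf p) (Ix L) (real n - s / ta)" if "p > 0" for p s
  unfolding sc errS_def diff_divide_distrib tt conv_Ix[OF L that] by (simp add: algebra_simps)
 have i: "SI {0..t} (%s. conv ?A ph (real n - s / ta) * g2 s)" if ph: "continuous_on UNIV ph" "!!x. x <= 0 ==> ph x = 0" for ph
 proof -
  have "continuous_on {0..real n} (conv ph ?A)" by (rule continuous_on_conv[OF ph jf_integral(1)]) (use q in auto)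
  moreover have "conv ph ?A = conv ?A ph" by (rule ext) (rule conv_commute)
  ultimately have "continuous_on {0..t} (%x. conv ?A ph (x / ta))"
   using ta by (intro continuous_on_compose2[of "{0..real n}" "conv ?A ph" _ "%x. x / ta"]) (auto intro!: continuous_intros simp: t_def pos_divide_le_eq)
  from SI_reflect[OF this gt] show ?thesis by (simp add: diff_divide_distrib tt)
 qed
 have i1: "SI {0..t} (%s. conv (vx l) ?A (t - s) * g2 s)"
  unfolding sc using SI_mult[OF i[OF continuous_on_vx[OF L]], of "ta powr (al + (mu + 2))"] by (simp add: vx_def mult.assoc)
 have i2: "SI {0..t} (%s. ta powr (al + (mu + 2)) * conv ?A (Ix L) (real n - s / ta) * g2 s)"
  using SI_mult[OF i[OF continuous_on_Ix], of "ta powr (al + (mu + 2))" L] by (simp add: Ix_def mult.assoc max_def sum.neutral)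
 have "conv (errS ta (mu + 2) L) g2 t = conv (conv (vx l) ?A) g2 t - (LBINT s:{0..t}. ta powr (al + (mu + 2)) * conv ?A (Ix L) (real n - s / ta) * g2 s)"
  unfolding conv_def[of "errS _ _ _"] E[OF q(2)] left_diff_distrib using LB_diff(2)[OF i1 i2] by (simp only: conv_def)
 moreover have "y t = y0*(1 - l * vx l t) + (g0*conv (vx l) (jf (mu + 1)) t + g1*conv (vx l) ?A t + conv (conv (vx l) ?A) g2 t)" by (rule mode_exact[OF l T mu y' g2 y f eq]) (use n in "auto simp: t_def")
 moreover have "l * vx l t = L * vx L (real n)" using vx_scale[OF ta l, of "real n"] by (simp add: t_def L_def mult.commute)
 moreover have "Y - ((1 - w - A) * y0 + g0*c0 + g1*c1 + I) = y0*A + g0*e0 + g1*e1 + e2"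
  if "e2 = k - I" "Y = y0*(1 - v) + (g0*a0 + g1*a1 + k)" "v = w" "e0 = a0 - c0" "e1 = a1 - c1" for Y v w A c0 c1 I e0 e1 e2 a0 a1 k :: real by (simp add: that algebra_simps)
 ultimately show ?thesis
  unfolding L_def[symmetric] t_def[symmetric] ut using E[OF q(1), of 0] E[OF q(2), of 0] by (simp only: diff_0_right div_0)
qed

end

section \<open>Smooth cutoff functions and weak derivatives in time\<close>

text \<open>The family is closed under differentiation, which changes only the polynomial. Carrying
  \<open>p\<close> along replaces an induction on the order of the derivative.\<close>

definition flat :: "real poly => real => real" where
 "flat p x = (if x <= 0 then 0 else poly p (1 / x) * exp (- (1 / x)))"

lemma flat_tendsto_0: "(flat p \<longlongrightarrow> 0) (at 0)"
proof -
 have "((%y. poly p y * exp (- y)) \<longlongrightarrow> (SUM i<=degree p. coeff p i * 0)) at_top"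
  unfolding poly_altdef sum_distrib_right mult.assoc exp_minus unfolding divide_inverse[symmetric] by (intro tendsto_intros tendsto_power_div_exp_0)
 hence "((%y. poly p y * exp (- y)) \<longlongrightarrow> 0) at_top" by simp
 hence "((%x. poly p (inverse x) * exp (- inverse x)) \<longlongrightarrow> 0) (at_right 0)"
  using filterlim_inverse_at_top_right by (rule filterlim_compose)
 moreover have "\<forall>\<^sub>F x in at_right 0. poly p (inverse x) * exp (- inverse x) = flat p x" by (auto simp: eventually_at_filter flat_def divide_inverse)
 ultimately have "(flat p \<longlongrightarrow> 0) (at_right 0)" by (rule Lim_transform_eventually)
 moreover have "(flat p \<longlongrightarrow> 0) (at_left 0)" by (rule Lim_transform_eventually[OF tendsto_const]) (auto simp: eventually_at_filter flat_def)
 ultimately show ?thesis by (simp add: filterlim_split_at_real)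
qed

lemma DERIV_flat: "(flat p has_real_derivative flat ([:0, 0, 1:] * (p - pderiv p)) x) (at x)"
proof -
 consider "x < 0" | "x = 0" | "x > 0" by linarith
 thus ?thesis
 proof cases
  case 1
  have "\<forall>\<^sub>F y in nhds x. flat p y = 0" using eventually_nhds_in_open[of "{..<0}" x] 1 by (auto elim!: eventually_mono simp: flat_def)
  thus ?thesis using 1 by (subst DERIV_cong_ev[OF refl _ refl, of _ "%_. 0"]) (auto simp: flat_def)
 next
  case 2
  have "flat p h / h = flat (pCons 0 p) h" for h by (auto simp: flat_def)
  thus ?thesis unfolding 2 DERIV_def using flat_tendsto_0[of "pCons 0 p"] by (simp add: flat_def[of _ 0])
 next
  case 3
  have "\<forall>\<^sub>F y in nhds x. flat p y = poly p (1 / y) * exp (- (1 / y))"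
   using eventually_nhds_in_open[of "{0<..}" x] 3 by (auto elim!: eventually_mono simp: flat_def)
  moreover have "((%y. poly p (1 / y) * exp (- (1 / y))) has_real_derivative flat ([:0, 0, 1:] * (p - pderiv p)) x) (at x)"
   using 3 by (auto intro!: derivative_eq_intros DERIV_chain2[OF poly_DERIV] simp: flat_def field_simps power2_eq_square)
  ultimately show ?thesis by (subst DERIV_cong_ev[OF refl _ refl]) auto
 qed
qed

lemma flat_bounds: "0 <= flat 1 x" "flat 1 x <= 1" "x <= 0 ==> flat 1 x = 0" "x > 0 ==> flat 1 x > 0" by (auto simp: flat_def)

text \<open>A class closed under partial derivatives, which is an invariant for the coinductive
  predicate \<open>smooth\<close>; it contains products of one-dimensional cutoffs in arbitrary
  directions.\<close>

inductive elem :: "('a::euclidean_space => real) => bool" where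
 elem_flat: "elem (%x. flat p (inner a x + b))"
| elem_const: "elem (%x. c)"
| elem_mult: "elem f ==> elem g ==> elem (%x. f x * g x)"
| elem_add: "elem f ==> elem g ==> elem (%x. f x + g x)"

lemma elem_deriv: "elem f ==> (ALL x. f differentiable at x) & (ALL i. elem (%x. frechet_derivative f (at x) i))"
proof (induction rule: elem.induct)
 case (elem_flat p a b)
 have d: "((%x. flat p (inner a x + b)) has_derivative (%h. flat ([:0, 0, 1:] * (p - pderiv p)) (inner a x + b) * inner a h)) (at x)" for x by (rule has_derivative_compose[OF _ DERIV_flat[unfolded has_field_derivative_def]]) (auto intro!: derivative_eq_intros)
 show ?case
  using d by (auto simp: differentiable_def frechet_derivative_at[OF d, symmetric] intro!: elem.intros)
next
 case (elem_const c)
 thus ?case by (auto intro: elem.intros)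
next
 case (elem_mult f g)
 hence d: "((%x. f x * g x) has_derivative (%h. f x * frechet_derivative g (at x) h + frechet_derivative f (at x) h * g x)) (at x)" for x by (intro has_derivative_mult) (auto simp: frechet_derivative_works)
 show ?case
  using d elem_mult by (auto simp: differentiable_def[of "%x. f x * g x"] frechet_derivative_at[OF d, symmetric] intro!: elem.intros)
next
 case (elem_add f g)
 hence d: "((%x. f x + g x) has_derivative (%h. frechet_derivative f (at x) h + frechet_derivative g (at x) h)) (at x)" for x by (intro has_derivative_add) (auto simp: frechet_derivative_works)
 show ?case
  using d elem_add by (auto simp: differentiable_def[of "%x. f x + g x"] frechet_derivative_at[OF d, symmetric] intro!: elem.intros)
qed

lemma smooth_elem: "elem f ==> smooth f" by (coinduction arbitrary: f) (use elem_deriv in blast)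

lemma smooth_linear_combination: "smooth f ==> smooth g ==> smooth (%x. r*f x + s*g x)"
proof (coinduction arbitrary: f g)
 case smooth
 hence df: "f differentiable at x" "g differentiable at x" for x by (auto elim: smooth.cases)
 hence d: "((%x. r*f x + s*g x) has_derivative (%h. r*frechet_derivative f (at x) h + s*frechet_derivative g (at x) h)) (at x)" for x by (intro has_derivative_add has_derivative_mult_right) (auto simp: frechet_derivative_works)
 have "smooth (%x. frechet_derivative f (at x) i)" "smooth (%x. frechet_derivative g (at x) i)" if "i : Basis" for i
  using smooth that by (auto elim: smooth.cases)
 hence "EX f' g'. (%x. frechet_derivative (%x. r*f x + s*g x) (at x) i) = (%x. r*f' x + s*g' x) & smooth f' & smooth g'" if "i : Basis" for i
  using that unfolding frechet_derivative_at[OF d, symmetric] by (intro exI[of _ "%x. frechet_derivative f (at x) i"] exI[of _ "%x. frechet_derivative g (at x) i"]) simp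
 thus ?case using d unfolding differentiable_def by (intro exI[of _ "%x. r*f x + s*g x"]) blast
qed

lemma smooth_real:
 assumes "!!x. (f has_real_derivative f' x) (at x)" "smooth f'"
 shows "smooth f"
proof (rule smooth.intros)
 have d: "(f has_derivative (%h. f' x * h)) (at x)" for x using assms(1)[of x] by (simp add: has_field_derivative_def)
 show "ALL x. f differentiable at x" using d by (auto simp: differentiable_def)
 show "ALL i:Basis. smooth (%x. frechet_derivative f (at x) i)" using assms(2) by (simp add: frechet_derivative_at[OF d, symmetric])
qed

definition bump :: "real => real" where "bump x = flat 1 x * flat 1 (1 - x)"

text \<open>A smooth transition, left without normalisation: the plateau \<open>step 1\<close> is
  positive and is divided out at the end of its use.\<close>

definition step :: "real => real" where "step x = integral {0..x} bump"

lemma bump: "continuous_on UNIV bump" "0 <= bump x" "bump x <= 1" "x \<notin> {0<..<1} ==> bump x = 0" "x : {0<..<1} ==> bump x > 0"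
proof -
 have "isCont (flat 1) x" for x using DERIV_flat by (rule DERIV_isCont)
 hence c: "continuous_on UNIV (flat 1)" by (intro continuous_at_imp_continuous_on ballI)
 have "continuous_on UNIV (%x. flat 1 (1 - x))" by (rule continuous_on_compose2[OF c]) (auto intro!: continuous_intros)
 with c show "continuous_on UNIV bump" unfolding bump_def by (rule continuous_on_mult)
 show "0 <= bump x" "bump x <= 1" unfolding bump_def using flat_bounds by (auto intro!: mult_le_one)
 show "x \<notin> {0<..<1} ==> bump x = 0" unfolding bump_def using flat_bounds(3)[of x] flat_bounds(3)[of "1 - x"] by auto
 show "x : {0<..<1} ==> bump x > 0" unfolding bump_def by (intro mult_pos_pos flat_bounds(4)) auto
qed

lemma step: "(step has_real_derivative bump x) (at x)" "x <= 0 ==> step x = 0" "x >= 1 ==> step x = step 1"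
 "step 1 > 0" "0 <= step x" "step x <= step 1" "(LBINT x. bump x) = step 1" "integrable lborel bump"
proof -
 have c: "continuous_on A bump" for A using bump(1) continuous_on_subset by blast
 have i: "bump integrable_on {a..b}" for a b by (rule integrable_continuous_real[OF c])
 have z: "integral {a..0} bump = 0" for a
  using integral_cong[of "{a..0}" bump "%_. 0"] bump(4) by simp
 \<comment> \<open>A base point below \<open>0\<close> and below \<open>x\<close>. As
   \<open>bump\<close> vanishes on the negative axis, integration from there also gives
   \<open>step\<close> at negative arguments, and \<open>x\<close> becomes an interior
   point.\<close>
 define c0 where "c0 = - abs x - 1"
 have e: "step y = integral {c0..y} bump" if "c0 <= y" for y
 proof (cases "0 <= y")
  case True
  thus ?thesis using Henstock_Kurzweil_Integration.integral_combine[of c0 0 y bump] i z[of c0] by (simp add: step_def c0_def)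
 next
  case False
  hence "integral {c0..y} bump = integral {c0..y} (%_. 0)" by (intro integral_cong bump(4)) auto
  thus ?thesis using False by (simp add: step_def)
 qed
 have "((%y. integral {c0..y} bump) has_real_derivative bump x) (at x within {c0..abs x + 1})"
  using integral_has_vector_derivative[OF c, of x c0 "abs x + 1"] unfolding has_real_derivative_iff_has_vector_derivative by (simp add: c0_def abs_if split: if_splits)
 hence "((%y. integral {c0..y} bump) has_real_derivative bump x) (at x)" by (subst (asm) at_within_interior) (auto simp: c0_def)
 moreover have "\<forall>\<^sub>F y in nhds x. step y = integral {c0..y} bump"
 proof (rule eventually_mono[OF eventually_nhds_in_open[of "{c0<..}" x]])
  show "x : {c0<..}" by (auto simp: c0_def)
 qed (auto simp: e)
 ultimately show "(step has_real_derivative bump x) (at x)" by (subst DERIV_cong_ev[OF refl _ refl]) auto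
 show "x <= 0 ==> step x = 0" using integral_cong[of "{0..x}" bump "%_. 0"] bump(4) by (auto simp: step_def)
 have s1: "step y = step 1" if "y >= 1" for y
  using Henstock_Kurzweil_Integration.integral_combine[of 0 1 y bump] i integral_cong[of "{1..y}" bump "%_. 0"] bump(4) that by (simp add: step_def)
 thus "x >= 1 ==> step x = step 1" .
 have nn: "0 <= step y" for y unfolding step_def by (rule integral_nonneg[OF i]) (rule bump(2))
 thus "0 <= step x" .
 have mono: "step y <= step z" if "y <= z" for y z
  unfolding step_def using that by (intro integral_subset_le i) (auto simp: bump(2))
 show "step x <= step 1" using mono[of x 1] s1[of x] by (cases "x <= 1") auto
 show "step 1 > 0"
 proof (rule ccontr)
  assume "\<not> step 1 > 0"
  hence "integral {0..1} bump = 0" using nn[of 1] by (simp add: step_def)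
  hence "ALL x:{0..1}. bump x = 0" using integral_eq_0_iff[OF c, of 0 1] bump(2) by auto
  thus False using bump(5)[of "1/2"] by auto
 qed
 have b: "bump x = indicator {0..1} x *\<^sub>R bump x" for x using bump(4)[of x] by (cases "x : {0..1}") auto
 have si: "SI {0..1} bump" by (rule SI_Icc[OF c])
 show "integrable lborel bump" using si unfolding SI_def b[symmetric] .
 have "(LBINT x. bump x) = (LBINT x:{0..1}. bump x)" unfolding LB_def b[symmetric] ..
 thus "(LBINT x. bump x) = step 1" using SI_HK(2)[OF si] by (simp add: step_def)
qed

lemma smooth_bump: "smooth bump"
proof -
 have "elem (%x::real. flat 1 (inner 1 x + 0) * flat 1 (inner (- 1) x + 1))" by (intro elem.intros)
 thus ?thesis using smooth_elem unfolding bump_def by force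
qed

lemma smooth_affine:
 fixes f :: "real => real"
 assumes "smooth f" shows "smooth (%x. f (c*x + d))"
proof -
 have "smooth (%x. r*f (c*x + d))" if "smooth f" for f :: "real => real" and r
  using that
 proof (coinduction arbitrary: f r)
  case smooth
  hence "f differentiable at x" for x by (auto elim: smooth.cases)
  hence f: "(f has_derivative frechet_derivative f (at x)) (at x)" for x by (simp add: frechet_derivative_works)
  have l: "frechet_derivative f (at x) h = h*frechet_derivative f (at x) 1" for x h
   using linear_scale[OF has_derivative_linear[OF f], of x h 1] by simp
  have "((%x. f (c*x + d)) has_derivative (%h. frechet_derivative f (at (c*x + d)) (c*h))) (at x)" for x by (rule has_derivative_compose[OF _ f]) (auto intro!: derivative_eq_intros)
  hence d: "((%x. r*f (c*x + d)) has_derivative (%h. (r*c*h) * frechet_derivative f (at (c*x + d)) 1)) (at x)" for x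
   using has_derivative_mult_right[of _ _ "at x" r] unfolding l[of _ "c*_"] by (simp add: mult.assoc)
  have "smooth (%x. frechet_derivative f (at x) 1)" using smooth by (auto elim: smooth.cases)
  thus ?case using d by (auto simp: differentiable_def frechet_derivative_at[OF d, symmetric])
 qed
 from this[OF assms, of 1] show ?thesis by simp
qed

text \<open>The test functions \<open>ph k\<close> rise to the plateau on
  \<open>[a, a + e k]\<close> and fall again on \<open>[b, b + e k]\<close>. Their derivatives are
  concentrated bumps that evaluate \<open>g\<close> at \<open>a\<close> and \<open>b\<close> in the
  limit, while the functions themselves tend to a multiple of the indicator of
  \<open>(a, b]\<close>. The endpoints \<open>0\<close> and \<open>T\<close>, out of reach of test
  functions, are added by continuity.\<close>

lemma weak_derivative_imp_integral:
 fixes g g' :: "real => real"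
 assumes g: "continuous_on {0..T} g" and g': "SI {0..T} g'" and T: "T > 0"
  and weak: "!!ph. test_function {0<..<T} ph ==> (LBINT t:{0<..<T}. deriv ph t * g t) = - (LBINT t:{0<..<T}. ph t * g' t)"
  and t: "t : {0..T}"
 shows "g t = g 0 + (LBINT s:{0..t}. g' s)"
proof -
 have "bounded (g ` {0..T})" by (intro compact_imp_bounded compact_continuous_image g) auto
 then obtain M where M: "!!t. t : {0..T} ==> abs (g t) <= M" unfolding bounded_iff by force
 hence M0: "M >= 0" using order_trans[OF abs_ge_zero M[of 0]] T by simp
 define G where "G t = indicator {0<..<T} t * g t" for t
 have Gm [measurable]: "G : borel_measurable borel"
  using SM_cont[OF continuous_on_subset[OF g], of "{0<..<T}"] by (simp add: G_def[abs_def] SM_def greaterThanLessThan_subseteq_atLeastAtMost_iff)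
 have Gb: "abs (G t) <= M" for t using M[of t] M0 by (auto simp: G_def indicator_def)
 have bm [measurable]: "bump : borel_measurable borel" by (rule borel_measurable_continuous_onI[OF bump(1)])
 have inc: "g b - g a = integral {a..b} g'" if ab: "0 < a" "a < b" "b < T" for a b
 proof -
  \<comment> \<open>At most half the distance from \<open>b\<close> to \<open>T\<close>, so the
    falling edge stays inside \<open>(0, T)\<close>.\<close>
  define e where "e k = (T - b) / (2 + real k)" for k
  have e: "e k > 0" "b + e k < T" for k
  proof -
   have "(T - b) / (2 + real k) <= (T - b)/2" using ab by (intro divide_left_mono) auto
   thus "e k > 0" "b + e k < T" using ab by (auto simp: e_def field_simps)
  qed
  have e0: "e \<longlonglongrightarrow> 0" unfolding e_def by real_asymp
  define ph where "ph k t = step ((t - a) / e k) - step ((t - b) / e k)" for k t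
  have dph: "(ph k has_real_derivative (bump ((t - a) / e k) - bump ((t - b) / e k)) / e k) (at t)" for k t
  proof -
   have "((%t. step ((t - c) / e k)) has_real_derivative bump ((t - c) / e k)*(1 / e k)) (at t)" for c by (rule DERIV_chain2[OF step(1)]) (use e(1)[of k] in "auto intro!: derivative_eq_intros")
   from DERIV_diff[OF this[of a] this[of b]] show ?thesis unfolding ph_def by (simp add: diff_divide_distrib)
  qed
  have phz: "ph k t = 0" if "t \<notin> {a..b + e k}" for k t
  proof (cases "t < a")
   case True
   thus ?thesis using ab e(1)[of k] by (simp add: ph_def step(2) divide_nonpos_pos)
  next
   case False
   hence "(t - a) / e k >= 1" "(t - b) / e k >= 1" using that ab e(1)[of k] by (auto simp: le_divide_eq)
   thus ?thesis by (simp only: ph_def step(3)[of "(t - a) / e k"] step(3)[of "(t - b) / e k"] diff_self)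
  qed
  have tf: "test_function {0<..<T} (ph k)" for k
  proof -
   have sm: "smooth (%t. step ((t - c) / e k))" for c
    using smooth_affine[OF smooth_real[OF step(1) smooth_bump], of "1 / e k" "- c / e k"] by (simp add: diff_divide_distrib)
   have sub: "{t. ph k t ~= 0} \<subseteq> {a..b + e k}" using phz by blast
   hence "closure {t. ph k t ~= 0} \<subseteq> {a..b + e k}" by (rule closure_minimal) simp
   moreover have "{a..b + e k} \<subseteq> {0<..<T}" using ab e(2)[of k] by auto
   moreover have "bounded {t. ph k t ~= 0}" by (rule bounded_subset[OF _ sub]) simp
   ultimately show ?thesis
    using smooth_linear_combination[OF sm[of a] sm[of b], of 1 "- 1"] by (auto simp: test_function_def ph_def[abs_def] compact_eq_bounded_closed)
  qed
  have c: "0 < c ==> c + e k <= T ==> (LBINT t:{0<..<T}. (bump ((t - c) / e k) / e k) * g t) = (LBINT x. bump x * G (c + e k * x))" for c k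
   unfolding LB_def by (subst lborel_integral_real_affine[of "e k" _ c]) (use e(1)[of k] in "auto simp: G_def mult_ac intro!: Bochner_Integration.integral_cong")
  have bG: "abs (bump x * G y) <= M*bump x" for x y
   using mult_left_mono[OF Gb[of y] bump(2)[of x]] bump(2)[of x] by (simp add: abs_mult mult.commute)
  have i: "integrable lborel (%x. bump x * G (c + e k * x))" for c k
  proof (rule Bochner_Integration.integrable_bound[OF integrable_mult_right[OF step(8), of M]])
   show "AE x in lborel. norm (bump x * G (c + e k * x)) <= norm (M*bump x)" by (intro AE_I2) (use order_trans[OF bG abs_ge_self] in simp)
  qed measurable
  have lim: "(%k. LBINT x. bump x * G (c + e k * x)) \<longlonglongrightarrow> step 1 * g c" if c: "0 < c" "c < T" for c
  proof -
   have "isCont G c"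
   proof -
    have "continuous_on {0<..<T} G" by (rule continuous_on_eq[OF continuous_on_subset[OF g]]) (auto simp: G_def)
    thus ?thesis using c by (simp add: continuous_on_eq_continuous_at)
   qed
   have "(%k. LBINT x. bump x * G (c + e k * x)) \<longlonglongrightarrow> (LBINT x. bump x * G c)"
   proof (rule integral_dominated_convergence[where w = "%x. M*bump x"])
    show "AE x in lborel. (%k. bump x * G (c + e k * x)) \<longlonglongrightarrow> bump x * G c"
    proof (intro AE_I2 tendsto_mult tendsto_const)
     fix x
     have "(%k. c + e k * x) \<longlonglongrightarrow> c + 0*x" by (intro tendsto_intros e0)
     thus "(%k. G (c + e k * x)) \<longlonglongrightarrow> G c" by (intro isCont_tendsto_compose[OF \<open>isCont G c\<close>]) simp
    qed
    show "AE x in lborel. norm (bump x * G (c + e k * x)) <= M*bump x" for k by (intro AE_I2) (use bG in simp)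
   qed (auto intro!: integrable_mult_right step)
   thus ?thesis using step(7) c by (simp add: G_def)
  qed
  have "(LBINT t:{0<..<T}. deriv (ph k) t * g t) = (LBINT x. bump x * G (a + e k * x)) - (LBINT x. bump x * G (b + e k * x))" for k
  proof -
   have dd: "deriv (ph k) t * g t = (bump ((t - a) / e k) / e k) * g t - (bump ((t - b) / e k) / e k) * g t" for t
    unfolding DERIV_imp_deriv[OF dph] by (simp add: left_diff_distrib diff_divide_distrib)
   have si: "SI {0<..<T} (%t. (bump ((t - c) / e k) / e k) * g t)" for c
   proof -
    have "continuous_on {0..T} (%t. (bump ((t - c) / e k) / e k) * g t)"
     using e(1)[of k] by (intro continuous_intros g continuous_on_compose2[OF bump(1)]) auto
    from SI_Icc[OF this] show ?thesis by (rule SI_subset) auto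
   qed
   show ?thesis unfolding dd using LB_diff(2)[OF si si] c[of a k] c[of b k] ab e[of k] by (simp add: less_imp_le)
  qed
  hence lm: "(%k. LBINT t:{0<..<T}. deriv (ph k) t * g t) \<longlonglongrightarrow> step 1 * g a - step 1 * g b"
   using ab by (auto intro!: tendsto_diff lim)
  have "(%k. LBINT t:{0<..<T}. ph k t * g' t) \<longlonglongrightarrow> (LBINT t. indicator {0<..<T} t *\<^sub>R ((step 1 * indicator {a<..b} t) * g' t))"
   unfolding LB_def
  proof (rule integral_dominated_convergence[where w = "%t. step 1 * abs (indicator {0<..<T} t *\<^sub>R g' t)"])
   have g'i: "SI {0<..<T} g'" by (rule SI_subset[OF g']) auto
   thus "integrable lborel (%t. step 1 * abs (indicator {0<..<T} t *\<^sub>R g' t))" by (auto simp: SI_def)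
   have [measurable]: "(%t. indicator {0<..<T} t *\<^sub>R g' t) : borel_measurable lborel" using g'i by (simp add: SI_def)
   have "step : borel_measurable borel" by (intro borel_measurable_continuous_onI continuous_at_imp_continuous_on ballI DERIV_isCont[OF step(1)])
   note [measurable] = this
   have "(%t. (step 1 * indicator {a<..b} t)*(indicator {0<..<T} t *\<^sub>R g' t)) : borel_measurable lborel" by measurable
   thus "(%t. indicator {0<..<T} t *\<^sub>R ((step 1 * indicator {a<..b} t) * g' t)) : borel_measurable lborel" by (simp add: mult_ac)
   have "(%t. ph k t * (indicator {0<..<T} t *\<^sub>R g' t)) : borel_measurable lborel" for k unfolding ph_def by measurable
   thus "(%t. indicator {0<..<T} t *\<^sub>R (ph k t * g' t)) : borel_measurable lborel" for k by (simp add: mult_ac)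
   have "abs (ph k t) <= step 1" for k t unfolding ph_def using step(5,6)[of "(t - a) / e k"] step(5,6)[of "(t - b) / e k"] by simp
   thus "AE t in lborel. norm (indicator {0<..<T} t *\<^sub>R (ph k t * g' t)) <= step 1 * abs (indicator {0<..<T} t *\<^sub>R g' t)" for k by (auto simp: abs_mult indicator_def intro!: mult_right_mono)
   have st: "(%k. step ((t - c) / e k)) \<longlonglongrightarrow> (if t <= c then 0 else step 1)" for t c
   proof (cases "t <= c")
    case True thus ?thesis using e(1) by (simp add: step(2) divide_nonpos_pos)
   next
    case False
    hence "\<forall>\<^sub>F k in sequentially. e k < t - c" using order_tendstoD(2)[OF e0, of "t - c"] by simp
    hence "\<forall>\<^sub>F k in sequentially. step ((t - c) / e k) = step 1" by eventually_elim (use e(1) in "auto intro!: step(3) simp: le_divide_eq")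
    thus ?thesis using False by (simp add: tendsto_eventually)
   qed
   have phl: "(%k. ph k t) \<longlonglongrightarrow> step 1 * indicator {a<..b} t" for t
    using tendsto_diff[OF st[of t a] st[of t b]] ab by (auto simp: ph_def indicator_def split: if_splits)
   show "AE t in lborel. (%k. indicator {0<..<T} t *\<^sub>R (ph k t * g' t)) \<longlonglongrightarrow> indicator {0<..<T} t *\<^sub>R ((step 1 * indicator {a<..b} t) * g' t)" by (intro AE_I2 tendsto_scaleR tendsto_mult tendsto_const phl)
  qed
  from tendsto_minus[OF this] have "(%k. LBINT t:{0<..<T}. deriv (ph k) t * g t) \<longlonglongrightarrow> - (LBINT t. indicator {0<..<T} t *\<^sub>R ((step 1 * indicator {a<..b} t) * g' t))"
   unfolding weak[OF tf] .
  from LIMSEQ_unique[OF lm this] have "step 1 * g a - step 1 * g b = - (LBINT t. indicator {0<..<T} t *\<^sub>R ((step 1 * indicator {a<..b} t) * g' t))" .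
  also have "(LBINT t. indicator {0<..<T} t *\<^sub>R ((step 1 * indicator {a<..b} t) * g' t)) = (LBINT t. step 1 * (indicator {a..b} t *\<^sub>R g' t))" by (rule integral_discrete_difference[of "{a}"]) (use ab in "auto simp: indicator_def")
  also have "... = step 1 * (LBINT t:{a..b}. g' t)" by (simp add: LB_def)
  finally have "step 1 * (g b - g a) = step 1 * (LBINT t:{a..b}. g' t)" by (simp add: algebra_simps)
  hence "g b - g a = (LBINT t:{a..b}. g' t)" using step(4) by simp
  moreover have "SI {a..b} g'" by (rule SI_subset[OF g']) (use ab in auto)
  ultimately show ?thesis by (simp add: SI_HK(2))
 qed
 have hk: "g' integrable_on {0..T}" by (rule SI_HK(1)[OF g'])
 define H where "H t = g t - integral {0..t} g'" for t
 have cH: "continuous_on {0..T} H" unfolding H_def by (intro continuous_intros g indefinite_integral_continuous_1 hk)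
 have "H a = H b" if ab: "0 < a" "a < b" "b < T" for a b
 proof -
  have "integral {0..b} g' = integral {0..a} g' + integral {a..b} g'" by (rule Henstock_Kurzweil_Integration.integral_combine[symmetric]) (use ab integrable_subinterval_real[OF hk] in auto)
  thus ?thesis using inc[OF ab] by (simp add: H_def)
 qed
 hence c: "H x = H (T/2)" if "x : {0<..<T}" for x using that by (cases x "T/2" rule: linorder_cases) auto
 have "H x = H (T/2)" if "x : {0..T}" for x by (rule continuous_constant_on_closure[of "{0<..<T}" H, OF _ c]) (use cH that T in "simp_all add: closure_greaterThanLessThan")
 from this[of t] this[of 0] have "H t = H 0" using t T by simp
 moreover have "SI {0..t} g'" by (rule SI_subset[OF g']) (use t in auto)
 ultimately show ?thesis by (simp add: H_def SI_HK(2))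
qed

section \<open>Weak partial derivatives and the elliptic form\<close>

lemma inner_L2_of: "square_integrable f ==> inner v (L2_of f) = (LBINT x. L2_fun v x * f x)"
 using L2_of_arith(3)[OF square_integrable_L2_fun, of f v] by simp

lemma AE_L2_fun_linear: "AE x in lborel. L2_fun (r *\<^sub>R v + s *\<^sub>R w) x = r*L2_fun v x + s*L2_fun w x"
proof -
 note sq = square_integrable_scale[OF square_integrable_L2_fun, of r v] square_integrable_scale[OF square_integrable_L2_fun, of s w]
 have "r *\<^sub>R v + s *\<^sub>R w = L2_of (%x. r*L2_fun v x + s*L2_fun w x)"
  using scaleR_L2_of[OF square_integrable_L2_fun, of r v] scaleR_L2_of[OF square_integrable_L2_fun, of s w] L2_of_arith(1)[OF sq] by simp
 thus ?thesis using AE_L2_fun_L2_of[OF square_integrable_add[OF sq]] by simp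
qed

lemma L2_on_linear: "v : L2_on Om ==> w : L2_on Om ==> r *\<^sub>R v + s *\<^sub>R w : L2_on Om"
proof -
 assume "v : L2_on Om" "w : L2_on Om"
 hence "AE x in lborel. x \<notin> Om --> L2_fun v x = 0" "AE x in lborel. x \<notin> Om --> L2_fun w x = 0" by (auto simp: L2_on_def)
 thus ?thesis using AE_L2_fun_linear[of r v s w] unfolding L2_on_def mem_Collect_eq by eventually_elim auto
qed

lemma elem_prod: "finite I ==> (!!i. i : I ==> elem (f i)) ==> elem (%x. \<Prod>i\<in>I. f i x)" by (induction I rule: finite_induct) (auto intro: elem.intros)

lemma smooth_D: "smooth ph ==> ph differentiable at x" "smooth ph ==> i : Basis ==> smooth (%x. frechet_derivative ph (at x) i)" by (auto elim: smooth.cases)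

lemma smooth_supported_square_integrable:
 assumes s: "smooth f" and K: "compact K" "!!x. x \<notin> K ==> f x = 0"
 shows "square_integrable f"
proof -
 have c: "continuous_on UNIV f" using smooth_D(1)[OF s] by (intro continuous_at_imp_continuous_on) (auto intro: differentiable_imp_continuous_within)
 have i: "integrable lborel (%x. indicator K x *\<^sub>R (f x)\<^sup>2)" by (rule borel_integrable_compact[OF K(1)]) (intro continuous_intros continuous_on_subset[OF c], simp)
 have e: "(%x. indicator K x *\<^sub>R (f x)\<^sup>2) = (%x. (f x)\<^sup>2)"
 proof
  show "indicator K x *\<^sub>R (f x)\<^sup>2 = (f x)\<^sup>2" for x using K(2)[of x] by (cases "x : K") auto
 qed
 show ?thesis using i[unfolded e] borel_measurable_continuous_onI[OF c] by (simp add: square_integrable_def)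
qed

lemma test_fun_sq:
 assumes t: "test_function Om ph"
 shows "square_integrable ph" "i : Basis ==> square_integrable (%x. frechet_derivative ph (at x) i)"
proof -
 let ?K = "closure {x. ph x ~= 0}"
 have K: "compact ?K" "smooth ph" using t by (auto simp: test_function_def)
 have z: "ph x = 0" if "x \<notin> ?K" for x using that closure_subset[of "{x. ph x ~= 0}"] by blast
 thus "square_integrable ph" by (rule smooth_supported_square_integrable[OF K(2,1)])
 assume i: "i : Basis"
 show "square_integrable (%x. frechet_derivative ph (at x) i)"
 proof (rule smooth_supported_square_integrable[OF smooth_D(2)[OF K(2) i] K(1)])
  fix x assume x: "x \<notin> ?K"
  have "(ph has_derivative (%_. 0)) (at x)"
  proof (rule has_derivative_transform_within_open)
   show "((%_. 0) has_derivative (%_. 0)) (at x)" by simp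
   show "open (- ?K)" by (rule open_Compl) (rule closed_closure)
   show "x : - ?K" using x by blast
   show "0 = ph y" if "y : - ?K" for y by (rule z[OF ComplD[OF that], symmetric])
  qed
  from frechet_derivative_at[OF this, THEN fun_cong, of i] show "frechet_derivative ph (at x) i = 0" by (rule sym)
 qed
qed

lemma test_function_linear:
 assumes "test_function Om ph" "test_function Om ps"
 shows "test_function Om (%x. r*ph x + s*ps x)"
  "frechet_derivative (%x. r*ph x + s*ps x) (at x) i = r*frechet_derivative ph (at x) i + s*frechet_derivative ps (at x) i"
proof -
 have s: "smooth ph" "smooth ps" using assms by (auto simp: test_function_def)
 let ?K = "closure {x. ph x ~= 0} \<union> closure {x. ps x ~= 0}"
 have K: "compact ?K" "?K \<subseteq> Om" using assms by (auto simp: test_function_def)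
 have "closure {x. r*ph x + s*ps x ~= 0} \<subseteq> ?K" unfolding closure_Un[symmetric] by (rule closure_mono) auto
 moreover from this have "compact (closure {x. r*ph x + s*ps x ~= 0})"
  using bounded_subset[OF compact_imp_bounded[OF K(1)]] by (simp add: compact_eq_bounded_closed)
 ultimately show "test_function Om (%x. r*ph x + s*ps x)"
  using K smooth_linear_combination[OF s] unfolding test_function_def by (meson order_trans)
 have "((%x. r*ph x + s*ps x) has_derivative (%h. r*frechet_derivative ph (at x) h + s*frechet_derivative ps (at x) h)) (at x)"
  using smooth_D(1)[OF s(1), of x] smooth_D(1)[OF s(2), of x] by (intro has_derivative_add has_derivative_mult_right) (auto simp: frechet_derivative_works)
 from frechet_derivative_at[OF this, THEN fun_cong, of i]
 show "frechet_derivative (%x. r*ph x + s*ps x) (at x) i = r*frechet_derivative ph (at x) i + s*frechet_derivative ps (at x) i" by (rule sym)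
qed

lemma set_integrable_L2_fun: "A : sets lborel ==> bounded A ==> SI A (L2_fun v)"
proof -
 assume A: "A : sets lborel" "bounded A"
 have "square_integrable (indicator A :: 'a => real)"
  using A emeasure_bounded_finite[OF A(2)] by (simp add: square_integrable_def power2_eq_square flip: indicator_inter_arith)
 from square_integrable_mult[OF this square_integrable_L2_fun] show ?thesis by (simp add: SI_def)
qed

text \<open>Test functions supported in the box tend to its indicator and are bounded by it. The
  argument \<open>(n + 1) d - 1\<close> of \<open>flat\<close>, with \<open>d\<close> the distance
  to a face, keeps the support at distance at least \<open>1 / (n + 1)\<close> from the faces and
  tends to infinity inside, where the product therefore tends to 1.\<close>

lemma box_integral_zero:
 assumes v: "!!ph. test_function Om ph ==> inner v (L2_of ph) = 0" and ab: "box a b \<subseteq> Om"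
 shows "(LBINT x:box a b. L2_fun v x) = 0"
proof -
 define ph where "ph n x = (\<Prod>i\<in>Basis. flat 1 (real (Suc n)*((x - a) \<bullet> i) - 1) * flat 1 (real (Suc n)*((b - x) \<bullet> i) - 1))" for n x
 have el: "elem (ph n)" for n
 proof -
  have e: "c*((x - a) \<bullet> i) - 1 = inner (c *\<^sub>R i) x + (- c*(a \<bullet> i) - 1)" "c*((b - x) \<bullet> i) - 1 = inner (- c *\<^sub>R i) x + (c*(b \<bullet> i) - 1)" for c i x by (simp_all add: inner_diff_left inner_commute[of i] algebra_simps)
  have "elem (%x. flat 1 (real (Suc n)*((x - a) \<bullet> i) - 1) * flat 1 (real (Suc n)*((b - x) \<bullet> i) - 1))" for i
   unfolding e by (intro elem.intros)
  thus ?thesis unfolding ph_def[abs_def] by (intro elem_prod) auto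
 qed
 have sup: "{x. ph n x ~= 0} \<subseteq> cbox (a + (1 / real (Suc n)) *\<^sub>R One) (b - (1 / real (Suc n)) *\<^sub>R One)" for n
 proof
  fix x assume "x : {x. ph n x ~= 0}"
  hence h: "real (Suc n)*((x - a) \<bullet> i) - 1 > 0 & real (Suc n)*((b - x) \<bullet> i) - 1 > 0" if "i : Basis" for i
   using that flat_bounds(3) unfolding ph_def by (auto simp: not_le[symmetric])
  show "x : cbox (a + (1 / real (Suc n)) *\<^sub>R One) (b - (1 / real (Suc n)) *\<^sub>R One)"
   unfolding mem_box by (intro ballI) (use h in "simp add: inner_diff_left inner_add_left field_simps less_imp_le")
 qed
 have tf: "test_function Om (ph n)" for n
 proof -
  have "cbox (a + (1 / real (Suc n)) *\<^sub>R One) (b - (1 / real (Suc n)) *\<^sub>R One) \<subseteq> box a b" by (auto simp: mem_box inner_diff_left inner_add_left) (smt (verit) divide_pos_pos of_nat_0_le_iff)+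
  moreover have "closure {x. ph n x ~= 0} \<subseteq> cbox (a + (1 / real (Suc n)) *\<^sub>R One) (b - (1 / real (Suc n)) *\<^sub>R One)" by (rule closure_minimal[OF sup closed_cbox])
  ultimately show ?thesis
   using smooth_elem[OF el[of n]] ab bounded_subset[OF bounded_cbox sup[of n]] by (auto simp: test_function_def)
 qed
 have sup': "ph n x = 0" if nx: "x \<notin> box a b" for n x
 proof -
  obtain i where i: "i : Basis" "\<not> (a \<bullet> i < x \<bullet> i & x \<bullet> i < b \<bullet> i)" using nx unfolding mem_box by blast
  hence "(x - a) \<bullet> i <= 0 \<or> (b - x) \<bullet> i <= 0" by (auto simp: inner_diff_left)
  hence "real (Suc n)*((x - a) \<bullet> i) - 1 <= 0 \<or> real (Suc n)*((b - x) \<bullet> i) - 1 <= 0" by (auto intro: order_trans[OF mult_nonneg_nonpos])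
  thus ?thesis unfolding ph_def using i(1) by (intro prod_zero) (auto simp: flat_bounds(3) intro!: bexI[of _ i])
 qed
 have b01: "0 <= ph n x" "ph n x <= 1" for n x
  unfolding ph_def using flat_bounds by (auto intro!: prod_nonneg prod_le_1 mult_le_one)
 have lim: "(%n. ph n x) \<longlonglongrightarrow> 1" if x: "x : box a b" for x
 proof -
  have l: "(%n. flat 1 (real (Suc n) * c - 1)) \<longlonglongrightarrow> 1" if "c > 0" for c
  proof -
   have "\<forall>\<^sub>F n in sequentially. exp (- (1 / (real (Suc n) * c - 1))) = flat 1 (real (Suc n) * c - 1)"
   proof -
    have "filterlim (%n. real (Suc n) * c - 1) at_top sequentially" using that by real_asymp
    from this[THEN filterlim_at_top_dense[THEN iffD1], rule_format, of 0] show ?thesis by eventually_elim (simp add: flat_def)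
   qed
   moreover have "(%n. exp (- (1 / (real (Suc n) * c - 1)))) \<longlonglongrightarrow> 1" using that by real_asymp
   ultimately show ?thesis by (rule Lim_transform_eventually[rotated])
  qed
  have "(%n. ph n x) \<longlonglongrightarrow> (\<Prod>i\<in>(Basis::'a set). 1*1)"
   unfolding ph_def by (intro tendsto_prod tendsto_mult l) (use x in "auto simp: mem_box inner_diff_left")
  thus ?thesis by simp
 qed
 have lm: "(%n. LBINT x. L2_fun v x * ph n x) \<longlonglongrightarrow> (LBINT x:box a b. L2_fun v x)"
  unfolding LB_def
 proof (rule integral_dominated_convergence[where w = "%x. abs (indicator (box a b) x *\<^sub>R L2_fun v x)"])
  have "SI (box a b) (L2_fun v)" by (rule set_integrable_L2_fun) auto
  thus "integrable lborel (%x. abs (indicator (box a b) x *\<^sub>R L2_fun v x))" "(%x. indicator (box a b) x *\<^sub>R L2_fun v x) : borel_measurable lborel" by (auto simp: SI_def)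
  show "(%x. L2_fun v x * ph n x) : borel_measurable lborel" for n
   using square_integrable_L2_fun[of v] test_fun_sq(1)[OF tf, of n] by (intro borel_measurable_times) (auto simp: square_integrable_def)
  show "AE x in lborel. (%n. L2_fun v x * ph n x) \<longlonglongrightarrow> indicator (box a b) x *\<^sub>R L2_fun v x"
  proof (intro AE_I2)
   fix x show "(%n. L2_fun v x * ph n x) \<longlonglongrightarrow> indicator (box a b) x *\<^sub>R L2_fun v x"
    using tendsto_mult_left[OF lim, of x "L2_fun v x"] sup' by (cases "x : box a b") auto
  qed
  show "AE x in lborel. norm (L2_fun v x * ph n x) <= abs (indicator (box a b) x *\<^sub>R L2_fun v x)" for n
   using b01[of n] sup'[of _ n] by (intro AE_I2) (auto simp: abs_mult indicator_def intro!: mult_left_le)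
 qed
 have z: "(LBINT x. L2_fun v x * ph n x) = 0" for n
  using v[OF tf] inner_L2_of[OF test_fun_sq(1)[OF tf]] by simp
 show ?thesis using LIMSEQ_unique[OF lm[unfolded z] tendsto_const] .
qed

text \<open>Positive and negative part of \<open>h\<close>, taken as densities, define measures that
  agree on boxes. Boxes are stable under intersection and generate the Borel sets, so the measures
  and hence the densities coincide.\<close>

lemma integral_boxes_zero_imp_AE_zero:
 fixes h :: "'a::euclidean_space => real"
 assumes h: "integrable lborel h" and z: "!!c d. (LBINT x:box c d. h x) = 0"
 shows "AE x in lborel. h x = 0"
proof -
 have [measurable]: "h : borel_measurable borel" using h by auto
 have i: "integrable lborel (%x. indicator (box c d) x *\<^sub>R max 0 (s*h x))" for c d s by (intro integrable_mult_indicator integrable_max integrable_mult_right h) auto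
 have "density lborel (%x. ennreal (max 0 (1*h x))) = density lborel (%x. ennreal (max 0 (- 1*h x)))" (is "?M 1 = ?M (- 1)")
 proof (rule measure_eqI_generator_eq[of "range (%(a, b). box a b)" UNIV _ _ "%n. box (- (real n *\<^sub>R One)) (real n *\<^sub>R One)"])
  have em: "emeasure (?M s) (box c d) = ennreal (LBINT x:box c d. max 0 (s*h x))" for c d s
   unfolding LB_def by (subst emeasure_density, simp, simp, subst nn_integral_eq_integral[OF i, symmetric]) (auto intro!: nn_integral_cong simp: indicator_def)
  have "(LBINT x:box c d. max 0 (1*h x)) = (LBINT x:box c d. max 0 (- 1*h x))" for c d
  proof -
   have "h x = max 0 (1*h x) - max 0 (- 1*h x)" for x by (simp add: max_def)
   hence "(LBINT x:box c d. h x) = (LBINT x:box c d. max 0 (1*h x)) - (LBINT x:box c d. max 0 (- 1*h x))"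
    using LB_diff(2)[of lborel "box c d" "%x. max 0 (1*h x)" "%x. max 0 (- 1*h x)"] i[of c d 1] i[of c d "- 1"] by (simp add: SI_def)
   thus ?thesis using z[of c d] by simp
  qed
  hence "emeasure (?M 1) (box c d) = emeasure (?M (- 1)) (box c d)" for c d using em[of 1 c d] em[of "- 1" c d] by (simp only:)
  thus "X : range (%(a, b). box a b) ==> emeasure (?M 1) X = emeasure (?M (- 1)) X" for X by auto
  show "emeasure (?M 1) (box (- (real n *\<^sub>R One)) (real n *\<^sub>R One)) ~= \<infinity>" for n unfolding em by simp
  show "Int_stable (range (%(a, b). box a b :: 'a set))" by (auto simp: Int_stable_def box_Int_box)
  show "sets (?M 1) = sigma_sets UNIV (range (%(a, b). box a b))" "sets (?M (- 1)) = sigma_sets UNIV (range (%(a, b). box a b))" by (simp_all add: borel_eq_box)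
  show "range (%n. box (- (real n *\<^sub>R One)) (real n *\<^sub>R One)) \<subseteq> range (%(a, b). box a b :: 'a set)" by auto
  show "(\<Union>n. box (- (real n *\<^sub>R One)) (real n *\<^sub>R One)) = (UNIV :: 'a set)" by (rule UN_box_eq_UNIV)
 qed simp
 hence "AE x in lborel. ennreal (max 0 (1*h x)) = ennreal (max 0 (- 1*h x))" by (subst (asm) sigma_finite_measure.density_unique_iff[OF lborel.sigma_finite_measure_axioms]) auto
 thus ?thesis by eventually_elim (auto simp: max_def split: if_splits)
qed

text \<open>The fundamental lemma of the calculus of variations, through a countable cover of the
  open set by boxes. It makes weak derivatives unique, so that the description in
  \<open>weak_pderiv\<close> denotes them and linearity can be proved.\<close>

lemma L2_on_eq_0I:
 assumes Om: "open Om" and v: "v : L2_on Om" "!!ph. test_function Om ph ==> inner v (L2_of ph) = 0"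
 shows "v = 0"
proof -
 obtain D where D: "countable D" "D \<subseteq> Pow Om" "!!X. X : D ==> EX a b. X = box a b" "\<Union>D = Om" by (rule open_countable_Union_open_box[OF Om]) blast
 have "AE x in lborel. x : X --> L2_fun v x = 0" if X: "X : D" for X
 proof -
  obtain a b where ab: "X = box a b" "box a b \<subseteq> Om" using D(2,3) X by blast
  have "AE x in lborel. indicator (box a b) x *\<^sub>R L2_fun v x = 0"
  proof (rule integral_boxes_zero_imp_AE_zero)
   have "SI (box a b) (L2_fun v)" by (rule set_integrable_L2_fun) auto
   thus "integrable lborel (%x. indicator (box a b) x *\<^sub>R L2_fun v x)" by (simp add: SI_def)
   fix c d
   obtain c' d' where cd: "box c d \<inter> box a b = box c' d'" by (rule that[OF box_Int_box])
   have "(LBINT x:box c d. indicator (box a b) x *\<^sub>R L2_fun v x) = (LBINT x:box c' d'. L2_fun v x)"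
    unfolding cd[symmetric] LB_def by (simp add: indicator_inter_arith mult.assoc)
   thus "(LBINT x:box c d. indicator (box a b) x *\<^sub>R L2_fun v x) = 0"
    using box_integral_zero[OF v(2), of Om c' d'] cd ab(2) by auto
  qed
  thus ?thesis by eventually_elim (auto simp: ab(1) indicator_def)
 qed
 hence "AE x in lborel. ALL X:D. x : X --> L2_fun v x = 0" using D(1) by (subst AE_ball_countable) auto
 moreover have "AE x in lborel. x \<notin> Om --> L2_fun v x = 0" using v(1) by (simp add: L2_on_def)
 ultimately have "AE x in lborel. L2_fun v x = 0" by eventually_elim (use D(4) in auto)
 hence "L2_of (L2_fun v) = L2_of (%x. 0)" using L2_of_eq_iff[OF square_integrable_L2_fun square_integrable_0] by auto
 thus ?thesis by (simp add: zero_L2_def)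
qed

lemma has_weak_pderiv_linear:
 assumes "has_weak_pderiv Om i v w" "has_weak_pderiv Om i v' w'"
 shows "has_weak_pderiv Om i (r *\<^sub>R v + s *\<^sub>R v') (r *\<^sub>R w + s *\<^sub>R w')"
 using assms by (simp add: has_weak_pderiv_def L2_on_linear inner_add_left)

lemma weak_pderiv_eq:
 assumes "open Om" "has_weak_pderiv Om i v w"
 shows "weak_pderiv Om i v = w"
 unfolding weak_pderiv_def
proof (rule the_equality)
 show "has_weak_pderiv Om i v w" by (rule assms(2))
 fix w' assume w': "has_weak_pderiv Om i v w'"
 have "1 *\<^sub>R w' + (- 1) *\<^sub>R w = 0"
 proof (rule L2_on_eq_0I[OF assms(1)])
  show "1 *\<^sub>R w' + (- 1) *\<^sub>R w : L2_on Om" using assms(2) w' by (intro L2_on_linear) (auto simp: has_weak_pderiv_def)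
  fix ph assume "test_function Om ph"
  hence "- inner w' (L2_of ph) = - inner w (L2_of ph)" using assms(2) w' unfolding has_weak_pderiv_def by metis
  thus "inner (1 *\<^sub>R w' + (- 1) *\<^sub>R w) (L2_of ph) = 0" by (simp add: inner_diff_left)
 qed
 thus "w' = w" by simp
qed

lemma H1_linear:
 assumes Om: "open Om" and v: "v : H1 Om" "v' : H1 Om"
 shows "r *\<^sub>R v + s *\<^sub>R v' : H1 Om"
  "i : Basis ==> weak_pderiv Om i (r *\<^sub>R v + s *\<^sub>R v') = r *\<^sub>R weak_pderiv Om i v + s *\<^sub>R weak_pderiv Om i v'"
proof -
 show "r *\<^sub>R v + s *\<^sub>R v' : H1 Om" using v has_weak_pderiv_linear unfolding H1_def by blast
 assume "i : Basis"
 then obtain w w' where w: "has_weak_pderiv Om i v w" "has_weak_pderiv Om i v' w'" using v unfolding H1_def by blast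
 show "weak_pderiv Om i (r *\<^sub>R v + s *\<^sub>R v') = r *\<^sub>R weak_pderiv Om i v + s *\<^sub>R weak_pderiv Om i v'"
  using weak_pderiv_eq[OF Om] w has_weak_pderiv_linear[OF w] by simp
qed

lemma H1_0_linear:
 assumes Om: "open Om" and v: "v : H1_0 Om" "v' : H1_0 Om"
 shows "r *\<^sub>R v + s *\<^sub>R v' : H1_0 Om"
proof -
 obtain ph ps where
  p: "!!k. test_function Om (ph k)" "(%k. L2_of (ph k)) \<longlonglongrightarrow> v" "!!i. i : Basis ==> (%k::nat. L2_of (%x. frechet_derivative (ph k) (at x) i)) \<longlonglongrightarrow> weak_pderiv Om i v"
  and q: "!!k. test_function Om (ps k)" "(%k. L2_of (ps k)) \<longlonglongrightarrow> v'" "!!i. i : Basis ==> (%k::nat. L2_of (%x. frechet_derivative (ps k) (at x) i)) \<longlonglongrightarrow> weak_pderiv Om i v'"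
  using v unfolding H1_0_def by blast
 have v1: "v : H1 Om" "v' : H1 Om" using v by (auto simp: H1_0_def)
 have lm: "L2_of (%x. r*f x + s*g x) = r *\<^sub>R L2_of f + s *\<^sub>R L2_of g" if "square_integrable f" "square_integrable g" for f g :: "'a => real"
  using that by (simp add: scaleR_L2_of L2_of_arith square_integrable_scale)
 show ?thesis
  unfolding H1_0_def mem_Collect_eq
 proof (intro conjI exI[of _ "%k x. r*ph k x + s*ps k x"] allI ballI)
  show "r *\<^sub>R v + s *\<^sub>R v' : H1 Om" by (rule H1_linear(1)[OF Om v1])
  show "test_function Om (%x. r*ph k x + s*ps k x)" for k by (rule test_function_linear(1)[OF p(1) q(1)])
  show "(%k. L2_of (%x. r*ph k x + s*ps k x)) \<longlonglongrightarrow> r *\<^sub>R v + s *\<^sub>R v'"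
   unfolding lm[OF test_fun_sq(1)[OF p(1)] test_fun_sq(1)[OF q(1)]] by (intro tendsto_intros p(2) q(2))
  fix i :: 'a assume i: "i : Basis"
  show "(%k. L2_of (%x. frechet_derivative (%x. r*ph k x + s*ps k x) (at x) i)) \<longlonglongrightarrow> weak_pderiv Om i (r *\<^sub>R v + s *\<^sub>R v')"
   unfolding test_function_linear(2)[OF p(1) q(1)] lm[OF test_fun_sq(2)[OF p(1) i] test_fun_sq(2)[OF q(1) i]] H1_linear(2)[OF Om v1 i] by (intro tendsto_intros p(3) q(3) i)
 qed
qed

text \<open>With the indicator of the domain absorbed into a bounded weight, every term of the
  elliptic form is an integral of this shape over the whole space.\<close>

definition weighted :: "('a::euclidean_space => real) => 'a L2 => 'a L2 => real" where
 "weighted m v w = (LBINT x. m x * (L2_fun v x * L2_fun w x))"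

lemma weighted:
 assumes m: "m : borel_measurable borel" "!!x. abs (m x) <= B"
 shows "integrable lborel (%x. m x * (L2_fun v x * L2_fun w x))"
  "weighted m (r *\<^sub>R v + s *\<^sub>R v') w = r*weighted m v w + s*weighted m v' w"
proof -
 have [measurable]: "L2_fun v : borel_measurable borel" for v :: "'a L2" using square_integrable_L2_fun[of v] by (simp add: square_integrable_def)
 note [measurable] = m(1)
 have i: "integrable lborel (%x. m x * (L2_fun v x * L2_fun w x))" for v w
 proof (rule Bochner_Integration.integrable_bound[OF integrable_mult_right[OF square_integrable_mult[OF square_integrable_L2_fun square_integrable_L2_fun], of B v w]])
  show "AE x in lborel. norm (m x * (L2_fun v x * L2_fun w x)) <= norm (B*(L2_fun v x * L2_fun w x))"
  proof (intro AE_I2)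
   fix x
   have "abs (m x) <= abs B" using m(2)[of x] by simp
   thus "norm (m x * (L2_fun v x * L2_fun w x)) <= norm (B*(L2_fun v x * L2_fun w x))" unfolding norm_mult by (intro mult_right_mono) auto
  qed
 qed measurable
 thus "integrable lborel (%x. m x * (L2_fun v x * L2_fun w x))" .
 have "weighted m (r *\<^sub>R v + s *\<^sub>R v') w = (LBINT x. r*(m x * (L2_fun v x * L2_fun w x)) + s*(m x * (L2_fun v' x * L2_fun w x)))"
  unfolding weighted_def
 proof (rule integral_cong_AE)
  show "AE x in lborel. m x * (L2_fun (r *\<^sub>R v + s *\<^sub>R v') x * L2_fun w x) = r*(m x * (L2_fun v x * L2_fun w x)) + s*(m x * (L2_fun v' x * L2_fun w x))"
   using AE_L2_fun_linear[of r v s v'] by eventually_elim (simp add: algebra_simps)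
 qed measurable
 thus "weighted m (r *\<^sub>R v + s *\<^sub>R v') w = r*weighted m v w + s*weighted m v' w"
  using i by (simp add: weighted_def)
qed

lemma elliptic_form_bilinear:
 assumes Om: "bounded_domain Om" and A: "elliptic_operator Om a q"
  and u: "u : H1_0 Om" "u' : H1_0 Om" "w : H1_0 Om"
 shows "elliptic_form Om a q u w = elliptic_form Om a q w u"
  "elliptic_form Om a q (r *\<^sub>R u + s *\<^sub>R u') w = r*elliptic_form Om a q u w + s*elliptic_form Om a q u' w"
proof -
 let ?D = "%j v. weak_pderiv Om (axis j 1) v"
 define m where "m i j x = indicator Om x * (a x $ i $ j)" for i j x
 define k where "k x = indicator Om x * q x" for x
 have op: "open Om" using Om by (simp add: bounded_domain_def)
 have a: "SM Om a" "bounded (a ` Om)" "SM Om q" "bounded (q ` Om)" "!!x. x : Om ==> transpose (a x) = a x"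
  using A by (auto simp: elliptic_operator_def)
 obtain Ba where Ba: "!!x. x : Om ==> norm (a x) <= Ba" using a(2) unfolding bounded_iff by force
 obtain Bq where Bq: "!!x. x : Om ==> abs (q x) <= Bq" using a(4) unfolding bounded_iff by force
 have mm: "m i j : borel_measurable borel" "abs (m i j x) <= max 0 Ba" for i j x
 proof -
  have "(%x. (indicator Om x *\<^sub>R a x) $ i $ j) : borel_measurable lborel"
   using a(1) unfolding SM_def by (rule measurable_compose) (intro borel_measurable_continuous_onI continuous_intros)
  thus "m i j : borel_measurable borel" by (simp add: m_def[abs_def])
  have "abs (a x $ i $ j) <= norm (a x)" by (meson component_le_norm_cart Finite_Cartesian_Product.norm_nth_le order_trans)
  thus "abs (m i j x) <= max 0 Ba" using Ba[of x] by (auto simp: m_def indicator_def)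
 qed
 have kk: "k : borel_measurable borel" "abs (k x) <= max 0 Bq" for x
  using a(3) Bq[of x] by (auto simp: k_def[abs_def] k_def SM_def indicator_def)
 have sym: "m i j x = m j i x" for i j x
  using a(5)[of x] unfolding m_def transpose_def by (cases "x : Om") (auto simp: vec_eq_iff)
 have F: "elliptic_form Om a q v w = (SUM i:UNIV. SUM j:UNIV. weighted (m i j) (?D j v) (?D i w)) + weighted k v w" for v w
 proof -
  have e: "indicator Om x *\<^sub>R ((SUM i:UNIV. SUM j:UNIV. a x $ i $ j * L2_fun (?D j v) x * L2_fun (?D i w) x) + q x * L2_fun v x * L2_fun w x)
    = (SUM i:UNIV. SUM j:UNIV. m i j x * (L2_fun (?D j v) x * L2_fun (?D i w) x)) + k x * (L2_fun v x * L2_fun w x)" for x by (cases "x : Om") (simp_all add: m_def k_def mult.assoc)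
  show ?thesis
   unfolding elliptic_form_def LB_def e weighted_def
   using weighted(1)[OF mm] weighted(1)[OF kk] by (simp add: Bochner_Integration.integral_sum)
 qed
 have com: "weighted n v w = weighted n w v" for n :: "real^'n => real" and v w unfolding weighted_def by (simp add: mult.commute)
 have "(SUM i:UNIV. SUM j:UNIV. weighted (m i j) (?D j u) (?D i w)) = (SUM i:UNIV. SUM j:UNIV. weighted (m i j) (?D j w) (?D i u))"
 proof -
  have "weighted (m j i) (?D i u) (?D j w) = weighted (m i j) (?D j w) (?D i u)" for i j
   using com[of "m i j"] sym[of j i, abs_def] by (simp add: fun_eq_iff weighted_def)
  thus ?thesis by (subst sum.swap) (simp only:)
 qed
 thus "elliptic_form Om a q u w = elliptic_form Om a q w u" unfolding F com[of k u w] by simp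
 have D: "?D j (r *\<^sub>R u + s *\<^sub>R u') = r *\<^sub>R ?D j u + s *\<^sub>R ?D j u'" for j
  using u by (intro H1_linear(2)[OF op]) (auto simp: H1_0_def)
 show "elliptic_form Om a q (r *\<^sub>R u + s *\<^sub>R u') w = r*elliptic_form Om a q u w + s*elliptic_form Om a q u' w"
  unfolding F D weighted(2)[OF mm] weighted(2)[OF kk] by (simp add: sum.distrib sum_distrib_left algebra_simps)
qed

section \<open>Eigenbasis of a symmetric form\<close>

definition ortho :: "'a::real_inner set => bool" where
 "ortho E \<longleftrightarrow> (ALL x:E. ALL y:E. inner x y = (if x = y then 1 else 0))"

lemma ortho_card:
 assumes "ortho E" "E \<subseteq> span B" "finite B"
 shows "finite E & card E <= card B"
proof (rule independent_span_bound[OF assms(3) _ assms(2)])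
 show "independent E"
  using assms(1) by (intro pairwise_orthogonal_independent) (force simp: ortho_def pairwise_def orthogonal_def)+
qed

lemma ortho_insert: "ortho E ==> norm u = 1 ==> ALL e:E. inner u e = 0 ==> ortho (insert u E) & u \<notin> E"
 unfolding ortho_def by (auto simp: inner_commute dot_square_norm)

lemma inner_ortho_sum:
 assumes "ortho E" "finite E" "e : E"
 shows "inner (SUM f:E. c f *\<^sub>R f) e = c e"
proof -
 have "inner (SUM f:E. c f *\<^sub>R f) e = (SUM f:E. c f * (if f = e then 1 else 0))"
  using assms(1,3) by (simp add: inner_sum_left ortho_def)
 thus ?thesis using assms(2,3) by (simp add: if_distrib cong: if_cong)
qed

text \<open>Finite dimension is expressed by inclusion in the span of a finite set rather than by a
  basis of \<open>V\<close>; the same \<open>B\<close> then serves the orthogonal complements in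
  \<open>eigenbasis\<close>.\<close>

locale fin_dim_subspace =
 fixes V B :: "'a::real_inner set"
 assumes lin: "v : V ==> w : V ==> r *\<^sub>R v + s *\<^sub>R w : V" and ne: "V ~= {}" and B: "finite B" "V \<subseteq> span B"
begin

lemma zero: "0 : V" using ne lin[of _ _ 0 0] by auto

lemma sum_in: "finite E ==> E \<subseteq> V ==> (SUM e:E. c e *\<^sub>R e) : V"
proof (induction E rule: finite_induct)
 case (insert x F)
 hence "c x *\<^sub>R x + 1 *\<^sub>R (SUM e:F. c e *\<^sub>R e) : V" by (intro lin) auto
 thus ?case using insert by simp
qed (simp add: zero)

text \<open>Orthonormal sets inside the span of \<open>B\<close> have at most \<open>card B\<close>
  elements, so one of maximal size exists. The predicate \<open>P\<close> covers both plain
  orthonormal sets and orthonormal sets of eigenvectors.\<close>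

lemma maximal_ortho:
 assumes P: "P {}" "!!E. P E ==> ortho E & E \<subseteq> V"
 obtains E where "P E" "finite E" "!!F. P F ==> card F <= card E"
proof -
 have b: "finite E & card E <= card B" if "P E" for E
  using P(2)[OF that] B by (intro ortho_card) auto
 obtain E where "P E" "ALL F. P F --> card F <= card E"
 proof (rule exE[OF ex_has_greatest_nat[of P "{}" card "Suc (card B)"]])
  show "P {}" by (rule P(1))
  show "ALL F. P F --> card F < Suc (card B)" using b by (simp add: less_Suc_eq_le)
 qed blast
 thus ?thesis using that b by blast
qed

lemma onb: obtains E where "finite E" "E \<subseteq> V" "ortho E" "!!v. v : V ==> v = (SUM e:E. inner v e *\<^sub>R e)"
proof -
 obtain E where E: "ortho E & E \<subseteq> V" "finite E" "!!F. ortho F & F \<subseteq> V ==> card F <= card E" by (rule maximal_ortho[of "%E. ortho E & E \<subseteq> V"]) (auto simp: ortho_def)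
 have "v = (SUM e:E. inner v e *\<^sub>R e)" if v: "v : V" for v
 proof (rule ccontr)
  assume n: "v ~= (SUM e:E. inner v e *\<^sub>R e)"
  define r where "r = v - (SUM e:E. inner v e *\<^sub>R e)"
  have r: "r ~= 0" "r : V" using n lin[OF v sum_in, of E 1 "-1" "inner v"] E by (auto simp: r_def)
  have "inner (r /\<^sub>R norm r) e = 0" if "e : E" for e using inner_ortho_sum[of E e "inner v"] E that by (simp add: r_def inner_diff_left)
  hence "ortho (insert (r /\<^sub>R norm r) E)" "r /\<^sub>R norm r \<notin> E" using ortho_insert[of E "r /\<^sub>R norm r"] E r by auto
  moreover have "r /\<^sub>R norm r : V" using lin[OF r(2) r(2), of "1 / norm r" 0] by (simp add: divide_inverse)
  ultimately show False using E(3)[of "insert (r /\<^sub>R norm r) E"] E by simp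
 qed
 thus ?thesis using that E by blast
qed

end

text \<open>Built up direction by direction as the continuous image of a product. It provides
  compactness in an ambient space whose balls need not be compact.\<close>

lemma compact_coordinate_box: "finite F ==> compact {SUM f:F. c f *\<^sub>R f |c. ALL f. abs (c f) <= (1::real)}" for F :: "'a::real_inner set"
proof (induction F rule: finite_induct)
 case empty
 have "{SUM f:({}::'a set). c f *\<^sub>R f |c. ALL f. abs (c f) <= (1::real)} = {0}" by (auto intro: exI[of _ "%_. 0"])
 thus ?case by simp
next
 case (insert x F)
 let ?C = "%F. {SUM f:F. c f *\<^sub>R f |c. ALL f. abs (c f) <= (1::real)}"
 have "?C (insert x F) = (%(s, y). s *\<^sub>R x + y) ` ({-1..1} \<times> ?C F)"
 proof (intro equalityI subsetI)
  fix v assume "v : ?C (insert x F)"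
  then obtain c where c: "v = (SUM f:insert x F. c f *\<^sub>R f)" "ALL f. abs (c f) <= 1" by auto
  hence "v = (%(s, y). s *\<^sub>R x + y) (c x, SUM f:F. c f *\<^sub>R f)" "c x : {-1..1}" using insert c(2)[rule_format, of x] by (auto simp: abs_le_iff)
  thus "v : (%(s, y). s *\<^sub>R x + y) ` ({-1..1} \<times> ?C F)" using c(2) by blast
 next
  fix v assume "v : (%(s, y). s *\<^sub>R x + y) ` ({-1..1} \<times> ?C F)"
  then obtain s c where c: "v = s *\<^sub>R x + (SUM f:F. c f *\<^sub>R f)" "s : {-1..1}" "ALL f. abs (c f) <= 1" by auto
  have "(SUM f:F. (c(x := s)) f *\<^sub>R f) = (SUM f:F. c f *\<^sub>R f)" using insert by (intro sum.cong) auto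
  hence "v = (SUM f:insert x F. (c(x := s)) f *\<^sub>R f)" using c(1) insert by simp
  moreover have "ALL f. abs ((c(x := s)) f) <= 1" using c by auto
  ultimately show "v : ?C (insert x F)" by blast
 qed
 moreover have "compact ((%(s, y). s *\<^sub>R x + y) ` ({-1..1} \<times> ?C F))"
  using insert by (intro compact_continuous_image compact_Times) (auto simp: case_prod_unfold intro!: continuous_intros)
 ultimately show ?case by simp
qed

locale symmetric_form = fin_dim_subspace V B for V B :: "'a::real_inner set" +
 fixes A :: "'a => 'a => real"
 assumes sym: "v : V ==> w : V ==> A v w = A w v"
  and bil: "u : V ==> v : V ==> w : V ==> A (r *\<^sub>R u + s *\<^sub>R v) w = r*A u w + s*A v w"
begin

lemma A_sum: "finite E ==> E \<subseteq> V ==> w : V ==> A (SUM e:E. c e *\<^sub>R e) w = (SUM e:E. c e * A e w)"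
proof (induction E rule: finite_induct)
 case empty
 thus ?case using bil[of w w w 0 0] by simp
next
 case (insert x F)
 hence "A (c x *\<^sub>R x + 1 *\<^sub>R (SUM e:F. c e *\<^sub>R e)) w = c x * A x w + 1*A (SUM e:F. c e *\<^sub>R e) w" by (intro bil sum_in) auto
 thus ?case using insert by simp
qed

text \<open>The unit sphere of \<open>V\<close> is a closed part of a coordinate box, hence compact,
  so the Rayleigh quotient attains its maximum.\<close>

lemma maximizer:
 assumes v: "v : V" "v ~= 0"
 obtains u where "u : V" "norm u = 1" "!!w. w : V ==> A w w <= A u u * (norm w)\<^sup>2"
proof -
 obtain F where F: "finite F" "F \<subseteq> V" "ortho F" "!!v. v : V ==> v = (SUM e:F. inner v e *\<^sub>R e)" by (rule onb) blast
 let ?S = "{v : V. norm v = 1}"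
 \<comment> \<open>In coordinates the quadratic form is a polynomial in inner products, hence
   continuous; about \<open>A\<close> itself only algebraic properties are given.\<close>
 define q where "q v = (SUM f:F. inner v f * (SUM g:F. inner v g * A g f))" for v
 have q: "A v v = q v" if "v : V" for v
 proof -
  have "A v v = (SUM f:F. inner v f * A f v)" using A_sum[OF F(1,2) that, of "inner v"] F(4)[OF that] by simp
  also have "... = q v" unfolding q_def
  proof (rule sum.cong[OF refl])
   fix f assume f: "f : F"
   have "A f v = A v f" using F(2) f that by (intro sym) auto
   also have "... = (SUM g:F. inner v g * A g f)" using A_sum[OF F(1,2), of f "inner v"] F(2) f F(4)[OF that] by auto
   finally show "inner v f * A f v = inner v f * (SUM g:F. inner v g * A g f)" by simp
  qed
  finally show ?thesis .
 qed
 have n1: "norm f = 1" if "f : F" for f using F(3) that by (simp add: ortho_def norm_eq_1)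
 have "?S = {SUM f:F. c f *\<^sub>R f |c. ALL f. abs (c f) <= (1::real)} \<inter> sphere 0 1"
 proof (intro equalityI subsetI)
  fix v assume v: "v : ?S"
  let ?c = "%f. if f : F then inner v f else 0"
  have "v = (SUM f:F. ?c f *\<^sub>R f)" using F(4)[of v] v by simp
  moreover have "ALL f. abs (?c f) <= 1" using Cauchy_Schwarz_ineq2[of v] n1 v by (metis (mono_tags, lifting) abs_zero mem_Collect_eq mult_1 zero_le_one)
  ultimately show "v : {SUM f:F. c f *\<^sub>R f |c. ALL f. abs (c f) <= (1::real)} \<inter> sphere 0 1" using v by fastforce
 qed (use sum_in[OF F(1,2)] in auto)
 moreover have "closed (sphere (0::'a) 1)" unfolding sphere_def by (intro closed_Collect_eq continuous_intros)
 ultimately have "compact ?S" using compact_Int_closed[OF compact_coordinate_box[OF F(1)]] by simp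
 moreover have "(1 / norm v) *\<^sub>R v + 0 *\<^sub>R v : ?S" using lin[OF v(1) v(1), of "1 / norm v" 0] v by simp
 hence "?S ~= {}" by blast
 moreover have "continuous_on ?S q" unfolding q_def by (intro continuous_intros)
 ultimately obtain u where u: "u : V" "norm u = 1" "!!w. w : ?S ==> q w <= q u" using continuous_attains_sup[of ?S q] by auto
 have "A w w <= A u u * (norm w)\<^sup>2" if w: "w : V" for w
 proof (cases "w = 0")
  case True thus ?thesis using bil[OF w w w, of 0 0] by simp
 next
  case False
  define x where "x = (1 / norm w) *\<^sub>R w + 0 *\<^sub>R w"
  have x: "x : V" "norm x = 1" using lin[OF w w, of "1 / norm w" 0] False by (auto simp: x_def)
  have "w = norm w *\<^sub>R x + 0 *\<^sub>R x" using False by (simp add: x_def)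
  hence "A w w = norm w * A w x" using bil[OF x(1) x(1) w, of "norm w" 0] sym[OF x(1) w] by simp
  also have "A w x = norm w * A x x" using bil[OF x(1) x(1) x(1), of "norm w" 0] \<open>w = _\<close> by simp
  finally have "A w w = A x x * (norm w)\<^sup>2" by (simp add: power2_eq_square)
  thus ?thesis using u(3)[of x] x q u(1) by (simp add: mult_right_mono)
 qed
 thus ?thesis using that u by blast
qed

text \<open>First variation at the maximum: along \<open>u + t w\<close> with \<open>w\<close>
  orthogonal to \<open>u\<close>, maximality reads \<open>2 t a <= t^2 c\<close> for all
  \<open>t\<close>, which forces \<open>a = A u w\<close> to vanish.\<close>

lemma maximizer_eigen:
 assumes u: "u : V" "norm u = 1" "!!w. w : V ==> A w w <= A u u * (norm w)\<^sup>2" and v: "v : V"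
 shows "A u v = A u u * inner u v"
proof -
 define w where "w = 1 *\<^sub>R v + (- inner u v) *\<^sub>R u"
 have w: "w : V" "inner u w = 0" using lin[OF v u(1), of 1 "- inner u v"] u(2) by (auto simp: w_def inner_diff_right dot_square_norm)
 define a c where "a = A u w" and "c = A u u * (norm w)\<^sup>2 - A w w"
 have "2*t*a <= t\<^sup>2*c" for t
 proof -
  define x where "x = 1 *\<^sub>R u + t *\<^sub>R w"
  have x: "x : V" unfolding x_def by (rule lin[OF u(1) w(1)])
  have "A x x = A u x + t*A w x" using bil[OF u(1) w(1) x, of 1 t] by (simp add: x_def)
  also have "A u x = A u u + t*a" using bil[OF u(1) w(1) u(1), of 1 t] sym[OF u(1) x] sym[OF w(1) u(1)] by (simp add: x_def a_def)
  also have "A w x = a + t*A w w" using bil[OF u(1) w(1) w(1), of 1 t] sym[OF w(1) x] by (simp add: x_def a_def)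
  finally have "A x x = A u u + 2*t*a + t\<^sup>2*A w w" by (simp add: power2_eq_square algebra_simps)
  moreover have "(norm x)\<^sup>2 = 1 + t\<^sup>2*(norm w)\<^sup>2"
  proof -
   have "inner u u = 1" using u(2) by (simp add: dot_square_norm)
   thus ?thesis using w(2) unfolding x_def power2_norm_eq_inner by (simp only: inner_add_left inner_add_right inner_scaleR_left inner_scaleR_right inner_commute[of w u]) (simp add: power2_eq_square)
  qed
  ultimately show ?thesis using u(3)[OF x] by (simp add: c_def algebra_simps)
 qed
 \<comment> \<open>\<open>k\<close> is positive and exceeds \<open>c\<close>, so the choice
   \<open>t = a / k\<close> turns the inequality into \<open>a^2 / k <= 0\<close>.\<close>
 moreover define k where "k = abs c + 1"
 ultimately have "2*(a / k) * a <= (a / k)\<^sup>2*c" by blast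
 also have "... <= (a / k)\<^sup>2*k" unfolding k_def by (intro mult_left_mono) auto
 also have "... = (a / k) * a" by (simp add: power2_eq_square k_def)
 finally have "a\<^sup>2 / k <= 0" by (simp add: power2_eq_square)
 moreover have "k > 0" by (simp add: k_def)
 ultimately have "a = 0" by (simp add: divide_le_0_iff)
 thus ?thesis using bil[OF v u(1) u(1), of 1 "- inner u v"] sym[OF u(1) w(1)] sym[OF u(1) v] by (simp add: a_def w_def)
qed

text \<open>A maximal orthonormal set of eigenvectors spans \<open>V\<close>: otherwise its
  orthogonal complement in \<open>V\<close> is nonzero, and the maximiser of the form there is one
  more eigenvector.\<close>

lemma eigenbasis:
 obtains E l where "finite E" "E \<subseteq> V" "ortho E" "!!v. v : V ==> v = (SUM e:E. inner v e *\<^sub>R e)"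
  "!!e v. e : E ==> v : V ==> A v e = l e * inner v e"
proof -
 define P where "P E \<longleftrightarrow> ortho E & E \<subseteq> V & (ALL e:E. EX l. ALL v:V. A v e = l*inner v e)" for E
 obtain E where E: "P E" "finite E" "!!F. P F ==> card F <= card E" by (rule maximal_ortho[of P]) (auto simp: ortho_def P_def)
 have E': "ortho E" "E \<subseteq> V" using E(1) by (auto simp: P_def)
 obtain l where l: "!!e v. e : E ==> v : V ==> A v e = l e * inner v e" using E(1) unfolding P_def by metis
 define pr where "pr v = 1 *\<^sub>R v + (- 1) *\<^sub>R (SUM e:E. inner v e *\<^sub>R e)" for v
 let ?V = "{v : V. ALL e:E. inner v e = 0}"
 have pr: "pr v : ?V" if "v : V" for v
  using lin[OF that sum_in[OF E(2) E'(2)], of 1 "- 1" "inner v"] inner_ortho_sum[OF E'(1) E(2)] by (auto simp: pr_def inner_diff_left)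
 have "v = (SUM e:E. inner v e *\<^sub>R e)" if v: "v : V" for v
 proof (rule ccontr)
  assume "v ~= (SUM e:E. inner v e *\<^sub>R e)"
  hence p0: "pr v ~= 0" by (simp add: pr_def)
  interpret W: symmetric_form ?V B A by unfold_locales (use lin sym bil B pr[OF v] in "auto simp: inner_add_left")
  obtain u where u: "u : ?V" "norm u = 1" "!!w. w : ?V ==> A w w <= A u u * (norm w)\<^sup>2" by (rule W.maximizer[OF pr[OF v] p0]) blast
  \<comment> \<open>On the complement this is \<open>maximizer_eigen\<close>. For general
    \<open>x\<close> the component along \<open>E\<close> contributes nothing, because the members
    of \<open>E\<close> are eigenvectors orthogonal to \<open>u\<close>.\<close>
  have "A x u = A u u * inner x u" if x: "x : V" for x
  proof -
   have "A (SUM e:E. inner x e *\<^sub>R e) u = (SUM e:E. inner x e * A e u)" using u(1) by (intro A_sum E(2) E'(2)) auto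
   also have "... = 0" using u(1) E'(2) l sym by (intro sum.neutral) (auto simp: subset_iff)
   finally have "A (pr x) u = A x u" using bil[OF x sum_in[OF E(2) E'(2)], of u 1 "- 1"] u(1) by (simp add: pr_def)
   moreover have "A (pr x) u = A u u * inner u (pr x)" using W.maximizer_eigen[OF u pr[OF x]] sym[of "pr x" u] pr[OF x] u(1) by auto
   moreover have "inner u (pr x) = inner x u" using u(1) by (simp add: pr_def inner_diff_right inner_sum_right inner_commute)
   ultimately show ?thesis by simp
  qed
  hence "EX l. ALL v:V. A v u = l*inner v u" by blast
  hence "P (insert u E)" using ortho_insert[OF E'(1) u(2)] u(1) E(1) unfolding P_def by simp
  moreover have "u \<notin> E" using ortho_insert[OF E'(1) u(2)] u(1) by auto
  ultimately show False using E(3)[of "insert u E"] E(2) by simp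
 qed
 thus ?thesis using that E(2) E' l by blast
qed

end

section \<open>The finite element space in coordinates\<close>

text \<open>In an orthonormal basis the defining equations have exactly one solution, read off from
  its coefficients; this resolves both definite descriptions.\<close>

lemma L2_projection_onb:
 assumes E: "finite E" "E \<subseteq> X" "ortho E" "!!v. v : X ==> v = (SUM e:E. inner v e *\<^sub>R e)"
  and X: "!!c. (SUM e:E. c e *\<^sub>R e) : X"
 shows "L2_projection X v = (SUM e:E. inner v e *\<^sub>R e)"
  "(!!ps. ps : X ==> A ph ps = (SUM e:E. inner ps e * A ph e)) ==> discrete_operator X A ph = (SUM e:E. A ph e *\<^sub>R e)"
proof -
 have *: "(THE w. w : X & (ALL ps:X. inner w ps = g ps)) = (SUM e:E. g e *\<^sub>R e)" if g: "!!ps. ps : X ==> g ps = (SUM e:E. inner ps e * g e)" for g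
 proof (rule the_equality)
  have "inner (SUM e:E. g e *\<^sub>R e) ps = g ps" if "ps : X" for ps using g[OF that] by (simp add: inner_sum_left inner_commute[of ps] mult.commute)
  thus "(SUM e:E. g e *\<^sub>R e) : X & (ALL ps:X. inner (SUM e:E. g e *\<^sub>R e) ps = g ps)" using X by blast
  fix w assume w: "w : X & (ALL ps:X. inner w ps = g ps)"
  hence "w = (SUM e:E. inner w e *\<^sub>R e)" using E(4) by blast
  also have "... = (SUM e:E. g e *\<^sub>R e)" using w E(2) by (intro sum.cong) auto
  finally show "w = (SUM e:E. g e *\<^sub>R e)" .
 qed
 show "L2_projection X v = (SUM e:E. inner v e *\<^sub>R e)"
  unfolding L2_projection_def
 proof (rule *)
  fix ps assume "ps : X"
  hence "inner v ps = inner v (SUM e:E. inner ps e *\<^sub>R e)" using E(4) by simp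
  thus "inner v ps = (SUM e:E. inner ps e * inner v e)" by (simp add: inner_sum_right)
 qed
 show "(!!ps. ps : X ==> A ph ps = (SUM e:E. inner ps e * A ph e)) ==> discrete_operator X A ph = (SUM e:E. A ph e *\<^sub>R e)"
  unfolding discrete_operator_def by (rule *) blast
qed

lemma square_integrable_indicator_mult:
 assumes D: "D : sets borel" "bounded D" and f: "continuous_on UNIV f"
 shows "square_integrable (%x. indicator D x * f x)"
proof -
 have "SI (closure D) (%x. (f x)\<^sup>2)"
  unfolding SI_def using D(2) by (intro borel_integrable_compact) (auto simp: compact_closure intro!: continuous_intros continuous_on_subset[OF f])
 hence "SI D (%x. (f x)\<^sup>2)" by (rule SI_subset) (use D closure_subset in auto)
 moreover have "(indicator D x * f x)\<^sup>2 = indicator D x *\<^sub>R (f x)\<^sup>2" for x by (simp add: indicator_def)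
 moreover have "(%x. indicator D x * f x) : borel_measurable borel" using D(1) borel_measurable_continuous_onI[OF f] by measurable
 ultimately show ?thesis by (simp add: square_integrable_def SI_def)
qed

lemma L2_of_add: "square_integrable f ==> square_integrable g ==> L2_of (%x. f x + g x) = L2_of f + L2_of g" by (simp add: L2_of_arith)

lemma affine_span:
 fixes D :: "'a::euclidean_space set"
 assumes D: "D : sets borel" "bounded D"
 shows "EX B. finite B & (ALL b c. L2_of (%x. indicator D x * (inner b x + c)) : span B)"
proof -
 let ?f = "%b x. indicator D x * inner b x"
 define B where "B = insert (L2_of (%x. indicator D x * 1)) ((%i. L2_of (?f i)) ` Basis)"
 have sq: "square_integrable (?f b)" "square_integrable (%x. indicator D x * (1::real))" for b by (intro square_integrable_indicator_mult D continuous_intros)+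
 have "L2_of (?f b) : span B" for b
 proof (rule span_induct[of b Basis "%b. L2_of (?f b) : span B"])
  show "subspace {b. L2_of (?f b) : span B}"
  proof (unfold subspace_def mem_Collect_eq, intro conjI allI ballI impI)
   have "?f 0 = (%x. 0*?f 0 x)" by simp
   thus "L2_of (?f 0) : span B" using scaleR_L2_of[OF sq(1), of 0 0] by (metis scaleR_zero_left span_zero)
   fix x y assume "x : {b. L2_of (?f b) : span B}" "y : {b. L2_of (?f b) : span B}"
   hence "L2_of (?f x) + L2_of (?f y) : span B" by (intro span_add) auto
   thus "L2_of (?f (x + y)) : span B" using L2_of_add[OF sq(1) sq(1), of x y] by (simp add: inner_add_left distrib_left)
  next
   fix c x assume "x : {b. L2_of (?f b) : span B}"
   hence "c *\<^sub>R L2_of (?f x) : span B" by (intro span_scale) auto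
   thus "L2_of (?f (c *\<^sub>R x)) : span B" using scaleR_L2_of[OF sq(1), of c x] by (simp add: mult.left_commute)
  qed
 qed (auto simp: B_def intro: span_base)
 moreover have "L2_of (%x. indicator D x * (inner b x + c)) = L2_of (?f b) + c *\<^sub>R L2_of (%x. indicator D x * 1)" for b c
  using L2_of_add[OF sq(1) square_integrable_scale[OF sq(2)], of b c] scaleR_L2_of[OF sq(2), of c] by (simp add: algebra_simps)
 moreover have "L2_of (%x. indicator D x * 1) : span B" unfolding B_def by (intro span_base) auto
 ultimately have "ALL b c. L2_of (%x. indicator D x * (inner b x + c)) : span B" by (auto intro!: span_add span_scale)
 thus ?thesis unfolding B_def by (intro exI[of _ B]) (auto simp: B_def)
qed

text \<open>Induction over the sets of \<open>S\<close>, adding only the part of \<open>K\<close>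
  outside the earlier ones, so that common faces are not counted twice. The new piece is an affine
  function on a bounded Borel set, and \<open>affine_span\<close> puts all of these into the span of
  a finite set.\<close>

lemma piecewise_affine_span:
 fixes Om :: "'a::euclidean_space set"
 assumes "finite S" "!!K. K : S ==> closed K" "open Om" "bounded Om"
 shows "EX B. finite B & (ALL w. (ALL K:S. EX b c. ALL x:K. w x = inner b x + c) -->
   square_integrable (%x. indicator (\<Union>S \<inter> Om) x * w x) & L2_of (%x. indicator (\<Union>S \<inter> Om) x * w x) : span B)"
 using assms(1,2)
proof (induction S rule: finite_induct)
 case empty
 thus ?case using square_integrable_0 by (intro exI[of _ "{}"]) (auto simp: zero_L2_def[symmetric])
next
 case (insert K S)
 obtain B where B: "finite B" "!!w. (ALL K:S. EX b c. ALL x:K. w x = inner b x + c) ==>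
   square_integrable (%x. indicator (\<Union>S \<inter> Om) x * w x) & L2_of (%x. indicator (\<Union>S \<inter> Om) x * w x) : span B"
  using insert.IH insert.prems by auto
 define D where "D = (K - \<Union>S) \<inter> Om"
 have "closed (\<Union>S)" using insert by (intro closed_Union) auto
 hence D: "D : sets borel" "bounded D"
  unfolding D_def using insert.prems[of K] assms(3,4) by (auto intro: bounded_subset borel_closed borel_open)
 obtain B' where B': "finite B'" "!!b c. L2_of (%x. indicator D x * (inner b x + c)) : span B'" using affine_span[OF D] by blast
 show ?case
 proof (intro exI[of _ "B \<union> B'"] conjI allI impI)
  fix w assume w: "ALL K:insert K S. EX b c. ALL x:K. w x = inner b x + c"
  then obtain b c where bc: "ALL x:K. w x = inner b x + c" by blast
  have s1: "square_integrable (%x. indicator (\<Union>S \<inter> Om) x * w x)" "L2_of (%x. indicator (\<Union>S \<inter> Om) x * w x) : span B" using B(2)[of w] w by auto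
  have s2: "square_integrable (%x. indicator D x * (inner b x + c))" by (intro square_integrable_indicator_mult D continuous_intros)
  have e: "(%x. indicator (\<Union>(insert K S) \<inter> Om) x * w x) = (%x. indicator (\<Union>S \<inter> Om) x * w x + indicator D x * (inner b x + c))"
  proof
   show "indicator (\<Union>(insert K S) \<inter> Om) x * w x = indicator (\<Union>S \<inter> Om) x * w x + indicator D x * (inner b x + c)" for x
    using bc by (cases "x : \<Union>S"; cases "x : K"; cases "x : Om") (auto simp: D_def indicator_def)
  qed
  show "square_integrable (%x. indicator (\<Union>(insert K S) \<inter> Om) x * w x)" unfolding e by (rule square_integrable_add[OF s1(1) s2])
  show "L2_of (%x. indicator (\<Union>(insert K S) \<inter> Om) x * w x) : span (B \<union> B')"
   unfolding e L2_of_add[OF s1(1) s2] using s1(2) B'(2) span_mono[of B "B \<union> B'"] span_mono[of B' "B \<union> B'"] by (intro span_add) auto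
 qed (use B B' in auto)
qed

section \<open>Expansion of the source in time\<close>

lemma set_integrable_endpoints:
 fixes f :: "real => 'b::{banach, second_countable_topology}"
 shows "SI {0<..<T} f \<longleftrightarrow> SI {0..T} f"
 unfolding SI_def by (rule integrable_discrete_difference[of "{0, T}"]) (auto simp: indicator_def)

lemma set_integrable_scaleR_continuous:
 fixes v :: "real => 'b::{banach, second_countable_topology}"
 assumes k: "continuous_on {0..T} k" and v: "SI {0..T} v"
 shows "SI {0..T} (%t. k t *\<^sub>R v t)"
proof -
 have "bounded (k ` {0..T})" by (intro compact_imp_bounded compact_continuous_image k) auto
 then obtain B where B: "!!s. s : {0..T} ==> abs (k s) <= B" unfolding bounded_iff by force
 have "(%s. indicator {0..T} s *\<^sub>R k s) : borel_measurable lborel" using borel_measurable_continuous_on_indicator[OF _ k] by simp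
 note borel_measurable_scaleR[OF this borel_measurable_integrable[OF v[unfolded SI_def]]]
 moreover have "(indicator {0..T} s *\<^sub>R k s) *\<^sub>R (indicator {0..T} s *\<^sub>R v s) = indicator {0..T} s *\<^sub>R (k s *\<^sub>R v s)" for s by (simp add: indicator_def)
 ultimately have m: "SM {0..T} (%t. k t *\<^sub>R v t)" by (simp only: SM_def)
 show ?thesis
 proof (rule SI_bound[OF SI_mult[of B, OF set_integrable_norm[OF v]] m], intro AE_I2 impI)
  fix s assume "s : {0..T}"
  hence "abs (k s) <= abs B" using B[of s] by linarith
  thus "norm (k s *\<^sub>R v s) <= norm (B*norm (v s))" by (simp add: abs_mult mult_right_mono)
 qed
qed

lemma set_integral_inner:
 fixes f :: "real => 'b::{real_inner, banach, second_countable_topology}"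
 assumes "SI A f"
 shows "SI A (%x. inner (f x) e)" "inner (LBINT x:A. f x) e = (LBINT x:A. inner (f x) e)"
 using assms integrable_inner_left[of e lborel "%x. indicator A x *\<^sub>R f x"] integral_inner_left[of e lborel "%x. indicator A x *\<^sub>R f x"]
 unfolding SI_def LB_def by simp_all

lemma weak_derivative_inner:
 fixes g g' :: "real => 'b::{real_inner, banach, second_countable_topology}"
 assumes T: "T > 0" and w: "has_weak_time_deriv T g g'" and g: "continuous_on {0..T} g" and g': "SI {0..T} g'" and t: "t : {0..T}"
 shows "inner (g t) e = inner (g 0) e + conv (jf 1) (%s. inner (g' s) e) t"
proof -
 have "inner (g t) e = inner (g 0) e + (LBINT s:{0..t}. inner (g' s) e)"
 proof (rule weak_derivative_imp_integral[OF _ set_integral_inner(1)[OF g'] T _ t])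
  show "continuous_on {0..T} (%t. inner (g t) e)" by (intro continuous_intros g)
  fix ph :: "real => real" assume p: "test_function {0<..<T} ph"
  have d: "(ph has_derivative frechet_derivative ph (at x)) (at x)" for x using p by (auto simp: test_function_def frechet_derivative_works[symmetric] elim: smooth.cases)
  have lin: "frechet_derivative ph (at x) h = frechet_derivative ph (at x) 1 * h" for x h
   using linear_scale[OF has_derivative_linear[OF d], of x h 1] by simp
  have fr: "frechet_derivative ph (at x) = (*) (frechet_derivative ph (at x) 1)" for x by (rule ext) (rule lin)
  have "(ph has_real_derivative frechet_derivative ph (at x) 1) (at x)" for x
   unfolding has_field_derivative_def fr[symmetric] by (rule d)
  from DERIV_imp_deriv[OF this] have dd: "deriv ph = (%x. frechet_derivative ph (at x) 1)" by auto
  have cont: "continuous_on A f" if "smooth f" for f :: "real => real" and A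
   using that by (intro continuous_at_imp_continuous_on ballI) (auto elim!: smooth.cases intro: differentiable_imp_continuous_within)
  have sm: "smooth ph" "smooth (deriv ph)" using p unfolding dd by (auto simp: test_function_def elim: smooth.cases)
  have gi: "SI {0..T} g" by (rule SI_Icc[OF g])
  have i: "SI {0<..<T} (%t. deriv ph t *\<^sub>R g t)" "SI {0<..<T} (%t. ph t *\<^sub>R g' t)"
   unfolding set_integrable_endpoints by (intro set_integrable_scaleR_continuous cont sm gi g')+
  have "(LBINT t:{0<..<T}. deriv ph t *\<^sub>R g t) = - (LBINT t:{0<..<T}. ph t *\<^sub>R g' t)" using w p by (simp add: has_weak_time_deriv_def)
  from arg_cong[OF this, of "%v. inner v e"]
  show "(LBINT t:{0<..<T}. deriv ph t * inner (g t) e) = - (LBINT t:{0<..<T}. ph t * inner (g' t) e)"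
   unfolding inner_minus_left set_integral_inner(2)[OF i(1)] set_integral_inner(2)[OF i(2)] by simp
 qed
 also have "(LBINT s:{0..t}. inner (g' s) e) = conv (%_. 1) (%s. inner (g' s) e) t" by (simp add: conv_def)
 also have "... = conv (jf 1) (%s. inner (g' s) e) t" by (rule conv_cong) (simp add: jf_def)
 finally show ?thesis .
qed

text \<open>The notion of weak derivative gives integrability on compact subsets of
  \<open>(0, T)\<close> only, which yields measurability by exhaustion. Since \<open>m <= 0\<close>,
  the weight \<open>(T - s) powr m\<close> is at least \<open>T powr m\<close>, so the weighted
  bound at time \<open>T\<close> gives integrability up to both ends.\<close>

lemma weak_second_derivative_integrable:
 fixes g' g'' :: "real => 'b::{banach, second_countable_topology}"
 assumes T: "T > 0" and w: "has_weak_time_deriv T g' g''" and m: "m <= 0"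
  and i: "SI {0..T} (%s. (T - s) powr m * norm (g'' s))"
 shows "SI {0..T} g''"
proof -
 let ?K = "%n. {T / (2 + real n)..T - T / (2 + real n)}"
 have "SI (?K n) g''" for n
 proof -
  have "T / (2 + real n) > 0" using T by (simp add: add_pos_nonneg)
  hence "?K n \<subseteq> {0<..<T}" by auto
  thus ?thesis using w unfolding has_weak_time_deriv_def by blast
 qed
 hence K: "(%x. indicator (?K n) x *\<^sub>R g'' x) : borel_measurable lborel" for n by (auto simp: SI_def)
 have l: "(%n. T / (2 + real n)) \<longlonglongrightarrow> 0" by real_asymp
 have "SM {0<..<T} g''"
  unfolding SM_def
 proof (rule borel_measurable_LIMSEQ_metric[OF K])
  fix x
  show "(%n. indicator (?K n) x *\<^sub>R g'' x) \<longlonglongrightarrow> indicator {0<..<T} x *\<^sub>R g'' x"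
  proof (cases "x : {0<..<T}")
   case True
   hence "\<forall>\<^sub>F n in sequentially. T / (2 + real n) < min x (T - x)" by (intro order_tendstoD(2)[OF l]) auto
   hence "\<forall>\<^sub>F n in sequentially. indicator (?K n) x *\<^sub>R g'' x = indicator {0<..<T} x *\<^sub>R g'' x" by eventually_elim (use True in "auto simp: indicator_def")
   thus ?thesis by (rule tendsto_eventually)
  next
   case False
   have "T / (2 + real n) > 0" for n using T by (simp add: add_pos_nonneg)
   hence "x \<notin> ?K n" for n using False by (smt (verit) atLeastAtMost_iff greaterThanLessThan_iff)
   thus ?thesis using False by simp
  qed
 qed
 note M = this
 have "SI {0<..<T} (%s. T powr (- m)*((T - s) powr m * norm (g'' s)))"
  unfolding set_integrable_endpoints by (intro SI_mult i)
 hence "SI {0<..<T} g''"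
 proof (rule SI_bound[OF _ M], intro AE_I2 impI)
  fix s assume s: "s : {0<..<T}"
  have "1 = T powr (- m) * T powr m" using T by (simp flip: powr_add)
  also have "... <= T powr (- m)*(T - s) powr m" using s m by (intro mult_left_mono powr_mono2') auto
  finally have "1*norm (g'' s) <= T powr (- m)*(T - s) powr m * norm (g'' s)" by (rule mult_right_mono) simp
  thus "norm (g'' s) <= norm (T powr (- m)*((T - s) powr m * norm (g'' s)))" by (simp add: mult.assoc)
 qed
 thus ?thesis by (simp only: set_integrable_endpoints)
qed

text \<open>After two integrations \<open>g = g(0) jf 1 + g'(0) jf 2 + conv (jf 2) g''\<close> in
  each direction \<open>e\<close>, and \<open>t powr mu\<close> is
  \<open>Gamma (mu + 1) * jf (mu + 1) t\<close>; the semigroup law adds the orders. Hence the factor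
  \<open>Gamma (mu + 1)\<close> in the final constant.\<close>

lemma convolution_source_inner:
 fixes g g' g'' :: "real => 'b::{real_inner, banach, second_countable_topology}"
 assumes mu: "mu > -1" and T: "T > 0" and g: "continuous_on {0..T} g" and g'': "SI {0..T} g''"
  and G: "!!t. t : {0..T} ==> inner (g t) e = inner (g 0) e + conv (jf 1) (%s. inner (g' s) e) t"
   "!!t. t : {0..T} ==> inner (g' t) e = inner (g' 0) e + conv (jf 1) (%s. inner (g'' s) e) t"
  and t: "t : {0..T}"
 shows "inner (convolution_source mu g t) e = Gamma (mu + 1) * inner (g 0) e * jf (mu + 2) t + Gamma (mu + 1) * inner (g' 0) e * jf (mu + 3) t
  + conv (jf (mu + 3)) (%s. Gamma (mu + 1) * inner (g'' s) e) t"
proof -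
 let ?A = "mu + 1"
 have q: "mu + 1 > 0" using mu by simp
 hence G0: "Gamma ?A ~= 0" using Gamma_real_pos[of "mu + 1"] by linarith
 have t': "0 <= t" "t <= T" using t by auto
 have cs: "continuous_on {0..t} g" by (rule continuous_on_subset[OF g]) (use t in auto)
 let ?g2 = "%s. inner (g'' s) e"
 have g2: "SI {0..T} ?g2" by (rule set_integral_inner(1)[OF g''])
 have i: "SI {0..t} (%s. (t - s) powr mu *\<^sub>R g s)"
 proof -
  have "bounded (g ` {0..t})" by (intro compact_imp_bounded compact_continuous_image cs) auto
  then obtain M where M: "!!s. s : {0..t} ==> norm (g s) <= M" unfolding bounded_iff by force
  have "SM {0..t} g" using borel_measurable_continuous_on_indicator[OF _ cs] by (simp add: SM_def)
  hence "(%s. (t - s) powr mu *\<^sub>R (indicator {0..t} s *\<^sub>R g s)) : borel_measurable lborel" unfolding SM_def by measurable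
  hence m: "SM {0..t} (%s. (t - s) powr mu *\<^sub>R g s)" unfolding SM_def by (simp add: mult.commute)
  show ?thesis
  proof (rule SI_bound[OF SI_mult[of "M*Gamma ?A", OF jf_reflect(1)[OF q t'(1), of t]] m], intro AE_I2 impI)
   fix s assume s: "s : {0..t}"
   have "norm ((t - s) powr mu *\<^sub>R g s) <= (t - s) powr mu * M" using M[OF s] by (simp add: mult_left_mono)
   also have "... = M*Gamma ?A * jf ?A (t - s)" using s G0 by (simp add: jf_def)
   finally show "norm ((t - s) powr mu *\<^sub>R g s) <= norm (M*Gamma ?A * jf ?A (t - s))" by simp
  qed
 qed
 have "inner (convolution_source mu g t) e = conv (%s. s powr mu) (%s. inner (g s) e) t"
  unfolding convolution_source_def set_integral_inner(2)[OF i] conv_def by simp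
 also have "... = conv (jf ?A) (%s. Gamma ?A * inner (g 0) e * jf 1 s + 1*(Gamma ?A * inner (g' 0) e * jf 2 s + Gamma ?A * conv (jf 2) ?g2 s)) t"
 proof (rule conv_cong)
  fix s assume s: "0 < s" "s < t"
  hence sT: "s : {0..T}" using t by auto
  have "conv (jf 1) (%s. inner (g' s) e) s = conv (jf 1) (%x. inner (g' 0) e * jf 1 x + 1*conv (jf 1) ?g2 x) s"
  proof (rule conv_cong)
   fix x assume x: "0 < x" "x < s"
   hence "inner (g' x) e = inner (g' 0) e * jf 1 x + 1*conv (jf 1) ?g2 x" using G(2)[of x] sT by (simp add: jf_def)
   thus "jf 1 (s - x) * inner (g' x) e = jf 1 (s - x)*(inner (g' 0) e * jf 1 x + 1*conv (jf 1) ?g2 x)" by (simp only:)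
  qed
  also have "... = inner (g' 0) e * conv (jf 1) (jf 1) s + 1*conv (jf 1) (conv (jf 1) ?g2) s"
  proof (rule conv_linear)
   have r: "SI {0..s} (%x. jf 1 (s - x) * h x)" if "SI {0..T} h" for h
   proof -
    have "SI {0..s} (%x. (%_. 1) (s - x) * h x)" by (rule SI_reflect[OF continuous_on_const SI_subset[OF that]]) (use sT in auto)
    thus ?thesis unfolding SI_def by (subst integrable_discrete_difference[of "{s}"]) (auto simp: indicator_def jf_def)
   qed
   show "SI {0..s} (%x. jf 1 (s - x) * jf 1 x)" by (rule r[OF jf_integral(1)]) (use T in auto)
   show "SI {0..s} (%x. jf 1 (s - x) * conv (jf 1) ?g2 x)" by (rule r[OF set_integrable_conv[OF jf_integral(1) g2]]) (use T in auto)
  qed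
  also have "... = inner (g' 0) e * jf 2 s + conv (jf 2) ?g2 s"
   using conv_jf_jf(1)[of 1 1 T ?g2 s, OF _ _ g2] sT by (simp add: conv_jf)
  finally have "inner (g s) e = inner (g 0) e * jf 1 s + (inner (g' 0) e * jf 2 s + conv (jf 2) ?g2 s)" using G(1)[OF sT] s by (simp add: jf_def[of 1])
  moreover have "(t - s) powr mu = jf ?A (t - s) * Gamma ?A" using s G0 by (simp add: jf_def)
  ultimately show "(t - s) powr mu * inner (g s) e = jf ?A (t - s)*(Gamma ?A * inner (g 0) e * jf 1 s + 1*(Gamma ?A * inner (g' 0) e * jf 2 s + Gamma ?A * conv (jf 2) ?g2 s))" by (simp add: distrib_left mult_ac)
 qed
 also have "... = Gamma ?A * inner (g 0) e * conv (jf ?A) (jf 1) t + 1*(Gamma ?A * inner (g' 0) e * conv (jf ?A) (jf 2) t + Gamma ?A * conv (jf ?A) (conv (jf 2) ?g2) t)"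
 proof -
  have c2: "continuous_on {0..t} (jf 2)" by (rule continuous_on_eq[of _ "%x. x"]) (auto simp: jf_def Gamma_numeral)
  have cj: "continuous_on UNIV (jf 2)"
  proof -
   have "jf 2 = (%x. max 0 x)" by (auto simp: jf_def Gamma_numeral)
   thus ?thesis by (auto intro!: continuous_intros)
  qed
  have cg: "continuous_on {0..t} (conv (jf 2) ?g2)" by (rule continuous_on_conv[OF cj]) (use SI_subset[OF g2] t in "auto simp: jf_def")
  have w: "SI {0..t} (%s. jf ?A (t - s) * h s)" if "continuous_on {0..t} h" for h by (rule jf_window(1)[OF q t'(1) that])
  have j1: "SI {0..t} (%s. jf ?A (t - s) * jf 1 s)"
  proof -
   have "SI {0..t} (%s. jf ?A (t - s) * 1)" by (rule w) (rule continuous_on_const)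
   thus ?thesis unfolding SI_def by (subst integrable_discrete_difference[of "{0}"]) (auto simp: indicator_def jf_def[of 1])
  qed
  have "continuous_on {0..t} (%s. Gamma ?A * inner (g' 0) e * jf 2 s + Gamma ?A * conv (jf 2) ?g2 s)" by (intro continuous_intros c2 cg)
  from conv_linear[OF j1 w[OF this]] conv_linear[OF w[OF c2] w[OF cg]] show ?thesis by (simp only:)
 qed
 also have "... = Gamma ?A * inner (g 0) e * jf (mu + 2) t + Gamma ?A * inner (g' 0) e * jf (mu + 3) t + Gamma ?A * conv (jf (mu + 3)) ?g2 t"
  using conv_jf_jf(2)[OF _ q g2 t'(2), of 2] q by (simp add: conv_jf add_ac)
 also have "Gamma ?A * conv (jf (mu + 3)) ?g2 t = conv (jf (mu + 3)) (%s. Gamma ?A * ?g2 s) t"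
  unfolding conv_def LB_mult[symmetric] by (simp add: mult.left_commute)
 finally show ?thesis .
qed

section \<open>Summation over the modes\<close>

lemma ortho_norm:
 assumes E: "finite E" "ortho E"
 shows "(norm (SUM e:E. c e *\<^sub>R e))\<^sup>2 = (SUM e:E. (c e)\<^sup>2)"
 unfolding power2_norm_eq_inner inner_sum_right by (rule sum.cong) (simp_all add: inner_ortho_sum[OF E(2,1)] power2_eq_square)

text \<open>Orthonormality bounds the vector with coefficients \<open>inner w e * k e\<close> by
  \<open>K\<close> times the norm of \<open>w\<close>; pairing it with \<open>v\<close> is
  Cauchy-Schwarz. The bilinear form suits a \<open>v\<close> that depends on time under an
  integral.\<close>

lemma multiplier_bound:
 assumes E: "finite E" "ortho E" and w: "w = (SUM e:E. inner w e *\<^sub>R e)" and k: "!!e. e : E ==> abs (k e) <= K" and K: "K >= 0"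
 shows "abs (SUM e:E. inner w e * (inner v e * k e)) <= norm w * (norm v * K)"
proof -
 let ?A = "SUM e:E. (inner w e * k e) *\<^sub>R e"
 have "(norm ?A)\<^sup>2 = (SUM e:E. (inner w e)\<^sup>2*(k e)\<^sup>2)"
  using ortho_norm[OF E] by (simp add: power_mult_distrib)
 also have "... <= (SUM e:E. (inner w e)\<^sup>2*K\<^sup>2)"
  using k by (intro sum_mono mult_left_mono) (auto simp: abs_le_square_iff[symmetric] K abs_of_nonneg)
 also have "... = (norm w * K)\<^sup>2"
  unfolding sum_distrib_right[symmetric] power_mult_distrib using ortho_norm[OF E, of "inner w"] w by simp
 finally have "norm ?A <= norm w * K" by (rule power2_le_imp_le) (simp add: K)
 hence "norm v * norm ?A <= norm v * (norm w * K)" by (rule mult_left_mono) simp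
 moreover have "(SUM e:E. inner w e * (inner v e * k e)) = inner v ?A" by (simp add: inner_sum_right mult_ac)
 ultimately show ?thesis using Cauchy_Schwarz_ineq2[of v "SUM e:E. (inner w e * k e) *\<^sub>R e"] by (simp add: mult_ac)
qed

context fractional_order
begin

lemma continuous_on_errS:
 assumes "L > 0" "ta > 0" "q > 0"
 shows "continuous_on {0..M} (errS ta q L)"
proof -
 have "SI {0..M / ta} (jf q)" by (cases "M / ta >= 0") (use assms jf_integral(1)[of q "M / ta"] in "simp_all add: not_le SI_def")
 from continuous_on_conv[OF continuous_on_ex[OF assms(1)] ex_nonpos this]
 have "continuous_on {0..M / ta} (conv (ex L) (jf q))" by simp
 moreover have "conv (ex L) (jf q) = conv (jf q) (ex L)" by (rule ext) (rule conv_commute)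
 ultimately have "continuous_on {0..M} (%x. conv (jf q) (ex L) (x / ta))"
  using assms by (intro continuous_on_compose2[of "{0..M / ta}" "conv (jf q) (ex L)" _ "%x. x / ta"]) (auto intro!: continuous_intros divide_right_mono)
 thus ?thesis unfolding errS_def by (intro continuous_intros)
qed

lemma errS_0: "errS ta q L 0 = 0"
proof -
 have "conv (jf q) (ex L) 0 = conv (%_. 0) (%_. 0) 0" by (rule conv_cong) simp
 thus ?thesis by (simp add: errS_def conv_def[of "%_. 0"])
qed

text \<open>Both problems are paired with an eigenvector: on coefficients the projection becomes the
  identity and the discrete operator multiplication by \<open>l e\<close>, so
  \<open>mode_error\<close> applies.\<close>

lemma mode_error_inner:
 fixes u g g' g'' :: "real => 'b::{real_inner, banach, second_countable_topology}" and U :: "int => 'b"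
 assumes mu: "mu > -1" and T: "T > 0" and N: "N >= 1" and ta: "ta = T / real N"
  and E: "finite E" "E \<subseteq> X" and l: "!!e. e : E ==> l e > 0"
  and P: "!!v. P v = (SUM e:E. inner v e *\<^sub>R e)" "!!v e. e : E ==> inner (P v) e = inner v e"
  and Ah: "!!v e. v : X ==> e : E ==> inner (Ah v) e = l e * inner v e" and X0: "0 : X"
  and g: "continuous_on {0..T} g" and g'': "SI {0..T} g''"
  and G: "!!t e. t : {0..T} ==> inner (g t) e = inner (g 0) e + conv (jf 1) (%s. inner (g' s) e) t"
   "!!t e. t : {0..T} ==> inner (g' t) e = inner (g' 0) e + conv (jf 1) (%s. inner (g'' s) e) t"
  and u: "semidiscrete_solution X Ah al T (%t. P (convolution_source mu g t)) (P u0) u"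
  and U: "cn1_solution X Ah al ta N (%t. P (convolution_source mu g t)) (u 0) U ut"
  and n: "n : {1..N}" and e: "e : E"
 shows "inner (u (real n * ta) - ut n) e = inner u0 e * errA (l e * ta powr al) (real n)
  + Gamma (mu + 1) * inner (g 0) e * errS ta (mu + 1) (l e * ta powr al) (real n * ta)
  + Gamma (mu + 1) * inner (g' 0) e * errS ta (mu + 2) (l e * ta powr al) (real n * ta)
  + conv (errS ta (mu + 2) (l e * ta powr al)) (%s. Gamma (mu + 1) * inner (g'' s) e) (real n * ta)"
proof -
 let ?f = "convolution_source mu g" and ?G = "Gamma (mu + 1)"
 let ?y' = "%t. inner (vector_derivative u (at t)) e"
 have ta0: "ta > 0" and nt: "real k * ta : {0..T}" if "k <= N" for k
 proof -
  show "ta > 0" using T N by (simp add: ta)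
  have "real k * ta = real k / real N * T" by (simp add: ta)
  also have "... <= 1*T" using that N T by (intro mult_right_mono) auto
  finally show "real k * ta : {0..T}" using \<open>ta > 0\<close> by simp
 qed
 have uc: "continuous_on {0..T} u" "u 0 = P u0" "!!t. t : {0..T} ==> u t : X" "!!t. t : {0<..<T} ==> u differentiable at t"
  and ui: "!!t. t : {0<..T} ==> SI {0..t} (%s. (t - s) powr (- al) *\<^sub>R vector_derivative u (at s))"
  and ue: "!!t. t : {0<..T} ==> caputo_deriv al u t + Ah (u t) = P (?f t)"
  using u by (auto simp: semidiscrete_solution_def)
 have g2: "SI {0..T} (%s. ?G*inner (g'' s) e)" for e by (intro SI_mult set_integral_inner(1) g'')
 have f: "inner (?f t) e = ?G*inner (g 0) e * jf (mu + 2) t + ?G*inner (g' 0) e * jf (mu + 3) t + conv (jf (mu + 3)) (%s. ?G*inner (g'' s) e) t"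
  if "t : {0..T}" for t e by (rule convolution_source_inner[OF mu T g g'' _ _ that]; rule G; assumption)
 \<comment> \<open>The solution concept gives integrability only with the Caputo weight;
   multiplication by the continuous function \<open>(T - s) powr al\<close> removes the weight
   except at the single point \<open>s = T\<close>.\<close>
 have y': "SI {0..T} ?y'"
 proof -
  have "continuous_on {0..T} (%x. x powr al)" using al by (intro continuous_intros continuous_on_powr') auto
  from SI_reflect[OF this set_integral_inner(1)[OF ui, of T e]] T
  have "SI {0..T} (%s. (T - s) powr al * ((T - s) powr (- al) * ?y' s))" by simp
  moreover have "(T - s) powr al * ((T - s) powr (- al) * ?y' s) = ?y' s" if "s < T" for s
   using that by (simp add: powr_add[symmetric] mult.assoc[symmetric])
  ultimately show ?thesis
   unfolding SI_def by (subst (asm) integrable_discrete_difference[of "{T}"]) (auto simp: indicator_def)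
 qed
 have dy: "((%t. inner (u t) e) has_vector_derivative ?y' t) (at t)" if "t : {0<..<T}" for t
  using uc(4)[OF that] by (intro bounded_linear.has_vector_derivative[OF bounded_linear_inner_left]) (simp add: vector_derivative_works)
 have y: "inner (u t) e = inner u0 e + conv (jf 1) ?y' t" if t: "t : {0..T}" for t
 proof -
  have "(?y' has_integral inner (u t) e - inner (u 0) e) {0..t}"
   using t by (intro fundamental_theorem_of_calculus_interior dy continuous_intros continuous_on_subset[OF uc(1)]) auto
  moreover have "SI {0..t} ?y'" by (rule SI_subset[OF y']) (use t in auto)
  ultimately have "(LBINT s:{0..t}. ?y' s) = inner (u t) e - inner u0 e"
   using P(2)[OF e, of u0] uc(2) by (simp add: SI_HK(2) integral_unique)
  moreover have "conv (jf 1) ?y' t = conv (%_. 1) ?y' t" by (rule conv_cong) (simp add: jf_def)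
  ultimately show ?thesis by (simp add: conv_def)
 qed
 have eq: "conv (jf (1 - al)) ?y' t + l e * inner (u t) e = inner (?f t) e" if t: "t : {0<..<T}" for t
 proof -
  have t': "t : {0<..T}" "u t : X" using t uc(3)[of t] by auto
  have "inner (caputo_deriv al u t) e = 1 / Gamma (1 - al) * conv (%s. s powr (- al)) ?y' t"
   unfolding caputo_deriv_def using set_integral_inner(2)[OF ui[OF t'(1)], of e] by (simp add: conv_def)
  also have "... = conv (%s. 1 / Gamma (1 - al) * s powr (- al)) ?y' t" unfolding conv_def LB_mult[symmetric] mult.assoc ..
  also have "... = conv (jf (1 - al)) ?y' t" by (rule conv_cong) (simp add: jf_def)
  finally show ?thesis
   using arg_cong[OF ue[OF t'(1)], of "%v. inner v e"] Ah[OF t'(2) e] P(2)[OF e] by (simp add: inner_add_left)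
 qed
 \<comment> \<open>The primitive is an integral of vectors. The expansion of \<open>P (?f s)\<close>
   in \<open>E\<close> with scalar coefficients \<open>r e s\<close> supplies the Bochner
   integrability that lets the inner product pass under the integral.\<close>
 have F: "inner (primitive (%t. P (?f t)) t) e = ?G*inner (g 0) e * jf (mu + 3) t + ?G*inner (g' 0) e * jf (mu + 4) t + conv (jf (mu + 4)) (%s. ?G*inner (g'' s) e) t"
  if t: "t : {0..T}" and e: "e : E" for t e
 proof -
  define r where "r e s = ?G*inner (g 0) e * jf (mu + 2) s + 1*(?G*inner (g' 0) e * jf (mu + 3) s + 1*conv (jf (mu + 3)) (%s. ?G*inner (g'' s) e) s)" for e s
  have q: "mu + 2 > 0" "mu + 3 > 0" using mu by auto
  have j: "SI {0..T} (jf p)" if "p > 0" for p using jf_integral(1)[OF that] T by simp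
  have c: "SI {0..T} (conv (jf (mu + 3)) (%s. ?G*inner (g'' s) e))" for e by (rule set_integrable_conv[OF j[OF q(2)] g2])
  have r2: "SI {0..T} (%s. ?G*inner (g' 0) e * jf (mu + 3) s + 1*conv (jf (mu + 3)) (%s. ?G*inner (g'' s) e) s)" for e by (intro LB_add(1) SI_mult j q c)
  have ri: "SI {0..t} (r e)" for e
  proof (rule SI_subset[of _ "{0..T}"])
   show "SI {0..T} (r e)" unfolding r_def by (intro LB_add(1) SI_mult j q r2)
  qed (use t in auto)
  have Pf: "P (?f s) = (SUM e:E. r e s *\<^sub>R e)" if "s : {0..T}" for s
   unfolding P(1) r_def using f[OF that] by (simp add: add.assoc)
  have i: "SI {0..t} (%s. SUM e:E. r e s *\<^sub>R e)"
  proof -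
   have "integrable lborel (%s. SUM e:E. (indicator {0..t} s *\<^sub>R r e s) *\<^sub>R e)"
    using ri[unfolded SI_def] by (intro Bochner_Integration.integrable_sum integrable_scaleR_left) auto
   thus ?thesis by (simp add: SI_def scaleR_sum_right)
  qed
  have "primitive (%t. P (?f t)) t = (LBINT s:{0..t}. SUM e:E. r e s *\<^sub>R e)"
   unfolding primitive_def by (rule LB_cong) (use Pf t in auto)
  hence "inner (primitive (%t. P (?f t)) t) e = (LBINT s:{0..t}. inner (SUM e:E. r e s *\<^sub>R e) e)" using set_integral_inner(2)[OF i] by simp
  also have "... = (LBINT s:{0..t}. r e s)" by (rule LB_cong) (use Pf[symmetric] P(2)[OF e] f t in "auto simp: r_def add.assoc")
  also have "... = conv (jf 1) (r e) t"
  proof -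
   have "conv (jf 1) (r e) t = conv (%_. 1) (r e) t" by (rule conv_cong) (simp add: jf_def)
   thus ?thesis by (simp add: conv_def)
  qed
  also have "... = ?G*inner (g 0) e * conv (jf 1) (jf (mu + 2)) t + 1*(?G*inner (g' 0) e * conv (jf 1) (jf (mu + 3)) t + 1*conv (jf 1) (conv (jf (mu + 3)) (%s. ?G*inner (g'' s) e)) t)"
  proof -
   have w: "SI {0..t} (%s. jf 1 (t - s) * h s)" if h: "SI {0..T} h" for h
   proof -
    have "SI {0..t} (%s. (%_. 1) (t - s) * h s)" by (rule SI_reflect[OF continuous_on_const SI_subset[OF h]]) (use t in auto)
    thus ?thesis unfolding SI_def by (subst integrable_discrete_difference[of "{t}"]) (auto simp: indicator_def jf_def)
   qed
   show ?thesis unfolding r_def using conv_linear[OF w[OF j[OF q(1)]] w[OF r2]] conv_linear[OF w[OF j[OF q(2)]] w[OF c]] by (simp only:)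
  qed
  also have "conv (jf 1) (conv (jf (mu + 3)) (%s. ?G*inner (g'' s) e)) t = conv (jf (mu + 4)) (%s. ?G*inner (g'' s) e) t"
   using conv_jf_jf(1)[OF _ q(2) g2, of 1 t] t by (simp add: add_ac)
  finally show ?thesis using q by (simp add: conv_jf add_ac)
 qed
 have UX: "U k = 0" if "k <= 0" for k using U that by (simp add: cn1_solution_def)
 have UX': "U (int k) : X" if "k <= N" for k using U that X0 UX[of "int k"] by (cases "k = 0") (auto simp: cn1_solution_def)
 have "inner (u (real n * ta)) e - (3/2*inner (U (int n)) e - 2*inner (U (int n - 1)) e + 1/2*inner (U (int n - 2)) e) / ta
  = inner u0 e * errA (l e * ta powr al) (real n)
  + ?G*inner (g 0) e * errS ta (mu + 1) (l e * ta powr al) (real n * ta)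
  + ?G*inner (g' 0) e * errS ta (mu + 2) (l e * ta powr al) (real n * ta)
  + conv (errS ta (mu + 2) (l e * ta powr al)) (%s. ?G*inner (g'' s) e) (real n * ta)"
 proof (rule mode_error[OF l[OF e] ta0 T mu y' g2 _ y _ eq, where N = N and F = "%k. inner (primitive (%t. P (?f t)) (real k * ta)) e"])
  show "continuous_on {0..T} (%t. inner (u t) e)" by (intro continuous_intros uc(1))
  show "inner (?f t) e = ?G*inner (g 0) e * jf (mu + 2) t + ?G*inner (g' 0) e * jf (mu + 3) t + conv (jf (mu + 3)) (%s. ?G*inner (g'' s) e) t" if "t : {0<..<T}" for t by (rule f) (use that in auto)
  show "inner (primitive (%t. P (?f t)) (real k * ta)) e = ?G*inner (g 0) e * jf (mu + 3) (real k * ta) + ?G*inner (g' 0) e * jf (mu + 4) (real k * ta) + conv (jf (mu + 4)) (%s. ?G*inner (g'' s) e) (real k * ta)" if "k <= N" for k by (rule F[OF nt[OF that] e])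
  fix m assume m: "m : {1..N}"
  hence m1: "real (m - 1) = real m - 1" "int m - 1 = int (m - 1)" by auto
  have s: "ta powr (- al) *\<^sub>R (SUM j<=m. cq_weight al j *\<^sub>R U (int m - int j)) + (1 - al/2) *\<^sub>R Ah (U (int m)) + (al/2) *\<^sub>R Ah (U (int m - 1))
    = (1 - al/2) *\<^sub>R primitive (%t. P (?f t)) (real m * ta) + (al/2) *\<^sub>R primitive (%t. P (?f t)) ((real m - 1) * ta)
     + ((1 - al/2) * bdf2 ta (start_kernel al) (real m * ta)) *\<^sub>R u 0 + ((al/2) * bdf2 ta (start_kernel al) ((real m - 1) * ta)) *\<^sub>R u 0"
   using U m unfolding cn1_solution_def by blast
  have A: "inner (Ah (U (int m))) e = l e * inner (U (int m)) e" "inner (Ah (U (int m - 1))) e = l e * inner (U (int m - 1)) e"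
  proof -
   have "m <= N" "m - 1 <= N" using m by auto
   thus "inner (Ah (U (int m))) e = l e * inner (U (int m)) e" "inner (Ah (U (int m - 1))) e = l e * inner (U (int m - 1)) e"
    unfolding m1(2) using Ah[OF UX' e] by blast+
  qed
  have "inner (u 0) e = inner u0 e" using P(2)[OF e] uc(2) by simp
  with arg_cong[OF s, of "%v. inner v e"]
  show "ta powr (- al)*(SUM j<=m. cq_weight al j * inner (U (int m - int j)) e) + (1 - al/2)*(l e * inner (U (int m)) e) + al/2*(l e * inner (U (int m - 1)) e)
   = (1 - al/2)*(inner (primitive (%t. P (?f t)) (real m * ta)) e + bdf2 ta (start_kernel al) (real m * ta) * inner u0 e)
    + al/2*(inner (primitive (%t. P (?f t)) (real (m - 1) * ta)) e + bdf2 ta (start_kernel al) (real (m - 1) * ta) * inner u0 e)"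
   unfolding m1(1) inner_add_left inner_scaleR_left inner_sum_left A by (simp only: distrib_left mult.assoc add_ac)
 qed (use n nt[of n] UX N in auto)
 moreover have "ut n = (1 / ta) *\<^sub>R ((3/2) *\<^sub>R U (int n) - 2 *\<^sub>R U (int n - 1) + (1/2) *\<^sub>R U (int n - 2))"
  using U n unfolding cn1_solution_def by blast
 hence "inner (ut n) e = (3/2*inner (U (int n)) e - 2*inner (U (int n - 1)) e + 1/2*inner (U (int n - 2)) e) / ta" by (simp only: inner_add_left inner_diff_left inner_scaleR_left) simp
 ultimately show ?thesis by (simp only: inner_diff_left)
qed

text \<open>The error is tested with itself: each of the four contributions is estimated by
  \<open>multiplier_bound\<close> with a factor \<open>norm w\<close>, which is divided out at the
  end. For the convolution term the bound is applied at each \<open>s\<close> before integration, so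
  that \<open>norm (g'' s)\<close> stays under the integral.\<close>

lemma error_bound:
 fixes w :: "'b::{real_inner, banach, second_countable_topology}" and g'' :: "real => 'b"
 assumes mu: "mu > -1" and T: "T > 0" and ta: "ta > 0" and t: "t : {0<..T}" "t = n*ta" "n >= 1"
  and E: "finite E" "ortho E" and w: "w = (SUM e:E. inner w e *\<^sub>R e)" and l: "!!e. e : E ==> lm e > 0"
  and g'': "SI {0..T} g''" "SI {0..t} (%s. (t - s) powr (min (al + mu) 0) * norm (g'' s))"
  and Ca: "Ca > 0" "!!L ta n. L > 0 ==> ta > 0 ==> n >= 1 ==> abs (errA L n) <= Ca*(ta\<^sup>2*(n*ta) powr - 2)"
  and Cb: "Cb > 0" "!!L ta x. L > 0 ==> ta > 0 ==> x > 0 ==> abs (errS ta (mu + 1) L x) <= Cb*(ta\<^sup>2*x powr (mu + 1 + al - 2))"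
  and Cc: "Cc > 0" "!!L ta x. L > 0 ==> ta > 0 ==> x > 0 ==> abs (errS ta (mu + 2) L x) <= Cc*(ta\<^sup>2*x powr (mu + 2 + al - 2))"
  and we: "!!e. e : E ==> inner w e = inner u0 e * errA (lm e) n + Gamma (mu + 1) * inner g0 e * errS ta (mu + 1) (lm e) t
    + Gamma (mu + 1) * inner g1 e * errS ta (mu + 2) (lm e) t + conv (errS ta (mu + 2) (lm e)) (%s. Gamma (mu + 1) * inner (g'' s) e) t"
 shows "norm w <= (Ca + Gamma (mu + 1)*(Cb + Cc)) * ta\<^sup>2*(t powr - 2*norm u0 + t powr (al + mu - 1) * norm g0 + t powr (al + mu) * norm g1
   + (LBINT s:{0..t}. (t - s) powr (al + mu) * norm (g'' s)))"
proof -
 let ?G = "Gamma (mu + 1)" and ?I = "LBINT s:{0..t}. (t - s) powr (al + mu) * norm (g'' s)"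
 have G: "?G > 0" using mu by simp
 have e2: "mu + 1 + al - 2 = al + mu - 1" "mu + 2 + al - 2 = al + mu" by simp_all
 have t0: "t > 0" using t by simp
 have gt: "SI {0..t} g''" by (rule SI_subset[OF g''(1)]) (use t in auto)
 \<comment> \<open>The assumption has the exponent \<open>min (al + mu) 0\<close>; for
   \<open>al + mu > 0\<close> the weight is continuous and integrability of \<open>g''\<close>
   suffices.\<close>
 have Ki: "SI {0..t} (%s. (t - s) powr (al + mu) * norm (g'' s))"
 proof (cases "al + mu <= 0")
  case True thus ?thesis using g''(2) by (simp add: min_def)
 next
  case False
  hence "continuous_on {0..t} (%x. x powr (al + mu))" by (intro continuous_intros continuous_on_powr') auto
  from SI_reflect[OF this set_integrable_norm[OF gt]] show ?thesis .
 qed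
 have "(norm w)\<^sup>2 = inner w (SUM e:E. inner w e *\<^sub>R e)" using w by (simp add: power2_norm_eq_inner)
 also have "... = (SUM e:E. inner w e * inner w e)" by (simp add: inner_sum_right)
 also have "... = (SUM e:E. inner w e * (inner u0 e * errA (lm e) n) + (?G*(inner w e * (inner g0 e * errS ta (mu + 1) (lm e) t))
   + (?G*(inner w e * (inner g1 e * errS ta (mu + 2) (lm e) t)) + inner w e * conv (errS ta (mu + 2) (lm e)) (%s. ?G*inner (g'' s) e) t)))" by (rule sum.cong[OF refl], subst (2) we) (simp_all add: algebra_simps)
 also have "... = (SUM e:E. inner w e * (inner u0 e * errA (lm e) n)) + (?G*(SUM e:E. inner w e * (inner g0 e * errS ta (mu + 1) (lm e) t))
   + (?G*(SUM e:E. inner w e * (inner g1 e * errS ta (mu + 2) (lm e) t)) + (SUM e:E. inner w e * conv (errS ta (mu + 2) (lm e)) (%s. ?G*inner (g'' s) e) t)))" by (simp only: sum.distrib sum_distrib_left)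
 also have "... <= norm w * (norm u0 * (Ca*(ta\<^sup>2*t powr - 2))) + (?G*(norm w * (norm g0 * (Cb*(ta\<^sup>2*t powr (al + mu - 1)))))
   + (?G*(norm w * (norm g1 * (Cc*(ta\<^sup>2*t powr (al + mu))))) + ?G*(norm w * (Cc*ta\<^sup>2*?I))))"
 proof (intro add_mono mult_left_mono)
  show "(SUM e:E. inner w e * (inner u0 e * errA (lm e) n)) <= norm w * (norm u0 * (Ca*(ta\<^sup>2*t powr - 2)))" by (rule order_trans[OF abs_ge_self multiplier_bound[OF E w]]) (use Ca l t ta in auto)
  show "(SUM e:E. inner w e * (inner g0 e * errS ta (mu + 1) (lm e) t)) <= norm w * (norm g0 * (Cb*(ta\<^sup>2*t powr (al + mu - 1))))" by (rule order_trans[OF abs_ge_self multiplier_bound[OF E w]]) (use Cb[unfolded e2] l t0 ta in auto)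
  show "(SUM e:E. inner w e * (inner g1 e * errS ta (mu + 2) (lm e) t)) <= norm w * (norm g1 * (Cc*(ta\<^sup>2*t powr (al + mu))))" by (rule order_trans[OF abs_ge_self multiplier_bound[OF E w]]) (use Cc[unfolded e2] l t0 ta in auto)
  have ci: "SI {0..t} (%s. inner w e * (inner (g'' s) e * errS ta (mu + 2) (lm e) (t - s)))" if "e : E" for e
  proof -
   have "SI {0..t} (%s. errS ta (mu + 2) (lm e) (t - s) * inner (g'' s) e)" by (rule SI_reflect[OF continuous_on_errS[OF l[OF that] ta] set_integral_inner(1)[OF gt]]) (use mu in simp)
   from SI_mult[OF this, of "inner w e"] show ?thesis by (simp add: mult_ac)
  qed
  have si: "SI {0..t} (%s. SUM e:E. inner w e * (inner (g'' s) e * errS ta (mu + 2) (lm e) (t - s)))"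
   using ci unfolding SI_def scaleR_sum_right by (intro Bochner_Integration.integrable_sum) auto
  have "(SUM e:E. inner w e * conv (errS ta (mu + 2) (lm e)) (%s. ?G*inner (g'' s) e) t)
   = ?G*(SUM e:E. LBINT s:{0..t}. inner w e * (inner (g'' s) e * errS ta (mu + 2) (lm e) (t - s)))"
   unfolding conv_def sum_distrib_left LB_mult[symmetric] by (intro sum.cong refl LB_cong) (auto simp: mult_ac)
  also have "(SUM e:E. LBINT s:{0..t}. inner w e * (inner (g'' s) e * errS ta (mu + 2) (lm e) (t - s)))
   = (LBINT s:{0..t}. SUM e:E. inner w e * (inner (g'' s) e * errS ta (mu + 2) (lm e) (t - s)))"
   using ci unfolding SI_def LB_def scaleR_sum_right by (intro Bochner_Integration.integral_sum[symmetric]) auto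
  also have "... <= (LBINT s:{0..t}. (norm w * (Cc*ta\<^sup>2))*((t - s) powr (al + mu) * norm (g'' s)))"
  proof (rule set_integral_mono[OF si SI_mult[OF Ki]])
   fix s assume s: "s : {0..t}"
   \<comment> \<open>At \<open>s = t\<close> the right-hand side is zero by the convention for
     powers of zero, and \<open>errS_0\<close> matches it.\<close>
   have "abs (errS ta (mu + 2) (lm e) (t - s)) <= Cc*(ta\<^sup>2*(t - s) powr (al + mu))" if "e : E" for e
    using Cc(2)[unfolded e2, of "lm e" ta "t - s"] l[OF that] ta s errS_0 by (cases "s = t") auto
   thus "(SUM e:E. inner w e * (inner (g'' s) e * errS ta (mu + 2) (lm e) (t - s))) <= (norm w * (Cc*ta\<^sup>2))*((t - s) powr (al + mu) * norm (g'' s))"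
    using order_trans[OF abs_ge_self multiplier_bound[OF E w, of "%e. errS ta (mu + 2) (lm e) (t - s)" "Cc*(ta\<^sup>2*(t - s) powr (al + mu))" "g'' s"]] Cc(1) by (simp add: mult_ac)
  qed
  also have "... = norm w * (Cc*ta\<^sup>2*?I)" unfolding LB_mult by simp
  finally show "(SUM e:E. inner w e * conv (errS ta (mu + 2) (lm e)) (%s. ?G*inner (g'' s) e) t) <= ?G*(norm w * (Cc*ta\<^sup>2*?I))"
   using G by (simp add: mult_left_mono)
 qed (use G in auto)
 also have "... = norm w * (ta\<^sup>2*(Ca*(t powr - 2*norm u0) + ?G*Cb*(t powr (al + mu - 1) * norm g0) + ?G*Cc*(t powr (al + mu) * norm g1) + ?G*Cc*?I))" by (simp add: algebra_simps)
 also have "... <= norm w * (ta\<^sup>2*((Ca + ?G*(Cb + Cc))*(t powr - 2*norm u0) + (Ca + ?G*(Cb + Cc))*(t powr (al + mu - 1) * norm g0)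
   + (Ca + ?G*(Cb + Cc))*(t powr (al + mu) * norm g1) + (Ca + ?G*(Cb + Cc)) * ?I))"
 proof (intro mult_left_mono add_mono mult_right_mono)
  show "0 <= ?I" unfolding LB_def by (intro integral_nonneg_AE AE_I2) simp
  have "0 < ?G*Cb" "0 < ?G*Cc" using G Cb(1) Cc(1) by auto
  thus "Ca <= Ca + ?G*(Cb + Cc)" "?G*Cb <= Ca + ?G*(Cb + Cc)" "?G*Cc <= Ca + ?G*(Cb + Cc)" "?G*Cc <= Ca + ?G*(Cb + Cc)"
   using Ca(1) by (simp_all add: distrib_left)
 qed auto
 finally have "norm w * norm w <= norm w * ((Ca + ?G*(Cb + Cc)) * ta\<^sup>2*(t powr - 2*norm u0 + t powr (al + mu - 1) * norm g0 + t powr (al + mu) * norm g1 + ?I))" by (simp add: power2_eq_square algebra_simps)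
 moreover have "0 <= (Ca + ?G*(Cb + Cc)) * ta\<^sup>2*(t powr - 2*norm u0 + t powr (al + mu - 1) * norm g0 + t powr (al + mu) * norm g1 + ?I)"
 proof -
  have "0 <= ?I" unfolding LB_def by (intro integral_nonneg_AE AE_I2) simp
  thus ?thesis using Ca(1) Cb(1) Cc(1) G by (intro mult_nonneg_nonneg add_nonneg_nonneg) auto
 qed
 ultimately show ?thesis by (cases "w = 0") auto
qed

end

theorem theorem3p3:
  fixes \<Omega> :: "(real^'n) set" and a :: "real^'n \<Rightarrow> real^'n^'n" and q :: "real^'n \<Rightarrow> real"
    and \<alpha> \<mu> T \<kappa> :: real
  assumes dim: "CARD('n) = 1 \<or> CARD('n) = 2"
    and alpha: "0 < \<alpha>" "\<alpha> < 1" and mu: "\<mu> > -1" and T: "T > 0"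
    and domain: "bounded_domain \<Omega>" and operator: "elliptic_operator \<Omega> a q"
  shows "\<exists>c>0. \<forall>h \<T> N u0 g g' g'' uh U ut.
    (let X = fe_space \<Omega> \<T>; P = L2_projection X; Ah = discrete_operator X (elliptic_form \<Omega> a q);
         f = convolution_source \<mu> g; fh = (\<lambda>t. P (f t)); \<tau> = T / real N
     in regular_triangulation \<kappa> h \<Omega> \<T> \<longrightarrow> N \<ge> 1 \<longrightarrow>
        u0 \<in> L2_on \<Omega> \<longrightarrow>
        W1infty T (L2_on \<Omega>) g g' \<longrightarrow> has_weak_time_deriv T g' g'' \<longrightarrow>
        continuous_on {0..T} g \<longrightarrow> continuous_on {0..T} g' \<longrightarrow>
        (\<forall>t\<in>{0<..T}. set_integrable lborel {0..t} (\<lambda>\<zeta>. (t - \<zeta>) powr (min (\<alpha> + \<mu>) 0) * norm (g'' \<zeta>))) \<longrightarrow>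
        semidiscrete_solution X Ah \<alpha> T fh (P u0) uh \<longrightarrow>
        cn1_solution X Ah \<alpha> \<tau> N fh (uh 0) U ut \<longrightarrow>
        (\<forall>n\<in>{1..N}. let t = real n * \<tau> in
           norm (uh t - ut n) \<le> c * \<tau>\<^sup>2 *
             (t powr (-2) * norm u0 + t powr (\<alpha> + \<mu> - 1) * norm (g 0) + t powr (\<alpha> + \<mu>) * norm (g' 0)
              + (LINT \<zeta>:{0..t}|lborel. (t - \<zeta>) powr (\<alpha> + \<mu>) * norm (g'' \<zeta>)))))"
proof -
 interpret F: fractional_order \<alpha> by unfold_locales (use alpha in auto)
 have q: "\<mu> + 1 > 0" "\<mu> + 2 > 0" and G: "Gamma (\<mu> + 1) > 0" using mu by auto
 \<comment> \<open>The scalar bounds hold for every \<open>L > 0\<close>, so the three constants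
   depend on \<open>\<alpha>\<close> and \<open>\<mu>\<close> only and are fixed before mesh, step
   size and data.\<close>
 obtain Ca where Ca: "Ca > 0" "!!L \<tau> n. L > 0 ==> \<tau> > 0 ==> n >= 1 ==> abs (F.errA L n) <= Ca*(\<tau>\<^sup>2*(n*\<tau>) powr - 2)"
  using F.errA_bound by blast
 obtain Cb where Cb: "Cb > 0" "!!L \<tau> x. L > 0 ==> \<tau> > 0 ==> x > 0 ==> abs (F.errS \<tau> (\<mu> + 1) L x) <= Cb*(\<tau>\<^sup>2*x powr (\<mu> + 1 + \<alpha> - 2))"
  using F.errS_bound[OF q(1)] by blast
 obtain Cc where Cc: "Cc > 0" "!!L \<tau> x. L > 0 ==> \<tau> > 0 ==> x > 0 ==> abs (F.errS \<tau> (\<mu> + 2) L x) <= Cc*(\<tau>\<^sup>2*x powr (\<mu> + 2 + \<alpha> - 2))"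
  using F.errS_bound[OF q(2)] by blast
 show ?thesis
  unfolding Let_def
 proof (intro exI[of _ "Ca + Gamma (\<mu> + 1)*(Cb + Cc)"] conjI allI impI ballI)
  show "0 < Ca + Gamma (\<mu> + 1)*(Cb + Cc)" using Ca(1) Cb(1) Cc(1) G by (intro add_pos_pos mult_pos_pos) auto
  fix h \<T> N u0 and g g' g'' uh :: "real => (real^'n) L2" and U ut n
  let ?X = "fe_space \<Omega> \<T>" and ?A = "elliptic_form \<Omega> a q" and ?t = "real n * (T / real N)"
  assume tri: "regular_triangulation \<kappa> h \<Omega> \<T>" and N: "N >= 1" and "u0 : L2_on \<Omega>"
   and W1: "W1infty T (L2_on \<Omega>) g g'" and w2: "has_weak_time_deriv T g' g''"
   and g: "continuous_on {0..T} g" and g': "continuous_on {0..T} g'"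
   and gi: "ALL t:{0<..T}. SI {0..t} (%\<zeta>. (t - \<zeta>) powr (min (\<alpha> + \<mu>) 0) * norm (g'' \<zeta>))"
   and sd: "semidiscrete_solution ?X (discrete_operator ?X ?A) \<alpha> T (%t. L2_projection ?X (convolution_source \<mu> g t)) (L2_projection ?X u0) uh"
   and cn: "cn1_solution ?X (discrete_operator ?X ?A) \<alpha> (T / real N) N (%t. L2_projection ?X (convolution_source \<mu> g t)) (uh 0) U ut"
   and n: "n : {1..N}"
  have \<Omega>: "open \<Omega>" "bounded \<Omega>" using domain by (auto simp: bounded_domain_def)
  have XH: "v : H1_0 \<Omega>" if "v : ?X" for v using that by (simp add: fe_space_def)
  have lin: "r *\<^sub>R v + s *\<^sub>R w : ?X" if v: "v : ?X" "w : ?X" for v w r s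
  proof -
   obtain f1 f2 where f: "continuous_on (closure \<Omega>) f1" "ALL K:\<T>. EX b c. ALL x:K. f1 x = inner b x + c" "AE x in lborel. x : \<Omega> --> L2_fun v x = f1 x"
    "continuous_on (closure \<Omega>) f2" "ALL K:\<T>. EX b c. ALL x:K. f2 x = inner b x + c" "AE x in lborel. x : \<Omega> --> L2_fun w x = f2 x"
    using v by (auto simp: fe_space_def)
   show ?thesis
    unfolding fe_space_def mem_Collect_eq
   proof (intro conjI exI[of _ "%x. r*f1 x + s*f2 x"] ballI)
    show "r *\<^sub>R v + s *\<^sub>R w : H1_0 \<Omega>" by (rule H1_0_linear[OF \<Omega>(1) XH[OF v(1)] XH[OF v(2)]])
    show "continuous_on (closure \<Omega>) (%x. r*f1 x + s*f2 x)" by (intro continuous_intros f)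
    show "AE x in lborel. x : \<Omega> --> L2_fun (r *\<^sub>R v + s *\<^sub>R w) x = r*f1 x + s*f2 x"
     using f(3,6) AE_L2_fun_linear[of r v s w] by eventually_elim auto
    fix K assume "K : \<T>"
    then obtain b1 c1 b2 c2 where "ALL x:K. f1 x = inner b1 x + c1" "ALL x:K. f2 x = inner b2 x + c2" using f(2,5) by blast
    thus "EX b c. ALL x:K. r*f1 x + s*f2 x = inner b x + c" by (intro exI[of _ "r *\<^sub>R b1 + s *\<^sub>R b2"] exI[of _ "r*c1 + s*c2"]) (simp add: inner_add_left algebra_simps)
   qed
  qed
  have t: "finite \<T>" "!!K. K : \<T> ==> closed K" "\<Union>\<T> = closure \<Omega>"
   using tri unfolding regular_triangulation_def triangulation_def by (auto intro: closed_simplex)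
  have Un: "\<Union>\<T> \<inter> \<Omega> = \<Omega>" using t(3) closure_subset by blast
  obtain B where B: "finite B" "!!w. ALL K:\<T>. EX b c. ALL x:K. w x = inner b x + c ==>
   square_integrable (%x. indicator \<Omega> x*w x) & L2_of (%x. indicator \<Omega> x*w x) : span B"
   using piecewise_affine_span[OF t(1,2) \<Omega>] unfolding Un by blast
  have XB: "?X \<subseteq> span B"
  proof
   fix v assume v: "v : ?X"
   then obtain w where w: "ALL K:\<T>. EX b c. ALL x:K. w x = inner b x + c" "AE x in lborel. x : \<Omega> --> L2_fun v x = w x" by (auto simp: fe_space_def)
   \<comment> \<open>Membership in \<open>L2_on \<Omega>\<close> is part of possessing a weak
     derivative, so one coordinate direction is picked.\<close>
   obtain i :: "real^'n" where "i : Basis" using nonempty_Basis by blast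
   hence "v : L2_on \<Omega>" using XH[OF v] by (auto simp: H1_0_def H1_def has_weak_pderiv_def)
   hence "AE x in lborel. x \<notin> \<Omega> --> L2_fun v x = 0" by (simp add: L2_on_def)
   hence "AE x in lborel. L2_fun v x = indicator \<Omega> x*w x" using w(2) by eventually_elim (auto simp: indicator_def)
   hence "v = L2_of (%x. indicator \<Omega> x*w x)"
    using L2_of_eq_iff[OF square_integrable_L2_fun, of _ v] B(2)[OF w(1)] by (metis L2_of_L2_fun)
   thus "v : span B" using B(2)[OF w(1)] by simp
  qed
  have uX: "uh t : ?X" if "t : {0..T}" for t using sd that unfolding semidiscrete_solution_def by blast
  hence Xne: "?X ~= {}" using T by force
  have sy: "?A v w = ?A w v" if "v : ?X" "w : ?X" for v w by (rule elliptic_form_bilinear(1)[OF domain operator XH[OF that(1)] XH[OF that(1)] XH[OF that(2)]])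
  have bi: "?A (r *\<^sub>R u + s *\<^sub>R v) w = r*?A u w + s*?A v w" if "u : ?X" "v : ?X" "w : ?X" for u v w r s by (rule elliptic_form_bilinear(2)[OF domain operator XH[OF that(1)] XH[OF that(2)] XH[OF that(3)]])
  interpret S: symmetric_form ?X B ?A by unfold_locales (rule lin XB Xne B(1) sy bi; assumption)+
  obtain E l where E: "finite E" "E \<subseteq> ?X" "ortho E" "!!v. v : ?X ==> v = (SUM e:E. inner v e *\<^sub>R e)"
   and l: "!!e v. e : E ==> v : ?X ==> ?A v e = l e * inner v e" by (rule S.eigenbasis) blast
  have X: "(SUM e:E. c e *\<^sub>R e) : ?X" for c by (rule S.sum_in[OF E(1,2)])
  have P: "L2_projection ?X v = (SUM e:E. inner v e *\<^sub>R e)" for v by (rule L2_projection_onb(1)[OF E X])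
  have Ah: "inner (discrete_operator ?X ?A v) e = l e * inner v e" if v: "v : ?X" and e: "e : E" for v e
  proof -
   have d: "?A v w = (SUM e:E. inner w e * ?A v e)" if w: "w : ?X" for w
   proof -
    have "?A v w = ?A (SUM e:E. inner w e *\<^sub>R e) v" using S.sym[OF v w] E(4)[OF w] by simp
    also have "... = (SUM e:E. inner w e * ?A e v)" by (rule S.A_sum[OF E(1,2) v])
    also have "... = (SUM e:E. inner w e * ?A v e)" using E(2) S.sym[OF v] by (intro sum.cong) auto
    finally show ?thesis .
   qed
   have "discrete_operator ?X ?A v = (SUM e:E. ?A v e *\<^sub>R e)" by (rule L2_projection_onb(2)[OF E(1-3) _ X]) (rule E(4) d; assumption)+
   thus ?thesis using inner_ortho_sum[OF E(3,1) e] l[OF e v] by simp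
  qed
  \<comment> \<open>Positive definiteness gives \<open>\<gamma> <= l e\<close>. Only the sign is
    passed on to the scalar bounds, so the constant does not depend on
    \<open>\<gamma>\<close>.\<close>
  have l0: "l e > 0" if e: "e : E" for e
  proof -
   obtain \<gamma> where \<gamma>: "\<gamma> > 0" "!!v. v : H1_0 \<Omega> ==> \<gamma> * (norm v)\<^sup>2 <= ?A v v" using operator by (auto simp: elliptic_operator_def)
   have "inner e e = 1" using E(3) e by (simp add: ortho_def)
   hence "\<gamma> <= l e" using \<gamma>(2)[of e] l[OF e, of e] E(2) e XH by (auto simp: power2_norm_eq_inner)
   thus ?thesis using \<gamma>(1) by simp
  qed
  have tT: "?t : {0<..T}" "T / real N > 0"
  proof -
   show "T / real N > 0" using T N by simp
   have "real n / real N * T <= 1*T" using n N T by (intro mult_right_mono) auto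
   thus "?t : {0<..T}" using \<open>T / real N > 0\<close> n T by auto
  qed
  have w1: "has_weak_time_deriv T g g'" using W1 by (simp add: W1infty_def)
  have g'': "SI {0..T} g''" by (rule weak_second_derivative_integrable[OF T w2, of "min (\<alpha> + \<mu>) 0"]) (use gi T in auto)
  have "ut n : ?X" using cn n unfolding cn1_solution_def by blast
  with uX[of ?t] have "1 *\<^sub>R uh ?t + (- 1) *\<^sub>R ut n : ?X" using tT(1) by (intro lin) auto
  hence "uh ?t - ut n : ?X" by simp
  hence w: "uh ?t - ut n = (SUM e:E. inner (uh ?t - ut n) e *\<^sub>R e)" by (rule E(4))
  have gi': "SI {0..?t} (%s. (?t - s) powr (min (\<alpha> + \<mu>) 0) * norm (g'' s))" using gi tT(1) by blast
  have we: "inner (uh ?t - ut n) e = inner u0 e * F.errA (l e * (T / real N) powr \<alpha>) (real n)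
   + Gamma (\<mu> + 1) * inner (g 0) e * F.errS (T / real N) (\<mu> + 1) (l e * (T / real N) powr \<alpha>) ?t
   + Gamma (\<mu> + 1) * inner (g' 0) e * F.errS (T / real N) (\<mu> + 2) (l e * (T / real N) powr \<alpha>) ?t
   + conv (F.errS (T / real N) (\<mu> + 2) (l e * (T / real N) powr \<alpha>)) (%s. Gamma (\<mu> + 1) * inner (g'' s) e) ?t" if e: "e : E" for e
  proof (rule F.mode_error_inner[OF mu T N refl E(1,2) l0 P _ Ah S.zero g g'' _ _ sd cn n e])
   show "inner (L2_projection ?X v) e = inner v e" if "e : E" for v e unfolding P by (rule inner_ortho_sum[OF E(3,1) that])
   show "inner (g t) e = inner (g 0) e + conv (jf 1) (%s. inner (g' s) e) t" if "t : {0..T}" for t e by (rule weak_derivative_inner[OF T w1 g SI_Icc[OF g'] that])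
   show "inner (g' t) e = inner (g' 0) e + conv (jf 1) (%s. inner (g'' s) e) t" if "t : {0..T}" for t e by (rule weak_derivative_inner[OF T w2 g' g'' that])
  qed
  have lp: "l e * (T / real N) powr \<alpha> > 0" if "e : E" for e
   using l0[OF that] tT(2) by (intro mult_pos_pos) (metis powr_gt_zero less_irrefl)+
  have n1: "1 <= real n" using n by simp
  show "norm (uh ?t - ut n) <= (Ca + Gamma (\<mu> + 1)*(Cb + Cc))*(T / real N)\<^sup>2 *
    (?t powr (-2) * norm u0 + ?t powr (\<alpha> + \<mu> - 1) * norm (g 0) + ?t powr (\<alpha> + \<mu>) * norm (g' 0)
    + (LBINT \<zeta>:{0..?t}. (?t - \<zeta>) powr (\<alpha> + \<mu>) * norm (g'' \<zeta>)))" by (rule F.error_bound[OF mu T tT(2) tT(1) refl n1 E(1,3) w _ g'' gi' Ca(1) _ Cb(1) _ Cc(1), where lm = "%e. l e * (T / real N) powr \<alpha>"])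
    (rule lp Ca(2) Cb(2) Cc(2) we; assumption)+
 qed
qed

end
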